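(* Let $\alpha\in\mathbb{R}$. Suppose $\hat\rho$ satisfies $\sup_{x\in\mathcal{M}}\frac{|\hat\rho(x)-\bar\rho(x)|}{|\bar\rho(x)|}<\varepsilon_\rho<0.1$, and that as $N\to\infty$, $$\epsilon=o(1),\qquad \epsilon^{d/2+1}N=\Omega(\log N),\qquad \varepsilon_\rho=o(\epsilon).$$ Then for any $f\in C^\infty(\mathcal{M})$, when $N$ is sufficiently large, where the threshold is determined by $(\mathcal{M},f,p)$ and is uniform for all $x\in\mathcal{M}$, with probability higher than $1-4N^{-10}$, $$L^{(\alpha)}_{rw'}f(x)=\mathcal{L}^{(\alpha)}f(x)+O^{[f,p]}\!\left(\epsilon,\ \frac{\varepsilon_\rho}{\epsilon}\right)+O^{[1]}\!\left(\|\nabla f\|_\infty\,p(x)^{1/d}\sqrt{\frac{\log N}{N\epsilon^{d/2+1}}}\right),$$ where the constants in big-$O$ are uniform for all $x\in\mathcal{M}$.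
   Context: $\mathcal{M}$ is a $d$-dimensional $C^\infty$ compact manifold without boundary, isometrically embedded in $\mathbb{R}^D$ ($\|\cdot\|$ is the Euclidean norm of $\mathbb{R}^D$), with Riemannian volume measure $dV$, Laplace–Beltrami operator $\Delta$ and manifold gradient $\nabla$. $p\in C^\infty(\mathcal{M})$ is a probability density with respect to $dV$ with $0<p_{min}\le p\le p_{max}<\infty$; $\bar\rho:=p^{-1/d}$. Kernel: $k_0:[0,\infty)\to\mathbb{R}$ is continuous on $[0,\infty)$, $C^4$ on $(0,\infty)$, $k_0\ge0$, $\|k_0\|_\infty>0$, and there are $a,a_l>0$ with $|k_0^{(l)}(\xi)|\le a_le^{-a\xi}$ for all $\xi>0$, $l=0,\dots,4$. $m_0:=\int_{\mathbb{R}^d}k_0(|u|^2)\,du$, $m_2:=\frac1d\int_{\mathbb{R}^d}|u|^2k_0(|u|^2)\,du$. Data: $X=\{x_i\}_{i=1}^N$ are i.i.d. from $p$. $\hat\rho$ is the kNN bandwidth function computed from a separate dataset $Y=\{y_j\}_{j=1}^{N_y}$ independent of $X$: $\hat\rho(x)=\hat R(x)\big(\frac{1}{v_d}\frac{k}{N_y}\big)^{-1/d}$, where $v_d$ is the volume of the unit ball of $\mathbb{R}^d$ and $\hat R(x)=\inf\{r>0:\sum_j\mathbf 1_{\{\|y_j-x\|<r\}}\ge k\}$. One conditions on $Y$, so that $\hat\rho$ is a fixed (non-random) function and probability is over $X$. $\epsilon>0$, $\varepsilon_\rho$ and $\hat\rho$ may vary with $N$. Modified random-walk graph Laplacian operator: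 $$L^{(\alpha)}_{rw'}f(x)=\frac{1}{\epsilon\frac{m_2}{2m_0}\hat\rho(x)^2}\left(\frac{\sum_{j=1}^Nk_0\!\left(\frac{\|x-x_j\|^2}{\epsilon\hat\rho(x)\hat\rho(x_j)}\right)\frac{f(x_j)}{\hat\rho(x_j)^\alpha}}{\sum_{j=1}^Nk_0\!\left(\frac{\|x-x_j\|^2}{\epsilon\hat\rho(x)\hat\rho(x_j)}\right)\frac{1}{\hat\rho(x_j)^\alpha}}-f(x)\right).$$ Limiting operator: $\mathcal{L}^{(\alpha)}=\Delta+\left(1+\frac{2(\alpha-1)}{d}\right)\frac{\nabla p}{p}\cdot\nabla$. Asymptotic notation: $f=O(g)$ means $|f|\le C|g|$ in the limit; $O(g_1,g_2)$ means $O(|g_1|+|g_2|)$; $f=o(g)$ means $|f|/g\to0$; $f=\Omega(g)$ (for $f,g>0$) means $f/g\to\infty$. Superscripts such as $^{[f,p]}$ list what the constant may depend on, $^{[1]}$ meaning an absolute constant; dependence on $\mathcal{M}$ (including $d$), $k_0$ is always allowed, and dependence on $\alpha$ is not declared. *)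

theory Defs
  imports "HOL-Probability.Probability" "HOL-Library.Landau_Symbols"
begin

text \<open>
  The intrinsic dimension \<open>d\<close> is \<open>CARD('n)\<close>; as it does not occur in the type of a subset of
  the ambient space, it is passed as an argument of type \<open>'n itself\<close>.
\<close>

section \<open>Smooth maps and smooth embedded submanifolds\<close>

text \<open>Only meaningful for open \<open>U\<close>: the derivatives are full Frechet derivatives.\<close>

primrec Ck_on ::
  "nat \<Rightarrow> ('a::euclidean_space \<Rightarrow> 'b::real_normed_vector) \<Rightarrow> 'a set \<Rightarrow> bool" where
  "Ck_on 0 f U \<longleftrightarrow> continuous_on U f"
| "Ck_on (Suc k) f U \<longleftrightarrow>
     (\<forall>x\<in>U. f differentiable at x) \<and> (\<forall>v. Ck_on k (\<lambda>x. frechet_derivative f (at x) v) U)"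

definition Cinf_on ::
  "('a::euclidean_space \<Rightarrow> 'b::real_normed_vector) \<Rightarrow> 'a set \<Rightarrow> bool" where
  "Cinf_on f U \<longleftrightarrow> (\<forall>k. Ck_on k f U)"

text \<open>Inverses of charts: smooth immersions that are homeomorphisms onto relatively open subsets.\<close>

definition local_param ::
  "'a::euclidean_space set \<Rightarrow> (real ^ 'n) set \<Rightarrow> (real ^ 'n \<Rightarrow> 'a) \<Rightarrow> bool" where
  "local_param M U \<phi> \<longleftrightarrow>
     open U \<and> Cinf_on \<phi> U \<and> (\<forall>u\<in>U. inj (frechet_derivative \<phi> (at u))) \<and>
     openin (top_of_set M) (\<phi> ` U) \<and> (\<exists>\<psi>. homeomorphism U (\<phi> ` U) \<phi> \<psi>)"

definition smooth_submanifold :: "'n::finite itself \<Rightarrow> 'a::euclidean_space set \<Rightarrow> bool" where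
  "smooth_submanifold _ M \<longleftrightarrow>
     (\<forall>x\<in>M. \<exists>U (\<phi> :: real ^ 'n \<Rightarrow> 'a). local_param M U \<phi> \<and> x \<in> \<phi> ` U)"

definition smooth_on_manifold ::
  "'n::finite itself \<Rightarrow> 'a::euclidean_space set \<Rightarrow> ('a \<Rightarrow> real) \<Rightarrow> bool" where
  "smooth_on_manifold _ M f \<longleftrightarrow>
     (\<forall>U (\<phi> :: real ^ 'n \<Rightarrow> 'a). local_param M U \<phi> \<longrightarrow> Cinf_on (f \<circ> \<phi>) U)"

section \<open>Riemannian structure induced by the ambient inner product\<close>

definition coord_deriv ::
  "'n::finite \<Rightarrow> (real ^ 'n \<Rightarrow> 'b::real_normed_vector) \<Rightarrow> real ^ 'n \<Rightarrow> 'b" where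
  "coord_deriv i h u = frechet_derivative h (at u) (axis i 1)"

definition metric_tensor ::
  "(real ^ 'n \<Rightarrow> 'a::euclidean_space) \<Rightarrow> real ^ 'n \<Rightarrow> real ^ 'n ^ 'n::finite" where
  "metric_tensor \<phi> u = (\<chi> i j. coord_deriv i \<phi> u \<bullet> coord_deriv j \<phi> u)"

definition sqrt_det_metric ::
  "(real ^ 'n \<Rightarrow> 'a::euclidean_space) \<Rightarrow> real ^ 'n::finite \<Rightarrow> real" where
  "sqrt_det_metric \<phi> u = sqrt (det (metric_tensor \<phi> u))"

definition inverse_metric ::
  "(real ^ 'n \<Rightarrow> 'a::euclidean_space) \<Rightarrow> 'n::finite \<Rightarrow> 'n \<Rightarrow> real ^ 'n \<Rightarrow> real" where
  "inverse_metric \<phi> i j u = matrix_inv (metric_tensor \<phi> u) $ i $ j"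

text \<open>
  The measure \<open>dV\<close>, characterized by \<open>dV = sqrt (det g) du\<close> in all local coordinates; for a compact
  submanifold there is exactly one such measure.
\<close>

definition riemannian_volume ::
  "'n::finite itself \<Rightarrow> 'a::euclidean_space set \<Rightarrow> 'a measure \<Rightarrow> bool" where
  "riemannian_volume _ M V \<longleftrightarrow>
     space V = M \<and> sets V = sets (restrict_space borel M) \<and>
     (\<forall>U (\<phi> :: real ^ 'n \<Rightarrow> 'a). local_param M U \<phi> \<longrightarrow>
        (\<forall>B\<in>sets borel. B \<subseteq> U \<longrightarrow>
           emeasure V (\<phi> ` B) = (\<integral>\<^sup>+u\<in>B. ennreal (sqrt_det_metric \<phi> u) \<partial>lborel)))"

text \<open>Here \<open>h = f \<circ> \<phi>\<close>; the gradient is the tangent vector \<open>g\<^sup>i\<^sup>j (\<partial>\<^sub>j h) \<partial>\<^sub>i \<phi>\<close> of the ambient space.\<close>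

definition coord_gradient ::
  "(real ^ 'n \<Rightarrow> 'a::euclidean_space) \<Rightarrow> (real ^ 'n \<Rightarrow> real) \<Rightarrow> real ^ 'n::finite \<Rightarrow> 'a" where
  "coord_gradient \<phi> h u =
     (\<Sum>i\<in>UNIV. (\<Sum>j\<in>UNIV. inverse_metric \<phi> i j u * coord_deriv j h u) *\<^sub>R coord_deriv i \<phi> u)"

definition coord_laplacian ::
  "(real ^ 'n \<Rightarrow> 'a::euclidean_space) \<Rightarrow> (real ^ 'n \<Rightarrow> real) \<Rightarrow> real ^ 'n::finite \<Rightarrow> real" where
  "coord_laplacian \<phi> h u =
     (\<Sum>i\<in>UNIV. coord_deriv i
        (\<lambda>v. \<Sum>j\<in>UNIV. sqrt_det_metric \<phi> v * inverse_metric \<phi> i j v * coord_deriv j h v) u)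
     / sqrt_det_metric \<phi> u"

text \<open>
  Gradient and Laplacian at \<open>x\<close> are computed in some local parametrization around \<open>x\<close>; their values
  do not depend on which one is chosen.
\<close>

definition param_at :: "'a::euclidean_space set \<Rightarrow> 'a \<Rightarrow> (real ^ 'n \<Rightarrow> 'a) \<times> (real ^ 'n::finite)" where
  "param_at M x = (SOME (\<phi>, u). \<exists>U. local_param M U \<phi> \<and> u \<in> U \<and> \<phi> u = x)"

definition manifold_gradient ::
  "'n::finite itself \<Rightarrow> 'a::euclidean_space set \<Rightarrow> ('a \<Rightarrow> real) \<Rightarrow> 'a \<Rightarrow> 'a" where
  "manifold_gradient _ M f x =
     (let (\<phi>, u) = (param_at M x :: (real ^ 'n \<Rightarrow> 'a) \<times> (real ^ 'n)) in coord_gradient \<phi> (f \<circ> \<phi>) u)"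

definition laplace_beltrami ::
  "'n::finite itself \<Rightarrow> 'a::euclidean_space set \<Rightarrow> ('a \<Rightarrow> real) \<Rightarrow> 'a \<Rightarrow> real" where
  "laplace_beltrami _ M f x =
     (let (\<phi>, u) = (param_at M x :: (real ^ 'n \<Rightarrow> 'a) \<times> (real ^ 'n)) in coord_laplacian \<phi> (f \<circ> \<phi>) u)"

definition gradient_sup_norm ::
  "'n::finite itself \<Rightarrow> 'a::euclidean_space set \<Rightarrow> ('a \<Rightarrow> real) \<Rightarrow> real" where
  "gradient_sup_norm T M f = (SUP x\<in>M. norm (manifold_gradient T M f x))"

section \<open>Density and kernel\<close>

definition smooth_positive_density ::
  "'n::finite itself \<Rightarrow> 'a::euclidean_space set \<Rightarrow> 'a measure \<Rightarrow> ('a \<Rightarrow> real) \<Rightarrow> bool" where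
  "smooth_positive_density T M V p \<longleftrightarrow>
     smooth_on_manifold T M p \<and>
     (\<exists>p_min p_max. 0 < p_min \<and> (\<forall>x\<in>M. p_min \<le> p x \<and> p x \<le> p_max)) \<and>
     (\<integral>\<^sup>+x. ennreal (p x) \<partial>V) = 1"

text \<open>The kernel is a function on \<open>[0, \<infinity>)\<close>; its values at negative arguments are irrelevant.\<close>

definition admissible_kernel :: "(real \<Rightarrow> real) \<Rightarrow> bool" where
  "admissible_kernel k0 \<longleftrightarrow>
     continuous_on {0..} k0 \<and> Ck_on 4 k0 {0<..} \<and>
     (\<forall>\<xi>\<ge>0. 0 \<le> k0 \<xi>) \<and> (SUP \<xi>\<in>{0..}. \<bar>k0 \<xi>\<bar>) > 0 \<and>
     (\<exists>a>0. \<exists>A :: nat \<Rightarrow> real. \<forall>l\<le>4. A l > 0 \<and>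
        (\<forall>\<xi>>0. \<bar>(deriv ^^ l) k0 \<xi>\<bar> \<le> A l * exp (- a * \<xi>)))"

definition kernel_m0 :: "'n::finite itself \<Rightarrow> (real \<Rightarrow> real) \<Rightarrow> real" where
  "kernel_m0 _ k0 = (LINT u|lborel. k0 ((norm (u :: real ^ 'n))\<^sup>2))"

definition kernel_m2 :: "'n::finite itself \<Rightarrow> (real \<Rightarrow> real) \<Rightarrow> real" where
  "kernel_m2 _ k0 =
     1 / real CARD('n) * (LINT u|lborel. (norm (u :: real ^ 'n))\<^sup>2 * k0 ((norm u)\<^sup>2))"

section \<open>Bandwidth functions\<close>

definition rho_bar :: "'n::finite itself \<Rightarrow> ('a \<Rightarrow> real) \<Rightarrow> 'a \<Rightarrow> real" where
  "rho_bar _ p x = p x powr (- 1 / real CARD('n))"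

text \<open>
  The data set consists of \<open>Y 0, \<dots>, Y (Ny - 1)\<close>, counted with multiplicity. For \<open>k > Ny\<close> the
  infimum is over the empty set, hence unspecified.
\<close>

definition knn_radius ::
  "nat \<Rightarrow> nat \<Rightarrow> (nat \<Rightarrow> 'a::euclidean_space) \<Rightarrow> 'a \<Rightarrow> real" where
  "knn_radius k Ny Y x = Inf {r. r > 0 \<and> k \<le> (\<Sum>j<Ny. of_bool (norm (Y j - x) < r))}"

definition rho_hat ::
  "'n::finite itself \<Rightarrow> nat \<Rightarrow> nat \<Rightarrow> (nat \<Rightarrow> 'a::euclidean_space) \<Rightarrow> 'a \<Rightarrow> real" where
  "rho_hat _ k Ny Y x =
     knn_radius k Ny Y x *
     (1 / measure lborel (ball (0 :: real ^ 'n) 1) * (real k / real Ny)) powr (- 1 / real CARD('n))"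

section \<open>The graph Laplacian and its limit\<close>

definition graph_laplacian_rw ::
  "'n::finite itself \<Rightarrow> (real \<Rightarrow> real) \<Rightarrow> real \<Rightarrow> real \<Rightarrow> ('a::euclidean_space \<Rightarrow> real) \<Rightarrow>
   nat \<Rightarrow> (nat \<Rightarrow> 'a) \<Rightarrow> ('a \<Rightarrow> real) \<Rightarrow> 'a \<Rightarrow> real" where
  "graph_laplacian_rw T k0 \<alpha> \<epsilon> \<rho> N X f x =
     1 / (\<epsilon> * (kernel_m2 T k0 / (2 * kernel_m0 T k0)) * (\<rho> x)\<^sup>2) *
     ((\<Sum>j<N. k0 ((norm (x - X j))\<^sup>2 / (\<epsilon> * \<rho> x * \<rho> (X j))) * (f (X j) / \<rho> (X j) powr \<alpha>)) /
      (\<Sum>j<N. k0 ((norm (x - X j))\<^sup>2 / (\<epsilon> * \<rho> x * \<rho> (X j))) * (1 / \<rho> (X j) powr \<alpha>))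
      - f x)"

definition limit_operator ::
  "'n::finite itself \<Rightarrow> 'a::euclidean_space set \<Rightarrow> ('a \<Rightarrow> real) \<Rightarrow> real \<Rightarrow> ('a \<Rightarrow> real) \<Rightarrow> 'a \<Rightarrow> real" where
  "limit_operator T M p \<alpha> f x =
     laplace_beltrami T M f x +
     (1 + 2 * (\<alpha> - 1) / real CARD('n)) *
     ((manifold_gradient T M p x /\<^sub>R p x) \<bullet> manifold_gradient T M f x)"

text \<open>The law of \<open>N\<close> i.i.d. samples with density \<open>p\<close> with respect to \<open>V\<close>.\<close>

definition iid_sample :: "'a measure \<Rightarrow> ('a \<Rightarrow> real) \<Rightarrow> nat \<Rightarrow> (nat \<Rightarrow> 'a) measure" where
  "iid_sample V p N = (\<Pi>\<^sub>M j\<in>{..<N}. density V (\<lambda>x. ennreal (p x)))"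

end

(*
  In a chart, the kernel sums have expectations that a Laplace expansion, symmetrized in the increment,
  evaluates to relative order epsilon; the second order coefficient is a divergence, which gives the limiting
  operator without integrating by parts. Replacing the estimated bandwidth by p powr (-1/d) costs a relative
  error of the size of the bandwidth error. The quotient of sums is compared with the quotient of their
  expectations by Bernstein's inequality; the variance of the recentred numerator involves the gradient norm of
  f with a constant depending on the manifold and the kernel only.
*)
theory Submission imports Defs begin


section \<open>Calculus of smooth functions\<close>

text \<open>Throughout, \<open>e\<close> is the square root of the bandwidth
  \<open>\<epsilon>\<close> and \<open>d\<close> is \<open>CARD('n)\<close>. Charts are arbitrary,
  not normal coordinates, so the squared chord has a cubic term and the weight a linear one; pairing
  an increment with its negative removes their contributions of odd order. The kernel is smooth at
  positive arguments only, hence Taylor estimates are made off the origin, a null set. Gradient and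
  Laplacian are evaluated in a chart picked by a choice operator. Transition maps are never
  differentiated: the value of the limit operator is the coefficient in the expansion of an integral
  over \<open>M\<close> that mentions no chart, and the norm of the gradient is a local slope. The
  constant \<open>C1\<close> is chosen before \<open>p\<close>, \<open>f\<close> and
  \<open>\<alpha>\<close>. So \<open>f\<close> may enter the variance only through its gradient
  norm, and the density has to cancel, by \<open>p x * rho_bar x ^ d = 1\<close>. Far points and the
  range term of Bernstein's inequality come with worse constants; they are absorbed by a summand
  \<open>Cp * e^2\<close> added to the gradient norm and by the smallness of
  \<open>ln N / (N * e ^ (d + 2))\<close>.\<close>

lemma Ck_on_Suc_imp: "Ck_on (Suc k) f U ==> Ck_on k f U"
proof (induction k arbitrary: f)
 case 0
 then show ?case
  by (auto intro!: differentiable_imp_continuous_on simp: differentiable_on_def differentiable_at_withinI)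
next
 case (Suc k)
 then show ?case by (metis Ck_on.simps(2))
qed

lemma frechet_derivative_cong_open:
 assumes "open U" "x \<in> U" "!!x. x \<in> U ==> f x = g x" "f differentiable at x"
 shows "frechet_derivative g (at x) = frechet_derivative f (at x)" "g differentiable at x"
proof -
 have "(f has_derivative frechet_derivative f (at x)) (at x)"
  using assms(4) frechet_derivative_works by blast
 then have "(g has_derivative frechet_derivative f (at x)) (at x)"
  by (rule has_derivative_transform_within_open[OF _ assms(1,2)]) (simp add: assms(3))
 then show "frechet_derivative g (at x) = frechet_derivative f (at x)" "g differentiable at x"
  using frechet_derivative_at differentiableI by (metis, blast)
qed

lemma Ck_on_cong_imp:
 assumes "open U" "!!x. x \<in> U ==> f x = g x" "Ck_on k f U"
 shows "Ck_on k g U"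
 using assms(2,3)
proof (induction k arbitrary: f g)
 case 0
 then show ?case by (metis Ck_on.simps(1) continuous_on_cong)
next
 case (Suc k)
 have "g differentiable at x" if "x \<in> U" for x
  using frechet_derivative_cong_open(2)[OF assms(1) that Suc.prems(1)] Suc.prems(2) that by auto
 moreover have "Ck_on k (%x. frechet_derivative g (at x) v) U" for v
 proof (rule Suc.IH)
  show "Ck_on k (%x. frechet_derivative f (at x) v) U"
   using Suc.prems(2) by simp
  show "!!x. x \<in> U ==> frechet_derivative f (at x) v = frechet_derivative g (at x) v"
   using frechet_derivative_cong_open(1)[OF assms(1) _ Suc.prems(1)] Suc.prems(2) by fastforce
 qed
 ultimately show ?case by simp
qed

lemma Ck_on_const: "Ck_on k (%x. c) U"
 by (induction k arbitrary: c) (auto simp: frechet_derivative_const)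

lemma Ck_on_add:
 assumes "open U" "Ck_on k f U" "Ck_on k g U"
 shows "Ck_on k (%x. f x + g x) U"
 using assms(2,3)
proof (induction k arbitrary: f g)
 case 0
 then show ?case by (auto intro: continuous_intros)
next
 case (Suc k)
 have *: "frechet_derivative f (at x) v + frechet_derivative g (at x) v =
  frechet_derivative (%x. f x + g x) (at x) v" if "x \<in> U" for x v
 proof -
  have "((%x. f x + g x) has_derivative
   (%v. frechet_derivative f (at x) v + frechet_derivative g (at x) v)) (at x)"
   using Suc.prems that by (intro has_derivative_add) (auto simp: frechet_derivative_works[symmetric])
  from fun_cong[OF frechet_derivative_at[OF this]] show ?thesis .
 qed
 show ?case
  using Suc.prems
  by (auto intro!: Ck_on_cong_imp[OF assms(1) *] Suc.IH differentiable_add)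
qed

lemma Ck_on_sum:
 assumes "open U" "!!i. i \<in> I ==> Ck_on k (f i) U"
 shows "Ck_on k (%x. \<Sum>i\<in>I. f i x) U"
 using assms(2) by (induction I rule: infinite_finite_induct) (auto intro!: Ck_on_const Ck_on_add assms(1))

lemma (in bounded_bilinear) Ck_on_bilinear:
 assumes "open U" "Ck_on k f U" "Ck_on k g U"
 shows "Ck_on k (%x. prod (f x) (g x)) U"
 using assms(2,3)
proof (induction k arbitrary: f g)
 case 0
 then show ?case by (auto intro: continuous_on)
next
 case (Suc k)
 have *: "((%x. prod (f x) (g x)) has_derivative
   (%v. prod (f x) (frechet_derivative g (at x) v) + prod (frechet_derivative f (at x) v) (g x))) (at x)"
  if "x \<in> U" for x
  using Suc.prems that by (intro FDERIV) (auto simp: frechet_derivative_works[symmetric])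
 show ?case
  unfolding Ck_on.simps
 proof (intro conjI ballI allI)
  show "(%x. prod (f x) (g x)) differentiable at x" if "x \<in> U" for x
   using *[OF that] differentiableI by blast
  show "Ck_on k (%x. frechet_derivative (%x. prod (f x) (g x)) (at x) v) U" for v
  proof (rule Ck_on_cong_imp[OF assms(1)])
   show "prod (f x) (frechet_derivative g (at x) v) + prod (frechet_derivative f (at x) v) (g x)
    = frechet_derivative (%x. prod (f x) (g x)) (at x) v" if "x \<in> U" for x
    using fun_cong[OF frechet_derivative_at[OF *[OF that]]] .
   show "Ck_on k (%x. prod (f x) (frechet_derivative g (at x) v) + prod (frechet_derivative f (at x) v) (g x)) U"
    using Suc.prems by (intro Ck_on_add[OF assms(1)] Suc.IH) (auto intro: Ck_on_Suc_imp)
  qed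
 qed
qed

lemma Ck_on_prod:
 fixes f :: "'i => 'a::euclidean_space => real"
 assumes "open U" "!!i. i \<in> I ==> Ck_on k (f i) U"
 shows "Ck_on k (%x. \<Prod>i\<in>I. f i x) U"
 using assms(2)
 by (induction I rule: infinite_finite_induct)
  (auto intro!: Ck_on_const bounded_bilinear.Ck_on_bilinear[OF bounded_bilinear_mult] assms(1))

text \<open>The induction runs over all exponents at once, because differentiation replaces
  \<open>c\<close> by \<open>c - 1\<close>; positivity keeps \<open>powr\<close> away from its
  singularity at zero.\<close>

lemma Ck_on_powr:
 fixes f :: "'a::euclidean_space => real"
 assumes "open U" "Ck_on k f U" "!!x. x \<in> U ==> f x > 0"
 shows "Ck_on k (%x. f x powr c) U"
 using assms(2)
proof (induction k arbitrary: c)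
 case 0
 then show ?case using assms(3) by (auto intro!: continuous_on_powr continuous_on_const) (metis less_irrefl)
next
 case (Suc k)
 have *: "((%x. f x powr c) has_derivative
   (%v. c * f x powr (c - 1) * frechet_derivative f (at x) v)) (at x)"
  if "x \<in> U" for x
 proof -
  have "(f has_derivative frechet_derivative f (at x)) (at x)"
   using Suc.prems that by (auto simp: frechet_derivative_works[symmetric])
  moreover have "((%y. y powr c) has_derivative (%v. (c * f x powr (c - 1)) * v)) (at (f x))"
   using has_real_derivative_powr[OF assms(3)[OF that], of c]
   by (simp add: has_field_derivative_def)
  ultimately show ?thesis
   by (rule has_derivative_compose)
 qed
 show ?case
  unfolding Ck_on.simps
 proof (intro conjI ballI allI)
  show "(%x. f x powr c) differentiable at x" if "x \<in> U" for x
   using *[OF that] differentiableI by blast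
  show "Ck_on k (%x. frechet_derivative (%x. f x powr c) (at x) v) U" for v
  proof (rule Ck_on_cong_imp[OF assms(1)])
   show "c * f x powr (c - 1) * frechet_derivative f (at x) v
    = frechet_derivative (%x. f x powr c) (at x) v" if "x \<in> U" for x
    using fun_cong[OF frechet_derivative_at[OF *[OF that]]] .
   show "Ck_on k (%x. c * f x powr (c - 1) * frechet_derivative f (at x) v) U"
    using Suc.prems Ck_on_Suc_imp
    by (intro bounded_bilinear.Ck_on_bilinear[OF bounded_bilinear_mult assms(1)] Suc.IH Ck_on_const) auto
  qed
 qed
qed

lemma Cinf_onD: "Cinf_on f U ==> Ck_on k f U"
 by (simp add: Cinf_on_def)

lemma Cinf_on_differentiable: "Cinf_on f U ==> x \<in> U ==> f differentiable at x"
 using Cinf_onD[of f U "Suc 0"] by auto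

lemma Cinf_on_has_derivative:
 "Cinf_on f U ==> x \<in> U ==> (f has_derivative frechet_derivative f (at x)) (at x)"
 using Cinf_on_differentiable frechet_derivative_works by blast

lemma Cinf_on_linear_derivative: "Cinf_on f U ==> x \<in> U ==> linear (frechet_derivative f (at x))"
 using Cinf_on_has_derivative has_derivative_linear by blast

lemma Cinf_on_continuous_on: "Cinf_on f U ==> continuous_on U f"
 using Cinf_onD[of f U 0] by simp

lemma Cinf_on_derivative: "Cinf_on f U ==> Cinf_on (%x. frechet_derivative f (at x) v) U"
 unfolding Cinf_on_def by (metis Ck_on.simps(2))

lemma Cinf_on_cong: "open U ==> (!!x. x \<in> U ==> f x = g x) ==> Cinf_on f U ==> Cinf_on g U"
 unfolding Cinf_on_def using Ck_on_cong_imp by blast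

lemma Cinf_on_const: "Cinf_on (%x. c) U"
 by (simp add: Cinf_on_def Ck_on_const)

lemma Cinf_on_sum: "open U ==> (!!i. i \<in> I ==> Cinf_on (f i) U) ==> Cinf_on (%x. \<Sum>i\<in>I. f i x) U"
 by (simp add: Cinf_on_def Ck_on_sum)

lemma (in bounded_bilinear) Cinf_on_bilinear:
 "open U ==> Cinf_on f U ==> Cinf_on g U ==> Cinf_on (%x. prod (f x) (g x)) U"
 by (simp add: Cinf_on_def Ck_on_bilinear)

lemmas Cinf_on_mult = bounded_bilinear.Cinf_on_bilinear[OF bounded_bilinear_mult]
 and Cinf_on_inner = bounded_bilinear.Cinf_on_bilinear[OF bounded_bilinear_inner]
 and Cinf_on_scaleR = bounded_bilinear.Cinf_on_bilinear[OF bounded_bilinear_scaleR]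

lemma Cinf_on_prod:
 fixes f :: "'i => 'a::euclidean_space => real"
 shows "open U ==> (!!i. i \<in> I ==> Cinf_on (f i) U) ==> Cinf_on (%x. \<Prod>i\<in>I. f i x) U"
 by (simp add: Cinf_on_def Ck_on_prod)

lemma Cinf_on_powr:
 fixes f :: "'a::euclidean_space => real"
 shows "open U ==> Cinf_on f U ==> (!!x. x \<in> U ==> f x > 0) ==> Cinf_on (%x. f x powr c) U"
 by (simp add: Cinf_on_def Ck_on_powr)

subsection \<open>Directional derivatives and symmetric Taylor estimates\<close>

text \<open>The derivative taken \<open>j\<close> times in the single direction \<open>w\<close>:
  the diagonal of the j-th derivative form, which is all that Taylor's formula along a line needs.
  The recursion differentiates \<open>f\<close> first, as \<open>Ck_on\<close> does;
  \<open>dir_deriv_Suc\<close> supplies the other order.\<close>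

primrec dir_deriv ::
 "nat => ('a::euclidean_space => 'b::real_normed_vector) => 'a => 'a => 'b" where
 "dir_deriv 0 f w = f"
| "dir_deriv (Suc j) f w = dir_deriv j (%x. frechet_derivative f (at x) w) w"

lemma dir_deriv_Suc: "dir_deriv (Suc j) f w x = frechet_derivative (dir_deriv j f w) (at x) w"
 by (induction j arbitrary: f x) simp_all

lemma Cinf_on_dir_deriv: "Cinf_on f U ==> Cinf_on (dir_deriv j f w) U"
 by (induction j arbitrary: f) (auto intro: Cinf_on_derivative)

lemma dir_deriv_cong:
 assumes "open U" "!!x. x \<in> U ==> f x = g x" "Cinf_on f U" "x \<in> U"
 shows "dir_deriv j f w x = dir_deriv j g w x"
 using assms(2-4)
proof (induction j arbitrary: f g x)
 case (Suc j)
 have "frechet_derivative f (at x) w = frechet_derivative g (at x) w" if "x \<in> U" for x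
  using frechet_derivative_cong_open(1)[OF assms(1) that Suc.prems(1)]
   Cinf_on_differentiable[OF Suc.prems(2) that] by simp
 then show ?case
  using Suc.IH[OF _ Cinf_on_derivative[OF Suc.prems(2)] Suc.prems(3)] by simp
qed simp

lemma frechet_derivative_lincomb:
 assumes "!!i. i \<in> I ==> f i differentiable at x"
 shows "frechet_derivative (%x. \<Sum>i\<in>I. c i *\<^sub>R f i x) (at x) w = (\<Sum>i\<in>I. c i *\<^sub>R frechet_derivative (f i) (at x) w)"
proof -
 have "((%x. \<Sum>i\<in>I. c i *\<^sub>R f i x) has_derivative (%w. \<Sum>i\<in>I. c i *\<^sub>R frechet_derivative (f i) (at x) w)) (at x)"
  using assms by (intro has_derivative_sum has_derivative_scaleR_right) (auto simp: frechet_derivative_works[symmetric])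
 from fun_cong[OF frechet_derivative_at[OF this]] show ?thesis by simp
qed

lemma dir_deriv_lincomb:
 assumes "open U" "!!i. i \<in> I ==> Cinf_on (f i) U" "x \<in> U"
 shows "dir_deriv j (%x. \<Sum>i\<in>I. c i *\<^sub>R f i x) w x = (\<Sum>i\<in>I. c i *\<^sub>R dir_deriv j (f i) w x)"
 using assms(2,3)
proof (induction j arbitrary: f x)
 case (Suc j)
 have eq: "(\<Sum>i\<in>I. c i *\<^sub>R frechet_derivative (f i) (at x) w) =
  frechet_derivative (%x. \<Sum>i\<in>I. c i *\<^sub>R f i x) (at x) w" if "x \<in> U" for x
  using that Suc.prems Cinf_on_differentiable by (subst frechet_derivative_lincomb) blast+
 have "dir_deriv j (%x. frechet_derivative (%x. \<Sum>i\<in>I. c i *\<^sub>R f i x) (at x) w) w x =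
  dir_deriv j (%x. \<Sum>i\<in>I. c i *\<^sub>R frechet_derivative (f i) (at x) w) w x"
  using Suc.prems
  by (intro dir_deriv_cong[OF assms(1), symmetric] eq Cinf_on_sum[OF assms(1)] Cinf_on_scaleR[OF assms(1)]
    Cinf_on_const Cinf_on_derivative) auto
 also have "... = (\<Sum>i\<in>I. c i *\<^sub>R dir_deriv j (%x. frechet_derivative (f i) (at x) w) w x)"
  using Suc.prems by (intro Suc.IH Cinf_on_derivative) auto
 finally show ?case by simp
qed simp

lemma frechet_derivative_basis:
 assumes "Cinf_on f U" "x \<in> U"
 shows "frechet_derivative f (at x) w = (\<Sum>b\<in>Basis. (w \<bullet> b) *\<^sub>R frechet_derivative f (at x) b)"
proof -
 note lin = Cinf_on_linear_derivative[OF assms]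
 have "frechet_derivative f (at x) w = frechet_derivative f (at x) (\<Sum>b\<in>Basis. (w \<bullet> b) *\<^sub>R b)"
  by (simp add: euclidean_representation)
 also have "... = (\<Sum>b\<in>Basis. (w \<bullet> b) *\<^sub>R frechet_derivative f (at x) b)"
  by (simp add: linear_sum[OF lin] linear_scale[OF lin])
 finally show ?thesis .
qed

text \<open>Writing \<open>w\<close> in the basis at every differentiation reduces the claim to
  finitely many iterated basis derivatives, which are bounded on the compact set. Each step
  contributes one factor \<open>norm w\<close>, so that no multilinear forms appear.\<close>

lemma dir_deriv_bound:
 assumes "open U" "compact K" "K \<subseteq> U" "Cinf_on f U"
 shows "\<exists>C\<ge>0. \<forall>x\<in>K. \<forall>w. norm (dir_deriv j f w x) <= C * norm w ^ j"
 using assms(4)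
proof (induction j arbitrary: f)
 case 0
 have "compact (f ` K)"
  using Cinf_on_continuous_on[OF 0] assms(2,3) compact_continuous_image continuous_on_subset by blast
 then obtain C where "!!x. x \<in> K ==> norm (f x) <= C"
  using compact_imp_bounded[of "f ` K"] unfolding bounded_iff by auto
 then show ?case by (intro exI[of _ "max 0 C"]) (auto simp: le_max_iff_disj)
next
 case (Suc j)
 have "\<forall>b. \<exists>C\<ge>0. \<forall>x\<in>K. \<forall>w. norm (dir_deriv j (%x. frechet_derivative f (at x) b) w x) <= C * norm w ^ j"
  by (intro allI Suc.IH Cinf_on_derivative Suc.prems)
 then obtain C where C: "!!b. C b \<ge> 0"
  "!!b x w. x \<in> K ==> norm (dir_deriv j (%x. frechet_derivative f (at x) b) w x) <= C b * norm w ^ j"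
  by metis
 show ?case
 proof (intro exI conjI ballI allI)
  show "0 <= (\<Sum>b\<in>Basis. C b)" by (simp add: C sum_nonneg)
  fix x w assume x: "x \<in> K"
  have "dir_deriv (Suc j) f w x = dir_deriv j (%x. \<Sum>b\<in>Basis. (w \<bullet> b) *\<^sub>R frechet_derivative f (at x) b) w x"
   unfolding dir_deriv.simps using x assms(3)
   by (intro dir_deriv_cong[OF assms(1)] frechet_derivative_basis[OF Suc.prems] Cinf_on_derivative Suc.prems) auto
  also have "... = (\<Sum>b\<in>Basis. (w \<bullet> b) *\<^sub>R dir_deriv j (%x. frechet_derivative f (at x) b) w x)"
   using x assms(3) by (intro dir_deriv_lincomb[OF assms(1)] Cinf_on_derivative Suc.prems) auto
  also have "norm ... <= (\<Sum>b\<in>Basis. norm w * (C b * norm w ^ j))"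
   using C(2)[OF x] by (intro sum_norm_le) (auto intro!: mult_mono Basis_le_norm)
  also have "... = (\<Sum>b\<in>Basis. C b) * norm w ^ Suc j"
   by (simp add: sum_distrib_left sum_distrib_right mult_ac)
  finally show "norm (dir_deriv (Suc j) f w x) <= (\<Sum>b\<in>Basis. C b) * norm w ^ Suc j" .
 qed
qed

lemma dir_deriv_line:
 assumes "Cinf_on f U" "u + t *\<^sub>R w \<in> U"
 shows "((%t. dir_deriv j f w (u + t *\<^sub>R w)) has_vector_derivative dir_deriv (Suc j) f w (u + t *\<^sub>R w)) (at t within S)"
proof -
 have "((%t. u + t *\<^sub>R w) has_derivative (%s. s *\<^sub>R w)) (at t within S)"
  by (auto intro!: derivative_eq_intros)
 from has_derivative_compose[OF this, OF Cinf_on_has_derivative[OF Cinf_on_dir_deriv[OF assms(1)] assms(2)]]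
 have "((%t. dir_deriv j f w (u + t *\<^sub>R w)) has_derivative
  (%s. frechet_derivative (dir_deriv j f w) (at (u + t *\<^sub>R w)) (s *\<^sub>R w))) (at t within S)" .
 moreover have "frechet_derivative (dir_deriv j f w) (at (u + t *\<^sub>R w)) (s *\<^sub>R w) =
  s *\<^sub>R dir_deriv (Suc j) f w (u + t *\<^sub>R w)" for s
  unfolding dir_deriv_Suc
  by (rule linear_scale[OF Cinf_on_linear_derivative[OF Cinf_on_dir_deriv[OF assms(1)] assms(2)]])
 ultimately show ?thesis by (simp add: has_vector_derivative_def)
qed

text \<open>Mean value inequality on the unit segment. Applied repeatedly to Taylor remainders,
  which vanish at zero, it integrates a bound on the highest derivative.\<close>

lemma increment_bound:
 fixes h :: "real => 'b::real_normed_vector"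
 assumes "!!t. t \<in> {0..1} ==> (h has_vector_derivative h' t) (at t within {0..1})"
  and "!!t. t \<in> {0..1} ==> norm (h' t) <= B" and "t \<in> {0..1}" and "h 0 = 0"
 shows "norm (h t) <= B"
proof -
 have "norm (h t - h 0) <= B * norm (t - 0)"
 proof (rule differentiable_bound[of "{0..1}" h "%t s. s *\<^sub>R h' t"])
  show "onorm (%s. s *\<^sub>R h' t) <= B" if "t \<in> {0..1}" for t
   using assms(2)[OF that] by (auto intro!: onorm_le simp: mult.commute[of B] mult_left_mono)
 qed (use assms in \<open>auto simp: has_vector_derivative_def\<close>)
 also have "... <= B * 1"
  using order_trans[OF norm_ge_zero assms(2)[OF assms(3)]] assms(3) by (intro mult_left_mono) auto
 finally show ?thesis using assms(4) by simp
qed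

text \<open>
 The four estimates below are Taylor's formula on the segment \<open>t \<mapsto> u + t w\<close>; odd and even parts
 gain one order, which is what later makes the bias of order \<open>\<epsilon>\<close> rather than \<open>sqrt \<epsilon>\<close>.
\<close>

lemma symmetric_taylor:
 fixes f :: "'a::euclidean_space => 'b::real_normed_vector"
 assumes "open U" "cball u0 (2 * r) \<subseteq> U" "Cinf_on f U"
 shows "\<exists>C\<ge>0. \<forall>u\<in>cball u0 r. \<forall>w. norm w <= r -->
  norm (f (u + w) - f u) <= C * norm w \<and>
  norm (f (u + w) - f u - dir_deriv 1 f w u) <= C * norm w ^ 2 \<and>
  norm (f (u + w) - f (u - w) - 2 *\<^sub>R dir_deriv 1 f w u) <= C * norm w ^ 3 \<and>
  norm (f (u + w) + f (u - w) - 2 *\<^sub>R f u - dir_deriv 2 f w u) <= C * norm w ^ 4 \<and>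
  norm (dir_deriv 1 f w u) <= C * norm w \<and> norm (dir_deriv 2 f w u) <= C * norm w ^ 2 \<and>
  norm (f u) <= C"
proof -
 have "\<forall>j. \<exists>C\<ge>0. \<forall>x\<in>cball u0 (2*r). \<forall>w. norm (dir_deriv j f w x) <= C * norm w ^ j"
  using dir_deriv_bound[OF assms(1) compact_cball assms(2,3)] by blast
 then obtain C where C: "!!j. C j \<ge> 0"
  "!!j x w. x \<in> cball u0 (2*r) ==> norm (dir_deriv j f w x) <= C j * norm w ^ j" by metis
 \<comment> \<open>The third and fourth derivatives carry a factor 2 because both half-segments,
   towards \<open>w\<close> and towards \<open>- w\<close>, contribute to them.\<close>
 define C' where "C' = C 0 + C 1 + C 2 + 2 * C 3 + 2 * C 4"
 have C'_ge: "C 0 <= C'" "C 1 <= C'" "C 2 <= C'" "2 * C 3 <= C'" "2 * C 4 <= C'"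
  using C(1)[of 0] C(1)[of 1] C(1)[of 2] C(1)[of 3] C(1)[of 4] by (auto simp: C'_def)
 have "C' \<ge> 0" using C'_ge(1) C(1)[of 0] by linarith
 moreover have "norm (f (u + w) - f u) <= C' * norm w \<and>
  norm (f (u + w) - f u - dir_deriv 1 f w u) <= C' * norm w ^ 2 \<and>
  norm (f (u + w) - f (u - w) - 2 *\<^sub>R dir_deriv 1 f w u) <= C' * norm w ^ 3 \<and>
  norm (f (u + w) + f (u - w) - 2 *\<^sub>R f u - dir_deriv 2 f w u) <= C' * norm w ^ 4 \<and>
  norm (dir_deriv 1 f w u) <= C' * norm w \<and> norm (dir_deriv 2 f w u) <= C' * norm w ^ 2 \<and>
  norm (f u) <= C'"
  if u: "u \<in> cball u0 r" and w: "norm w <= r" for u w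
 proof -
  define g where "g = (%j t. dir_deriv j f w (u + t *\<^sub>R w))"
  have seg: "u + t *\<^sub>R w \<in> cball u0 (2*r)" if "\<bar>t\<bar> <= 1" for t
  proof -
   have "\<bar>t\<bar> * norm w <= 1 * r" using that w by (intro mult_mono) auto
   moreover have "dist u0 (u + t *\<^sub>R w) <= dist u0 u + norm (t *\<^sub>R w)"
    using dist_triangle[of u0 "u + t *\<^sub>R w" u] by (simp add: dist_norm)
   ultimately show ?thesis using u by simp
  qed
  have der: "(g j has_vector_derivative g (Suc j) t) (at t within S)" if "\<bar>t\<bar> <= 1" for j t S
   unfolding g_def using dir_deriv_line[OF assms(3)] seg[OF that] assms(2) by blast
  have der': "((%t. g j (- t)) has_vector_derivative - g (Suc j) (- t)) (at t within S)" if "\<bar>t\<bar> <= 1" for j t S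
  proof -
   have "(uminus has_vector_derivative - 1) (at t within S)"
    by (auto intro!: derivative_eq_intros)
   then show ?thesis
    using vector_diff_chain_within[of uminus "-1" t S "g j" "g (Suc j) (-t)"] der[of "-t" j] that
    by (simp add: o_def)
  qed
  have bd: "norm (g j t) <= C j * norm w ^ j" if "\<bar>t\<bar> <= 1" for j t
   unfolding g_def using C(2)[OF seg[OF that]] .
  have n1: "norm (g 0 t - g 0 0) <= C 1 * norm w ^ 1" if "t \<in> {0..1}" for t
   by (rule increment_bound[of "%t. g 0 t - g 0 0" "%t. g 1 t"])
    (use that bd[of _ 1] in \<open>auto intro!: derivative_eq_intros der\<close>)
  have n2: "norm (g 0 t - g 0 0 - t *\<^sub>R g 1 0) <= C 2 * norm w ^ 2" if "t \<in> {0..1}" for t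
  proof (rule increment_bound[of "%t. g 0 t - g 0 0 - t *\<^sub>R g 1 0" "%t. g 1 t - g 1 0"])
   show "norm (g 1 t - g 1 0) <= C 2 * norm w ^ 2" if "t \<in> {0..1}" for t
    by (rule increment_bound[of "%t. g 1 t - g 1 0" "%t. g 2 t"])
     (use that bd[of _ 2] der[of _ 1] in \<open>auto intro!: derivative_eq_intros simp: numeral_2_eq_2\<close>)
  qed (use that der[of _ 0] in \<open>auto intro!: derivative_eq_intros\<close>)
  have plus: "((%t. g j t + g j (- t)) has_vector_derivative g (Suc j) t - g (Suc j) (- t)) (at t within S)"
   if "t \<in> {0..1}" for t j S
   using has_vector_derivative_add[OF der[of t j] der'[of t j]] that by simp
  have minus: "((%t. g j t - g j (- t)) has_vector_derivative g (Suc j) t + g (Suc j) (- t)) (at t within S)"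
   if "t \<in> {0..1}" for t j S
   using has_vector_derivative_diff[OF der[of t j] der'[of t j]] that by simp
  \<comment> \<open>The derivative of an even part is the odd part one order higher, and the
    derivative of that is even again. The odd part vanishes at zero by itself, the even part after
    its value there is subtracted, so two integrations suffice.\<close>
  have evn: "norm (g j t + g j (-t) - 2 *\<^sub>R g j 0) <= 2 * C (j + 2) * norm w ^ (j + 2)" if "t \<in> {0..1}" for t j
  proof (rule increment_bound[of "%t. g j t + g j (-t) - 2 *\<^sub>R g j 0" "%t. g (Suc j) t - g (Suc j) (-t)"])
   show "norm (g (Suc j) t - g (Suc j) (- t)) <= 2 * C (j + 2) * norm w ^ (j+2)" if "t \<in> {0..1}" for t
   proof (rule increment_bound[of "%t. g (Suc j) t - g (Suc j) (-t)" "%t. g (j+2) t + g (j+2) (-t)"])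
    show "norm (g (j+2) t + g (j+2) (- t)) <= 2 * C (j + 2) * norm w ^ (j+2)" if "t \<in> {0..1}" for t
     using norm_triangle_ineq[of "g (j+2) t" "g (j+2) (-t)"] bd[of t "j+2"] bd[of "-t" "j+2"] that by auto
   qed (use that minus[of _ "Suc j"] in auto)
  qed (use that has_vector_derivative_diff[OF plus has_vector_derivative_const] in \<open>auto simp: scaleR_2\<close>)
  have odd: "norm (g j t - g j (-t) - (2 * t) *\<^sub>R g (Suc j) 0) <= 2 * C (j + 3) * norm w ^ (j + 3)" if "t \<in> {0..1}" for t j
  proof (rule increment_bound[of "%t. g j t - g j (-t) - (2*t) *\<^sub>R g (Suc j) 0"
     "%t. g (Suc j) t + g (Suc j) (-t) - 2 *\<^sub>R g (Suc j) 0"])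
   show "norm (g (Suc j) t + g (Suc j) (-t) - 2 *\<^sub>R g (Suc j) 0) <= 2 * C (j + 3) * norm w ^ (j+3)" if "t \<in> {0..1}" for t
    using evn[OF that, of "Suc j"] by (simp add: numeral_3_eq_3)
   show "((%t. g j t - g j (-t) - (2*t) *\<^sub>R g (Suc j) 0) has_vector_derivative
    g (Suc j) t + g (Suc j) (-t) - 2 *\<^sub>R g (Suc j) 0) (at t within {0..1})" if "t \<in> {0..1}" for t
    using that by (intro has_vector_derivative_diff minus) (auto intro!: derivative_eq_intros)
  qed (use that in auto)
  \<comment> \<open>One more integration, of \<open>odd\<close> at order one; it gives the weight
    \<open>t^2\<close> to the second derivative.\<close>
  have evn4: "norm (g 0 t + g 0 (-t) - 2 *\<^sub>R g 0 0 - (t^2) *\<^sub>R g 2 0) <= 2 * C 4 * norm w ^ 4" if "t \<in> {0..1}" for t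
  proof (rule increment_bound[of "%t. g 0 t + g 0 (-t) - 2 *\<^sub>R g 0 0 - (t^2) *\<^sub>R g 2 0"
     "%t. g 1 t - g 1 (-t) - (2 * t) *\<^sub>R g 2 0"])
   show "norm (g 1 t - g 1 (-t) - (2 * t) *\<^sub>R g 2 0) <= 2 * C 4 * norm w ^ 4" if "t \<in> {0..1}" for t
    using odd[OF that, of 1] by (simp add: numeral_2_eq_2)
   show "((%t. g 0 t + g 0 (-t) - 2 *\<^sub>R g 0 0 - (t^2) *\<^sub>R g 2 0) has_vector_derivative
    g 1 t - g 1 (-t) - (2 * t) *\<^sub>R g 2 0) (at t within {0..1})" if "t \<in> {0..1}" for t
    using that has_vector_derivative_diff[OF plus[OF that, of 0] has_vector_derivative_const]
    by (intro has_vector_derivative_diff[where f' = "g 1 t - g 1 (-t)"]) (auto intro!: derivative_eq_intros)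
  qed (use that in \<open>auto simp: scaleR_2\<close>)
  have up: "c * norm w ^ j <= C' * norm w ^ j" if "c <= C'" for c j
   using that by (intro mult_right_mono) auto
  have g_simps: "g j 0 = dir_deriv j f w u" "g 0 1 = f (u + w)" "g 0 (-1) = f (u - w)" for j
   by (auto simp: g_def)
  note g_simps0 = g_simps(1)[of 0, simplified]
  show ?thesis
   using n1[of 1] n2[of 1] odd[of 1 0] evn4[of 1] bd[of 0 1] bd[of 0 2] bd[of 0 0]
    up[OF C'_ge(2), of 1] up[OF C'_ge(3), of 2] up[OF C'_ge(4), of 3] up[OF C'_ge(5), of 4] C'_ge(1)
   by (simp add: g_simps g_simps0)
 qed
 ultimately show ?thesis by (intro exI[of _ C']) blast
qed

section \<open>Integrals over Euclidean space\<close>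

text \<open>Fubini in the coordinate \<open>b\<close>: on each line parallel to \<open>b\<close> the
  shear is the translation by the number \<open>x c\<close>, which is constant on that line.\<close>

lemma lborel_shear:
 fixes b c :: "'a::euclidean_space"
 assumes bc: "b \<in> Basis" "c \<in> Basis" "b ~= c" and [measurable]: "F \<in> borel_measurable borel"
 shows "(\<integral>\<^sup>+x. F (x + (x \<bullet> c) *\<^sub>R b) \<partial>lborel) = (\<integral>\<^sup>+x. F x \<partial>lborel)"
proof -
 interpret product_sigma_finite "%b::'a. lborel :: real measure" ..
 let ?B = "Basis - {b}"
 define G where "G f = (\<Sum>b\<in>Basis. f b *\<^sub>R b)" for f :: "'a => real"
 have ins: "insert b ?B = Basis" "Basis = ?B \<union> {b}" using bc by auto
 have G_inner: "G f \<bullet> i = f i" if "i \<in> Basis" for f i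
  using that by (simp add: G_def inner_sum_left_Basis)
 have upd: "G (x(b := t)) + (G (x(b := t)) \<bullet> c) *\<^sub>R b = G (x(b := x c + 1 * t))" for x t
  by (rule euclidean_eqI) (use bc in \<open>auto simp: inner_add_left G_inner inner_Basis\<close>)
 have [measurable]: "G \<in> measurable (Pi\<^sub>M Basis (%_. lborel)) borel"
  unfolding G_def by measurable
 have [measurable]: "(%t. x(b := t)) \<in> measurable lborel (Pi\<^sub>M Basis (%_. lborel))"
  if "x \<in> space (Pi\<^sub>M ?B (%_. lborel))" for x :: "'a => real"
  using measurable_fun_upd[OF ins(2), of "%_. x" lborel "%_. lborel" "%t. t"] that by simp
 have iter: "(\<integral>\<^sup>+x. H x \<partial>lborel) = (\<integral>\<^sup>+x. \<integral>\<^sup>+t. H (G (x(b := t))) \<partial>lborel \<partial>Pi\<^sub>M ?B (%_. lborel))"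
  if [measurable]: "H \<in> borel_measurable borel" for H :: "'a => ennreal"
 proof -
  have "(\<integral>\<^sup>+x. H x \<partial>lborel) = (\<integral>\<^sup>+f. H (G f) \<partial>Pi\<^sub>M Basis (%_. lborel))"
   by (subst lborel_eq) (simp add: nn_integral_distr G_def[abs_def, symmetric])
  also have "... = (\<integral>\<^sup>+x. \<integral>\<^sup>+t. H (G (x(b := t))) \<partial>lborel \<partial>Pi\<^sub>M ?B (%_. lborel))"
   using product_nn_integral_insert[of ?B b "%f. H (G f)"] by (simp add: ins(1) insert_absorb[OF bc(1)])
  finally show ?thesis .
 qed
 have "(\<integral>\<^sup>+x. F (x + (x \<bullet> c) *\<^sub>R b) \<partial>lborel) =
  (\<integral>\<^sup>+x. \<integral>\<^sup>+t. F (G (x(b := x c + 1 * t))) \<partial>lborel \<partial>Pi\<^sub>M ?B (%_. lborel))"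
  by (subst iter) (simp_all only: upd, measurable)
 also have "... = (\<integral>\<^sup>+x. \<integral>\<^sup>+t. F (G (x(b := t))) \<partial>lborel \<partial>Pi\<^sub>M ?B (%_. lborel))"
 proof (rule nn_integral_cong)
  fix x :: "'a => real" assume [measurable]: "x \<in> space (Pi\<^sub>M ?B (%_. lborel))"
  show "(\<integral>\<^sup>+t. F (G (x(b := x c + 1 * t))) \<partial>lborel) = (\<integral>\<^sup>+t. F (G (x(b := t))) \<partial>lborel)"
   by (subst (2) nn_integral_real_affine[of _ 1 "x c"]) auto
 qed
 also have "... = (\<integral>\<^sup>+x. F x \<partial>lborel)" by (subst iter) simp_all
 finally show ?thesis .
qed

lemma axis_in_Basis_real: "axis i (1::real) \<in> Basis"
 by (auto simp: Basis_vec_def)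

text \<open>
 The change of variables formula of the library requires a well-ordered index type, which a bare
 \<open>'n::finite\<close> is not.
\<close>

lemma lborel_linear_nn_integral:
 fixes f :: "real^'n => real^'n"
 assumes "linear f" "det (matrix f) ~= 0" "F \<in> borel_measurable borel"
 shows "(\<integral>\<^sup>+x. F x \<partial>lborel) = ennreal \<bar>det (matrix f)\<bar> * (\<integral>\<^sup>+x. F (f x) \<partial>lborel)"
proof -
 have bm: "f \<in> borel_measurable borel" if "linear f" for f :: "real^'n => real^'n"
  using that by (simp add: borel_measurable_continuous_onI linear_continuous_on linear_linear)
 \<comment> \<open>Singular maps satisfy \<open>P\<close> vacuously. This fits the induction over
   elementary maps: a composition with nonzero determinant has both factors nonsingular, and a map
   that annihilates a coordinate falls under the vacuous case.\<close>
 define P where "P f \<longleftrightarrow> (det (matrix f) ~= 0 --> (\<forall>F\<in>borel_measurable borel.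
  (\<integral>\<^sup>+x. F x \<partial>lborel) = ennreal \<bar>det (matrix f)\<bar> * (\<integral>\<^sup>+x. F (f x) \<partial>lborel)))" for f :: "real^'n => real^'n"
 have "P f"
 proof (rule induct_linear_elementary[where P = P, OF assms(1)])
  fix f g :: "real^'n => real^'n" assume comp: "linear f" "linear g" "P f" "P g"
  show "P (f \<circ> g)"
   unfolding P_def
  proof (intro impI ballI)
   fix F :: "real^'n => ennreal" assume F[measurable]: "F \<in> borel_measurable borel"
   have d: "det (matrix (f \<circ> g)) = det (matrix f) * det (matrix g)"
    by (simp add: matrix_compose comp det_mul)
   assume "det (matrix (f \<circ> g)) ~= 0"
   then have nz: "det (matrix f) ~= 0" "det (matrix g) ~= 0" by (auto simp: d)
   note [measurable] = bm[OF comp(1)] bm[OF comp(2)]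
   have "(\<integral>\<^sup>+x. F x \<partial>lborel) = ennreal \<bar>det (matrix f)\<bar> * (\<integral>\<^sup>+x. F (f x) \<partial>lborel)"
    using comp(3) nz F unfolding P_def by blast
   also have "(\<integral>\<^sup>+x. F (f x) \<partial>lborel) = ennreal \<bar>det (matrix g)\<bar> * (\<integral>\<^sup>+x. F (f (g x)) \<partial>lborel)"
    using comp(4) nz unfolding P_def by (elim impE bspec[of _ _ "%x. F (f x)"]) auto
   finally show "(\<integral>\<^sup>+x. F x \<partial>lborel) = ennreal \<bar>det (matrix (f \<circ> g))\<bar> * (\<integral>\<^sup>+x. F ((f \<circ> g) x) \<partial>lborel)"
    by (simp add: d abs_mult ennreal_mult' mult.assoc)
  qed
 next
  fix f :: "real^'n => real^'n" and i assume zeroes: "linear f" "!!x. f x $ i = 0"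
  have "\<not> inj f"
   by (metis zeroes linear_injective_imp_surjective one_neq_zero surjE vec_component)
  then have "det (matrix f) = 0" using det_nz_iff_inj[OF zeroes(1)] by blast
  then show "P f" by (simp add: P_def)
 next
  fix c :: "'n => real"
  have d: "det (matrix (%x::real^'n. \<chi> i. c i * x $ i)) = (\<Prod>i\<in>UNIV. c i)"
   by (subst det_diagonal) (auto simp: matrix_def axis_def)
  show "P (%x. \<chi> i. c i * x $ i)"
   unfolding P_def d
  proof (intro impI ballI)
   fix F :: "real^'n => ennreal" assume F[measurable]: "F \<in> borel_measurable borel"
   assume nz: "(\<Prod>i\<in>UNIV. c i) ~= 0"
   \<comment> \<open>The affine formula indexes its factors by basis vectors; \<open>c'\<close>
     recovers the index from the vector.\<close>
   define c' where "c' b = c (SOME i. b = axis i 1)" for b :: "real^'n"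
   have c': "c' (axis i 1) = c i" for i
    by (simp add: c'_def axis_eq_axis)
   have Bas: "(Basis :: (real^'n) set) = (%i. axis i 1) ` UNIV"
    by (auto simp: Basis_vec_def)
   have inj: "inj (%i::'n. axis i (1::real))" by (auto simp: inj_on_def axis_eq_axis)
   have T: "0 + (\<Sum>j\<in>Basis. (c' j * (x \<bullet> j)) *\<^sub>R j) = (\<chi> i. c i * x $ i)" for x :: "real^'n"
    unfolding Bas sum.reindex[OF inj] o_def
    by (simp add: vec_eq_iff c' inner_axis) (simp add: axis_def if_distrib cong: if_cong)
   have p: "(\<Prod>j\<in>Basis. \<bar>c' j\<bar>) = \<bar>\<Prod>i\<in>UNIV. c i\<bar>"
    unfolding Bas prod.reindex[OF inj] o_def by (simp add: c' abs_prod)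
   have eq: "lborel = density (distr lborel borel (%x::real^'n. \<chi> i. c i * x $ i)) (%_. ennreal \<bar>\<Prod>i\<in>UNIV. c i\<bar>)"
   proof -
    have "c' j ~= 0" if "j \<in> Basis" for j using nz that by (auto simp: Bas c')
    from lborel_affine_euclidean[where c = c' and t = 0, OF this] show ?thesis unfolding T p by simp
   qed
   have [measurable]: "(%x::real^'n. \<chi> i. c i * x $ i) \<in> borel_measurable borel"
    by (intro bm linearI) (auto simp: vec_eq_iff algebra_simps)
   show "(\<integral>\<^sup>+x. F x \<partial>lborel) = ennreal \<bar>\<Prod>i\<in>UNIV. c i\<bar> * (\<integral>\<^sup>+x. F (\<chi> i. c i * x $ i) \<partial>lborel)"
    by (subst eq) (simp add: nn_integral_density nn_integral_distr nn_integral_cmult)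
  qed
 next
  fix m n :: 'n
  let ?h = "%x::real^'n. \<chi> i. x $ Transposition.transpose m n i"
  have "matrix ?h = (\<chi> i. (mat 1 :: real^'n^'n) $ Transposition.transpose m n i)"
   by (auto simp: vec_eq_iff matrix_def axis_def mat_def)
  then have d: "\<bar>det (matrix ?h)\<bar> = 1"
   using det_permute_rows[OF permutes_swap_id[of m UNIV n], of "mat 1 :: real^'n^'n"]
   by (simp add: sign_swap_id abs_mult)
  have lin: "linear ?h" by (rule linearI) (auto simp: vec_eq_iff)
  have [measurable]: "?h \<in> borel_measurable borel" by (rule bm[OF lin])
  have eq: "lborel = distr lborel borel ?h"
  proof (rule lborel_eqI)
   fix l u :: "real^'n" assume le: "!!b. b \<in> Basis ==> l \<bullet> b <= u \<bullet> b"
   have le': "l $ i <= u $ i" for i 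
   using le[OF axis_in_Basis_real, of i] by (simp add: inner_axis)
   have "?h -` box l u = box (?h l) (?h u)"
    by (auto simp: mem_box_cart) (metis transpose_involutory)+
   moreover have "emeasure lborel (box (?h l) (?h u)) = (\<Prod>b\<in>Basis. (?h u - ?h l) \<bullet> b)"
    by (intro emeasure_lborel_box) (auto simp: Basis_vec_def inner_axis le')
   moreover have Bas: "(\<Prod>b\<in>Basis. (v :: real^'n) \<bullet> b) = (\<Prod>i\<in>UNIV. v $ i)" for v
   proof -
    have b: "(Basis :: (real^'n) set) = (%i. axis i 1) ` UNIV" by (auto simp: Basis_vec_def)
    have inj: "inj (%i::'n. axis i (1::real))" by (auto simp: inj_on_def axis_eq_axis)
    show ?thesis unfolding b prod.reindex[OF inj] o_def by (simp add: inner_axis)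
   qed
   have "(\<Prod>i\<in>UNIV. (?h u - ?h l) $ i) = (\<Prod>i\<in>UNIV. (u - l) $ i)"
    using prod.permute[OF permutes_swap_id[of m UNIV n], of "%i. (u - l) $ i"] by (simp add: o_def)
   ultimately show "emeasure (distr lborel borel ?h) (box l u) = (\<Prod>b\<in>Basis. (u - l) \<bullet> b)"
    by (simp add: emeasure_distr Bas)
  qed simp
  show "P ?h"
   unfolding P_def d
  proof (intro impI ballI)
   fix F :: "real^'n => ennreal" assume F[measurable]: "F \<in> borel_measurable borel"
   show "(\<integral>\<^sup>+x. F x \<partial>lborel) = ennreal 1 * (\<integral>\<^sup>+x. F (?h x) \<partial>lborel)"
    by (subst eq) (simp add: nn_integral_distr)
  qed
 next
  fix m n :: 'n assume idplus: "m ~= n"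
  let ?h = "%x::real^'n. \<chi> i. if i = m then x $ m + x $ n else x $ i"
  have h: "?h x = x + (x \<bullet> axis n 1) *\<^sub>R axis m 1" for x
   using idplus by (simp add: vec_eq_iff inner_axis) (simp add: axis_def)
  have "matrix ?h = (\<chi> k. if k = m then row m (mat 1) + 1 *s row n (mat 1) else row k (mat 1 :: real^'n^'n))"
   using idplus by (auto simp: vec_eq_iff matrix_def axis_def mat_def row_def)
  then have d: "det (matrix ?h) = 1"
   using det_row_operation[OF idplus, of "mat 1 :: real^'n^'n" 1] by simp
  show "P ?h"
   using d unfolding P_def h
   using lborel_shear[of "axis m 1 :: real^'n" "axis n 1"] idplus
   by (simp add: axis_in_Basis_real axis_eq_axis)
 qed
 then show ?thesis using assms by (simp add: P_def)
qed

lemma lborel_linear: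
 fixes f :: "real^'n => real^'n"
 assumes "linear f" "det (matrix f) ~= 0"
 shows "lborel = density (distr lborel borel f) (%_. ennreal \<bar>det (matrix f)\<bar>)"
proof (rule measure_eqI)
 have [measurable]: "f \<in> borel_measurable borel"
  using assms(1) by (simp add: borel_measurable_continuous_onI linear_continuous_on linear_linear)
 fix A assume "A \<in> sets (lborel :: (real^'n) measure)"
 then have [measurable]: "A \<in> sets borel" by simp
 have "emeasure lborel A = (\<integral>\<^sup>+x. indicator A x \<partial>lborel)" by simp
 also have "... = ennreal \<bar>det (matrix f)\<bar> * (\<integral>\<^sup>+x. indicator A (f x) \<partial>lborel)"
  by (rule lborel_linear_nn_integral[OF assms]) simp
 also have "(\<integral>\<^sup>+x. indicator A (f x) \<partial>lborel) = emeasure (distr lborel borel f) A"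
  by (subst nn_integral_indicator[symmetric], simp, subst nn_integral_distr) auto
 also have "ennreal \<bar>det (matrix f)\<bar> * ... = emeasure (density (distr lborel borel f) (%_. ennreal \<bar>det (matrix f)\<bar>)) A"
  by (simp add: emeasure_density_const)
 finally show "emeasure lborel A = ..." .
qed simp

lemma integral_linear:
 fixes f :: "real^'n => real^'n" and F :: "real^'n => real"
 assumes "linear f" "det (matrix f) ~= 0" "F \<in> borel_measurable borel"
 shows "(LINT x|lborel. F x) = \<bar>det (matrix f)\<bar> * (LINT x|lborel. F (f x))"
proof -
 have [measurable]: "f \<in> borel_measurable borel"
  using assms(1) by (simp add: borel_measurable_continuous_onI linear_continuous_on linear_linear)
 note [measurable] = assms(3)
 show ?thesis
  by (subst lborel_linear[OF assms(1,2)]) (simp add: integral_density integral_distr)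
qed

lemma integral_affine:
 fixes F :: "'a::euclidean_space => real"
 assumes "c ~= 0" "F \<in> borel_measurable borel"
 shows "(LINT x|lborel. F x) = \<bar>c\<bar> ^ DIM('a) * (LINT x|lborel. F (t + c *\<^sub>R x))"
proof -
 note [measurable] = assms(2)
 show ?thesis
  using assms(1) by (subst lborel_affine[of c t]) (simp_all add: integral_density integral_distr)
qed

lemma nn_integral_affine:
 fixes F :: "'a::euclidean_space => ennreal"
 assumes "c > 0" "F \<in> borel_measurable borel"
 shows "(\<integral>\<^sup>+x. F x \<partial>lborel) = ennreal (c ^ DIM('a)) * (\<integral>\<^sup>+x. F (t + c *\<^sub>R x) \<partial>lborel)"
proof -
 note [measurable] = assms(2)
 show ?thesis
  using assms(1)
  by (subst lborel_affine[of c t]) (simp_all add: nn_integral_density nn_integral_distr nn_integral_cmult)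
qed

text \<open>The squared norm is a sum over coordinates, so the integral is a product of
  one-dimensional ones, each a rescaled normal density with variance
  \<open>1 / (2 * c)\<close>.\<close>

lemma integrable_gaussian:
 assumes "c > 0"
 shows "integrable lborel (%x::'a::euclidean_space. exp (- c * (norm x)\<^sup>2))"
proof (rule integrableI_bounded)
 define \<sigma> where "\<sigma> = sqrt (1 / (2 * c))"
 have \<sigma>: "\<sigma> > 0" "\<sigma>\<^sup>2 = 1 / (2 * c)" using assms by (auto simp: \<sigma>_def)
 have one: "exp (- c * t\<^sup>2) = sqrt (2 * pi * \<sigma>\<^sup>2) * normal_density 0 \<sigma> t" for t
  unfolding normal_density_def using assms \<sigma> by (simp add: field_simps)
 have "integrable lborel (%t. exp (- c * t\<^sup>2))"
  unfolding one using \<sigma> by (intro integrable_mult_right integrable_normal_density) auto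
 then have fin: "(\<integral>\<^sup>+t. ennreal (exp (- c * t\<^sup>2)) \<partial>lborel) < \<infinity>"
  by (simp add: integrable_iff_bounded)
 have "(norm x)\<^sup>2 = (\<Sum>b\<in>Basis. (x \<bullet> b)\<^sup>2)" for x :: 'a
  unfolding power2_norm_eq_inner by (subst euclidean_inner) (simp add: power2_eq_square)
 then have e: "exp (- c * (norm x)\<^sup>2) = (\<Prod>b\<in>Basis. exp (- c * (x \<bullet> b)\<^sup>2))" for x :: 'a
  by (simp add: sum_distrib_left exp_sum sum_negf[symmetric] del: sum_negf)
 have "(\<integral>\<^sup>+(x::'a). ennreal (norm (exp (- c * (norm x)\<^sup>2))) \<partial>lborel) =
  (\<integral>\<^sup>+(x::'a). (\<Prod>b\<in>Basis. ennreal (exp (- c * (x \<bullet> b)\<^sup>2))) \<partial>lborel)"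
  unfolding e by (simp add: prod_ennreal abs_prod)
 also have "... = (\<Prod>b\<in>(Basis::'a set). (\<integral>\<^sup>+t. ennreal (exp (- c * t\<^sup>2)) \<partial>lborel))"
  by (rule nn_integral_lborel_prod) auto
 also have "... < \<infinity>" using fin by (simp add: power_less_top_ennreal)
 finally show "(\<integral>\<^sup>+(x::'a). ennreal (norm (exp (- c * (norm x)\<^sup>2))) \<partial>lborel) < \<infinity>" .
qed simp

text \<open>The bound \<open>1 + x \<le> exp x\<close> turns the polynomial into
  \<open>exp (m * x)\<close>, and completing the square splits \<open>m * x\<close> into a constant
  and half of the Gaussian exponent.\<close>

lemma poly_exp_bound:
 fixes c :: real
 assumes "c > 0"
 shows "\<exists>C>0. \<forall>x\<ge>0. (1 + x) ^ m * exp (- c * x\<^sup>2) <= C * exp (- (c / 2) * x\<^sup>2)"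
proof -
 have "(1 + x) ^ m * exp (- c * x\<^sup>2) <= exp (real m ^ 2 / (2 * c)) * exp (- (c / 2) * x\<^sup>2)" if "x \<ge> 0" for x
 proof -
  have "(1 + x) ^ m <= exp x ^ m" using that by (intro power_mono exp_ge_add_one_self) auto
  also have "... = exp (real m * x)" by (simp add: exp_of_nat_mult)
  finally have "(1 + x) ^ m * exp (- c * x\<^sup>2) <= exp (real m * x) * exp (- c * x\<^sup>2)"
   by (intro mult_right_mono) auto
  also have "... = exp (real m * x - c * x\<^sup>2)" by (simp add: exp_add[symmetric])
  also have "... <= exp (real m ^ 2 / (2 * c) + - (c / 2) * x\<^sup>2)"
  proof -
   have "0 <= (c * x - real m)\<^sup>2 / (2 * c)" using assms by simp
   also have "... = real m ^ 2 / (2 * c) + (c / 2) * x\<^sup>2 - real m * x"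
    using assms by (simp add: power2_eq_square field_simps)
   finally show ?thesis by (simp add: algebra_simps)
  qed
  finally show ?thesis by (simp only: exp_add)
 qed
 then show ?thesis by (intro exI[of _ "exp (real m ^ 2 / (2 * c))"]) auto
qed

lemma integrable_poly_gaussian:
 assumes "c > 0"
 shows "integrable lborel (%x::'a::euclidean_space. (1 + norm x) ^ m * exp (- c * (norm x)\<^sup>2))"
proof -
 obtain C where C: "C > 0" "!!x. x \<ge> 0 ==> (1 + x) ^ m * exp (- c * x\<^sup>2) <= C * exp (- (c / 2) * x\<^sup>2)"
  using poly_exp_bound[OF assms] by blast
 show ?thesis
 proof (rule Bochner_Integration.integrable_bound)
  show "integrable lborel (%x::'a. C * exp (- (c / 2) * (norm x)\<^sup>2))"
   using integrable_gaussian[of "c / 2"] assms by (intro integrable_mult_right) auto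
 qed (use C in \<open>auto intro!: AE_I2\<close>)
qed

text \<open>The bound is asked only off the origin, because the derivatives of the kernel are
  controlled at positive arguments only; the origin is a null set.\<close>

lemma integrable_dominated:
 fixes F :: "'a::euclidean_space => real"
 assumes "c > 0" "F \<in> borel_measurable borel"
  "!!x. x ~= 0 ==> \<bar>F x\<bar> <= B * ((1 + norm x) ^ m * exp (- c * (norm x)\<^sup>2))"
 shows "integrable lborel F"
proof (rule Bochner_Integration.integrable_bound)
 show "integrable lborel (%x::'a. B * ((1 + norm x) ^ m * exp (- c * (norm x)\<^sup>2)))"
  using integrable_poly_gaussian[OF assms(1)] by (intro integrable_mult_right) auto
 show "AE x in lborel. norm (F x) <= norm (B * ((1 + norm x) ^ m * exp (- c * (norm x)\<^sup>2)))"
  using AE_lborel_singleton[of 0]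
 proof eventually_elim
  case (elim x)
  then show ?case using assms(3)[of x] by auto
 qed
qed (use assms in auto)

section \<open>The kernel\<close>

text \<open>The exponential bound is monotone and can be frozen at a common lower bound
  \<open>m\<close> of both points; the convex set \<open>{0<..} \<inter> {m..}\<close> contains the
  segment between them.\<close>

lemma exp_decay_lipschitz:
 fixes f f' :: "real => real"
 assumes "!!\<xi>. \<xi> > 0 ==> (f has_real_derivative f' \<xi>) (at \<xi>)"
  and "!!\<xi>. \<xi> > 0 ==> \<bar>f' \<xi>\<bar> <= A * exp (- a * \<xi>)"
  and "a > 0" "A > 0" "x > 0" "y > 0" "m <= x" "m <= y"
 shows "\<bar>f x - f y\<bar> <= A * exp (- a * m) * \<bar>x - y\<bar>"
proof -
 have "norm (f x - f y) <= A * exp (- a * m) * norm (x - y)"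
 proof (rule field_differentiable_bound)
  show "convex ({0<..} \<inter> {m..})" by (intro convex_Int convex_real_interval)
  show "(f has_real_derivative f' z) (at z within {0<..} \<inter> {m..})" if "z \<in> {0<..} \<inter> {m..}" for z
   using assms(1) that by (auto intro: has_field_derivative_at_within)
  show "norm (f' z) <= A * exp (- a * m)" if "z \<in> {0<..} \<inter> {m..}" for z
   using order_trans[OF assms(2)[of z], of "A * exp (- a * m)"] that assms(3,4) by auto
 qed (use assms in auto)
 then show ?thesis by simp
qed

lemma exp_decay_taylor:
 fixes f f' f'' :: "real => real"
 assumes "!!\<xi>. \<xi> > 0 ==> (f has_real_derivative f' \<xi>) (at \<xi>)"
  and "!!\<xi>. \<xi> > 0 ==> (f' has_real_derivative f'' \<xi>) (at \<xi>)"
  and "!!\<xi>. \<xi> > 0 ==> \<bar>f'' \<xi>\<bar> <= A * exp (- a * \<xi>)"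
  and "a > 0" "A > 0" "x > 0" "y > 0" "m <= x" "m <= y"
 shows "\<bar>f x - f y - f' y * (x - y)\<bar> <= A * exp (- a * m) * (x - y)\<^sup>2"
proof -
 \<comment> \<open>Intersecting with the ball about \<open>y\<close> keeps
   \<open>\<bar>z - y\<bar> \<le> \<bar>x - y\<bar>\<close>, so that the derivative of the remainder
   is itself of first order in \<open>\<bar>x - y\<bar>\<close>.\<close>
 let ?S = "{0<..} \<inter> {m..} \<inter> cball y \<bar>x - y\<bar>"
 have "norm ((f x - f' y * x) - (f y - f' y * y)) <= (A * exp (- a * m) * \<bar>x - y\<bar>) * norm (x - y)"
 proof (rule field_differentiable_bound)
  show "convex ?S" by (intro convex_Int convex_real_interval convex_cball)
  show "((%x. f x - f' y * x) has_real_derivative f' z - f' y) (at z within ?S)" if "z \<in> ?S" for z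
   using assms(1) that by (auto intro!: derivative_eq_intros intro: has_field_derivative_at_within)
  show "norm (f' z - f' y) <= A * exp (- a * m) * \<bar>x - y\<bar>" if "z \<in> ?S" for z
  proof -
   have "\<bar>f' z - f' y\<bar> <= A * exp (- a * m) * \<bar>z - y\<bar>"
    using that assms by (intro exp_decay_lipschitz[of f' f'']) auto
   also have "... <= A * exp (- a * m) * \<bar>x - y\<bar>"
    using that assms(5) by (intro mult_left_mono) (auto simp: dist_real_def)
   finally show ?thesis by simp
  qed
 qed (use assms in \<open>auto simp: dist_real_def\<close>)
 moreover have "(f x - f' y * x) - (f y - f' y * y) = f x - f y - f' y * (x - y)"
  by (simp add: algebra_simps)
 moreover have "\<bar>x - y\<bar> * \<bar>x - y\<bar> = (x - y)\<^sup>2"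
  by (simp add: power2_eq_square)
 ultimately show ?thesis by (simp only: real_norm_def mult.assoc)
qed

text \<open>About the midpoint the second order terms of \<open>f x\<close> and \<open>f y\<close>
  are equal and cancel in the difference, which leaves a cubic remainder. The proof integrates the
  second difference of \<open>f1\<close> along the segment from the midpoint.\<close>

lemma exp_decay_midpoint:
 fixes f f1 f2 f3 :: "real => real"
 assumes "!!\<xi>. \<xi> > 0 ==> (f has_real_derivative f1 \<xi>) (at \<xi>)"
  and "!!\<xi>. \<xi> > 0 ==> (f1 has_real_derivative f2 \<xi>) (at \<xi>)"
  and "!!\<xi>. \<xi> > 0 ==> (f2 has_real_derivative f3 \<xi>) (at \<xi>)"
  and "!!\<xi>. \<xi> > 0 ==> \<bar>f3 \<xi>\<bar> <= A * exp (- a * \<xi>)"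
  and "a > 0" "A > 0" "x > 0" "y > 0" "m <= x" "m <= y"
 shows "\<bar>f x - f y - f1 ((x + y) / 2) * (x - y)\<bar> <= A * exp (- a * m) * \<bar>x - y\<bar> ^ 3"
proof -
 define c d where "c = (x + y) / 2" and "d = (x - y) / 2"
 have pos: "c + t * d > 0" "c + t * d \<ge> m" "c - t * d > 0" "c - t * d \<ge> m" if "t \<in> {0..1}" for t
 proof -
  have e: "c + t * d = (1 + t) / 2 * x + (1 - t) / 2 * y" "c - t * d = (1 - t) / 2 * x + (1 + t) / 2 * y"
   by (auto simp: c_def d_def field_simps)
  have n: "(1 + t) / 2 > 0" "(1 - t) / 2 \<ge> 0" using that by auto
  have m: "m = (1 + t) / 2 * m + (1 - t) / 2 * m" "m = (1 - t) / 2 * m + (1 + t) / 2 * m"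
   by (auto simp: field_simps)
  show "c + t * d > 0" unfolding e using n assms(7,8) by (intro add_pos_nonneg mult_pos_pos mult_nonneg_nonneg) auto
  show "c - t * d > 0" unfolding e using n assms(7,8) by (intro add_nonneg_pos mult_pos_pos mult_nonneg_nonneg) auto
  show "c + t * d \<ge> m" unfolding e using n assms(9,10) by (subst m(1)) (intro add_mono mult_left_mono, auto)
  show "c - t * d \<ge> m" unfolding e using n assms(9,10) by (subst m(2)) (intro add_mono mult_left_mono, auto)
 qed
 let ?B = "A * exp (- a * m)"
 let ?h = "%t. f (c + t * d) - f (c - t * d) - 2 * t * d * f1 c"
 have B: "?B > 0" using assms by simp
 have "norm (?h 1) <= ?B * (2 * \<bar>d\<bar> ^ 3)"
 proof (rule increment_bound[where h = ?h and h' = "%t. d * (f1 (c + t * d) + f1 (c - t * d) - 2 * f1 c)"])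
  fix t :: real assume t: "t \<in> {0..1}"
  note der = DERIV_chain2[OF assms(1)]
  have "(?h has_real_derivative d * (f1 (c + t * d) + f1 (c - t * d) - 2 * f1 c)) (at t)"
   using pos[OF t] by (auto intro!: derivative_eq_intros der simp: algebra_simps)
  then show "(?h has_vector_derivative d * (f1 (c + t * d) + f1 (c - t * d) - 2 * f1 c)) (at t within {0..1})"
   by (simp add: has_real_derivative_iff_has_vector_derivative has_vector_derivative_at_within)
  have c: "c > 0" "c \<ge> m" using pos[of 0] by auto
  have "\<bar>f1 (c + t * d) - f1 c - f2 c * (c + t * d - c)\<bar> <= ?B * (c + t * d - c)\<^sup>2"
   "\<bar>f1 (c - t * d) - f1 c - f2 c * (c - t * d - c)\<bar> <= ?B * (c - t * d - c)\<^sup>2"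
   by (rule exp_decay_taylor[OF assms(2,3,4,5,6)]; use pos[OF t] c in simp)+
  then have "\<bar>f1 (c + t * d) + f1 (c - t * d) - 2 * f1 c\<bar> <= ?B * (2 * (t * d)\<^sup>2)"
   by (simp add: algebra_simps abs_le_iff)
  also have "... <= ?B * (2 * d\<^sup>2)"
   using B t by (intro mult_left_mono) (auto simp: power_mult_distrib power_le_one mult_left_le_one_le)
  finally have "\<bar>d\<bar> * \<bar>f1 (c + t * d) + f1 (c - t * d) - 2 * f1 c\<bar> <= \<bar>d\<bar> * (?B * (2 * d\<^sup>2))"
   by (intro mult_left_mono) auto
  then show "norm (d * (f1 (c + t * d) + f1 (c - t * d) - 2 * f1 c)) <= ?B * (2 * \<bar>d\<bar> ^ 3)"
   by (simp add: abs_mult power3_eq_cube power2_eq_square mult_ac)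
 qed auto
 also have "... <= ?B * \<bar>x - y\<bar> ^ 3"
  using B by (intro mult_left_mono) (auto simp: d_def power_divide)
 finally show ?thesis by (simp add: c_def d_def algebra_simps add_divide_distrib diff_divide_distrib)
qed

lemma matrix_inv_eqI:
 fixes X Y :: "real^'n^'n"
 assumes "X ** Y = mat 1" "Y ** X = mat 1"
 shows "matrix_inv X = Y"
proof -
 have "X ** matrix_inv X = mat 1"
  unfolding matrix_inv_def by (rule someI2[of _ Y]) (use assms in auto)
 then have "Y ** (X ** matrix_inv X) = Y" by simp
 then show ?thesis by (simp add: matrix_mul_assoc assms(2))
qed

text \<open>The kernel is extended to the whole line so that it is measurable there. The extension
  may fail to be differentiable at zero, hence \<open>k1\<close>, \<open>k2\<close>,
  \<open>k3\<close> are tied to it at positive arguments only. One pair \<open>A\<close>,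
  \<open>a\<close> serves for all bounds.\<close>

locale decaying_kernel =
 fixes k0 k1 k2 k3 :: "real => real" and A a :: real
 assumes A_pos: "A > 0" and a_pos: "a > 0"
  and k0_cont: "continuous_on UNIV k0"
  and k1_meas [measurable]: "k1 \<in> borel_measurable borel"
  and k0_nonneg: "0 <= k0 \<xi>"
  and k0_pos: "\<exists>\<xi>>0. k0 \<xi> > 0"
  and k0_der: "\<xi> > 0 ==> (k0 has_real_derivative k1 \<xi>) (at \<xi>)"
  and k1_der: "\<xi> > 0 ==> (k1 has_real_derivative k2 \<xi>) (at \<xi>)"
  and k2_der: "\<xi> > 0 ==> (k2 has_real_derivative k3 \<xi>) (at \<xi>)"
  and k0_bound: "\<xi> \<ge> 0 ==> k0 \<xi> <= A * exp (- a * \<xi>)"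
  and k1_bound: "\<xi> > 0 ==> \<bar>k1 \<xi>\<bar> <= A * exp (- a * \<xi>)"
  and k2_bound: "\<xi> > 0 ==> \<bar>k2 \<xi>\<bar> <= A * exp (- a * \<xi>)"
  and k3_bound: "\<xi> > 0 ==> \<bar>k3 \<xi>\<bar> <= A * exp (- a * \<xi>)"
begin

lemma k0_meas [measurable]: "k0 \<in> borel_measurable borel"
 using k0_cont by (rule borel_measurable_continuous_onI)

text \<open>Both values are expanded at \<open>b\<close>. The linear terms add up to
  \<open>k1 b * (x + y - 2 * b)\<close>, which is of second order when \<open>x\<close> and
  \<open>y\<close> lie nearly symmetrically about \<open>b\<close>.\<close>

lemma k0_sum_bound:
 assumes "x > 0" "y > 0" "b > 0" "m <= x" "m <= y" "m <= b"
 shows "\<bar>k0 x + k0 y - 2 * k0 b\<bar> <= A * exp (- a * m) * (\<bar>x + y - 2 * b\<bar> + (x - b)\<^sup>2 + (y - b)\<^sup>2)"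
proof -
 have "\<bar>k0 x - k0 b - k1 b * (x - b)\<bar> <= A * exp (- a * m) * (x - b)\<^sup>2"
  using assms A_pos a_pos by (intro exp_decay_taylor[OF k0_der k1_der k2_bound]) auto
 moreover have "\<bar>k0 y - k0 b - k1 b * (y - b)\<bar> <= A * exp (- a * m) * (y - b)\<^sup>2"
  using assms A_pos a_pos by (intro exp_decay_taylor[OF k0_der k1_der k2_bound]) auto
 moreover have "\<bar>k1 b\<bar> * \<bar>x + y - 2 * b\<bar> <= A * exp (- a * m) * \<bar>x + y - 2 * b\<bar>"
  using k1_bound[of b] assms A_pos a_pos
  by (intro mult_right_mono) (auto intro: order_trans[OF _ mult_left_mono])
 moreover have "k0 x + k0 y - 2 * k0 b = (k0 x - k0 b - k1 b * (x - b)) + (k0 y - k0 b - k1 b * (y - b)) + k1 b * (x + y - 2 * b)"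
  by (simp add: algebra_simps)
 ultimately show ?thesis
  using abs_mult[of "k1 b" "x + y - 2 * b"]
  by (simp add: distrib_left) linarith
qed

text \<open>The expansion at the midpoint has a cubic error; moving \<open>k1\<close> from the
  midpoint to \<open>b\<close> costs the Lipschitz term with the factor
  \<open>\<bar>x + y - 2 * b\<bar>\<close>.\<close>

lemma k0_diff_bound:
 assumes "x > 0" "y > 0" "b > 0" "m <= x" "m <= y" "m <= b"
 shows "\<bar>k0 x - k0 y - k1 b * (x - y)\<bar> <= A * exp (- a * m) * (\<bar>x - y\<bar> ^ 3 + \<bar>x - y\<bar> * \<bar>x + y - 2 * b\<bar>)"
proof -
 let ?c = "(x + y) / 2"
 have "\<bar>k0 x - k0 y - k1 ?c * (x - y)\<bar> <= A * exp (- a * m) * \<bar>x - y\<bar> ^ 3"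
  using assms A_pos a_pos by (intro exp_decay_midpoint[OF k0_der k1_der k2_der k3_bound]) auto
 moreover have "\<bar>(k1 ?c - k1 b) * (x - y)\<bar> <= A * exp (- a * m) * (\<bar>x - y\<bar> * \<bar>x + y - 2 * b\<bar>)"
 proof -
  have "\<bar>k1 ?c - k1 b\<bar> <= A * exp (- a * m) * \<bar>?c - b\<bar>"
   using assms A_pos a_pos by (intro exp_decay_lipschitz[OF k1_der k2_bound]) auto
  also have "... <= A * exp (- a * m) * \<bar>x + y - 2 * b\<bar>"
  proof (intro mult_left_mono)
   have "?c - b = (x + y - 2 * b) / 2" by (simp add: field_simps)
   then show "\<bar>?c - b\<bar> <= \<bar>x + y - 2 * b\<bar>" by (simp only: abs_divide) simp
  qed (use A_pos in auto)
  finally show ?thesis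
   using mult_right_mono[of _ _ "\<bar>x - y\<bar>"] by (fastforce simp: abs_mult mult_ac)
 qed
 moreover have "k0 x - k0 y - k1 b * (x - y) = (k0 x - k0 y - k1 ?c * (x - y)) + (k1 ?c - k1 b) * (x - y)"
  by (simp add: algebra_simps)
 ultimately show ?thesis by (simp only: distrib_left)
qed

text \<open>
 Also valid for \<open>x = 0\<close> or \<open>y = 0\<close>, where \<open>k0\<close> need not be differentiable.
\<close>

lemma k0_scale_bound:
 assumes "x \<ge> 0" "\<tau> > 0" "m <= \<tau>" "m <= 1" "m > 0"
 shows "\<bar>k0 (x * \<tau>) - k0 x\<bar> <= A * exp (- a * (m * x)) * (x * \<bar>\<tau> - 1\<bar>)"
proof (cases "x = 0")
 case False
 then have "x > 0" using assms by simp
 then have "\<bar>k0 (x * \<tau>) - k0 x\<bar> <= A * exp (- a * (m * x)) * \<bar>x * \<tau> - x\<bar>"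
  using assms A_pos a_pos
  by (intro exp_decay_lipschitz[OF k0_der k1_bound]) (auto simp: mult.commute mult_left_le)
 also have "\<bar>x * \<tau> - x\<bar> = x * \<bar>\<tau> - 1\<bar>"
  using \<open>x > 0\<close> abs_mult[of x "\<tau> - 1"] by (simp add: algebra_simps)
 finally show ?thesis .
qed simp

lemma kernel_moment_integrable:
 "integrable lborel (%u::'b::euclidean_space. norm u ^ j * k0 ((norm u)\<^sup>2))"
proof (rule integrable_dominated)
 show "\<bar>norm u ^ j * k0 ((norm u)\<^sup>2)\<bar> <= A * ((1 + norm u) ^ j * exp (- a * (norm u)\<^sup>2))" for u :: 'b
 proof -
  have "norm u ^ j * k0 ((norm u)\<^sup>2) <= (1 + norm u) ^ j * (A * exp (- a * (norm u)\<^sup>2))"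
   using k0_bound[of "(norm u)\<^sup>2"] k0_nonneg by (intro mult_mono power_mono) auto
  then show ?thesis using k0_nonneg by (simp add: mult_ac)
 qed
qed (use a_pos in \<open>auto\<close>)

text \<open>The integrand is continuous, nonnegative and positive at a vector of length
  \<open>sqrt \<xi>\<close>, where \<open>k0 \<xi> > 0\<close>; hence it is positive on a ball,
  which has positive measure.\<close>

lemma kernel_moment_pos: "0 < (LINT u|lborel. norm (u::'b::euclidean_space) ^ j * k0 ((norm u)\<^sup>2))"
proof -
 let ?F = "%u::'b. norm u ^ j * k0 ((norm u)\<^sup>2)"
 have "integral\<^sup>L lborel ?F ~= 0"
 proof
  assume "integral\<^sup>L lborel ?F = 0"
  then have AE: "AE u in lborel. ?F u = 0"
   using integral_nonneg_eq_0_iff_AE[OF kernel_moment_integrable] k0_nonneg by auto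
  obtain \<xi> where \<xi>: "\<xi> > 0" "k0 \<xi> > 0" using k0_pos by blast
  define u0 :: 'b where "u0 = sqrt \<xi> *\<^sub>R (SOME b. b \<in> Basis)"
  have n: "norm u0 = sqrt \<xi>" using \<xi> by (simp add: u0_def norm_Basis[OF SOME_Basis])
  have "?F u0 > 0" using \<xi> by (simp add: n)
  moreover have "continuous_on UNIV ?F"
   by (intro continuous_intros continuous_on_compose2[OF k0_cont]) auto
  ultimately have "open (?F -` {0<..})" "u0 \<in> ?F -` {0<..}"
   by (auto intro!: open_vimage)
  then obtain e where e: "e > 0" "ball u0 e \<subseteq> ?F -` {0<..}"
   by (meson open_contains_ball)
  from AE have "AE u in lborel. u \<notin> ball u0 e"
  proof eventually_elim
   case (elim u)
   then have "u \<notin> ?F -` {0<..}" by (simp only: vimage_eq greaterThan_iff less_irrefl not_False_eq_True)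
   then show ?case using e(2) by blast
  qed
  then have "emeasure lborel (ball u0 e) = 0"
   by (subst (asm) AE_iff_measurable[OF _ refl]) (auto simp: ball_def)
  then show False using content_ball_pos[OF e(1), of u0] by (simp add: measure_def)
 qed
 moreover have "integral\<^sup>L lborel ?F \<ge> 0" using k0_nonneg by (intro Bochner_Integration.integral_nonneg) auto
 ultimately show ?thesis by simp
qed

lemma kernel_m0_pos: "kernel_m0 TYPE('n::finite) k0 > 0"
 using kernel_moment_pos[of 0, where 'b = "real^'n"] by (simp add: kernel_m0_def)

lemma kernel_m2_pos: "kernel_m2 TYPE('n::finite) k0 > 0"
 using kernel_moment_pos[of 2, where 'b = "real^'n"] by (simp add: kernel_m2_def)

lemma integrable_component_moment:
 "integrable lborel (%u::real^'n. k0 ((norm u)\<^sup>2) * (u $ i * u $ j))"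
proof (rule Bochner_Integration.integrable_bound[OF kernel_moment_integrable[of 2]])
 show "AE u in lborel. norm (k0 ((norm u)\<^sup>2) * (u $ i * u $ j)) <= norm (norm u ^ 2 * k0 ((norm (u::real^'n))\<^sup>2))"
 proof (intro AE_I2)
  fix u :: "real^'n"
  have "\<bar>u $ i\<bar> * \<bar>u $ j\<bar> <= norm u * norm u"
   by (intro mult_mono component_le_norm_cart) auto
  then have "k0 ((norm u)\<^sup>2) * (\<bar>u $ i\<bar> * \<bar>u $ j\<bar>) <= k0 ((norm u)\<^sup>2) * (norm u * norm u)"
   using k0_nonneg by (intro mult_left_mono)
  then show "norm (k0 ((norm u)\<^sup>2) * (u $ i * u $ j)) <= norm (norm u ^ 2 * k0 ((norm u)\<^sup>2))"
   using k0_nonneg by (simp add: abs_mult power2_eq_square mult_ac)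
 qed
qed measurable

lemma integral_orthogonal:
 fixes F :: "real^'n => real" and f :: "real^'n => real^'n"
 assumes "orthogonal_transformation f" "F \<in> borel_measurable borel"
 shows "(LINT x|lborel. F x) = (LINT x|lborel. F (f x))"
proof -
 have d: "\<bar>det (matrix f)\<bar> = 1" by (rule orthogonal_transformation_det[OF assms(1)])
 then have "det (matrix f) ~= 0" by auto
 from integral_linear[OF orthogonal_transformation_linear[OF assms(1)] this assms(2)] d
 show ?thesis by simp
qed

text \<open>Isotropy: reflecting the coordinate \<open>i\<close> changes the sign of an off-diagonal
  moment, exchanging two coordinates equates the diagonal ones, and their sum is the integral in
  \<open>kernel_m2\<close>.\<close>

lemma component_moment:
 "(LINT u|lborel. k0 ((norm (u::real^'n))\<^sup>2) * (u $ i * u $ j)) = (if i = j then kernel_m2 TYPE('n) k0 else 0)"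
proof -
 let ?I = "%i j. LINT u|lborel. k0 ((norm (u::real^'n))\<^sup>2) * (u $ i * u $ j)"
 have off: "?I i j = 0" if "i ~= j"
 proof -
  let ?f = "%x::real^'n. \<chi> k. if k = i then - x $ k else x $ k"
  have "orthogonal_transformation ?f"
   unfolding orthogonal_transformation
   by (auto intro!: linearI simp: vec_eq_iff norm_vec_def L2_set_def intro!: arg_cong[where f = sqrt] sum.cong)
  then have n: "norm (?f x) = norm x" and "?I i j = (LINT x|lborel. k0 ((norm (?f x))\<^sup>2) * (?f x $ i * ?f x $ j))" for x
   using integral_orthogonal[of ?f "%u. k0 ((norm u)\<^sup>2) * (u $ i * u $ j)"]
   by (auto simp: orthogonal_transformation)
  then have "?I i j = - ?I i j" using that by (simp add: n)
  then show ?thesis by simp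
 qed
 have diag: "?I k k = ?I l l" for k l
 proof -
  let ?f = "%x::real^'n. \<chi> i. x $ Transposition.transpose k l i"
  have s: "(\<Sum>i\<in>UNIV. (x $ Transposition.transpose k l i)\<^sup>2) = (\<Sum>i\<in>UNIV. (x $ i)\<^sup>2)" for x :: "real^'n"
   using sum.permute[OF permutes_swap_id[of k UNIV l], of "%i. (x $ i)\<^sup>2"] by (simp add: o_def)
  have "orthogonal_transformation ?f"
   unfolding orthogonal_transformation
   by (auto intro!: linearI simp: vec_eq_iff norm_vec_def L2_set_def s)
  then have n: "norm (?f x) = norm x" and "?I k k = (LINT x|lborel. k0 ((norm (?f x))\<^sup>2) * (?f x $ k * ?f x $ k))" for x
   using integral_orthogonal[of ?f "%u. k0 ((norm u)\<^sup>2) * (u $ k * u $ k)"]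
   by (auto simp: orthogonal_transformation)
  then show ?thesis by (simp add: n)
 qed
 have "(LINT u|lborel. (norm (u::real^'n))\<^sup>2 * k0 ((norm u)\<^sup>2)) = (LINT u|lborel. (\<Sum>k\<in>UNIV. k0 ((norm (u::real^'n))\<^sup>2) * (u $ k * u $ k)))"
  by (intro Bochner_Integration.integral_cong refl)
   (simp add: power2_norm_eq_inner inner_vec_def sum_distrib_right sum_distrib_left mult_ac)
 also have "... = (\<Sum>k\<in>UNIV. ?I k k)"
  by (intro Bochner_Integration.integral_sum integrable_component_moment)
 also have "... = (\<Sum>k\<in>(UNIV :: 'n set). ?I i i)" by (intro sum.cong refl diag)
 also have "... = real CARD('n) * ?I i i" by simp
 finally show ?thesis using off by (auto simp: kernel_m2_def)
qed

lemma linear_moment0: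
 fixes L :: "real^'n => real^'n"
 assumes "linear L" "det (matrix L) ~= 0"
 shows "(LINT z|lborel. k0 ((norm (L z))\<^sup>2)) = kernel_m0 TYPE('n) k0 / \<bar>det (matrix L)\<bar>"
 using integral_linear[OF assms, of "%u. k0 ((norm u)\<^sup>2)"] assms(2)
 by (simp add: kernel_m0_def field_simps)

text \<open>Under the substitution \<open>u = L z\<close> one has \<open>z = B u\<close> with
  \<open>B\<close> the inverse matrix. Isotropy leaves \<open>B ** transpose B\<close>, which is the
  inverse of the Gram matrix of \<open>L\<close>.\<close>

lemma linear_moment2:
 fixes L :: "real^'n => real^'n"
 assumes "linear L" "det (matrix L) ~= 0"
 shows "(LINT z|lborel. k0 ((norm (L z))\<^sup>2) * (z $ i * z $ j)) =
  kernel_m2 TYPE('n) k0 * matrix_inv (transpose (matrix L) ** matrix L) $ i $ j / \<bar>det (matrix L)\<bar>"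
proof -
 obtain B where B: "matrix L ** B = mat 1" "B ** matrix L = mat 1"
  using assms(2) unfolding invertible_det_nz[symmetric] invertible_def by blast
 have inv: "matrix_inv (transpose (matrix L) ** matrix L) = B ** transpose B"
 proof -
  have 1: "(B ** transpose B) ** (transpose (matrix L) ** matrix L) = mat 1"
   by (metis B matrix_mul_assoc matrix_mul_rid matrix_transpose_mul transpose_mat)
  then have 2: "(transpose (matrix L) ** matrix L) ** (B ** transpose B) = mat 1"
   using matrix_left_right_inverse by blast
  show ?thesis by (rule matrix_inv_eqI[OF 2 1])
 qed
 have BL: "B *v L z = z" for z
 proof -
  have "L z = matrix L *v z" by (simp add: matrix_works assms(1))
  then show ?thesis by (simp add: matrix_vector_mul_assoc B(2))
 qed
 have comp: "(B *v x) $ i = (\<Sum>k\<in>UNIV. B $ i $ k * x $ k)" for x i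
  by (simp add: matrix_vector_mult_def)
 have m: "(%u. k0 ((norm u)\<^sup>2) * ((B *v u) $ i * (B *v u) $ j)) \<in> borel_measurable borel"
  unfolding comp by measurable
 have "(LINT u|lborel. k0 ((norm u)\<^sup>2) * ((B *v u) $ i * (B *v u) $ j)) =
  (LINT u|lborel. (\<Sum>k\<in>UNIV. \<Sum>l\<in>UNIV. B $ i $ k * B $ j $ l * (k0 ((norm u)\<^sup>2) * (u $ k * u $ l))))"
  by (intro Bochner_Integration.integral_cong refl)
   (simp only: comp sum_product, simp only: sum_distrib_left, intro sum.cong refl, simp only: mult_ac)
 also have "... = (\<Sum>k\<in>UNIV. \<Sum>l\<in>UNIV. B $ i $ k * B $ j $ l * (if k = l then kernel_m2 TYPE('n) k0 else 0))"
  by (simp add: Bochner_Integration.integral_sum integrable_component_moment Bochner_Integration.integrable_sum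
    component_moment)
 also have "... = kernel_m2 TYPE('n) k0 * (B ** transpose B) $ i $ j"
  by (simp add: if_distrib matrix_matrix_mult_def transpose_def sum_distrib_left mult_ac cong: if_cong)
 finally show ?thesis
  using integral_linear[OF assms m] assms(2) by (simp add: BL inv field_simps)
qed

end

section \<open>Symmetrized Laplace expansion\<close>

lemma abs_mult_le: "\<bar>p\<bar> <= P ==> \<bar>q\<bar> <= Q ==> \<bar>p * q\<bar> <= P * (Q :: real)"
 by (simp add: abs_mult mult_mono')

context decaying_kernel
begin

text \<open>The four summands are the constants of the error terms \<open>t1\<close> to
  \<open>t4\<close> in \<open>laplace_pointwise\<close>, in this order.\<close>

definition laplace_const :: "real => real" where
 "laplace_const C = A * (3 * C * (C + 8 * C\<^sup>2) + 2 * C + 3 * C * (8 * C ^ 3 + 2 * C\<^sup>2 + C) + C\<^sup>2)"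

text \<open>Here \<open>x\<close> and \<open>y\<close> are the kernel arguments at a point and at
  its mirror image, \<open>b\<close> is their common leading term and \<open>G\<close> the leading
  odd term; \<open>P\<close> and \<open>Q\<close> are the leading even and odd parts of the
  amplitude. Pairing even with even and odd with odd parts puts every error two orders in
  \<open>h\<close> below the main term. The odd part \<open>Q\<close> has degree
  \<open>m - 1\<close>; the extra factors \<open>n\<close> and \<open>h\<close> avoid a negative
  degree at \<open>m = 0\<close>.\<close>

lemma laplace_pointwise:
 assumes h: "0 < h" "h <= 1" and n: "0 < n" and "0 < \<mu>" "\<mu> <= x" "\<mu> <= y" "\<mu> <= b" and C: "0 <= C"
  and e1: "\<bar>x + y - 2 * b\<bar> <= C * h\<^sup>2 * n ^ 4" and e2: "\<bar>x - y - h * G\<bar> <= C * h ^ 3 * n ^ 5"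
  and G: "\<bar>G\<bar> <= C * n ^ 3"
  and e3: "\<bar>Hp + Hm - 2 * h ^ m * P\<bar> <= C * h ^ (m + 2) * n ^ (m + 2)"
  and e4: "n * \<bar>h * (Hp - Hm) - 2 * h ^ m * Q\<bar> <= C * h ^ (m + 2) * n ^ (m + 2)"
  and P: "\<bar>P\<bar> <= C * n ^ m" and Q: "n * \<bar>Q\<bar> <= C * n ^ m"
 shows "\<bar>k0 x * Hp + k0 y * Hm - 2 * h ^ m * (k0 b * P + k1 b * G * Q / 2)\<bar>
  <= laplace_const C * h ^ (m + 2) * (1 + n) ^ (m + 16) * exp (- a * \<mu>)"
proof -
 define N where "N = 1 + n"
 define E where "E = A * exp (- a * \<mu>)"
 have N: "1 <= N" "n <= N" using n by (auto simp: N_def)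
 have E: "E > 0" using A_pos by (simp add: E_def)
 have pow: "n ^ i <= N ^ j" if "i <= j" for i j
  using power_mono[of n N i] power_increasing[OF that N(1)] n N by simp
 have Npow: "N ^ i <= N ^ j" if "i <= j" for i j
  using power_increasing[OF that N(1)] by simp
 have hpow: "h ^ i <= h ^ j" if "j <= i" for i j
  using power_decreasing[OF that, of h] h by simp
 have pos: "x > 0" "y > 0" "b > 0" using assms by auto
 \<comment> \<open>One factor \<open>n\<close> is kept apart instead of being raised to
   \<open>N\<close>: in \<open>t3\<close> it meets the odd part of the amplitude, which is
   controlled only after multiplication by \<open>n\<close>.\<close>
 have xy: "\<bar>x - y\<bar> <= 2 * C * h * n * N ^ 4"
 proof -
  have "\<bar>h * G\<bar> <= h * (C * n ^ 3)" using G h by (intro abs_mult_le) auto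
  then have "\<bar>x - y\<bar> <= C * h ^ 3 * n ^ 5 + h * (C * n ^ 3)"
   using e2 by linarith
  also have "... = C * (h ^ 3 * (n ^ 4 * n)) + C * (h * (n ^ 2 * n))"
   by (simp add: power_numeral_reduce algebra_simps)
  also have "... <= C * (h * (N ^ 4 * n)) + C * (h * (N ^ 4 * n))"
   using C h n N pow[of 4 4] pow[of 2 4] hpow[of 1 3]
   by (intro add_mono mult_left_mono mult_mono mult_right_mono) auto
  finally show ?thesis by (simp add: mult_ac)
 qed
 have nN: "n * N ^ 4 <= N ^ 5"
  using mult_right_mono[OF N(2), of "N ^ 4"] N by (simp add: power_numeral_reduce)
 have xy': "\<bar>x - y\<bar> <= 2 * C * h * N ^ 5"
  using order_trans[OF xy, of "2 * C * h * N ^ 5"] mult_left_mono[OF nN, of "2 * C * h"] C h by (simp add: mult.assoc)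
 have e1': "\<bar>x + y - 2 * b\<bar> <= C * h\<^sup>2 * N ^ 4"
  by (rule order_trans[OF e1]) (use C pow[of 4 4] in \<open>auto intro!: mult_left_mono\<close>)
 have e1'': "\<bar>x + y - 2 * b\<bar> <= C * h * N ^ 5"
  by (rule order_trans[OF e1]) (use C h n N pow[of 4 5] hpow[of 1 2] in \<open>auto intro!: mult_mono mult_left_mono\<close>)
 have xb: "\<bar>x - b\<bar> <= 2 * C * h * N ^ 5" "\<bar>y - b\<bar> <= 2 * C * h * N ^ 5"
  using e1'' xy' by linarith+
 have sq: "(x - b)\<^sup>2 <= 4 * C\<^sup>2 * h\<^sup>2 * N ^ 10" "(y - b)\<^sup>2 <= 4 * C\<^sup>2 * h\<^sup>2 * N ^ 10" "\<bar>x - y\<bar>\<^sup>2 <= 4 * C\<^sup>2 * h\<^sup>2 * N ^ 10"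
  using power_mono[OF xb(1), of 2] power_mono[OF xb(2), of 2] power_mono[OF xy', of 2]
  by (simp_all add: power_mult_distrib flip: power_mult)
 have Kp: "\<bar>k0 x + k0 y - 2 * k0 b\<bar> <= E * ((C + 8 * C\<^sup>2) * h\<^sup>2 * N ^ 10)"
 proof -
  have "\<bar>k0 x + k0 y - 2 * k0 b\<bar> <= E * (\<bar>x + y - 2 * b\<bar> + (x - b)\<^sup>2 + (y - b)\<^sup>2)"
   unfolding E_def using assms pos by (intro k0_sum_bound) auto
  also have "... <= E * (C * h\<^sup>2 * N ^ 10 + 4 * C\<^sup>2 * h\<^sup>2 * N ^ 10 + 4 * C\<^sup>2 * h\<^sup>2 * N ^ 10)"
   using order_trans[OF e1' mult_left_mono[OF Npow[of 4 10]]] C sq E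
   by (intro mult_left_mono add_mono) auto
  finally show ?thesis by (simp add: algebra_simps)
 qed
 have k1b: "\<bar>k1 b\<bar> <= E" "\<bar>k0 b\<bar> <= E"
  using k1_bound[of b] k0_bound[of b] k0_nonneg[of b] pos assms a_pos A_pos
  by (auto simp: E_def intro: order_trans[OF _ mult_left_mono])
 have Km: "\<bar>k0 x - k0 y - h * k1 b * G\<bar> <= E * ((8 * C ^ 3 + 2 * C\<^sup>2 + C) * h ^ 3 * n * N ^ 14)"
 proof -
  have "\<bar>k0 x - k0 y - k1 b * (x - y)\<bar> <= E * (\<bar>x - y\<bar> ^ 3 + \<bar>x - y\<bar> * \<bar>x + y - 2 * b\<bar>)"
   unfolding E_def using assms pos by (intro k0_diff_bound) auto
  also have "... <= E * ((2 * C * h * n * N ^ 4) * (4 * C\<^sup>2 * h\<^sup>2 * N ^ 10) + (2 * C * h * n * N ^ 4) * (C * h\<^sup>2 * N ^ 4))"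
  proof (intro mult_left_mono add_mono mult_mono)
   have "\<bar>x - y\<bar> ^ 3 = \<bar>x - y\<bar> * \<bar>x - y\<bar>\<^sup>2" by (simp add: power3_eq_cube power2_eq_square)
   also have "... <= (2 * C * h * n * N ^ 4) * (4 * C\<^sup>2 * h\<^sup>2 * N ^ 10)"
    using xy sq C h n N by (intro mult_mono) auto
   finally show "\<bar>x - y\<bar> ^ 3 <= ..." .
  qed (use E C h n N xy e1' in auto)
  also have "... = E * (8 * C ^ 3 * (h ^ 3 * n) * N ^ 14 + 2 * C\<^sup>2 * (h ^ 3 * n) * N ^ 8)"
   by (simp add: power_numeral_reduce algebra_simps)
  also have "... <= E * (8 * C ^ 3 * (h ^ 3 * n) * N ^ 14 + 2 * C\<^sup>2 * (h ^ 3 * n) * N ^ 14)"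
   using E C h n Npow[of 8 14] by (intro mult_left_mono add_mono order_refl) auto
  finally have 1: "\<bar>k0 x - k0 y - k1 b * (x - y)\<bar> <= E * (8 * C ^ 3 * (h ^ 3 * n) * N ^ 14 + 2 * C\<^sup>2 * (h ^ 3 * n) * N ^ 14)" .
  have "\<bar>k1 b * (x - y - h * G)\<bar> <= E * (C * h ^ 3 * n ^ 5)"
   by (intro abs_mult_le k1b e2)
  also have "... = E * (C * (h ^ 3 * n) * n ^ 4)"
   by (simp add: power_numeral_reduce algebra_simps)
  also have "... <= E * (C * (h ^ 3 * n) * N ^ 14)"
   using E C h n pow[of 4 14] by (intro mult_left_mono) auto
  finally have 2: "\<bar>k1 b * (x - y - h * G)\<bar> <= E * (C * (h ^ 3 * n) * N ^ 14)" .
  have "k0 x - k0 y - h * k1 b * G = (k0 x - k0 y - k1 b * (x - y)) + k1 b * (x - y - h * G)"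
   by (simp add: algebra_simps)
  then have "\<bar>k0 x - k0 y - h * k1 b * G\<bar> <= E * (8 * C ^ 3 * (h ^ 3 * n) * N ^ 14 + 2 * C\<^sup>2 * (h ^ 3 * n) * N ^ 14) + E * (C * (h ^ 3 * n) * N ^ 14)"
   using 1 2 by linarith
  then show ?thesis by (simp add: algebra_simps)
 qed
 have Hp: "\<bar>Hp + Hm\<bar> <= 3 * C * h ^ m * N ^ (m + 2)"
 proof -
  have "\<bar>2 * h ^ m * P\<bar> <= (2 * h ^ m) * (C * N ^ (m + 2))"
   using order_trans[OF P mult_left_mono[OF pow[of m "m + 2"] C]] h by (intro abs_mult_le) auto
  also have "... = 2 * (C * h ^ m * N ^ (m + 2))" by simp
  finally have "\<bar>2 * h ^ m * P\<bar> <= 2 * (C * h ^ m * N ^ (m + 2))" .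
  moreover have "C * h ^ (m + 2) * n ^ (m + 2) <= C * h ^ m * N ^ (m + 2)"
   using C h n N pow[of "m + 2" "m + 2"] hpow[of m "m + 2"] by (intro mult_mono mult_left_mono) auto
  ultimately show ?thesis using e3 by linarith
 qed
 have Hm: "n * \<bar>h * (Hp - Hm)\<bar> <= 3 * C * h ^ m * N ^ (m + 2)"
 proof -
  have "n * \<bar>2 * h ^ m * Q\<bar> = 2 * h ^ m * (n * \<bar>Q\<bar>)" using h by (simp add: abs_mult)
  also have "... <= 2 * h ^ m * (C * N ^ (m + 2))"
   using order_trans[OF Q mult_left_mono[OF pow[of m "m + 2"] C]] h by (intro mult_left_mono) auto
  also have "... = 2 * (C * h ^ m * N ^ (m + 2))" by simp
  finally have "n * \<bar>2 * h ^ m * Q\<bar> <= 2 * (C * h ^ m * N ^ (m + 2))" .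
  moreover have "C * h ^ (m + 2) * n ^ (m + 2) <= C * h ^ m * N ^ (m + 2)"
   using C h n N pow[of "m + 2" "m + 2"] hpow[of m "m + 2"] by (intro mult_mono mult_left_mono) auto
  moreover have "n * \<bar>h * (Hp - Hm)\<bar> <= n * \<bar>h * (Hp - Hm) - 2 * h ^ m * Q\<bar> + n * \<bar>2 * h ^ m * Q\<bar>"
   unfolding distrib_left[symmetric] using n by (intro mult_left_mono) auto
  ultimately show ?thesis using e4 by linarith
 qed
 have t1: "\<bar>(k0 x + k0 y - 2 * k0 b) * (Hp + Hm)\<bar> <= E * (3 * C * (C + 8 * C\<^sup>2)) * (h ^ (m + 2) * N ^ (m + 16))"
 proof -
  have "\<bar>(k0 x + k0 y - 2 * k0 b) * (Hp + Hm)\<bar> <= (E * ((C + 8 * C\<^sup>2) * h\<^sup>2 * N ^ 10)) * (3 * C * h ^ m * N ^ (m + 2))"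
   by (intro abs_mult_le Kp Hp)
  also have "... = E * (3 * C * (C + 8 * C\<^sup>2)) * (h ^ (m + 2) * N ^ (m + 12))"
   by (simp add: power_add power_numeral_reduce algebra_simps)
  also have "... <= E * (3 * C * (C + 8 * C\<^sup>2)) * (h ^ (m + 2) * N ^ (m + 16))"
   using E C h Npow[of "m+12" "m+16"] by (intro mult_left_mono) auto
  finally show ?thesis .
 qed
 have t2: "\<bar>(2 * k0 b) * (Hp + Hm - 2 * h ^ m * P)\<bar> <= E * (2 * C) * (h ^ (m + 2) * N ^ (m + 16))"
 proof -
  have "\<bar>(2 * k0 b) * (Hp + Hm - 2 * h ^ m * P)\<bar> <= (2 * E) * (C * h ^ (m + 2) * n ^ (m + 2))"
   using k1b by (intro abs_mult_le e3) auto
  also have "... <= (2 * E) * (C * h ^ (m + 2) * N ^ (m + 16))"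
   using E C h pow[of "m+2" "m+16"] by (intro mult_left_mono) auto
  finally show ?thesis by (simp add: mult_ac)
 qed
 have t3: "\<bar>(k0 x - k0 y - h * k1 b * G) * (Hp - Hm)\<bar> <= E * (3 * C * (8 * C ^ 3 + 2 * C\<^sup>2 + C)) * (h ^ (m + 2) * N ^ (m + 16))"
 proof -
  have "\<bar>(k0 x - k0 y - h * k1 b * G) * (Hp - Hm)\<bar> <= (E * ((8 * C ^ 3 + 2 * C\<^sup>2 + C) * h ^ 3 * n * N ^ 14)) * \<bar>Hp - Hm\<bar>"
   unfolding abs_mult by (intro mult_right_mono Km) auto
  also have "... = E * (8 * C ^ 3 + 2 * C\<^sup>2 + C) * h\<^sup>2 * N ^ 14 * (n * \<bar>h * (Hp - Hm)\<bar>)"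
  proof -
   have "\<bar>h * (Hp - Hm)\<bar> = h * \<bar>Hp - Hm\<bar>" using h by (simp add: abs_mult)
   moreover have "h ^ 3 = h * h\<^sup>2" by (simp add: power3_eq_cube power2_eq_square)
   ultimately show ?thesis by (simp only: mult_ac)
  qed
  also have "... <= E * (8 * C ^ 3 + 2 * C\<^sup>2 + C) * h\<^sup>2 * N ^ 14 * (3 * C * h ^ m * N ^ (m + 2))"
   using E C h N by (intro mult_left_mono Hm mult_nonneg_nonneg add_nonneg_nonneg) auto
  also have "... = E * (3 * C * (8 * C ^ 3 + 2 * C\<^sup>2 + C)) * (h ^ (m + 2) * N ^ (m + 16))"
   by (simp add: power_add power_numeral_reduce algebra_simps)
  finally show ?thesis .
 qed
 define D where "D = h * (Hp - Hm) - 2 * h ^ m * Q"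
 have t4: "\<bar>k1 b * G * D\<bar> <= E * C\<^sup>2 * (h ^ (m + 2) * N ^ (m + 16))"
 proof -
  have "\<bar>k1 b * G * D\<bar> <= (E * (C * n ^ 3)) * \<bar>D\<bar>"
   by (intro abs_mult_le k1b G) simp
  also have "... = E * C * n\<^sup>2 * (n * \<bar>D\<bar>)" by (simp add: power_numeral_reduce algebra_simps)
  also have "... <= E * C * n\<^sup>2 * (C * h ^ (m + 2) * n ^ (m + 2))"
   using e4 E C by (intro mult_left_mono) (auto simp: D_def)
  also have "... = E * C\<^sup>2 * (h ^ (m + 2) * n ^ (m + 4))"
   by (simp add: power_add power_numeral_reduce algebra_simps)
  also have "... <= E * C\<^sup>2 * (h ^ (m + 2) * N ^ (m + 16))"
   using E C h pow[of "m+4" "m+16"] by (intro mult_left_mono) auto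
  finally show ?thesis .
 qed
 \<comment> \<open>Twice the even part of a product is even times even plus odd times odd; each
   factor is then compared with its leading part.\<close>
 have split: "2 * (k0 x * Hp + k0 y * Hm - 2 * h ^ m * (k0 b * P + k1 b * G * Q / 2)) =
  (k0 x + k0 y - 2 * k0 b) * (Hp + Hm) + (2 * k0 b) * (Hp + Hm - 2 * h ^ m * P)
  + (k0 x - k0 y - h * k1 b * G) * (Hp - Hm) + k1 b * G * D"
  by (simp add: D_def algebra_simps)
 let ?W = "h ^ (m + 2) * N ^ (m + 16)"
 have "\<bar>2 * (k0 x * Hp + k0 y * Hm - 2 * h ^ m * (k0 b * P + k1 b * G * Q / 2))\<bar> \<le>
  E * (3 * C * (C + 8 * C\<^sup>2)) * ?W + E * (2 * C) * ?W + E * (3 * C * (8 * C ^ 3 + 2 * C\<^sup>2 + C)) * ?W + E * C\<^sup>2 * ?W"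
  unfolding split using t1 t2 t3 t4 by linarith
 also have "... = laplace_const C * h ^ (m + 2) * (1 + n) ^ (m + 16) * exp (- a * \<mu>)"
  unfolding laplace_const_def E_def N_def by (simp only: distrib_left distrib_right mult_ac)
 finally show ?thesis
  by (rule order_trans[rotated]) (simp add: abs_mult)
qed

text \<open>For the phase \<open>s\<close>, \<open>g\<close> is the quadratic part and
  \<open>g1\<close> twice the cubic part; for the amplitude \<open>H\<close>, \<open>P\<close> and
  \<open>Q\<close> are the leading even and odd parts, homogeneous of degrees \<open>m\<close> and
  \<open>m - 1\<close>. The numbers \<open>c\<close>, \<open>C\<close>, \<open>r\<close> are
  separate arguments so that one remainder constant serves for all phases and amplitudes that share
  them, in particular for all base points of a ball.\<close>

definition sym_expansion ::
 "real => real => real => nat => ('b::euclidean_space => real) => ('b => real) => ('b => real) =>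
  ('b => real) => ('b => real) => ('b => real) => bool" where
 "sym_expansion c C r m s g g1 H P Q \<longleftrightarrow>
  s \<in> borel_measurable borel \<and> g \<in> borel_measurable borel \<and> g1 \<in> borel_measurable borel \<and>
  H \<in> borel_measurable borel \<and> P \<in> borel_measurable borel \<and> Q \<in> borel_measurable borel \<and>
  (\<forall>w. norm w < r -->
   c * (norm w)\<^sup>2 <= s w \<and> \<bar>H w\<bar> <= C \<and>
   \<bar>s w + s (- w) - 2 * g w\<bar> <= C * norm w ^ 4 \<and>
   \<bar>s w - s (- w) - g1 w\<bar> <= C * norm w ^ 5 \<and>
   \<bar>H w + H (- w) - 2 * P w\<bar> <= C * norm w ^ (m + 2) \<and>
   norm w * \<bar>H w - H (- w) - 2 * Q w\<bar> <= C * norm w ^ (m + 2)) \<and>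
  (\<forall>w. c * (norm w)\<^sup>2 <= g w \<and> \<bar>g1 w\<bar> <= C * norm w ^ 3 \<and> \<bar>P w\<bar> <= C * norm w ^ m \<and>
   norm w * \<bar>Q w\<bar> <= C * norm w ^ m) \<and>
  (\<forall>w t. t > 0 --> g (t *\<^sub>R w) = t\<^sup>2 * g w \<and> g1 (t *\<^sub>R w) = t ^ 3 * g1 w \<and>
   P (t *\<^sub>R w) = t ^ m * P w \<and> t * Q (t *\<^sub>R w) = t ^ m * Q w)"

text \<open>After the substitution \<open>w = h z\<close> the integrand is replaced by its even
  part, which has the same integral; its distance to the main term is at most
  \<open>h ^ (m + 2)\<close> times an integrable Gaussian weight that depends on \<open>c\<close>
  and \<open>m\<close> alone.\<close>

lemma laplace_expansion:
 assumes c: "c > 0" and C: "C \<ge> 0" and r: "r > 0"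
 shows "\<exists>B\<ge>0. \<forall>(s::'b::euclidean_space => real) g g1 H P Q h. sym_expansion c C r m s g g1 H P Q --> 0 < h --> h <= 1 -->
  \<bar>(LINT w|lborel. indicator (ball 0 r) w * (k0 (s w / h\<^sup>2) * H w))
   - h ^ (DIM('b) + m) * (LINT z|lborel. k0 (g z) * P z + k1 (g z) * g1 z * Q z / 2)\<bar> <= B * h ^ (DIM('b) + m + 2)"
proof -
 define L where "L = laplace_const C + A * (C + C\<^sup>2) / r\<^sup>2"
 define J where "J = (LINT z::'b|lborel. (1 + norm z) ^ (m + 16) * exp (- (a * c) * (norm z)\<^sup>2))"
 have ac: "a * c > 0" using a_pos c by simp
 have L0: "L \<ge> 0" "laplace_const C \<ge> 0" "0 <= A * (C + C\<^sup>2) / r\<^sup>2"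
  using C A_pos by (auto simp: L_def laplace_const_def)
 have J0: "J \<ge> 0" unfolding J_def by (intro Bochner_Integration.integral_nonneg) auto
 show ?thesis
 proof (intro exI[of _ "L * J"] conjI allI impI)
  show "0 <= L * J" using L0 J0 by simp
  fix s g g1 H P Q :: "'b => real" and h :: real
  assume se: "sym_expansion c C r m s g g1 H P Q" and h: "0 < h" "h <= 1"
  have [measurable]: "s \<in> borel_measurable borel" "g \<in> borel_measurable borel" "g1 \<in> borel_measurable borel"
   "H \<in> borel_measurable borel" "P \<in> borel_measurable borel" "Q \<in> borel_measurable borel"
   using se by (auto simp: sym_expansion_def)
  have loc: "c * (norm w)\<^sup>2 <= s w" "\<bar>H w\<bar> <= C" "\<bar>s w + s (- w) - 2 * g w\<bar> <= C * norm w ^ 4"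
   "\<bar>s w - s (- w) - g1 w\<bar> <= C * norm w ^ 5" "\<bar>H w + H (- w) - 2 * P w\<bar> <= C * norm w ^ (m + 2)"
   "norm w * \<bar>H w - H (- w) - 2 * Q w\<bar> <= C * norm w ^ (m + 2)" if "norm w < r" for w
   using se that by (auto simp: sym_expansion_def)
  have glob: "c * (norm w)\<^sup>2 <= g w" "\<bar>g1 w\<bar> <= C * norm w ^ 3" "\<bar>P w\<bar> <= C * norm w ^ m"
   "norm w * \<bar>Q w\<bar> <= C * norm w ^ m" for w
   using se by (auto simp: sym_expansion_def)
  have hom: "g (h *\<^sub>R w) = h\<^sup>2 * g w" "g1 (h *\<^sub>R w) = h ^ 3 * g1 w" "P (h *\<^sub>R w) = h ^ m * P w"
   "h * Q (h *\<^sub>R w) = h ^ m * Q w" for w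
   using se h by (auto simp: sym_expansion_def)
  define f where "f w = indicator (ball 0 r) w * (k0 (s w / h\<^sup>2) * H w)" for w
  define M where "M z = k0 (g z) * P z + k1 (g z) * g1 z * Q z / 2" for z
  define w where "w z = (1 + norm z) ^ (m + 16) * exp (- (a * c) * (norm z)\<^sup>2)" for z :: 'b
  have [measurable]: "ball (0::'b) r \<in> sets borel" by simp
  have [measurable]: "f \<in> borel_measurable borel" unfolding f_def[abs_def] by measurable
  have [measurable]: "M \<in> borel_measurable borel" unfolding M_def[abs_def] by measurable
  have [measurable]: "w \<in> borel_measurable borel" unfolding w_def[abs_def] by measurable
  have f_bd: "\<bar>f v\<bar> <= A * C * ((1 + norm v) ^ 0 * exp (- (a * c / h\<^sup>2) * (norm v)\<^sup>2))" for v
  proof (cases "norm v < r")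
   case True
   have sv: "c * (norm v)\<^sup>2 / h\<^sup>2 <= s v / h\<^sup>2" "0 <= c * (norm v)\<^sup>2 / h\<^sup>2"
    using loc(1)[OF True] c by (auto intro: divide_right_mono)
   have "k0 (s v / h\<^sup>2) <= A * exp (- a * (s v / h\<^sup>2))"
    using sv by (intro k0_bound) linarith
   also have "... <= A * exp (- a * (c * (norm v)\<^sup>2 / h\<^sup>2))"
   proof (intro mult_left_mono)
    have "a * (c * (norm v)\<^sup>2 / h\<^sup>2) <= a * (s v / h\<^sup>2)" using sv a_pos by (intro mult_left_mono) auto
    then show "exp (- a * (s v / h\<^sup>2)) <= exp (- a * (c * (norm v)\<^sup>2 / h\<^sup>2))"
     by (simp only: exp_le_cancel_iff mult_minus_left neg_le_iff_le)
   qed (use A_pos in simp)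
   finally have "\<bar>k0 (s v / h\<^sup>2)\<bar> <= A * exp (- a * (c * (norm v)\<^sup>2 / h\<^sup>2))" using k0_nonneg by simp
   from abs_mult_le[OF this loc(2)[OF True]] True show ?thesis by (simp add: f_def mult_ac)
  qed (use A_pos C in \<open>simp add: f_def\<close>)
  have f_int: "integrable lborel f"
   by (rule integrable_dominated[of "a * c / h\<^sup>2" _ "A * C" 0]) (use f_bd ac h in auto)
  have M_bd: "\<bar>M z\<bar> <= A * (C + C\<^sup>2) * ((1 + norm z) ^ (m + 2) * exp (- (a * c) * (norm z)\<^sup>2))" if "z ~= 0" for z
  proof -
   let ?E = "exp (- (a * c) * (norm z)\<^sup>2)" and ?n = "norm z"
   have n: "?n > 0" using that by simp
   have gz: "g z > 0" "c * ?n\<^sup>2 <= g z" using glob(1)[of z] c n by (auto intro: less_le_trans[rotated])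
   have le: "exp (- a * g z) <= ?E" using gz a_pos by (simp add: mult.assoc)
   have k: "\<bar>k0 (g z)\<bar> <= A * ?E" "\<bar>k1 (g z)\<bar> <= A * ?E"
   proof -
    have "A * exp (- a * g z) <= A * ?E" using le A_pos by (intro mult_left_mono) auto
    moreover have "k0 (g z) <= A * exp (- a * g z)" "\<bar>k1 (g z)\<bar> <= A * exp (- a * g z)" "k0 (g z) \<ge> 0"
     using k0_bound[of "g z"] k1_bound[of "g z"] k0_nonneg[of "g z"] gz by auto
    ultimately show "\<bar>k0 (g z)\<bar> <= A * ?E" "\<bar>k1 (g z)\<bar> <= A * ?E" by linarith+
   qed
   have pw: "?n ^ m <= (1 + ?n) ^ (m + 2)" "?n ^ 2 * ?n ^ m <= (1 + ?n) ^ (m + 2)"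
   proof -
    have "?n ^ m <= (1 + ?n) ^ m" by (intro power_mono) auto
    also have "... <= (1 + ?n) ^ (m + 2)" by (intro power_increasing) auto
    finally show "?n ^ m <= (1 + ?n) ^ (m + 2)" .
    show "?n ^ 2 * ?n ^ m <= (1 + ?n) ^ (m + 2)"
     unfolding power_add[symmetric] by (subst add.commute) (intro power_mono, auto)
   qed
   have "\<bar>k0 (g z) * P z\<bar> <= A * ?E * (C * ?n ^ m)" by (intro abs_mult_le k glob)
   also have "... <= A * ?E * (C * (1 + ?n) ^ (m + 2))"
    using A_pos C pw by (intro mult_left_mono) auto
   finally have 1: "\<bar>k0 (g z) * P z\<bar> <= A * C * ((1 + ?n) ^ (m + 2) * ?E)" by (simp add: mult_ac)
   have "\<bar>k1 (g z) * g1 z * Q z\<bar> <= (A * ?E * (C * ?n ^ 3)) * \<bar>Q z\<bar>"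
    by (intro abs_mult_le k glob) simp
   also have "... = A * ?E * C * ?n ^ 2 * (?n * \<bar>Q z\<bar>)" by (simp add: power_numeral_reduce)
   also have "... <= A * ?E * C * ?n ^ 2 * (C * ?n ^ m)"
    using A_pos C by (intro mult_left_mono glob) auto
   also have "... = A * ?E * C\<^sup>2 * (?n ^ 2 * ?n ^ m)" by (simp add: power2_eq_square)
   also have "... <= A * ?E * C\<^sup>2 * (1 + ?n) ^ (m + 2)"
    using A_pos C pw by (intro mult_left_mono) auto
   finally have 2: "\<bar>k1 (g z) * g1 z * Q z\<bar> <= A * C\<^sup>2 * ((1 + ?n) ^ (m + 2) * ?E)" by (simp add: mult_ac)
   have "0 <= A * C\<^sup>2 * ((1 + ?n) ^ (m + 2) * ?E)" using A_pos by simp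
   then show ?thesis using 1 2 unfolding M_def by (simp add: distrib_left distrib_right)
  qed
  have M_int: "integrable lborel M"
   by (rule integrable_dominated[OF ac _ M_bd]) auto
  have w_int: "integrable lborel w"
   unfolding w_def[abs_def] by (rule integrable_poly_gaussian[OF ac])
  \<comment> \<open>The average of the two substitutions \<open>w = h z\<close> and
    \<open>w = - h z\<close>, which have the same Jacobian.\<close>
  define F where "F z = (f (h *\<^sub>R z) + f (- h *\<^sub>R z)) / 2" for z
  have f_sc_int: "integrable lborel (%z. f (t *\<^sub>R z))" if "t ~= 0" "t\<^sup>2 = h\<^sup>2" for t
  proof (rule integrable_dominated[of "a * c" _ "A * C" 0])
   show "\<bar>f (t *\<^sub>R z)\<bar> <= A * C * ((1 + norm z) ^ 0 * exp (- (a * c) * (norm z)\<^sup>2))" for z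
    using f_bd[of "t *\<^sub>R z"] that h by (simp add: power_mult_distrib mult.assoc)
  qed (use ac in auto)
  have F_int: "integrable lborel F"
   unfolding F_def[abs_def] using f_sc_int[of h] f_sc_int[of "-h"] h by auto
  let ?a = "LINT z|lborel. f (h *\<^sub>R z)" and ?b = "LINT z|lborel. f (- h *\<^sub>R z)"
  have "integral\<^sup>L lborel f = h ^ DIM('b) * ?a" "integral\<^sup>L lborel f = h ^ DIM('b) * ?b"
   using integral_affine[of h f 0] integral_affine[of "- h" f 0] h by simp_all
  moreover have F: "integral\<^sup>L lborel F = (?a + ?b) / 2"
   unfolding F_def[abs_def] using f_sc_int[of h] f_sc_int[of "-h"] h by simp
  have "2 * (h ^ DIM('b) * integral\<^sup>L lborel F) = h ^ DIM('b) * ?a + h ^ DIM('b) * ?b"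
   unfolding F by (simp add: distrib_left)
  ultimately have fF: "integral\<^sup>L lborel f = h ^ DIM('b) * integral\<^sup>L lborel F"
   by linarith
  have pointwise: "\<bar>F z - h ^ m * M z\<bar> <= L * h ^ (m + 2) * w z" if z: "z ~= 0" for z
  proof (cases "h * norm z < r")
   case False
   then have F0: "F z = 0" using h by (simp add: F_def f_def)
   \<comment> \<open>Outside the cut-off only the main term is left. There
     \<open>h * norm z / r \<ge> 1\<close>, and its square supplies the two missing powers of
     \<open>h\<close> at the price of a factor \<open>(norm z)^2\<close>.\<close>
   have "1 <= (h * norm z / r)\<^sup>2"
    using False r by (intro one_le_power) (simp add: field_simps)
   then have one: "1 <= h\<^sup>2 * (norm z)\<^sup>2 / r\<^sup>2" by (simp add: power_divide power_mult_distrib)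
   have "\<bar>h ^ m * M z\<bar> <= h ^ m * (A * (C + C\<^sup>2) * ((1 + norm z) ^ (m + 2) * exp (- (a * c) * (norm z)\<^sup>2))) * 1"
    using M_bd[OF z] h by (simp add: abs_mult)
   also have "... <= h ^ m * (A * (C + C\<^sup>2) * ((1 + norm z) ^ (m + 2) * exp (- (a * c) * (norm z)\<^sup>2))) * (h\<^sup>2 * (norm z)\<^sup>2 / r\<^sup>2)"
    using one h A_pos C by (intro mult_left_mono) auto
   also have "... = (A * (C + C\<^sup>2) / r\<^sup>2) * h ^ (m + 2) * (((1 + norm z) ^ (m + 2) * (norm z)\<^sup>2) * exp (- (a * c) * (norm z)\<^sup>2))"
    by (simp add: power_add power2_eq_square)
   also have "... <= (A * (C + C\<^sup>2) / r\<^sup>2) * h ^ (m + 2) * ((1 + norm z) ^ (m + 16) * exp (- (a * c) * (norm z)\<^sup>2))"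
   proof (intro mult_left_mono mult_right_mono)
    have "(1 + norm z) ^ (m + 2) * (norm z)\<^sup>2 <= (1 + norm z) ^ (m + 2) * (1 + norm z)\<^sup>2"
     by (intro mult_left_mono power_mono) auto
    also have "... = (1 + norm z) ^ (m + 4)" by (simp only: power_add[symmetric] add.assoc) simp
    also have "... <= (1 + norm z) ^ (m + 16)" by (intro power_increasing) auto
    finally show "(1 + norm z) ^ (m + 2) * (norm z)\<^sup>2 <= (1 + norm z) ^ (m + 16)" .
   qed (use A_pos C h in auto)
   also have "... <= L * h ^ (m + 2) * w z"
    unfolding w_def L_def using L0 h by (intro mult_right_mono) auto
   finally show ?thesis by (simp add: F0)
  next
   case True
   have nz: "norm (h *\<^sub>R z) = h * norm z" using h by simp
   have lt: "norm (h *\<^sub>R z) < r" "norm (- (h *\<^sub>R z)) < r" using True h by auto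
   have F: "F z = (k0 (s (h *\<^sub>R z) / h\<^sup>2) * H (h *\<^sub>R z) + k0 (s (- (h *\<^sub>R z)) / h\<^sup>2) * H (- (h *\<^sub>R z))) / 2"
    using lt by (simp add: F_def f_def)
   have h2: "h\<^sup>2 > 0" using h by simp
   have "\<bar>k0 (s (h *\<^sub>R z) / h\<^sup>2) * H (h *\<^sub>R z) + k0 (s (- (h *\<^sub>R z)) / h\<^sup>2) * H (- (h *\<^sub>R z))
    - 2 * h ^ m * (k0 (g z) * P z + k1 (g z) * g1 z * Q z / 2)\<bar>
    <= laplace_const C * h ^ (m + 2) * (1 + norm z) ^ (m + 16) * exp (- a * (c * (norm z)\<^sup>2))"
   proof (rule laplace_pointwise[OF h])
    show "0 < norm z" "0 < c * (norm z)\<^sup>2" using z c by auto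
    show "c * (norm z)\<^sup>2 <= s (h *\<^sub>R z) / h\<^sup>2" "c * (norm z)\<^sup>2 <= s (- (h *\<^sub>R z)) / h\<^sup>2"
     using loc(1)[OF lt(1)] loc(1)[OF lt(2)] h2 h by (auto simp: le_divide_eq power_mult_distrib mult_ac)
    show "\<bar>s (h *\<^sub>R z) / h\<^sup>2 + s (- (h *\<^sub>R z)) / h\<^sup>2 - 2 * g z\<bar> <= C * h\<^sup>2 * norm z ^ 4"
    proof -
     have "s (h *\<^sub>R z) / h\<^sup>2 + s (- (h *\<^sub>R z)) / h\<^sup>2 - 2 * g z = (s (h *\<^sub>R z) + s (- (h *\<^sub>R z)) - 2 * g (h *\<^sub>R z)) / h\<^sup>2"
      using h by (simp add: hom diff_divide_distrib add_divide_distrib)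
     then have "\<bar>s (h *\<^sub>R z) / h\<^sup>2 + s (- (h *\<^sub>R z)) / h\<^sup>2 - 2 * g z\<bar> <= C * (h * norm z) ^ 4 / h\<^sup>2"
      using loc(3)[OF lt(1)] h h2 by (simp add: nz abs_divide divide_right_mono)
     also have "... = C * h\<^sup>2 * norm z ^ 4" using h by (simp add: power_numeral_reduce field_simps)
     finally show ?thesis .
    qed
    show "\<bar>s (h *\<^sub>R z) / h\<^sup>2 - s (- (h *\<^sub>R z)) / h\<^sup>2 - h * g1 z\<bar> <= C * h ^ 3 * norm z ^ 5"
    proof -
     have "s (h *\<^sub>R z) / h\<^sup>2 - s (- (h *\<^sub>R z)) / h\<^sup>2 - h * g1 z = (s (h *\<^sub>R z) - s (- (h *\<^sub>R z)) - g1 (h *\<^sub>R z)) / h\<^sup>2"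
      using h by (simp add: hom diff_divide_distrib power_numeral_reduce)
     then have "\<bar>s (h *\<^sub>R z) / h\<^sup>2 - s (- (h *\<^sub>R z)) / h\<^sup>2 - h * g1 z\<bar> <= C * (h * norm z) ^ 5 / h\<^sup>2"
      using loc(4)[OF lt(1)] h h2 by (simp add: nz abs_divide divide_right_mono)
     also have "... = C * h ^ 3 * norm z ^ 5" using h by (simp add: power_numeral_reduce field_simps)
     finally show ?thesis .
    qed
    show "\<bar>H (h *\<^sub>R z) + H (- (h *\<^sub>R z)) - 2 * h ^ m * P z\<bar> <= C * h ^ (m + 2) * norm z ^ (m + 2)"
     using loc(5)[OF lt(1)] unfolding nz hom by (simp only: power_mult_distrib mult.assoc)
    have "norm z * \<bar>h * (H (h *\<^sub>R z) - H (- (h *\<^sub>R z))) - 2 * h ^ m * Q z\<bar> =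
     norm z * \<bar>h * (H (h *\<^sub>R z) - H (- (h *\<^sub>R z)) - 2 * Q (h *\<^sub>R z))\<bar>"
    proof -
     have "h * (H (h *\<^sub>R z) - H (- (h *\<^sub>R z)) - 2 * Q (h *\<^sub>R z)) =
      h * (H (h *\<^sub>R z) - H (- (h *\<^sub>R z))) - 2 * (h * Q (h *\<^sub>R z))"
      by (simp only: right_diff_distrib mult.left_commute)
     then show ?thesis by (simp only: hom(4) mult.assoc)
    qed
    also have "... = norm (h *\<^sub>R z) * \<bar>H (h *\<^sub>R z) - H (- (h *\<^sub>R z)) - 2 * Q (h *\<^sub>R z)\<bar>"
     using h by (simp add: abs_mult)
    also have "... <= C * h ^ (m + 2) * norm z ^ (m + 2)"
     using loc(6)[OF lt(1)] unfolding nz by (simp only: power_mult_distrib mult.assoc)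
    finally show "norm z * \<bar>h * (H (h *\<^sub>R z) - H (- (h *\<^sub>R z))) - 2 * h ^ m * Q z\<bar> <= C * h ^ (m + 2) * norm z ^ (m + 2)" .
   qed (use C glob in auto)
   moreover have "F z - h ^ m * M z = (k0 (s (h *\<^sub>R z) / h\<^sup>2) * H (h *\<^sub>R z) + k0 (s (- (h *\<^sub>R z)) / h\<^sup>2) * H (- (h *\<^sub>R z))
    - 2 * h ^ m * (k0 (g z) * P z + k1 (g z) * g1 z * Q z / 2)) / 2" (is "_ = ?T / 2")
    unfolding F M_def by (simp add: diff_divide_distrib)
   moreover have "\<bar>?T / 2\<bar> <= \<bar>?T\<bar>" by simp
   ultimately have "\<bar>F z - h ^ m * M z\<bar> <= laplace_const C * h ^ (m + 2) * w z"
    unfolding w_def by (simp only: mult.assoc mult_minus_left)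
   also have "... <= L * h ^ (m + 2) * w z"
    unfolding w_def L_def using L0 h by (intro mult_right_mono) auto
   finally show ?thesis .
  qed
  have "\<bar>integral\<^sup>L lborel F - h ^ m * integral\<^sup>L lborel M\<bar> = \<bar>LINT z|lborel. F z - h ^ m * M z\<bar>"
   using F_int M_int by simp
  also have "... <= (LINT z|lborel. \<bar>F z - h ^ m * M z\<bar>)" by (rule integral_abs_bound)
  also have "... <= (LINT z|lborel. L * h ^ (m + 2) * w z)"
  proof (rule integral_mono_AE)
   show "AE z in lborel. \<bar>F z - h ^ m * M z\<bar> <= L * h ^ (m + 2) * w z"
    using AE_lborel_singleton[of 0] by eventually_elim (rule pointwise)
  qed (use F_int M_int w_int in auto)
  also have "... = L * J * h ^ (m + 2)" by (simp add: J_def w_def)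
  finally have "\<bar>integral\<^sup>L lborel F - h ^ m * integral\<^sup>L lborel M\<bar> <= L * J * h ^ (m + 2)" .
  from mult_left_mono[OF this, of "h ^ DIM('b)"] h
  have "\<bar>h ^ DIM('b) * (integral\<^sup>L lborel F - h ^ m * integral\<^sup>L lborel M)\<bar> <= L * J * (h ^ DIM('b) * h ^ (m + 2))"
   by (simp add: abs_mult mult_ac)
  then show "\<bar>(LINT w|lborel. indicator (ball 0 r) w * (k0 (s w / h\<^sup>2) * H w))
   - h ^ (DIM('b) + m) * (LINT z|lborel. k0 (g z) * P z + k1 (g z) * g1 z * Q z / 2)\<bar> <= L * J * h ^ (DIM('b) + m + 2)"
   using fF unfolding f_def M_def by (simp add: right_diff_distrib power_add mult_ac)
 qed
qed

end

section \<open>Charts\<close>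

lemma local_paramD:
 assumes "local_param M U \<phi>"
 shows "open U" "Cinf_on \<phi> U" "!!u. u \<in> U ==> inj (frechet_derivative \<phi> (at u))"
  "openin (top_of_set M) (\<phi> ` U)" "!!u. u \<in> U ==> \<phi> u \<in> M"
 using assms openin_subset[of "top_of_set M" "\<phi> ` U"] by (auto simp: local_param_def)

lemma dir_deriv_1: "dir_deriv 1 f w u = frechet_derivative f (at u) w"
 by simp

lemma frechet_derivative_axis:
 fixes f :: "real^'n => 'b::real_normed_vector"
 assumes "Cinf_on f U" "u \<in> U"
 shows "frechet_derivative f (at u) w = (\<Sum>i\<in>UNIV. (w $ i) *\<^sub>R coord_deriv i f u)"
proof -
 have b: "(Basis :: (real^'n) set) = (%i. axis i 1) ` UNIV" by (auto simp: Basis_vec_def)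
 have inj: "inj (%i::'n. axis i (1::real))" by (auto simp: inj_on_def axis_eq_axis)
 show ?thesis
  unfolding frechet_derivative_basis[OF assms, of w] b sum.reindex[OF inj] o_def
  by (simp add: inner_axis coord_deriv_def)
qed

lemma Cinf_on_coord_deriv: "Cinf_on f U ==> Cinf_on (coord_deriv i f) U"
 using Cinf_on_derivative[of f U "axis i 1"] by (simp add: coord_deriv_def[abs_def])

text \<open>The range of \<open>L\<close> has the dimension of the domain and is mapped
  isometrically onto it. The composition \<open>B\<close> is a square matrix with the same Gram
  matrix as \<open>L\<close>, so that determinants and linear substitution become available for a
  map into a larger space.\<close>

lemma gram_factor:
 fixes L :: "real^'n => 'a::euclidean_space"
 assumes "linear L" "inj L"
 obtains B :: "real^'n => real^'n" where "linear B" "!!z. norm (B z) = norm (L z)" "det (matrix B) ~= 0"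
  "(\<chi> i j. L (axis i 1) \<bullet> L (axis j 1)) = transpose (matrix B) ** matrix B"
proof -
 have "dim (range L) = dim (UNIV :: (real^'n) set)"
  using dim_image_eq[OF assms(1), of UNIV] assms(2) by simp
 then obtain f :: "'a => real^'n" where f: "linear f" "f ` range L = UNIV" "!!x. x \<in> range L ==> norm (f x) = norm x"
  using isometry_subspaces[of "range L" "UNIV :: (real^'n) set"] linear_subspace_image[OF assms(1) subspace_UNIV]
  by (metis subspace_UNIV)
 define B where "B = f \<circ> L"
 have lin: "linear B" unfolding B_def by (rule linear_compose[OF assms(1) f(1)])
 have norm: "norm (B z) = norm (L z)" for z using f(3) by (simp add: B_def)
 have "inj B"
  unfolding linear_injective_0[OF lin]
  using norm assms linear_injective_0[OF assms(1)] by (metis norm_eq_zero)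
 then have det: "det (matrix B) ~= 0" using det_nz_iff_inj[OF lin] by blast
 have inner: "B z \<bullet> B w = L z \<bullet> L w" for z w
  unfolding dot_norm using norm[of "z + w"] norm[of z] norm[of w]
  by (simp add: linear_add[OF lin] linear_add[OF assms(1)])
 have "(\<chi> i j. L (axis i 1) \<bullet> L (axis j 1)) = transpose (matrix B) ** matrix B"
  by (simp add: vec_eq_iff inner[symmetric] matrix_matrix_mult_def transpose_def matrix_def inner_vec_def)
 with lin norm det show ?thesis by (rule that)
qed

lemma metric_factor:
 assumes "local_param M U \<phi>" "u \<in> U"
 obtains B :: "real^'n::finite => real^'n" where "linear B" "!!z. norm (B z) = norm (frechet_derivative \<phi> (at u) z)"
  "det (matrix B) ~= 0" "metric_tensor \<phi> u = transpose (matrix B) ** matrix B"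
  "det (metric_tensor \<phi> u) = (det (matrix B))\<^sup>2" "sqrt_det_metric \<phi> u = \<bar>det (matrix B)\<bar>"
proof -
 note lp = local_paramD[OF assms(1)]
 obtain B :: "real^'n => real^'n" where B: "linear B" "!!z. norm (B z) = norm (frechet_derivative \<phi> (at u) z)"
  "det (matrix B) ~= 0" "metric_tensor \<phi> u = transpose (matrix B) ** matrix B"
  using gram_factor[OF Cinf_on_linear_derivative[OF lp(2) assms(2)] lp(3)[OF assms(2)]]
  unfolding metric_tensor_def coord_deriv_def by blast
 moreover have "det (metric_tensor \<phi> u) = (det (matrix B))\<^sup>2"
  by (simp add: B(4) det_mul det_transpose power2_eq_square)
 ultimately show ?thesis by (intro that) (auto simp: sqrt_det_metric_def)
qed

lemma sqrt_det_metric_pos: "local_param M U \<phi> ==> u \<in> U ==> sqrt_det_metric \<phi> u > 0"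
 by (erule (1) metric_factor) auto

lemma metric_inverse:
 fixes \<phi> :: "real^'n::finite => 'a::euclidean_space"
 assumes "local_param M U \<phi>" "u \<in> U"
 shows "metric_tensor \<phi> u ** matrix_inv (metric_tensor \<phi> u) = mat 1"
proof -
 obtain B :: "real^'n => real^'n" where "det (metric_tensor \<phi> u) = (det (matrix B))\<^sup>2" "det (matrix B) ~= 0"
  by (rule metric_factor[OF assms]) blast
 then have "invertible (metric_tensor \<phi> u)" unfolding invertible_det_nz by simp
 then show ?thesis unfolding invertible_def matrix_inv_def by (rule someI2_ex) simp
qed

lemma Cinf_on_metric_entry:
 "local_param M U \<phi> ==> Cinf_on (%u. metric_tensor \<phi> u $ i $ j) U"
 using local_paramD(1,2)[of M U \<phi>] by (simp add: metric_tensor_def Cinf_on_inner Cinf_on_coord_deriv)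

lemma Cinf_on_sqrt_det_metric:
 assumes "local_param M U \<phi>"
 shows "Cinf_on (sqrt_det_metric \<phi>) U"
proof -
 note lp = local_paramD[OF assms]
 have pos: "det (metric_tensor \<phi> u) > 0" if "u \<in> U" for u
  using sqrt_det_metric_pos[OF assms that] by (simp add: sqrt_det_metric_def)
 have "Cinf_on (%u. det (metric_tensor \<phi> u)) U"
  unfolding det_def
  by (intro Cinf_on_sum Cinf_on_mult Cinf_on_const Cinf_on_prod lp Cinf_on_metric_entry[OF assms])
 then have "Cinf_on (%u. det (metric_tensor \<phi> u) powr (1 / 2)) U"
  using pos by (intro Cinf_on_powr lp)
 then show ?thesis
  by (rule Cinf_on_cong[OF lp(1), rotated]) (use pos in \<open>force simp: sqrt_det_metric_def powr_half_sqrt\<close>)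
qed

lemma norm_derivative_metric:
 fixes \<phi> :: "real^'n => 'a::euclidean_space"
 assumes "Cinf_on \<phi> U" "u \<in> U"
 shows "(norm (frechet_derivative \<phi> (at u) z))\<^sup>2 = (\<Sum>i\<in>UNIV. \<Sum>j\<in>UNIV. metric_tensor \<phi> u $ i $ j * (z $ i * z $ j))"
 unfolding power2_norm_eq_inner frechet_derivative_axis[OF assms]
 by (simp add: inner_sum_left inner_sum_right metric_tensor_def sum_distrib_left mult_ac inner_commute)

text \<open>Contracting with the metric tensor cancels the inverse metric. Together with
  \<open>coord_gradient_range\<close> this says that the gradient is the tangent vector representing
  the differential.\<close>

lemma coord_gradient_inner:
 assumes "local_param M U \<phi>" "u \<in> U" "Cinf_on h U"
 shows "coord_gradient \<phi> h u \<bullet> frechet_derivative \<phi> (at u) w = frechet_derivative h (at u) w"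
proof -
 note lp = local_paramD[OF assms(1)]
 let ?G = "metric_tensor \<phi> u"
 have axis: "coord_gradient \<phi> h u \<bullet> coord_deriv k \<phi> u = coord_deriv k h u" for k
 proof -
  have "coord_gradient \<phi> h u \<bullet> coord_deriv k \<phi> u =
   (\<Sum>i\<in>UNIV. \<Sum>j\<in>UNIV. (inverse_metric \<phi> i j u * coord_deriv j h u) * ?G $ k $ i)"
   by (simp add: coord_gradient_def inner_sum_left sum_distrib_right metric_tensor_def) (simp add: inner_commute)
  also have "... = (\<Sum>j\<in>UNIV. \<Sum>i\<in>UNIV. (inverse_metric \<phi> i j u * coord_deriv j h u) * ?G $ k $ i)"
   by (rule sum.swap)
  also have "... = (\<Sum>j\<in>UNIV. coord_deriv j h u * (?G ** matrix_inv ?G) $ k $ j)"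
   by (simp add: inverse_metric_def matrix_matrix_mult_def sum_distrib_left mult_ac)
  also have "... = coord_deriv k h u"
   unfolding metric_inverse[OF assms(1,2)] by (simp add: mat_def if_distrib cong: if_cong)
  finally show ?thesis .
 qed
 show ?thesis
  unfolding frechet_derivative_axis[OF lp(2) assms(2)] frechet_derivative_axis[OF assms(3,2)]
  by (simp add: inner_sum_right axis)
qed

lemma coord_gradient_range:
 assumes "local_param M U \<phi>" "u \<in> U"
 shows "\<exists>w. coord_gradient \<phi> h u = frechet_derivative \<phi> (at u) w"
 unfolding frechet_derivative_axis[OF local_paramD(2)[OF assms(1)] assms(2)] coord_gradient_def
 by (intro exI[of _ "\<chi> i. \<Sum>j\<in>UNIV. inverse_metric \<phi> i j u * coord_deriv j h u"]) simp

text \<open>Compactness of a ball times the unit sphere bounds the injective derivative from below;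
  on a smaller ball the quadratic Taylor remainder costs at most half of this bound. The last clause
  uses that a chart is a homeomorphism onto a relatively open set: \<open>M\<close> does not come
  back close to \<open>\<phi> u\<close> from outside the chart.\<close>

lemma chart_bilipschitz:
 fixes \<phi> :: "real^'n::finite => 'a::euclidean_space"
 assumes "local_param M U \<phi>" "u0 \<in> U"
 obtains R r c C \<eta> where "R > 0" "0 < r" "r <= R" "c > 0" "C > 0" "\<eta> > 0" "cball u0 (2 * R) \<subseteq> U"
  "!!u z. u \<in> cball u0 R ==> c * norm z <= norm (frechet_derivative \<phi> (at u) z)"
  "!!u z. u \<in> cball u0 (2 * R) ==> norm (frechet_derivative \<phi> (at u) z) <= C * norm z"
  "!!u w. u \<in> cball u0 R ==> norm w <= R ==> c * norm w <= norm (\<phi> (u + w) - \<phi> u)"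
  "!!u w. u \<in> cball u0 R ==> norm w <= R ==> norm (\<phi> (u + w) - \<phi> u) <= C * norm w"
  "!!u y. u \<in> cball u0 r ==> y \<in> M ==> norm (y - \<phi> u) < \<eta> ==> \<exists>w. norm w < R \<and> y = \<phi> (u + w)"
proof -
 note lp = local_paramD[OF assms(1)]
 obtain e where e: "e > 0" "cball u0 e \<subseteq> U" using lp(1) assms(2) open_contains_cball by blast
 define R1 where "R1 = e / 2"
 have R1: "R1 > 0" "cball u0 (2 * R1) \<subseteq> U" using e by (auto simp: R1_def)
 obtain K where K: "K \<ge> 0" "!!u w. u \<in> cball u0 R1 ==> norm w <= R1 ==>
   norm (\<phi> (u + w) - \<phi> u) <= K * norm w \<and>
   norm (\<phi> (u + w) - \<phi> u - frechet_derivative \<phi> (at u) w) <= K * (norm w)\<^sup>2"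
  using symmetric_taylor[OF lp(1) R1(2) lp(2)] unfolding dir_deriv_1 by blast
 obtain K' where K': "K' \<ge> 0" "!!u w. u \<in> cball u0 (2 * R1) ==> norm (frechet_derivative \<phi> (at u) w) <= K' * norm w"
  using dir_deriv_bound[OF lp(1) compact_cball R1(2) lp(2), of 1] unfolding dir_deriv_1 by auto
 let ?S = "cball u0 R1 \<times> sphere (0::real^'n) 1"
 have cont: "continuous_on ?S (%(u, z). norm (frechet_derivative \<phi> (at u) z))"
 proof -
  have "continuous_on ?S (%p. norm (\<Sum>b\<in>Basis. (snd p \<bullet> b) *\<^sub>R frechet_derivative \<phi> (at (fst p)) b))"
   using R1 by (intro continuous_intros continuous_on_compose2[OF Cinf_on_continuous_on[OF Cinf_on_derivative[OF lp(2)]]]) force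
  then show ?thesis
  proof (rule continuous_on_eq)
   fix p assume "p \<in> ?S"
   then have "fst p \<in> U" using R1 by force
   from frechet_derivative_basis[OF lp(2) this, of "snd p"]
   show "norm (\<Sum>b\<in>Basis. (snd p \<bullet> b) *\<^sub>R frechet_derivative \<phi> (at (fst p)) b) = (case p of (u, z) => norm (frechet_derivative \<phi> (at u) z))"
    by (simp add: case_prod_beta)
  qed
 qed
 obtain b :: "real^'n" where b: "norm b = 1" using vector_choose_size[of 1] by auto
 have "compact ?S" by (intro compact_Times compact_cball compact_sphere)
 moreover have "(u0, b) \<in> ?S" using R1 b by simp
 ultimately obtain p where p: "p \<in> ?S"
  "!!q. q \<in> ?S ==> (case p of (u, z) => norm (frechet_derivative \<phi> (at u) z)) <= (case q of (u, z) => norm (frechet_derivative \<phi> (at u) z))"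
  using continuous_attains_inf[OF _ _ cont] by (metis empty_iff)
 define c0 where "c0 = norm (frechet_derivative \<phi> (at (fst p)) (snd p))"
 have c0: "c0 > 0"
 proof -
  have "fst p \<in> U" using p(1) R1 by force
  then have "frechet_derivative \<phi> (at (fst p)) (snd p) ~= 0"
   using linear_injective_0[OF Cinf_on_linear_derivative[OF lp(2)]] lp(3) p(1) by force
  then show ?thesis by (simp add: c0_def)
 qed
 have low: "c0 * norm z <= norm (frechet_derivative \<phi> (at u) z)" if u: "u \<in> cball u0 R1" for u z
 proof (cases "z = 0")
  case False
  have "(u, z /\<^sub>R norm z) \<in> ?S" using u False by simp
  from p(2)[OF this] have "c0 <= norm (frechet_derivative \<phi> (at u) (z /\<^sub>R norm z))"
   by (simp add: c0_def case_prod_beta)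
  also have "... = norm (frechet_derivative \<phi> (at u) z) / norm z"
   using linear_scale[OF Cinf_on_linear_derivative[OF lp(2)], of u] u R1 by (simp add: subset_eq divide_inverse mult.commute)
  finally show ?thesis using False by (simp add: field_simps)
 qed simp
 define R where "R = min R1 (c0 / (2 * (K + 1)))"
 have R: "R > 0" "R <= R1" "K * R <= c0 / 2"
 proof -
  show "R > 0" "R <= R1" using R1 c0 K by (auto simp: R_def)
  have "K * R <= (K + 1) * (c0 / (2 * (K + 1)))"
   using K c0 \<open>R > 0\<close> by (intro mult_mono) (auto simp: R_def)
  also have "(K + 1) * (c0 / (2 * (K + 1))) = c0 / 2"
  proof -
   have "K + 1 ~= 0" "2 * K + 2 ~= 0" using K(1) by linarith+
   then show ?thesis by (simp add: field_simps)
  qed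
  finally show "K * R <= c0 / 2" .
 qed
 have sub: "cball u0 R \<subseteq> cball u0 R1" "cball u0 (2 * R) \<subseteq> cball u0 (2 * R1)" using R by auto
 have low2: "c0 / 2 * norm w <= norm (\<phi> (u + w) - \<phi> u)" if "u \<in> cball u0 R" "norm w <= R" for u w
 proof -
  have "norm (\<phi> (u + w) - \<phi> u - frechet_derivative \<phi> (at u) w) <= K * (norm w)\<^sup>2"
   using K(2)[of u w] that R sub by auto
  moreover have "K * (norm w)\<^sup>2 <= c0 / 2 * norm w"
   using mult_right_mono[OF order_trans[OF mult_left_mono[OF that(2) K(1)] R(3)], of "norm w"]
   by (simp add: power2_eq_square mult.assoc)
  moreover have "c0 * norm w <= norm (frechet_derivative \<phi> (at u) w)" using low that sub by blast
  moreover have "norm (frechet_derivative \<phi> (at u) w) <= norm (\<phi> (u + w) - \<phi> u) + norm (\<phi> (u + w) - \<phi> u - frechet_derivative \<phi> (at u) w)"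
   by norm
  ultimately show ?thesis by linarith
 qed
 obtain \<psi> where \<psi>: "homeomorphism U (\<phi> ` U) \<phi> \<psi>" using assms(1) by (auto simp: local_param_def)
 have "openin (top_of_set (\<phi> ` U)) (\<phi> ` ball u0 (R / 2))"
 proof (rule homeomorphism_imp_open_map[OF \<psi>])
  show "openin (top_of_set U) (ball u0 (R / 2))"
   using sub R R1 ball_subset_cball[of u0 "R/2"] by (intro open_openin_trans lp open_ball) force+
 qed
 then have "openin (top_of_set M) (\<phi> ` ball u0 (R / 2))"
  using lp(4) openin_trans by blast
 moreover have "\<phi> u0 \<in> \<phi> ` ball u0 (R / 2)" using R by simp
 ultimately obtain \<eta> where \<eta>: "\<eta> > 0" "ball (\<phi> u0) \<eta> \<inter> M \<subseteq> \<phi> ` ball u0 (R / 2)"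
  unfolding openin_contains_ball by meson
 have "isCont \<phi> u0"
  using Cinf_on_continuous_on[OF lp(2)] lp(1) assms(2) continuous_on_eq_continuous_at by blast
 then obtain d where d: "d > 0" "!!u. dist u u0 < d ==> dist (\<phi> u) (\<phi> u0) < \<eta> / 2"
  unfolding continuous_at_eps_delta using \<eta>(1) by (metis half_gt_zero)
 define r where "r = min (R / 4) (d / 2)"
 show ?thesis
 proof (rule that[of R r "c0 / 2" "K + K' + 1" "\<eta> / 2"])
  show "R > 0" "0 < r" "r <= R" "c0 / 2 > 0" "K + K' + 1 > 0" "\<eta> / 2 > 0" "cball u0 (2 * R) \<subseteq> U"
   using R c0 \<eta> d K K' sub R1 by (auto simp: r_def)
  show "c0 / 2 * norm z <= norm (frechet_derivative \<phi> (at u) z)" if "u \<in> cball u0 R" for u z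
   using order_trans[OF _ low, of "c0 / 2 * norm z" z u] that sub c0 by (auto intro: mult_right_mono)
  show "norm (frechet_derivative \<phi> (at u) z) <= (K + K' + 1) * norm z" if "u \<in> cball u0 (2 * R)" for u z
   by (rule order_trans[OF K'(2)]) (use that sub K in \<open>auto intro!: mult_right_mono\<close>)
  show "c0 / 2 * norm w <= norm (\<phi> (u + w) - \<phi> u)" if "u \<in> cball u0 R" "norm w <= R" for u w
   by (rule low2[OF that])
  show "norm (\<phi> (u + w) - \<phi> u) <= (K + K' + 1) * norm w" if "u \<in> cball u0 R" "norm w <= R" for u w
  proof -
   have "norm (\<phi> (u + w) - \<phi> u) <= K * norm w" using K(2)[of u w] that R by auto
   also have "... <= (K + K' + 1) * norm w" using K' by (intro mult_right_mono) auto
   finally show ?thesis .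
  qed
  show "\<exists>w. norm w < R \<and> y = \<phi> (u + w)" if u: "u \<in> cball u0 r" and y: "y \<in> M" "norm (y - \<phi> u) < \<eta> / 2" for u y
  proof -
   have "dist (\<phi> u) (\<phi> u0) < \<eta> / 2" using d u R by (intro d(2)) (auto simp: r_def dist_commute)
   moreover have "dist (\<phi> u) y < \<eta> / 2" using y by (simp add: dist_norm norm_minus_commute)
   ultimately have "dist (\<phi> u0) y < \<eta>" using dist_triangle_half_r[of "\<phi> u" "\<phi> u0" \<eta> y] by simp
   then obtain v where v: "dist u0 v < R / 2" "y = \<phi> v" using \<eta>(2) y by auto
   have "dist u v < R" using dist_triangle_half_r[of u0 u R v] v u d R by (simp add: r_def)
   then show ?thesis using v by (intro exI[of _ "v - u"]) (simp add: dist_norm norm_minus_commute)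
  qed
 qed
qed

subsection \<open>The volume measure in a chart\<close>

text \<open>As an identity of measures the volume formula extends from images of Borel sets to
  integrals. The map \<open>\<phi>'\<close> sends everything off \<open>B\<close>, where the density
  vanishes, to the dummy point \<open>x0\<close>, which makes it a total measurable map into
  \<open>V\<close>.\<close>

lemma chart_measure:
 fixes \<phi> :: "real^'n::finite => 'a::euclidean_space"
 assumes "riemannian_volume TYPE('n) M V" "local_param M U \<phi>" "B \<in> sets borel" "B \<subseteq> U" "x0 \<in> M"
 defines "\<phi>' \<equiv> %u. if u \<in> B then \<phi> u else x0"
  and "\<mu> \<equiv> density lborel (%u. ennreal (indicator B u * sqrt_det_metric \<phi> u))"
 shows "\<phi> ` B \<in> sets V" "\<phi>' \<in> measurable borel V" "\<phi>' \<in> measurable \<mu> V"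
  "density V (indicator (\<phi> ` B)) = distr \<mu> V \<phi>'"
  "(%u. indicator B u * sqrt_det_metric \<phi> u) \<in> borel_measurable borel"
proof -
 note lp = local_paramD[OF assms(2)]
 have V: "space V = M" "sets V = sets (restrict_space borel M)"
  and em: "!!B. B \<in> sets borel ==> B \<subseteq> U ==> emeasure V (\<phi> ` B) = (\<integral>\<^sup>+u\<in>B. ennreal (sqrt_det_metric \<phi> u) \<partial>lborel)"
  using assms(1,2) by (auto simp: riemannian_volume_def)
 have [measurable]: "B \<in> sets borel" by fact
 have [measurable]: "U \<in> sets borel" using lp(1) by simp
 have "(%u. indicator U u *\<^sub>R sqrt_det_metric \<phi> u) \<in> borel_measurable borel"
  by (rule borel_measurable_continuous_on_indicator[OF _ Cinf_on_continuous_on[OF Cinf_on_sqrt_det_metric[OF assms(2)]]]) simp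
 then have "(%u. indicator B u * (indicator U u *\<^sub>R sqrt_det_metric \<phi> u)) \<in> borel_measurable borel"
  by measurable
 moreover have "indicator B u * (indicator U u *\<^sub>R sqrt_det_metric \<phi> u) = indicator B u * sqrt_det_metric \<phi> u" for u
  using assms(4) by (auto simp: indicator_def)
 ultimately show sd [measurable]: "(%u. indicator B u * sqrt_det_metric \<phi> u) \<in> borel_measurable borel"
  by (simp only:)
 \<comment> \<open>Images of Borel sets are preimages under the inverse of the chart, which is
   continuous on a relatively open subset of \<open>M\<close>.\<close>
 have img: "\<phi> ` B' \<in> sets V" if B': "B' \<in> sets borel" "B' \<subseteq> U" for B'
 proof -
  obtain \<psi> where \<psi>: "homeomorphism U (\<phi> ` U) \<phi> \<psi>" using assms(2) by (auto simp: local_param_def)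
  obtain T where T: "open T" "\<phi> ` U = M \<inter> T" using lp(4) by (auto simp: openin_open)
  have "continuous_on (\<phi> ` U) \<psi>" using \<psi> by (simp add: homeomorphism_def)
  then have "\<psi> \<in> measurable (restrict_space borel (\<phi> ` U)) borel"
   by (rule borel_measurable_continuous_on_restrict)
  from measurable_sets[OF this B'(1)]
  have "\<psi> -` B' \<inter> \<phi> ` U \<in> sets (restrict_space borel (\<phi> ` U))" by (simp add: space_restrict_space)
  moreover have "\<psi> -` B' \<inter> \<phi> ` U = \<phi> ` B'"
   using \<psi> B'(2) by (auto simp: homeomorphism_def)
  ultimately obtain S where "S \<in> sets borel" "\<phi> ` B' = \<phi> ` U \<inter> S"
   by (auto simp: sets_restrict_space)
  then have "\<phi> ` B' = (S \<inter> T) \<inter> M" "S \<inter> T \<in> sets borel" using T by auto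
  then show ?thesis by (auto simp: V(2) sets_restrict_space)
 qed
 show imgB: "\<phi> ` B \<in> sets V" by (rule img) (use assms in auto)
 have "\<phi>' \<in> borel_measurable borel"
 proof -
  have "(%u. indicator U u *\<^sub>R \<phi> u) \<in> borel_measurable borel"
   by (intro borel_measurable_continuous_on_indicator Cinf_on_continuous_on lp(2)) simp
  then have "(%u. if u \<in> B then indicator U u *\<^sub>R \<phi> u else x0) \<in> borel_measurable borel"
   by measurable
  moreover have "(if u \<in> B then indicator U u *\<^sub>R \<phi> u else x0) = \<phi>' u" for u
   using assms(4) by (auto simp: \<phi>'_def indicator_def)
  ultimately show ?thesis by simp
 qed
 moreover have "\<phi>' \<in> UNIV \<rightarrow> M" using lp(5) assms(4,5) by (auto simp: \<phi>'_def)
 ultimately show m [measurable]: "\<phi>' \<in> measurable borel V"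
  unfolding measurable_cong_sets[OF refl V(2)] by (intro measurable_restrict_space2) auto
 then show m' [measurable]: "\<phi>' \<in> measurable \<mu> V" unfolding \<mu>_def by simp
 show "density V (indicator (\<phi> ` B)) = distr \<mu> V \<phi>'"
 proof (rule measure_eqI)
  fix S assume "S \<in> sets (density V (indicator (\<phi> ` B)))"
  then have S [measurable]: "S \<in> sets V" by simp
  have B1: "B \<inter> \<phi>' -` S \<in> sets borel" using measurable_sets[OF m S] by (intro sets.Int) auto
  have "emeasure (density V (indicator (\<phi> ` B))) S = emeasure V (\<phi> ` B \<inter> S)"
   using imgB by (simp add: emeasure_density nn_integral_set_ennreal[symmetric] indicator_inter_arith[symmetric])
  also have "\<phi> ` B \<inter> S = \<phi> ` (B \<inter> \<phi>' -` S)" by (auto simp: \<phi>'_def)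
  also have "emeasure V ... = (\<integral>\<^sup>+u\<in>(B \<inter> \<phi>' -` S). ennreal (sqrt_det_metric \<phi> u) \<partial>lborel)"
   using B1 assms(4) by (intro em) auto
  also have "... = (\<integral>\<^sup>+u. ennreal (indicator B u * sqrt_det_metric \<phi> u) * indicator (\<phi>' -` S) u \<partial>lborel)"
   by (intro nn_integral_cong) (auto simp: indicator_def)
  also have "... = emeasure \<mu> (\<phi>' -` S)"
   unfolding \<mu>_def using measurable_sets[OF m S] by (subst emeasure_density) auto
  also have "... = emeasure (distr \<mu> V \<phi>') S"
   by (simp add: emeasure_distr \<mu>_def)
  finally show "emeasure (density V (indicator (\<phi> ` B))) S = emeasure (distr \<mu> V \<phi>') S" .
 qed simp
qed

lemma chart_integral:
 fixes \<phi> :: "real^'n::finite => 'a::euclidean_space" and F :: "'a => real"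
 assumes "riemannian_volume TYPE('n) M V" "local_param M U \<phi>" "B \<in> sets borel" "B \<subseteq> U" "F \<in> borel_measurable V"
 shows "(LINT y|V. indicator (\<phi> ` B) y * F y) = (LINT u|lborel. indicator B u * (F (\<phi> u) * sqrt_det_metric \<phi> u))"
proof (cases "B = {}")
 case False
 then obtain x0 where x0: "x0 \<in> M" using assms(4) local_paramD(5)[OF assms(2)] by blast
 note cm = chart_measure[OF assms(1-4) x0]
 note [measurable] = assms(3,5) cm
 have sd: "indicator B u * sqrt_det_metric \<phi> u \<ge> 0" for u
  using sqrt_det_metric_pos[OF assms(2), of u] assms(4) by (auto simp: indicator_def less_imp_le)
 let ?\<phi> = "%u. if u \<in> B then \<phi> u else x0"
 have "(LINT y|V. indicator (\<phi> ` B) y * F y) = (LINT y|density V (%y. ennreal (indicator (\<phi> ` B) y)). F y)"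
  by (subst integral_density) auto
 also have "(%y. ennreal (indicator (\<phi> ` B) y)) = indicator (\<phi> ` B)"
  by (auto simp: fun_eq_iff indicator_def)
 also have "(LINT y|density V (indicator (\<phi> ` B)). F y) =
  (LINT u|density lborel (%u. ennreal (indicator B u * sqrt_det_metric \<phi> u)). F (?\<phi> u))"
  unfolding cm(4) by (subst integral_distr) auto
 also have "... = (LINT u|lborel. (indicator B u * sqrt_det_metric \<phi> u) * F (?\<phi> u))"
  using sd by (subst integral_density) auto
 also have "... = (LINT u|lborel. indicator B u * (F (\<phi> u) * sqrt_det_metric \<phi> u))"
  by (intro Bochner_Integration.integral_cong) (auto simp: indicator_def)
 finally show ?thesis .
qed simp

lemma chart_nn_integral:
 fixes \<phi> :: "real^'n::finite => 'a::euclidean_space" and F :: "'a => ennreal"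
 assumes "riemannian_volume TYPE('n) M V" "local_param M U \<phi>" "B \<in> sets borel" "B \<subseteq> U" "F \<in> borel_measurable V"
 shows "(\<integral>\<^sup>+y\<in>\<phi> ` B. F y \<partial>V) = (\<integral>\<^sup>+u\<in>B. F (\<phi> u) * ennreal (sqrt_det_metric \<phi> u) \<partial>lborel)"
proof (cases "B = {}")
 case False
 then obtain x0 where x0: "x0 \<in> M" using assms(4) local_paramD(5)[OF assms(2)] by blast
 note cm = chart_measure[OF assms(1-4) x0]
 note [measurable] = assms(3,5) cm
 let ?\<phi> = "%u. if u \<in> B then \<phi> u else x0"
 have "(\<integral>\<^sup>+y\<in>\<phi> ` B. F y \<partial>V) = (\<integral>\<^sup>+y. F y \<partial>density V (indicator (\<phi> ` B)))"
  by (subst nn_integral_density) (auto simp: mult.commute)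
 also have "... = (\<integral>\<^sup>+u. F (?\<phi> u) \<partial>density lborel (%u. ennreal (indicator B u * sqrt_det_metric \<phi> u)))"
  unfolding cm(4) by (subst nn_integral_distr) auto
 also have "... = (\<integral>\<^sup>+u. ennreal (indicator B u * sqrt_det_metric \<phi> u) * F (?\<phi> u) \<partial>lborel)"
  by (subst nn_integral_density) auto
 also have "... = (\<integral>\<^sup>+u\<in>B. F (\<phi> u) * ennreal (sqrt_det_metric \<phi> u) \<partial>lborel)"
  by (intro nn_integral_cong) (auto simp: indicator_def mult.commute)
 finally show ?thesis .
qed simp

section \<open>From charts to the compact manifold\<close>

text \<open>Finite subcover: a property that holds near each point with some constant, and is
  monotone in it, holds on all of \<open>M\<close> with the maximum over finitely many pieces. The
  inserted \<open>1\<close> makes the constant positive.\<close>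

lemma mono_if_charts:
 fixes P :: "real => 'a::euclidean_space => bool"
 assumes sub: "smooth_submanifold TYPE('n::finite) M" and M: "compact M"
  and mono: "!!B B' y. B <= B' ==> P B y ==> P B' y"
  and loc: "!!U (\<phi> :: real^'n => 'a) u0. local_param M U \<phi> ==> u0 \<in> U ==>
   \<exists>r>0. \<exists>B. \<forall>u\<in>ball u0 r \<inter> U. P B (\<phi> u)"
 shows "\<exists>B>0. \<forall>y\<in>M. P B y"
proof -
 have "\<exists>T B. open T \<and> x \<in> T \<and> (\<forall>y\<in>M \<inter> T. P B y)" if x: "x \<in> M" for x
 proof -
  obtain U and \<phi> :: "real^'n => 'a" where lp: "local_param M U \<phi>" "x \<in> \<phi> ` U"
   using sub x unfolding smooth_submanifold_def by blast
  then obtain u0 where u0: "u0 \<in> U" "x = \<phi> u0" by blast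
  obtain r B where r: "r > 0" and B: "!!u. u \<in> ball u0 r \<inter> U ==> P B (\<phi> u)"
   using loc[OF lp(1) u0(1)] by blast
  obtain \<psi> where \<psi>: "homeomorphism U (\<phi> ` U) \<phi> \<psi>" using lp(1) by (auto simp: local_param_def)
  have "openin (top_of_set (\<phi> ` U)) (\<phi> ` (ball u0 r \<inter> U))"
   by (rule homeomorphism_imp_open_map[OF \<psi>]) (auto simp: openin_open)
  then have "openin (top_of_set M) (\<phi> ` (ball u0 r \<inter> U))"
   using local_paramD(4)[OF lp(1)] openin_trans by blast
  then obtain T where T: "open T" "\<phi> ` (ball u0 r \<inter> U) = M \<inter> T" by (auto simp: openin_open)
  have "x \<in> T" using T(2) u0 r by auto
  moreover have "P B y" if "y \<in> M \<inter> T" for y using that B unfolding T(2)[symmetric] by blast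
  ultimately show ?thesis using T(1) by blast
 qed
 then obtain T B where TB: "!!x. x \<in> M ==> open (T x) \<and> x \<in> T x \<and> (\<forall>y\<in>M \<inter> T x. P (B x) y)"
  by metis
 then have "M \<subseteq> (\<Union>x\<in>M. T x)" "!!x. x \<in> M ==> open (T x)" by auto
 then obtain F where F: "F \<subseteq> M" "finite F" "M \<subseteq> (\<Union>x\<in>F. T x)"
  using compactE_image[OF M, of M T] by metis
 define B' where "B' = Max (insert 1 (B ` F))"
 have "P B' y" if y: "y \<in> M" for y
 proof -
  obtain x where x: "x \<in> F" "y \<in> T x" using F y by blast
  have "P (B x) y" using TB[of x] x F y by auto
  moreover have "B x <= B'" unfolding B'_def using x F by (intro Max_ge) auto
  ultimately show ?thesis using mono by blast
 qed
 moreover have "B' > 0"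
 proof -
  have "1 <= B'" unfolding B'_def using F by (intro Max_ge) auto
  then show ?thesis by simp
 qed
 ultimately show ?thesis by blast
qed

lemma param_at_chart:
 fixes M :: "'a::euclidean_space set"
 assumes "smooth_submanifold TYPE('n::finite) M" "x \<in> M"
 obtains U and \<phi> :: "real^'n => 'a" and u where "param_at M x = (\<phi>, u)" "local_param M U \<phi>" "u \<in> U" "\<phi> u = x"
proof -
 have "\<exists>p. case p of (\<phi> :: real^'n => 'a, u) => \<exists>U. local_param M U \<phi> \<and> u \<in> U \<and> \<phi> u = x"
  using assms unfolding smooth_submanifold_def by fastforce
 from someI_ex[OF this] have "case (param_at M x :: (real^'n => 'a) \<times> _) of (\<phi>, u) => \<exists>U. local_param M U \<phi> \<and> u \<in> U \<and> \<phi> u = x"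
  by (simp add: param_at_def)
 then show ?thesis using that by (auto split: prod.splits)
qed

lemma smooth_on_chart:
 fixes \<phi> :: "real^'n::finite => 'a::euclidean_space"
 shows "smooth_on_manifold TYPE('n) M f ==> local_param M U \<phi> ==> Cinf_on (f \<circ> \<phi>) U"
 by (simp add: smooth_on_manifold_def)

lemma abs_le_linear_imp:
 fixes X Y K t0 :: real
 assumes "t0 > 0" "!!t. 0 < t ==> t < t0 ==> X <= Y + t * K"
 shows "X <= Y"
proof (rule field_le_epsilon)
 fix e :: real assume "e > 0"
 define t where "t = min (t0 / 2) (e / (\<bar>K\<bar> + 1))"
 have t: "0 < t" "t < t0" "t <= e / (\<bar>K\<bar> + 1)" using assms(1) \<open>e > 0\<close> by (auto simp: t_def)
 have "t * K <= t * (\<bar>K\<bar> + 1)" using t by (intro mult_left_mono) auto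
 also have "... <= (e / (\<bar>K\<bar> + 1)) * (\<bar>K\<bar> + 1)" using t by (intro mult_right_mono) auto
 also have "... = e" by (simp add: add_nonneg_eq_0_iff)
 finally show "X <= Y + e" using assms(2)[OF t(1,2)] by linarith
qed

text \<open>First order Taylor expansion in the chart, rewritten with ambient distances by the lower
  bi-Lipschitz bound. The left side does not see the chart, which makes the estimate suitable for
  comparing two charts.\<close>

lemma slope_bound:
 fixes \<phi> :: "real^'n::finite => 'a::euclidean_space"
 assumes "local_param M U \<phi>" "u \<in> U" "Cinf_on (f \<circ> \<phi>) U"
 shows "\<exists>\<eta>>0. \<exists>K\<ge>0. \<forall>y\<in>M. norm (y - \<phi> u) < \<eta> -->
  \<bar>f y - f (\<phi> u)\<bar> <= norm (coord_gradient \<phi> (f \<circ> \<phi>) u) * norm (y - \<phi> u) + K * (norm (y - \<phi> u))\<^sup>2"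
proof -
 note lp = local_paramD[OF assms(1)]
 obtain R r c C \<eta> where ch: "R > 0" "0 < r" "r <= R" "c > 0" "\<eta> > 0" "cball u (2 * R) \<subseteq> U"
  "!!v w. v \<in> cball u R ==> norm w <= R ==> c * norm w <= norm (\<phi> (v + w) - \<phi> v)"
  "!!v y. v \<in> cball u r ==> y \<in> M ==> norm (y - \<phi> v) < \<eta> ==> \<exists>w. norm w < R \<and> y = \<phi> (v + w)"
  by (rule chart_bilipschitz[OF assms(1,2)]) blast
 obtain K1 where K1: "K1 \<ge> 0" "!!v w. v \<in> cball u R ==> norm w <= R ==>
   norm (\<phi> (v + w) - \<phi> v - frechet_derivative \<phi> (at v) w) <= K1 * (norm w)\<^sup>2"
  using symmetric_taylor[OF lp(1) ch(6) lp(2)] unfolding dir_deriv_1 by blast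
 obtain K2 where K2: "K2 \<ge> 0" "!!v w. v \<in> cball u R ==> norm w <= R ==>
   norm ((f \<circ> \<phi>) (v + w) - (f \<circ> \<phi>) v - frechet_derivative (f \<circ> \<phi>) (at v) w) <= K2 * (norm w)\<^sup>2"
  using symmetric_taylor[OF lp(1) ch(6) assms(3)] unfolding dir_deriv_1 by blast
 define g where "g = norm (coord_gradient \<phi> (f \<circ> \<phi>) u)"
 have "\<bar>f y - f (\<phi> u)\<bar> <= g * norm (y - \<phi> u) + (g * K1 + K2) / c\<^sup>2 * (norm (y - \<phi> u))\<^sup>2"
  if y: "y \<in> M" "norm (y - \<phi> u) < \<eta>" for y
 proof -
  obtain w where w: "norm w < R" "y = \<phi> (u + w)" using ch(8)[of u y] y ch(2) by auto
  let ?n = "norm (y - \<phi> u)"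
  have cw: "c * norm w <= ?n" using ch(7)[of u w] w ch(1) by simp
  have nw: "(norm w)\<^sup>2 <= ?n\<^sup>2 / c\<^sup>2"
   using power_mono[OF cw, of 2] ch(4) by (simp add: power_mult_distrib field_simps)
  have k1: "norm (y - \<phi> u - frechet_derivative \<phi> (at u) w) <= K1 * (norm w)\<^sup>2"
   using K1(2)[of u w] w ch(1) by simp
  have k2: "\<bar>f y - f (\<phi> u) - frechet_derivative (f \<circ> \<phi>) (at u) w\<bar> <= K2 * (norm w)\<^sup>2"
   using K2(2)[of u w] w ch(1) by simp
  have "\<bar>frechet_derivative (f \<circ> \<phi>) (at u) w\<bar> <= g * norm (frechet_derivative \<phi> (at u) w)"
   unfolding g_def coord_gradient_inner[OF assms, symmetric] by (rule Cauchy_Schwarz_ineq2)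
  also have "... <= g * (?n + K1 * (norm w)\<^sup>2)"
  proof (rule mult_left_mono)
   have "norm (frechet_derivative \<phi> (at u) w) <= ?n + norm (y - \<phi> u - frechet_derivative \<phi> (at u) w)" by norm
   then show "norm (frechet_derivative \<phi> (at u) w) <= ?n + K1 * (norm w)\<^sup>2" using k1 by linarith
  qed (simp add: g_def)
  finally have "\<bar>f y - f (\<phi> u)\<bar> <= g * ?n + (g * K1 + K2) * (norm w)\<^sup>2"
   using k2 by (simp add: algebra_simps)
  also have "(g * K1 + K2) * (norm w)\<^sup>2 <= (g * K1 + K2) * (?n\<^sup>2 / c\<^sup>2)"
   using nw K1 K2 by (intro mult_left_mono) (auto simp: g_def)
  finally show ?thesis by simp
 qed
 moreover have "(g * K1 + K2) / c\<^sup>2 \<ge> 0" using K1 K2 by (simp add: g_def)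
 ultimately show ?thesis unfolding g_def using ch(5) by blast
qed

text \<open>Along the curve \<open>\<phi> (u + t w)\<close> the slope bound of the second chart
  controls the increments of \<open>f\<close>. Dividing by \<open>t\<close> and letting
  \<open>t\<close> tend to zero compares the differentials without a transition map.\<close>

lemma gradient_compare:
 fixes \<phi> \<phi>' :: "real^'n::finite => 'a::euclidean_space"
 assumes 1: "local_param M U \<phi>" "u \<in> U" "Cinf_on (f \<circ> \<phi>) U"
  and 2: "local_param M U' \<phi>'" "u' \<in> U'" "Cinf_on (f \<circ> \<phi>') U'" and eq: "\<phi> u = \<phi>' u'"
 shows "\<bar>frechet_derivative (f \<circ> \<phi>) (at u) w\<bar> <= norm (coord_gradient \<phi>' (f \<circ> \<phi>') u') * norm (frechet_derivative \<phi> (at u) w)"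
proof -
 note lp = local_paramD[OF 1(1)]
 define g where "g = norm (coord_gradient \<phi>' (f \<circ> \<phi>') u')"
 obtain \<eta>' K where \<eta>': "\<eta>' > 0" "K \<ge> 0" "!!y. y \<in> M ==> norm (y - \<phi> u) < \<eta>' ==>
   \<bar>f y - f (\<phi> u)\<bar> <= g * norm (y - \<phi> u) + K * (norm (y - \<phi> u))\<^sup>2"
  using slope_bound[OF 2] unfolding g_def eq by blast
 obtain e where e: "e > 0" "cball u e \<subseteq> U" using lp(1) 1(2) open_contains_cball by blast
 define R where "R = e / 2"
 have R: "R > 0" "cball u (2 * R) \<subseteq> U" using e by (auto simp: R_def)
 obtain K1 where K1: "K1 \<ge> 0" "!!v w. v \<in> cball u R ==> norm w <= R ==>
   norm (\<phi> (v + w) - \<phi> v) <= K1 * norm w \<and>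
   norm (\<phi> (v + w) - \<phi> v - frechet_derivative \<phi> (at v) w) <= K1 * (norm w)\<^sup>2"
  using symmetric_taylor[OF lp(1) R(2) lp(2)] unfolding dir_deriv_1 by blast
 obtain K2 where K2: "K2 \<ge> 0" "!!v w. v \<in> cball u R ==> norm w <= R ==>
   norm ((f \<circ> \<phi>) (v + w) - (f \<circ> \<phi>) v - frechet_derivative (f \<circ> \<phi>) (at v) w) <= K2 * (norm w)\<^sup>2"
  using symmetric_taylor[OF lp(1) R(2) 1(3)] unfolding dir_deriv_1 by blast
 define n where "n = norm w"
 \<comment> \<open>Below \<open>t0\<close> the curve stays in the Taylor ball of the first chart and
   within the radius where the slope bound of the second one is valid.\<close>
 define t0 where "t0 = min (R / (n + 1)) (\<eta>' / (K1 * n + 1))"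
 have n: "n \<ge> 0" by (simp add: n_def)
 have t0: "t0 > 0" using R(1) \<eta>'(1) n K1(1) by (auto simp: t0_def intro!: divide_pos_pos add_nonneg_pos)
 have "\<bar>frechet_derivative (f \<circ> \<phi>) (at u) w\<bar> <= g * norm (frechet_derivative \<phi> (at u) w)"
 proof (rule abs_le_linear_imp[OF t0])
  fix t assume t: "0 < t" "t < t0"
  have tn: "t * n <= R"
  proof -
   have "t * n <= (R / (n + 1)) * (n + 1)" using t n R by (intro mult_mono) (auto simp: t0_def)
   then show ?thesis using n by simp
  qed
  have tw: "norm (t *\<^sub>R w) = t * n" "norm (t *\<^sub>R w) <= R" using t tn by (auto simp: n_def)
  let ?y = "\<phi> (u + t *\<^sub>R w)"
  have D: "frechet_derivative \<phi> (at u) (t *\<^sub>R w) = t *\<^sub>R frechet_derivative \<phi> (at u) w"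
   "frechet_derivative (f \<circ> \<phi>) (at u) (t *\<^sub>R w) = t * frechet_derivative (f \<circ> \<phi>) (at u) w"
   using linear_scale[OF Cinf_on_linear_derivative[OF lp(2) 1(2)]] linear_scale[OF Cinf_on_linear_derivative[OF 1(3,2)]] by auto
  have k1: "norm (?y - \<phi> u) <= K1 * (t * n)" "norm (?y - \<phi> u - t *\<^sub>R frechet_derivative \<phi> (at u) w) <= K1 * (t * n)\<^sup>2"
   using K1(2)[of u "t *\<^sub>R w"] tw R by (auto simp: D)
  have k2: "\<bar>f ?y - f (\<phi> u) - t * frechet_derivative (f \<circ> \<phi>) (at u) w\<bar> <= K2 * (t * n)\<^sup>2"
   using K2(2)[of u "t *\<^sub>R w"] tw R by (auto simp: D)
  have "K1 * (t * n) < \<eta>'"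
  proof -
   have "t * (K1 * n + 1) < \<eta>' / (K1 * n + 1) * (K1 * n + 1)"
    using t K1 n by (intro mult_strict_right_mono) (auto simp: t0_def add_nonneg_pos)
   then have "t * (K1 * n + 1) < \<eta>'" using K1 n by (simp add: add_nonneg_eq_0_iff)
   then show ?thesis using t by (simp add: algebra_simps)
  qed
  moreover have "?y \<in> M" using R tw by (intro lp(5)) (auto simp: subset_eq dist_norm)
  ultimately have sl: "\<bar>f ?y - f (\<phi> u)\<bar> <= g * norm (?y - \<phi> u) + K * (norm (?y - \<phi> u))\<^sup>2"
   using k1 \<eta>' by auto
  have "norm (?y - \<phi> u) <= norm (t *\<^sub>R frechet_derivative \<phi> (at u) w) + norm (?y - \<phi> u - t *\<^sub>R frechet_derivative \<phi> (at u) w)"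
   using norm_triangle_ineq[of "t *\<^sub>R frechet_derivative \<phi> (at u) w" "?y - \<phi> u - t *\<^sub>R frechet_derivative \<phi> (at u) w"] by simp
  then have "norm (?y - \<phi> u) <= t * norm (frechet_derivative \<phi> (at u) w) + K1 * (t * n)\<^sup>2"
   using k1 t by simp
  then have "g * norm (?y - \<phi> u) <= g * (t * norm (frechet_derivative \<phi> (at u) w) + K1 * (t * n)\<^sup>2)"
   by (intro mult_left_mono) (auto simp: g_def)
  moreover have "K * (norm (?y - \<phi> u))\<^sup>2 <= K * (K1 * (t * n))\<^sup>2"
   using \<eta>'(2) k1 by (intro mult_left_mono power_mono) auto
  ultimately have "\<bar>t * frechet_derivative (f \<circ> \<phi>) (at u) w\<bar> \<le>
   g * (t * norm (frechet_derivative \<phi> (at u) w) + K1 * (t * n)\<^sup>2) + K * (K1 * (t * n))\<^sup>2 + K2 * (t * n)\<^sup>2"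
   using sl k2 by linarith
  also have "... = t * (g * norm (frechet_derivative \<phi> (at u) w) + t * ((g * K1 + K * K1\<^sup>2 + K2) * n\<^sup>2))"
   by (simp add: power2_eq_square algebra_simps)
  finally show "\<bar>frechet_derivative (f \<circ> \<phi>) (at u) w\<bar> \<le>
   g * norm (frechet_derivative \<phi> (at u) w) + t * ((g * K1 + K * K1\<^sup>2 + K2) * n\<^sup>2)"
   using t by (simp add: abs_mult)
 qed
 then show ?thesis by (simp add: g_def)
qed

text \<open>Both parts are \<open>gradient_compare\<close> with the roles of the given and the
  selected chart exchanged; for the second part it is tested with the direction of the selected
  gradient itself, which is tangent.\<close>

lemma manifold_gradient_chart:
 fixes \<phi> :: "real^'n::finite => 'a::euclidean_space"
 assumes sub: "smooth_submanifold TYPE('n) M" and f: "smooth_on_manifold TYPE('n) M f"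
  and lp: "local_param M U \<phi>" "u \<in> U"
 shows "\<bar>frechet_derivative (f \<circ> \<phi>) (at u) w\<bar> <= norm (manifold_gradient TYPE('n) M f (\<phi> u)) * norm (frechet_derivative \<phi> (at u) w)"
  and "norm (manifold_gradient TYPE('n) M f (\<phi> u)) <= norm (coord_gradient \<phi> (f \<circ> \<phi>) u)"
proof -
 have x: "\<phi> u \<in> M" by (rule local_paramD(5)[OF lp])
 obtain U' and \<phi>' :: "real^'n => 'a" and u' where pa: "param_at M (\<phi> u) = (\<phi>', u')"
  and lp': "local_param M U' \<phi>'" "u' \<in> U'" "\<phi>' u' = \<phi> u"
  by (rule param_at_chart[OF sub x])
 have mg: "manifold_gradient TYPE('n) M f (\<phi> u) = coord_gradient \<phi>' (f \<circ> \<phi>') u'"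
  by (simp add: manifold_gradient_def pa)
 note c1 = smooth_on_chart[OF f lp(1)] and c2 = smooth_on_chart[OF f lp'(1)]
 show "\<bar>frechet_derivative (f \<circ> \<phi>) (at u) w\<bar> <= norm (manifold_gradient TYPE('n) M f (\<phi> u)) * norm (frechet_derivative \<phi> (at u) w)"
  unfolding mg by (rule gradient_compare[OF lp c1 lp'(1,2) c2 lp'(3)[symmetric]])
 obtain w' where w': "coord_gradient \<phi>' (f \<circ> \<phi>') u' = frechet_derivative \<phi>' (at u') w'"
  using coord_gradient_range[OF lp'(1,2)] by blast
 let ?g = "norm (coord_gradient \<phi>' (f \<circ> \<phi>') u')"
 have "?g * ?g = frechet_derivative (f \<circ> \<phi>') (at u') w'"
  using coord_gradient_inner[OF lp'(1,2) c2, of w'] unfolding w'[symmetric] by (simp add: norm_eq_square dot_square_norm power2_eq_square)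
 also have "... <= norm (coord_gradient \<phi> (f \<circ> \<phi>) u) * ?g"
  using gradient_compare[OF lp'(1,2) c2 lp c1 lp'(3), of w'] unfolding w' by linarith
 finally show "norm (manifold_gradient TYPE('n) M f (\<phi> u)) <= norm (coord_gradient \<phi> (f \<circ> \<phi>) u)"
  unfolding mg by (cases "?g = 0") auto
qed

text \<open>A real supremum bounds its members only for a set bounded above. In a chart the norm is
  at most \<open>K / c\<close>, a derivative bound over the lower bound of the differential of the
  chart, and compactness does the rest.\<close>

lemma manifold_gradient_le_sup:
 fixes M :: "'a::euclidean_space set"
 assumes sub: "smooth_submanifold TYPE('n::finite) M" and M: "compact M"
  and f: "smooth_on_manifold TYPE('n) M f" and x: "x \<in> M"
 shows "norm (manifold_gradient TYPE('n) M f x) <= gradient_sup_norm TYPE('n) M f"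
proof -
 have "\<exists>B>0. \<forall>y\<in>M. norm (manifold_gradient TYPE('n) M f y) <= B"
 proof (rule mono_if_charts[OF sub M])
  fix U and \<phi> :: "real^'n => 'a" and u0 assume lp: "local_param M U \<phi>" "u0 \<in> U"
  note lpD = local_paramD[OF lp(1)]
  obtain R r c C \<eta> where ch: "R > 0" "c > 0" "cball u0 (2 * R) \<subseteq> U"
   "!!u z. u \<in> cball u0 R ==> c * norm z <= norm (frechet_derivative \<phi> (at u) z)"
   by (rule chart_bilipschitz[OF lp]) blast
  note c1 = smooth_on_chart[OF f lp(1)]
  obtain K where K: "K \<ge> 0" "!!x w. x \<in> cball u0 (2 * R) ==> norm (frechet_derivative (f \<circ> \<phi>) (at x) w) <= K * norm w"
   using dir_deriv_bound[OF lpD(1) compact_cball ch(3) c1, of 1] unfolding dir_deriv_1 by auto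
  have "norm (manifold_gradient TYPE('n) M f (\<phi> u)) <= K / c" if u: "u \<in> ball u0 R \<inter> U" for u
  proof -
   obtain w where w: "coord_gradient \<phi> (f \<circ> \<phi>) u = frechet_derivative \<phi> (at u) w"
    using coord_gradient_range[OF lp(1)] u by blast
   let ?g = "norm (coord_gradient \<phi> (f \<circ> \<phi>) u)"
   have "?g * ?g = frechet_derivative (f \<circ> \<phi>) (at u) w"
    using coord_gradient_inner[OF lp(1) _ c1, of u w] u unfolding w[symmetric] by (simp add: dot_square_norm power2_eq_square)
   also have "... <= K * norm w" using K(2)[of u w] u ch(1) by simp
   also have "... <= K * (?g / c)"
    using ch(4)[of u w] u ch(2) K(1) unfolding w by (intro mult_left_mono) (auto simp: field_simps)
   finally have "?g * ?g <= (K / c) * ?g" by simp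
   moreover have "0 <= K / c" using K(1) ch(2) by simp
   ultimately have "?g <= K / c"
    using mult_right_le_imp_le[of ?g ?g "K / c"] norm_ge_zero[of "coord_gradient \<phi> (f \<circ> \<phi>) u"]
    by (cases "?g = 0") linarith+
   then show ?thesis using manifold_gradient_chart(2)[OF sub f lp(1), of u] u by simp
  qed
  then show "\<exists>r>0. \<exists>B. \<forall>u\<in>ball u0 r \<inter> U. norm (manifold_gradient TYPE('n) M f (\<phi> u)) <= B" using ch(1) by blast
 qed auto
 then obtain B where "!!y. y \<in> M ==> norm (manifold_gradient TYPE('n) M f y) <= B" by blast
 then have "bdd_above ((%x. norm (manifold_gradient TYPE('n) M f x)) ` M)" by (rule bdd_aboveI2)
 then show ?thesis unfolding gradient_sup_norm_def using x by (rule cSUP_upper[rotated])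
qed

text \<open>Smoothness is defined through charts; \<open>slope_bound\<close> transfers it to
  continuity in the ambient topology of \<open>M\<close>.\<close>

lemma smooth_continuous_on:
 fixes M :: "'a::euclidean_space set"
 assumes sub: "smooth_submanifold TYPE('n::finite) M" and f: "smooth_on_manifold TYPE('n) M f"
 shows "continuous_on M f"
 unfolding continuous_on_def
proof
 fix x assume x: "x \<in> M"
 obtain U and \<phi> :: "real^'n => 'a" and u where lp: "local_param M U \<phi>" "u \<in> U" "\<phi> u = x"
  by (rule param_at_chart[OF sub x])
 obtain \<eta> K where \<eta>: "\<eta> > 0" "!!y. y \<in> M ==> norm (y - x) < \<eta> ==>
  \<bar>f y - f x\<bar> <= norm (coord_gradient \<phi> (f \<circ> \<phi>) u) * norm (y - x) + K * (norm (y - x))\<^sup>2"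
  using slope_bound[OF lp(1,2) smooth_on_chart[OF f lp(1)]] unfolding lp(3) by blast
 show "(f \<longlongrightarrow> f x) (at x within M)"
 proof (rule LIM_zero_cancel, rule Lim_null_comparison)
  show "\<forall>\<^sub>F y in at x within M. norm (f y - f x) <= norm (coord_gradient \<phi> (f \<circ> \<phi>) u) * norm (y - x) + K * (norm (y - x))\<^sup>2"
   unfolding eventually_at using \<eta> by (intro exI[of _ \<eta>]) (auto simp: dist_norm)
  show "((%y. norm (coord_gradient \<phi> (f \<circ> \<phi>) u) * norm (y - x) + K * (norm (y - x))\<^sup>2) \<longlongrightarrow> 0) (at x within M)"
   by (auto intro!: tendsto_eq_intros)
 qed
qed

lemma borel_measurable_volume:
 assumes "riemannian_volume TYPE('n::finite) M V"
 shows "f \<in> borel_measurable borel ==> f \<in> borel_measurable V"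
  and "continuous_on M g ==> g \<in> borel_measurable V"
proof -
 have V: "sets V = sets (restrict_space borel M)" using assms by (simp add: riemannian_volume_def)
 show "f \<in> borel_measurable borel ==> f \<in> borel_measurable V"
  unfolding measurable_cong_sets[OF V refl] by (rule measurable_restrict_space1)
 show "continuous_on M g ==> g \<in> borel_measurable V"
  unfolding measurable_cong_sets[OF V refl] by (rule borel_measurable_continuous_on_restrict)
qed

text \<open>The constant depends on the manifold only; this is what keeps the noise constant absolute.\<close>

lemma lipschitz_on_manifold:
 fixes M :: "'a::euclidean_space set"
 assumes sub: "smooth_submanifold TYPE('n::finite) M" and M: "compact M"
 shows "\<exists>B>0. \<forall>x\<in>M. \<forall>f y. smooth_on_manifold TYPE('n) M f --> y \<in> M --> norm (y - x) < 1 / B -->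
  \<bar>f y - f x\<bar> <= B * gradient_sup_norm TYPE('n) M f * norm (y - x)"
proof -
 \<comment> \<open>The constant also determines the radius \<open>1 / B\<close>, so that a single
   monotone parameter can be passed to \<open>mono_if_charts\<close>.\<close>
 let ?P = "%B x. B > 0 \<and> (\<forall>f y. smooth_on_manifold TYPE('n) M f --> y \<in> M --> norm (y - x) < 1 / B -->
  \<bar>f y - f x\<bar> <= B * gradient_sup_norm TYPE('n) M f * norm (y - x))"
 have gnn: "gradient_sup_norm TYPE('n) M f \<ge> 0" if "y \<in> M" "smooth_on_manifold TYPE('n) M f" for f y
  using manifold_gradient_le_sup[OF sub M that(2,1)] norm_ge_zero order_trans by blast
 have "\<exists>B>0. \<forall>x\<in>M. ?P B x"
 proof (rule mono_if_charts[OF sub M])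
  fix B B' x assume B: "B <= B'" "?P B x"
  show "?P B' x"
  proof (intro conjI allI impI)
   show "B' > 0" using B by simp
   fix f y assume y: "smooth_on_manifold TYPE('n) M f" "y \<in> M" "norm (y - x) < 1 / B'"
   have "1 / B' <= 1 / B" using B by (simp add: field_simps)
   then have "\<bar>f y - f x\<bar> <= B * gradient_sup_norm TYPE('n) M f * norm (y - x)" using B y by auto
   also have "... <= B' * gradient_sup_norm TYPE('n) M f * norm (y - x)"
    using B gnn[OF y(2,1)] by (intro mult_right_mono) auto
   finally show "\<bar>f y - f x\<bar> <= B' * gradient_sup_norm TYPE('n) M f * norm (y - x)" .
  qed
 next
  fix U and \<phi> :: "real^'n => 'a" and u0 assume lp: "local_param M U \<phi>" "u0 \<in> U"
  note lpD = local_paramD[OF lp(1)]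
  obtain R r c C \<eta> where ch: "R > 0" "0 < r" "r <= R" "c > 0" "C > 0" "\<eta> > 0" "cball u0 (2 * R) \<subseteq> U"
   "!!u z. u \<in> cball u0 (2 * R) ==> norm (frechet_derivative \<phi> (at u) z) <= C * norm z"
   "!!u w. u \<in> cball u0 R ==> norm w <= R ==> c * norm w <= norm (\<phi> (u + w) - \<phi> u)"
   "!!u y. u \<in> cball u0 r ==> y \<in> M ==> norm (y - \<phi> u) < \<eta> ==> \<exists>w. norm w < R \<and> y = \<phi> (u + w)"
   by (rule chart_bilipschitz[OF lp]) blast
  define B where "B = max (C / c) (1 / \<eta>)"
  have B: "B > 0" "C / c <= B" "1 / B <= \<eta>"
  proof -
   show "B > 0" "C / c <= B" using ch by (auto simp: B_def less_max_iff_disj)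
   have "1 / \<eta> <= B" by (simp add: B_def)
   then show "1 / B <= \<eta>" using \<open>B > 0\<close> ch by (simp add: field_simps)
  qed
  have "?P B (\<phi> u)" if u: "u \<in> ball u0 r \<inter> U" for u
  proof (intro conjI allI impI)
   fix f y assume f: "smooth_on_manifold TYPE('n) M f" and y: "y \<in> M" "norm (y - \<phi> u) < 1 / B"
   obtain w where w: "norm w < R" "y = \<phi> (u + w)" using ch(10)[of u y] u y B by auto
   let ?\<Lambda> = "gradient_sup_norm TYPE('n) M f"
   have \<Lambda>: "?\<Lambda> \<ge> 0" using gnn[OF y(1) f] .
   note c1 = smooth_on_chart[OF f lp(1)]
   have seg: "u + t *\<^sub>R w \<in> cball u0 (2 * R)" if "t \<in> {0..1}" for t
   proof -
    have "\<bar>t\<bar> * norm w <= 1 * R" using that w by (intro mult_mono) auto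
    moreover have "dist u0 (u + t *\<^sub>R w) <= dist u0 u + norm (t *\<^sub>R w)"
     using dist_triangle[of u0 "u + t *\<^sub>R w" u] by (simp add: dist_norm)
    ultimately show ?thesis using u ch by simp
   qed
   have "norm ((%t. (f \<circ> \<phi>) (u + t *\<^sub>R w) - (f \<circ> \<phi>) u) 1) <= ?\<Lambda> * (C * norm w)"
   proof (rule increment_bound[where h = "%t. (f \<circ> \<phi>) (u + t *\<^sub>R w) - (f \<circ> \<phi>) u" and h' = "%t. dir_deriv 1 (f \<circ> \<phi>) w (u + t *\<^sub>R w)"])
    fix t :: real assume t: "t \<in> {0..1}"
    have inU: "u + t *\<^sub>R w \<in> U" using seg[OF t] ch(7) by blast
    show "((%t. (f \<circ> \<phi>) (u + t *\<^sub>R w) - (f \<circ> \<phi>) u) has_vector_derivative dir_deriv 1 (f \<circ> \<phi>) w (u + t *\<^sub>R w)) (at t within {0..1})"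
     using has_vector_derivative_diff[OF dir_deriv_line[OF c1 inU, of 0] has_vector_derivative_const] by simp
    have "norm (dir_deriv 1 (f \<circ> \<phi>) w (u + t *\<^sub>R w)) <= norm (manifold_gradient TYPE('n) M f (\<phi> (u + t *\<^sub>R w))) * norm (frechet_derivative \<phi> (at (u + t *\<^sub>R w)) w)"
     unfolding dir_deriv_1 real_norm_def by (rule manifold_gradient_chart(1)[OF sub f lp(1) inU])
    also have "... <= ?\<Lambda> * (C * norm w)"
     using seg[OF t] \<Lambda> by (intro mult_mono manifold_gradient_le_sup[OF sub M f] lpD(5)[OF inU] ch(8)) auto
    finally show "norm (dir_deriv 1 (f \<circ> \<phi>) w (u + t *\<^sub>R w)) <= ?\<Lambda> * (C * norm w)" .
   qed auto
   then have "\<bar>f y - f (\<phi> u)\<bar> <= ?\<Lambda> * (C * norm w)" by (simp add: w(2))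
   also have "... <= ?\<Lambda> * (C * (norm (y - \<phi> u) / c))"
    using ch(9)[of u w] u w ch \<Lambda> by (intro mult_left_mono) (auto simp: field_simps)
   also have "... = (C / c) * (?\<Lambda> * norm (y - \<phi> u))" by simp
   also have "... <= B * (?\<Lambda> * norm (y - \<phi> u))" using B \<Lambda> by (intro mult_right_mono) auto
   finally show "\<bar>f y - f (\<phi> u)\<bar> <= B * ?\<Lambda> * norm (y - \<phi> u)" by (simp add: mult.assoc)
  qed (rule B)
  then show "\<exists>r>0. \<exists>B. \<forall>u\<in>ball u0 r \<inter> U. ?P B (\<phi> u)" using ch(2) by blast
 qed
 then show ?thesis by blast
qed

text \<open>The bi-Lipschitz bounds turn the integral into a Euclidean Gaussian one, and the
  substitution \<open>v = u + z / sqrt b\<close> produces the power of \<open>b\<close>. The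
  constant is chosen without reference to a density or a function, as the noise constant
  demands.\<close>

lemma gaussian_volume_bound:
 fixes M :: "'a::euclidean_space set"
 assumes sub: "smooth_submanifold TYPE('n::finite) M" and M: "compact M"
  and V: "riemannian_volume TYPE('n) M V"
 shows "\<exists>B>0. \<forall>x\<in>M. \<forall>b>0. (\<integral>\<^sup>+y\<in>{y. norm (y - x) < 1 / B}. ennreal (exp (- b * (norm (y - x))\<^sup>2) * norm (y - x) ^ m) \<partial>V)
  <= ennreal (B / sqrt b ^ (CARD('n) + m))"
proof -
 let ?I = "%B x b. \<integral>\<^sup>+y\<in>{y. norm (y - x) < 1 / B}. ennreal (exp (- b * (norm (y - x))\<^sup>2) * norm (y - x) ^ m) \<partial>V"
 let ?P = "%B x. B > 0 \<and> (\<forall>b>0. ?I B x b <= ennreal (B / sqrt b ^ (CARD('n) + m)))"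
 have "\<exists>B>0. \<forall>x\<in>M. ?P B x"
 proof (rule mono_if_charts[OF sub M])
  fix B B' x assume B: "B <= B'" "?P B x"
  have "?I B' x b <= ennreal (B' / sqrt b ^ (CARD('n) + m))" if b: "b > 0" for b
  proof -
   have "1 / B' <= 1 / B" using B by (simp add: field_simps)
   then have "?I B' x b <= ?I B x b" by (intro nn_integral_mono) (auto simp: indicator_def)
   also have "... <= ennreal (B / sqrt b ^ (CARD('n) + m))" using B b by blast
   also have "... <= ennreal (B' / sqrt b ^ (CARD('n) + m))" using B b by (intro ennreal_leI divide_right_mono) auto
   finally show ?thesis .
  qed
  then show "?P B' x" using B by simp
 next
  fix U and \<phi> :: "real^'n => 'a" and u0 assume lp: "local_param M U \<phi>" "u0 \<in> U"
  note lpD = local_paramD[OF lp(1)]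
  obtain R r c C \<eta> where ch: "R > 0" "0 < r" "r <= R" "c > 0" "C > 0" "\<eta> > 0" "cball u0 (2 * R) \<subseteq> U"
   "!!u w. u \<in> cball u0 R ==> norm w <= R ==> c * norm w <= norm (\<phi> (u + w) - \<phi> u)"
   "!!u w. u \<in> cball u0 R ==> norm w <= R ==> norm (\<phi> (u + w) - \<phi> u) <= C * norm w"
   "!!u y. u \<in> cball u0 r ==> y \<in> M ==> norm (y - \<phi> u) < \<eta> ==> \<exists>w. norm w < R \<and> y = \<phi> (u + w)"
   by (rule chart_bilipschitz[OF lp]) blast
  obtain S where S: "S \<ge> 0" "!!u. u \<in> cball u0 (2 * R) ==> \<bar>sqrt_det_metric \<phi> u\<bar> <= S"
   using dir_deriv_bound[OF lpD(1) compact_cball ch(7) Cinf_on_sqrt_det_metric[OF lp(1)], of 0] by auto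
  define J where "J = (LINT z::real^'n|lborel. norm z ^ m * exp (- c\<^sup>2 * (norm z)\<^sup>2))"
  have Jint: "integrable lborel (%z::real^'n. norm z ^ m * exp (- c\<^sup>2 * (norm z)\<^sup>2))"
   by (rule integrable_dominated[of "c\<^sup>2" _ 1 m]) (use ch in \<open>auto intro!: mult_right_mono power_mono\<close>)
  have J: "J \<ge> 0" unfolding J_def by (intro Bochner_Integration.integral_nonneg) auto
  define B where "B = max (S * C ^ m * J) (1 / \<eta>)"
  have B: "B > 0" "S * C ^ m * J <= B" "1 / B <= \<eta>"
  proof -
   show "B > 0" "S * C ^ m * J <= B" using ch by (auto simp: B_def less_max_iff_disj)
   have "1 / \<eta> <= B" by (simp add: B_def)
   then show "1 / B <= \<eta>" using \<open>B > 0\<close> ch by (simp add: field_simps)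
  qed
  have "?I B (\<phi> u) b <= ennreal (B / sqrt b ^ (CARD('n) + m))" if u: "u \<in> ball u0 r \<inter> U" and b: "b > 0" for u b
  proof -
   let ?x = "\<phi> u"
   let ?F = "%y. ennreal (exp (- b * (norm (y - ?x))\<^sup>2) * norm (y - ?x) ^ m)"
   have uR: "u \<in> cball u0 R" using u ch by auto
   have bU: "ball u R \<subseteq> cball u0 (2 * R)"
   proof
    fix v assume "v \<in> ball u R"
    then show "v \<in> cball u0 (2 * R)" using u ch dist_triangle[of u0 v u] by auto
   qed
   have sM: "space V = M" using V by (simp add: riemannian_volume_def)
   have Fm: "?F \<in> borel_measurable V" by (rule borel_measurable_volume(1)[OF V]) measurable
   have "?I B ?x b <= (\<integral>\<^sup>+y\<in>\<phi> ` ball u R. ?F y \<partial>V)"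
   proof (intro nn_integral_mono)
    fix y assume y: "y \<in> space V"
    have "y \<in> \<phi> ` ball u R" if yx: "norm (y - ?x) < 1 / B"
    proof -
     obtain w where "norm w < R" "y = \<phi> (u + w)" using ch(10)[of u y] u y yx B sM by auto
     then show ?thesis by (intro image_eqI[of _ _ "u + w"]) (auto simp: dist_norm)
    qed
    then show "?F y * indicator {y. norm (y - ?x) < 1 / B} y <= ?F y * indicator (\<phi> ` ball u R) y"
     by (auto simp: indicator_def)
   qed
   also have "... = (\<integral>\<^sup>+v\<in>ball u R. ?F (\<phi> v) * ennreal (sqrt_det_metric \<phi> v) \<partial>lborel)"
    using bU ch(7) by (intro chart_nn_integral[OF V lp(1) _ _ Fm]) auto
   also have "... <= (\<integral>\<^sup>+v. ennreal (S * C ^ m * (norm (v - u) ^ m * exp (- b * c\<^sup>2 * (norm (v - u))\<^sup>2))) \<partial>lborel)"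
   proof (intro nn_integral_mono)
    fix v :: "real^'n"
    show "?F (\<phi> v) * ennreal (sqrt_det_metric \<phi> v) * indicator (ball u R) v \<le>
     ennreal (S * C ^ m * (norm (v - u) ^ m * exp (- b * c\<^sup>2 * (norm (v - u))\<^sup>2)))"
    proof (cases "v \<in> ball u R")
     case True
     then have n: "norm (v - u) <= R" by (simp add: dist_norm norm_minus_commute)
     have l: "c * norm (v - u) <= norm (\<phi> v - ?x)" "norm (\<phi> v - ?x) <= C * norm (v - u)"
      using ch(8)[OF uR n] ch(9)[OF uR n] by auto
     have "(c * norm (v - u))\<^sup>2 <= (norm (\<phi> v - ?x))\<^sup>2" using l ch by (intro power_mono) auto
     then have e: "exp (- b * (norm (\<phi> v - ?x))\<^sup>2) <= exp (- b * c\<^sup>2 * (norm (v - u))\<^sup>2)"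
      using b by (simp add: power_mult_distrib mult.assoc)
     have p: "norm (\<phi> v - ?x) ^ m <= (C * norm (v - u)) ^ m" using l by (intro power_mono) auto
     have s: "sqrt_det_metric \<phi> v <= S" using S(2)[of v] bU True by auto
     have "?F (\<phi> v) * ennreal (sqrt_det_metric \<phi> v) <= ennreal (exp (- b * c\<^sup>2 * (norm (v - u))\<^sup>2) * (C * norm (v - u)) ^ m) * ennreal S"
      using e p s ch by (intro mult_mono ennreal_leI) auto
     also have "... = ennreal (S * C ^ m * (norm (v - u) ^ m * exp (- b * c\<^sup>2 * (norm (v - u))\<^sup>2)))"
      using S(1) ch by (simp add: ennreal_mult'[symmetric] power_mult_distrib mult_ac ennreal_mult''[symmetric])
     finally show ?thesis using True by simp
    qed simp
   qed
   also have "... = ennreal ((1 / sqrt b) ^ CARD('n)) * (\<integral>\<^sup>+z. ennreal (S * C ^ m * (norm ((1 / sqrt b) *\<^sub>R (z::real^'n)) ^ m * exp (- b * c\<^sup>2 * (norm ((1 / sqrt b) *\<^sub>R z))\<^sup>2))) \<partial>lborel)"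
    using b by (subst nn_integral_affine[of "1 / sqrt b" _ u]) auto
   also have "(\<integral>\<^sup>+z. ennreal (S * C ^ m * (norm ((1 / sqrt b) *\<^sub>R (z::real^'n)) ^ m * exp (- b * c\<^sup>2 * (norm ((1 / sqrt b) *\<^sub>R z))\<^sup>2))) \<partial>lborel) =
    (\<integral>\<^sup>+z. ennreal (S * C ^ m * (1 / sqrt b) ^ m * (norm (z::real^'n) ^ m * exp (- c\<^sup>2 * (norm z)\<^sup>2))) \<partial>lborel)"
    using b by (intro nn_integral_cong arg_cong[where f = ennreal]) (simp add: power_mult_distrib power_divide)
   also have "... = ennreal (LINT z::real^'n|lborel. S * C ^ m * (1 / sqrt b) ^ m * (norm z ^ m * exp (- c\<^sup>2 * (norm z)\<^sup>2)))"
    using Jint S(1) ch b by (intro nn_integral_eq_integral integrable_mult_right AE_I2) auto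
   also have "(LINT z::real^'n|lborel. S * C ^ m * (1 / sqrt b) ^ m * (norm z ^ m * exp (- c\<^sup>2 * (norm z)\<^sup>2))) = S * C ^ m * (1 / sqrt b) ^ m * J"
    by (simp add: J_def)
   also have "ennreal ((1 / sqrt b) ^ CARD('n)) * ennreal (S * C ^ m * (1 / sqrt b) ^ m * J) = ennreal ((S * C ^ m * J) / sqrt b ^ (CARD('n) + m))"
    using b by (subst ennreal_mult'[symmetric]) (auto simp: power_add power_divide mult_ac)
   also have "... <= ennreal (B / sqrt b ^ (CARD('n) + m))"
    using B b by (intro ennreal_leI divide_right_mono) auto
   finally show ?thesis .
  qed
  then have "\<forall>u\<in>ball u0 r \<inter> U. ?P B (\<phi> u)" using B(1) by blast
  then show "\<exists>r>0. \<exists>B. \<forall>u\<in>ball u0 r \<inter> U. ?P B (\<phi> u)" using ch(2) by blast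
 qed
 then show ?thesis by blast
qed

section \<open>Moments of the kernel in a chart\<close>

lemma has_derivative_quadratic:
 fixes F :: "'b::euclidean_space => 'c::real_normed_vector"
 assumes "linear F'" "r > 0" "!!w. norm w <= r ==> norm (F (u + w) - F u - F' w) <= C * (norm w)\<^sup>2"
 shows "(F has_derivative F') (at u)"
 unfolding has_derivative_at
proof
 show "bounded_linear F'" using assms(1) by (simp add: linear_conv_bounded_linear)
 show "(%h. norm (F (u + h) - F u - F' h) / norm h) \<midarrow>0\<rightarrow> 0"
 proof (rule Lim_null_comparison)
  show "((%h. C * norm h) \<longlongrightarrow> 0) (at 0)" by (auto intro!: tendsto_eq_intros)
  show "\<forall>\<^sub>F h in at 0. norm (norm (F (u + h) - F u - F' h) / norm h) <= C * norm h"
   unfolding eventually_at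
  proof (intro exI[of _ r] conjI ballI impI)
   fix h :: 'b assume h: "h ~= 0 \<and> dist h 0 < r"
   then have "norm (F (u + h) - F u - F' h) <= C * (norm h)\<^sup>2" using assms(3)[of h] by simp
   then show "norm (norm (F (u + h) - F u - F' h) / norm h) <= C * norm h"
    using h by (simp add: divide_le_eq power2_eq_square mult.assoc)
  qed fact
 qed
qed

text \<open>The conclusion of \<open>symmetric_taylor\<close> as a predicate, so that by
  monotonicity one constant can serve several functions.\<close>

definition taylor_bd :: "('a::euclidean_space => 'b::real_normed_vector) => 'a => real => real => bool" where
 "taylor_bd f u0 r C \<longleftrightarrow> (\<forall>u\<in>cball u0 r. \<forall>w. norm w <= r -->
  norm (f (u + w) - f u) <= C * norm w \<and>
  norm (f (u + w) - f u - dir_deriv 1 f w u) <= C * norm w ^ 2 \<and>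
  norm (f (u + w) - f (u - w) - 2 *\<^sub>R dir_deriv 1 f w u) <= C * norm w ^ 3 \<and>
  norm (f (u + w) + f (u - w) - 2 *\<^sub>R f u - dir_deriv 2 f w u) <= C * norm w ^ 4 \<and>
  norm (dir_deriv 1 f w u) <= C * norm w \<and> norm (dir_deriv 2 f w u) <= C * norm w ^ 2 \<and>
  norm (f u) <= C)"

lemma taylor_bd_exists:
 assumes "open U" "cball u0 (2 * r) \<subseteq> U" "Cinf_on f U"
 shows "\<exists>C\<ge>0. taylor_bd f u0 r C"
 using symmetric_taylor[OF assms] unfolding taylor_bd_def .

lemma taylor_bd_mono:
 assumes "taylor_bd f u0 r C" "C <= C'" "r' <= r"
 shows "taylor_bd f u0 r' C'"
proof -
 have up: "x <= C * norm (w::'a) ^ j ==> x <= C' * norm w ^ j" for x w j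
  using mult_right_mono[OF assms(2), of "norm w ^ j"] by simp
 have up1: "x <= C * norm (w::'a) ==> x <= C' * norm w" for x w
  using up[of x w 1] by simp
 have up0: "x <= C ==> x <= C'" for x using assms(2) by linarith
 show ?thesis
  unfolding taylor_bd_def
 proof (intro ballI allI impI)
  fix u w :: 'a assume "u \<in> cball u0 r'" "norm w <= r'"
  then have "u \<in> cball u0 r" "norm w <= r" using assms(3) by auto
  note H = assms(1)[unfolded taylor_bd_def, rule_format, OF this]
  show "norm (f (u + w) - f u) <= C' * norm w \<and>
   norm (f (u + w) - f u - dir_deriv 1 f w u) <= C' * norm w ^ 2 \<and>
   norm (f (u + w) - f (u - w) - 2 *\<^sub>R dir_deriv 1 f w u) <= C' * norm w ^ 3 \<and>
   norm (f (u + w) + f (u - w) - 2 *\<^sub>R f u - dir_deriv 2 f w u) <= C' * norm w ^ 4 \<and>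
   norm (dir_deriv 1 f w u) <= C' * norm w \<and> norm (dir_deriv 2 f w u) <= C' * norm w ^ 2 \<and>
   norm (f u) <= C'"
   using H by (elim conjE, intro conjI) (rule up1, assumption | rule up, assumption | rule up0, assumption)+
 qed
qed

lemma abs_quadratic_form_le:
 fixes z :: "real^'n"
 assumes "!!i j. \<bar>c i j\<bar> <= C"
 shows "\<bar>\<Sum>i\<in>UNIV. \<Sum>j\<in>UNIV. c i j * (z $ i * z $ j)\<bar> <= real CARD('n) ^ 2 * C * (norm z)\<^sup>2"
proof -
 have "\<bar>\<Sum>i\<in>UNIV. \<Sum>j\<in>UNIV. c i j * (z $ i * z $ j)\<bar> <= (\<Sum>i\<in>(UNIV::'n set). \<Sum>j\<in>(UNIV::'n set). C * (norm z * norm z))"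
 proof (intro order_trans[OF sum_abs] sum_mono)
  fix i j
  have "\<bar>z $ i * z $ j\<bar> <= norm z * norm z"
   by (intro abs_mult_le component_le_norm_cart)
  then show "\<bar>c i j * (z $ i * z $ j)\<bar> <= C * (norm z * norm z)"
   by (rule abs_mult_le[OF assms])
 qed
 also have "... = real CARD('n) ^ 2 * C * (norm z)\<^sup>2"
  by (simp add: power2_eq_square)
 finally show ?thesis .
qed

lemma compact_positive_lower_bound:
 fixes f :: "'a::euclidean_space => real"
 assumes "compact K" "continuous_on K f" "!!x. x \<in> K ==> f x > 0"
 shows "\<exists>c>0. \<forall>x\<in>K. c <= f x"
proof (cases "K = {}")
 case False
 then obtain x where "x \<in> K" "\<forall>y\<in>K. f x <= f y" using continuous_attains_inf[OF assms(1) _ assms(2)] by blast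
 then show ?thesis using assms(3) by blast
qed (auto intro: exI[of _ 1])

locale weighted_chart = decaying_kernel +
 fixes M :: "'a::euclidean_space set" and U :: "(real^'n::finite) set" and \<phi> :: "real^'n => 'a"
  and P h :: "real^'n => real" and \<alpha> :: real
 assumes lp: "local_param M U \<phi>" and P: "Cinf_on P U" and P_pos: "u \<in> U ==> P u > 0" and h: "Cinf_on h U"
begin

abbreviation sg :: "real^'n => real" where "sg \<equiv> sqrt_det_metric \<phi>"

text \<open>In the application \<open>P\<close> is the density and \<open>h\<close> the function,
  both read in the chart. Then \<open>inv_rho\<close> is the reciprocal of \<open>rho_bar\<close>;
  \<open>weight\<close> collects density, bandwidth factor and volume element; \<open>cform\<close>
  is the metric divided by \<open>rho_bar\<close> squared, the leading part of the kernel argument,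
  and \<open>dcform\<close> its derivative in the base point. \<open>W\<close> is the matrix of
  second moments and \<open>dW\<close> its derivative.\<close>

definition inv_rho :: "real^'n => real" where "inv_rho v = P v powr (1 / real CARD('n))"
definition weight :: "real^'n => real" where "weight v = P v powr (1 + \<alpha> / real CARD('n)) * sg v"
definition cmetric :: "'n => 'n => real^'n => real" where
 "cmetric i j v = metric_tensor \<phi> v $ i $ j * P v powr (2 / real CARD('n))"
definition cform :: "real^'n => real^'n => real" where
 "cform v z = (\<Sum>i\<in>UNIV. \<Sum>j\<in>UNIV. cmetric i j v * (z $ i * z $ j))"
definition dcform :: "real^'n => real^'n => real^'n => real" where
 "dcform v w z = (\<Sum>i\<in>UNIV. \<Sum>j\<in>UNIV. frechet_derivative (cmetric i j) (at v) w * (z $ i * z $ j))"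
definition W :: "'n => 'n => real^'n => real" where
 "W i j v = (LINT z|lborel. k0 (cform v z) * (z $ i * z $ j))"
definition dW :: "'n => 'n => real^'n => real^'n => real" where
 "dW i j v w = (LINT z|lborel. k1 (cform v z) * dcform v w z * (z $ i * z $ j))"

lemma openU: "open U" using local_paramD(1)[OF lp] .

lemma Cinf_inv_rho: "Cinf_on inv_rho U"
 unfolding inv_rho_def[abs_def] by (rule Cinf_on_powr[OF openU P P_pos])

lemma Cinf_weight: "Cinf_on weight U"
 unfolding weight_def[abs_def]
 by (intro Cinf_on_mult[OF openU] Cinf_on_powr[OF openU P P_pos] Cinf_on_sqrt_det_metric[OF lp])

lemma Cinf_cmetric: "Cinf_on (cmetric i j) U"
 unfolding cmetric_def[abs_def]
 by (intro Cinf_on_mult[OF openU] Cinf_on_powr[OF openU P P_pos] Cinf_on_metric_entry[OF lp])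

lemma inv_rho_pos: "u \<in> U ==> inv_rho u > 0"
 using P_pos[of u] by (simp add: inv_rho_def)

lemma inv_rho_square: "u \<in> U ==> (inv_rho u)\<^sup>2 = P u powr (2 / real CARD('n))"
 by (simp add: inv_rho_def power2_eq_square powr_add[symmetric])

lemma cform_eq:
 assumes u: "u \<in> U"
 shows "cform u z = (inv_rho u)\<^sup>2 * (norm (frechet_derivative \<phi> (at u) z))\<^sup>2"
 unfolding norm_derivative_metric[OF local_paramD(2)[OF lp] u] cform_def cmetric_def inv_rho_square[OF u] sum_distrib_left
 by (intro sum.cong refl) (simp only: mult_ac)

lemma cform_measurable [measurable]: "cform v \<in> borel_measurable borel"
 unfolding cform_def[abs_def] by measurable

lemma dcform_measurable [measurable]: "dcform v w \<in> borel_measurable borel"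
 unfolding dcform_def[abs_def] by measurable

lemma linear_dcmetric: "u \<in> U ==> linear (frechet_derivative (cmetric i j) (at u))"
 by (rule Cinf_on_linear_derivative[OF Cinf_cmetric])

lemma dcform_measurable2:
 assumes u: "u \<in> U"
 shows "(%w. dcform u w w) \<in> borel_measurable borel"
proof -
 have [measurable]: "frechet_derivative (cmetric i j) (at u) \<in> borel_measurable borel" for i j
  by (intro borel_measurable_continuous_onI linear_continuous_on)
   (simp add: linear_conv_bounded_linear[symmetric] linear_dcmetric[OF u])
 show ?thesis unfolding dcform_def by measurable
qed

lemma cform_scale: "cform v (t *\<^sub>R z) = t\<^sup>2 * cform v z"
 unfolding cform_def sum_distrib_left by (intro sum.cong refl) (simp add: power2_eq_square)

definition local_const :: "real^'n => real => real => real => real => real => bool" where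
 "local_const u0 R r c K \<eta> \<longleftrightarrow> 0 < R \<and> R <= 1 \<and> 0 < r \<and> r <= R \<and> 0 < c \<and> 1 <= K \<and> \<eta> > 0 \<and> cball u0 (2 * R) \<subseteq> U \<and>
  (\<forall>u\<in>cball u0 R. \<forall>z. c * (norm z)\<^sup>2 <= cform u z) \<and>
  (\<forall>u\<in>cball u0 R. \<forall>w. norm w <= R -->
   c * (norm w)\<^sup>2 <= (norm (\<phi> (u + w) - \<phi> u))\<^sup>2 * inv_rho u * inv_rho (u + w)) \<and>
  taylor_bd \<phi> u0 R K \<and> taylor_bd inv_rho u0 R K \<and> taylor_bd weight u0 R K \<and> taylor_bd h u0 R K \<and>
  (\<forall>i j. taylor_bd (cmetric i j) u0 R K) \<and>
  (\<forall>u\<in>cball u0 r. \<forall>y\<in>M. norm (y - \<phi> u) < \<eta> --> (\<exists>w. norm w < R \<and> y = \<phi> (u + w)))"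

lemma local_constD:
 assumes "local_const u0 R r c K \<eta>"
 shows "0 < R" "R <= 1" "0 < r" "r <= R" "0 < c" "1 <= K" "\<eta> > 0" "cball u0 (2 * R) \<subseteq> U"
  "!!u z. u \<in> cball u0 R ==> c * (norm z)\<^sup>2 <= cform u z"
  "!!u w. u \<in> cball u0 R ==> norm w <= R ==>
   c * (norm w)\<^sup>2 <= (norm (\<phi> (u + w) - \<phi> u))\<^sup>2 * inv_rho u * inv_rho (u + w)"
  "taylor_bd \<phi> u0 R K" "taylor_bd inv_rho u0 R K" "taylor_bd weight u0 R K" "taylor_bd h u0 R K"
  "!!i j. taylor_bd (cmetric i j) u0 R K"
  "!!u y. u \<in> cball u0 r ==> y \<in> M ==> norm (y - \<phi> u) < \<eta> ==> \<exists>w. norm w < R \<and> y = \<phi> (u + w)"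
 using assms unfolding local_const_def by blast+

lemma local_constants:
 assumes u0: "u0 \<in> U"
 obtains R r c K \<eta> where "local_const u0 R r c K \<eta>"
proof -
 obtain e where e: "e > 0" "cball u0 e \<subseteq> U" using openU u0 open_contains_cball by blast
 obtain R1 r1 c1 C1 \<eta>1 where ch: "R1 > 0" "c1 > 0" "cball u0 (2 * R1) \<subseteq> U"
   "!!u z. u \<in> cball u0 R1 ==> c1 * norm z <= norm (frechet_derivative \<phi> (at u) z)"
   "!!u w. u \<in> cball u0 R1 ==> norm w <= R1 ==> c1 * norm w <= norm (\<phi> (u + w) - \<phi> u)"
   "0 < r1" "\<eta>1 > 0"
   "!!u y. u \<in> cball u0 r1 ==> y \<in> M ==> norm (y - \<phi> u) < \<eta>1 ==> \<exists>w. norm w < R1 \<and> y = \<phi> (u + w)"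
  by (rule chart_bilipschitz[OF lp u0]) blast
 obtain i0 where i0: "i0 > 0" "!!v. v \<in> cball u0 (2 * R1) ==> i0 <= inv_rho v"
  using compact_positive_lower_bound[OF compact_cball continuous_on_subset[OF Cinf_on_continuous_on[OF Cinf_inv_rho] ch(3)]]
   inv_rho_pos ch(3) by blast
 define R where "R = min 1 R1"
 have R: "0 < R" "R <= 1" "R <= R1" using ch by (auto simp: R_def)
 have sub: "cball u0 (2 * R) \<subseteq> U" "cball u0 R \<subseteq> cball u0 R1" "cball u0 R1 \<subseteq> cball u0 (2 * R1)" using ch R by auto
 note T = taylor_bd_exists[OF openU sub(1)]
 obtain K1 where K1: "K1 \<ge> 0" "taylor_bd \<phi> u0 R K1" using T[OF local_paramD(2)[OF lp]] by blast
 obtain K2 where K2: "K2 \<ge> 0" "taylor_bd inv_rho u0 R K2" using T[OF Cinf_inv_rho] by blast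
 obtain K3 where K3: "K3 \<ge> 0" "taylor_bd weight u0 R K3" using T[OF Cinf_weight] by blast
 obtain K4 where K4: "K4 \<ge> 0" "taylor_bd h u0 R K4" using T[OF h] by blast
 obtain K5 where K5: "!!i j. K5 i j \<ge> 0" "!!i j. taylor_bd (cmetric i j) u0 R (K5 i j)" using T[OF Cinf_cmetric] by metis
 define S where "S = (\<Sum>i\<in>UNIV. \<Sum>j\<in>UNIV. K5 i j)"
 have S: "K5 i j <= S" for i j
 proof -
  have "K5 i j <= (\<Sum>j\<in>UNIV. K5 i j)" using K5 by (intro member_le_sum) auto
  also have "... <= S" unfolding S_def using K5 by (intro member_le_sum[of i UNIV "%i. \<Sum>j\<in>UNIV. K5 i j"]) (auto intro: sum_nonneg)
  finally show ?thesis .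
 qed
 have S0: "S \<ge> 0" unfolding S_def using K5 by (intro sum_nonneg) auto
 define K where "K = 1 + K1 + K2 + K3 + K4 + S"
 have Kge: "1 <= K" "K1 <= K" "K2 <= K" "K3 <= K" "K4 <= K" "!!i j. K5 i j <= K"
  using K1(1) K2(1) K3(1) K4(1) S0 order_trans[OF S] by (auto simp: K_def)
 define c where "c = i0\<^sup>2 * c1\<^sup>2"
 have c: "c > 0" using i0 ch by (simp add: c_def)
 have cf: "c * (norm z)\<^sup>2 <= cform u z" if "u \<in> cball u0 R" for u z
 proof -
  have "u \<in> U" using that sub ch by blast
  have "i0\<^sup>2 * (c1 * norm z)\<^sup>2 <= (inv_rho u)\<^sup>2 * (norm (frechet_derivative \<phi> (at u) z))\<^sup>2"
   using i0 ch that sub by (intro mult_mono power_mono) auto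
  then show ?thesis unfolding cform_eq[OF \<open>u \<in> U\<close>] c_def by (simp add: power_mult_distrib mult.assoc)
 qed
 have sl: "c * (norm w)\<^sup>2 <= (norm (\<phi> (u + w) - \<phi> u))\<^sup>2 * inv_rho u * inv_rho (u + w)"
  if "u \<in> cball u0 R" "norm w <= R" for u w
 proof -
  have "u + w \<in> cball u0 (2 * R1)"
   using that R dist_triangle[of u0 "u + w" u] by (auto simp: dist_norm)
  then have i: "i0 <= inv_rho u" "i0 <= inv_rho (u + w)" using i0 that sub by blast+
  have "(c1 * norm w)\<^sup>2 * i0 * i0 <= (norm (\<phi> (u + w) - \<phi> u))\<^sup>2 * inv_rho u * inv_rho (u + w)"
   using i i0(1) ch that sub R by (intro mult_mono power_mono mult_nonneg_nonneg) auto
  then show ?thesis by (simp add: c_def power_mult_distrib power2_eq_square mult_ac)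
 qed
 \<comment> \<open>Points closer than \<open>c1 * R\<close> have an increment below \<open>R\<close>
   by the bi-Lipschitz bound; this shrinks the radius \<open>R1\<close> of the chart lemma to
   \<open>R\<close>.\<close>
 have "local_const u0 R (min r1 R) c K (min \<eta>1 (c1 * R))"
  unfolding local_const_def
 proof (intro conjI ballI allI impI)
  fix u y assume uy: "u \<in> cball u0 (min r1 R)" "y \<in> M" "norm (y - \<phi> u) < min \<eta>1 (c1 * R)"
  have u: "u \<in> cball u0 r1" "u \<in> cball u0 R1" using uy(1) R by auto
  obtain w where w: "norm w < R1" "y = \<phi> (u + w)" using ch(8)[OF u(1) uy(2)] uy(3) by auto
  have "c1 * norm w < c1 * R" using ch(5)[OF u(2), of w] w uy(3) by simp
  then show "\<exists>w. norm w < R \<and> y = \<phi> (u + w)" using w(2) ch(2) by auto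
 next
  show "0 < R" "R <= 1" "0 < min r1 R" "min r1 R <= R" "0 < c" "1 <= K" "min \<eta>1 (c1 * R) > 0" "cball u0 (2 * R) \<subseteq> U"
   using R ch(2,6,7) c Kge(1) sub(1) by auto
  show "taylor_bd \<phi> u0 R K" by (rule taylor_bd_mono[OF K1(2) Kge(2) order_refl])
  show "taylor_bd inv_rho u0 R K" by (rule taylor_bd_mono[OF K2(2) Kge(3) order_refl])
  show "taylor_bd weight u0 R K" by (rule taylor_bd_mono[OF K3(2) Kge(4) order_refl])
  show "taylor_bd h u0 R K" by (rule taylor_bd_mono[OF K4(2) Kge(5) order_refl])
  show "taylor_bd (cmetric i j) u0 R K" for i j by (rule taylor_bd_mono[OF K5(2) Kge(6) order_refl])
 qed (rule cf sl; assumption)+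
 then show ?thesis by (rule that)
qed

text \<open>The form \<open>cform u\<close> is the squared norm of an invertible linear map, so the
  linear moments apply. Scaling by \<open>inv_rho u\<close> contributes its \<open>d\<close>-th
  power, which is \<open>P u\<close>.\<close>

lemma W_eq:
 assumes u: "u \<in> U"
 shows "W i j u = kernel_m2 TYPE('n) k0 * inverse_metric \<phi> i j u / (P u powr (1 + 2 / real CARD('n)) * sg u)"
  and "(LINT z|lborel. k0 (cform u z)) = kernel_m0 TYPE('n) k0 / (P u * sg u)"
proof -
 obtain B :: "real^'n => real^'n" where B: "linear B" "!!z. norm (B z) = norm (frechet_derivative \<phi> (at u) z)"
  "det (matrix B) ~= 0" "metric_tensor \<phi> u = transpose (matrix B) ** matrix B" "sg u = \<bar>det (matrix B)\<bar>"
  by (rule metric_factor[OF lp u]) blast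
 let ?c = "inv_rho u"
 have c: "?c > 0" by (rule inv_rho_pos[OF u])
 have cd: "?c ^ CARD('n) = P u"
  using P_pos[OF u] by (simp add: inv_rho_def powr_powr flip: powr_realpow)
 note c2 = inv_rho_square[OF u]
 have cf: "cform u z = (norm (B (?c *\<^sub>R z)))\<^sup>2" for z
  using c by (simp add: cform_eq[OF u] B(2) linear_scale[OF B(1)] power_mult_distrib)
 have [measurable]: "B \<in> borel_measurable borel"
  using B(1) by (intro borel_measurable_continuous_onI linear_continuous_on) (simp add: linear_conv_bounded_linear)
 have "(LINT z|lborel. k0 ((norm (B z))\<^sup>2) * (z $ i * z $ j)) = P u * (LINT z|lborel. k0 (cform u z) * ((?c * z $ i) * (?c * z $ j)))"
  using integral_affine[of ?c "%z::real^'n. k0 ((norm (B z))\<^sup>2) * (z $ i * z $ j)" 0] c by (simp add: cf cd)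
 also have "(%z. k0 (cform u z) * ((?c * z $ i) * (?c * z $ j))) = (%z. ?c\<^sup>2 * (k0 (cform u z) * (z $ i * z $ j)))"
  by (simp add: fun_eq_iff power2_eq_square mult_ac)
 also have "P u * (LINT z|lborel. ?c\<^sup>2 * (k0 (cform u z) * (z $ i * z $ j))) = (P u * ?c\<^sup>2) * W i j u"
  by (simp add: W_def)
 also have "P u * ?c\<^sup>2 = P u powr (1 + 2 / real CARD('n))"
  unfolding c2 using P_pos[OF u] by (simp add: powr_add)
 finally have "P u powr (1 + 2 / real CARD('n)) * W i j u = kernel_m2 TYPE('n) k0 * inverse_metric \<phi> i j u / sg u"
  unfolding linear_moment2[OF B(1,3)] by (simp add: inverse_metric_def B(4,5))
 then show "W i j u = kernel_m2 TYPE('n) k0 * inverse_metric \<phi> i j u / (P u powr (1 + 2 / real CARD('n)) * sg u)"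
  using P_pos[OF u] sqrt_det_metric_pos[OF lp u] by (simp add: field_simps)
 have "(LINT z|lborel. k0 ((norm (B z))\<^sup>2)) = P u * (LINT z|lborel. k0 (cform u z))"
  using integral_affine[of ?c "%z::real^'n. k0 ((norm (B z))\<^sup>2)" 0] c by (simp add: cf cd)
 then show "(LINT z|lborel. k0 (cform u z)) = kernel_m0 TYPE('n) k0 / (P u * sg u)"
  unfolding linear_moment0[OF B(1,3)] using P_pos[OF u] sqrt_det_metric_pos[OF lp u] by (simp add: field_simps B(5))
qed

lemma W_sym: "W i j u = W j i u"
 by (simp add: W_def mult_ac)

lemma cmetric_bounds:
 assumes "!!i j. taylor_bd (cmetric i j) u0 R K" "u \<in> cball u0 R" "norm w <= R" 
 shows "\<bar>cform (u + w) z - cform u z\<bar> <= (real CARD('n))\<^sup>2 * (K * norm w) * (norm z)\<^sup>2"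
  and "\<bar>cform (u + w) z - cform u z - dcform u w z\<bar> <= (real CARD('n))\<^sup>2 * (K * (norm w)\<^sup>2) * (norm z)\<^sup>2"
  and "\<bar>dcform u w z\<bar> <= (real CARD('n))\<^sup>2 * (K * norm w) * (norm z)\<^sup>2"
proof -
 have t: "\<bar>cmetric i j (u + w) - cmetric i j u\<bar> <= K * norm w"
  "\<bar>cmetric i j (u + w) - cmetric i j u - frechet_derivative (cmetric i j) (at u) w\<bar> <= K * (norm w)\<^sup>2"
  "\<bar>frechet_derivative (cmetric i j) (at u) w\<bar> <= K * norm w" for i j
  using assms(1)[of i j] assms(2,3) unfolding taylor_bd_def dir_deriv_1 by (auto simp del: dir_deriv.simps)
 have 1: "cform (u + w) z - cform u z = (\<Sum>i\<in>UNIV. \<Sum>j\<in>UNIV. (cmetric i j (u + w) - cmetric i j u) * (z $ i * z $ j))"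
  by (simp add: cform_def sum_subtractf left_diff_distrib)
 show "\<bar>cform (u + w) z - cform u z\<bar> <= (real CARD('n))\<^sup>2 * (K * norm w) * (norm z)\<^sup>2"
  unfolding 1 by (rule abs_quadratic_form_le[OF t(1)])
 have 2: "cform (u + w) z - cform u z - dcform u w z = (\<Sum>i\<in>UNIV. \<Sum>j\<in>UNIV.
  (cmetric i j (u + w) - cmetric i j u - frechet_derivative (cmetric i j) (at u) w) * (z $ i * z $ j))"
  by (simp add: 1 dcform_def sum_subtractf left_diff_distrib)
 show "\<bar>cform (u + w) z - cform u z - dcform u w z\<bar> <= (real CARD('n))\<^sup>2 * (K * (norm w)\<^sup>2) * (norm z)\<^sup>2"
  unfolding 2 by (rule abs_quadratic_form_le[OF t(2)])
 show "\<bar>dcform u w z\<bar> <= (real CARD('n))\<^sup>2 * (K * norm w) * (norm z)\<^sup>2"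
  unfolding dcform_def by (rule abs_quadratic_form_le[OF t(3)])
qed

lemma dcform_linear:
 assumes u: "u \<in> U"
 shows "dcform u (x + y) z = dcform u x z + dcform u y z" "dcform u (t *\<^sub>R x) z = t * dcform u x z"
proof -
 note lin = linear_add[OF linear_dcmetric[OF u]] linear_scale[OF linear_dcmetric[OF u]]
 show "dcform u (x + y) z = dcform u x z + dcform u y z"
  unfolding dcform_def lin distrib_right sum.distrib ..
 show "dcform u (t *\<^sub>R x) z = t * dcform u x z"
  unfolding dcform_def lin sum_distrib_left by (simp add: mult.assoc)
qed

lemma
 assumes u: "u \<in> U"
 shows k1_dcform_integrable: "integrable lborel (%z. k1 (cform u z) * dcform u w z * (z $ i * z $ j))"
  and k0_integrable: "integrable lborel (%z. k0 (cform u z) * (z $ i * z $ j))"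
proof -
 obtain R r c K \<eta> where lc: "local_const u R r c K \<eta>" by (rule local_constants[OF u])
 note L = local_constD(1,2,5,6,9,15)[OF lc]
 have uR: "u \<in> cball u R" using L by simp
 have zz: "\<bar>z $ i * z $ j\<bar> <= norm z * norm z" for z :: "real^'n"
  by (intro abs_mult_le component_le_norm_cart)
 have E: "A * exp (- a * cform u z) <= A * exp (- (a * c) * (norm z)\<^sup>2)" for z
  using L(5)[OF uR, of z] A_pos a_pos by (simp add: mult.assoc)
 have pos: "cform u z > 0" if "z ~= 0" for z
  using L(5)[OF uR, of z] L(3) that by (auto intro: less_le_trans[rotated])
 show "integrable lborel (%z. k0 (cform u z) * (z $ i * z $ j))"
 proof (rule integrable_dominated[of "a * c" _ A 2])
  fix z :: "real^'n" assume z: "z ~= 0"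
  have "\<bar>k0 (cform u z)\<bar> <= A * exp (- (a * c) * (norm z)\<^sup>2)"
   using k0_bound[of "cform u z"] k0_nonneg[of "cform u z"] pos[OF z] E[of z] by linarith
  then have "\<bar>k0 (cform u z) * (z $ i * z $ j)\<bar> <= A * exp (- (a * c) * (norm z)\<^sup>2) * (norm z * norm z)"
   by (intro abs_mult_le zz)
  also have "... <= A * exp (- (a * c) * (norm z)\<^sup>2) * (1 + norm z)\<^sup>2"
   unfolding power2_eq_square[symmetric] using A_pos by (intro mult_left_mono power_mono) auto
  finally show "\<bar>k0 (cform u z) * (z $ i * z $ j)\<bar> <= A * ((1 + norm z)\<^sup>2 * exp (- (a * c) * (norm z)\<^sup>2))"
   by (simp add: mult_ac)
 qed (use a_pos L in auto)
 \<comment> \<open>The Taylor constants bound \<open>dcform\<close> for short directions only;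
   linearity in the direction carries the bound to \<open>w\<close> by scaling.\<close>
 have dc: "\<exists>C\<ge>0. \<forall>z. \<bar>dcform u w z\<bar> <= C * (norm z)\<^sup>2"
 proof -
  define t where "t = R / (norm w + 1)"
  have t: "t > 0" "norm (t *\<^sub>R w) <= R"
   using L by (auto simp: t_def field_simps add_pos_nonneg)
  have "\<bar>dcform u w z\<bar> <= ((real CARD('n))\<^sup>2 * (K * norm (t *\<^sub>R w)) / t) * (norm z)\<^sup>2" for z
   using cmetric_bounds(3)[OF L(6) uR t(2), of z] t(1) by (simp add: dcform_linear[OF u] abs_mult field_simps)
  then show ?thesis using L t by (intro exI[of _ "(real CARD('n))\<^sup>2 * (K * norm (t *\<^sub>R w)) / t"]) auto
 qed
 then obtain C where C: "C \<ge> 0" "!!z. \<bar>dcform u w z\<bar> <= C * (norm z)\<^sup>2" by blast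
 show "integrable lborel (%z. k1 (cform u z) * dcform u w z * (z $ i * z $ j))"
 proof (rule integrable_dominated[of "a * c" _ "A * C" 4])
  fix z :: "real^'n" assume z: "z ~= 0"
  have "\<bar>k1 (cform u z)\<bar> <= A * exp (- (a * c) * (norm z)\<^sup>2)"
   using k1_bound[of "cform u z"] pos[OF z] E[of z] by linarith
  then have "\<bar>k1 (cform u z) * dcform u w z * (z $ i * z $ j)\<bar> <= A * exp (- (a * c) * (norm z)\<^sup>2) * (C * (norm z)\<^sup>2) * (norm z * norm z)"
   by (intro abs_mult_le zz C)
  also have "... = A * C * exp (- (a * c) * (norm z)\<^sup>2) * norm z ^ 4"
   by (simp add: power2_eq_square power4_eq_xxxx)
  also have "... <= A * C * exp (- (a * c) * (norm z)\<^sup>2) * (1 + norm z) ^ 4"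
   using A_pos C by (intro mult_left_mono power_mono) auto
  finally show "\<bar>k1 (cform u z) * dcform u w z * (z $ i * z $ j)\<bar> <= A * C * ((1 + norm z) ^ 4 * exp (- (a * c) * (norm z)\<^sup>2))"
   by (simp add: mult_ac)
 qed (use a_pos L in auto)
qed

text \<open>Differentiation under the integral through an explicit quadratic remainder: Taylor's
  formula for \<open>k0\<close> at \<open>cform u z\<close> and for the metric entries, with the
  decay at \<open>c * (norm z)^2\<close> as common Gaussian weight. The point \<open>z = 0\<close>
  is left out.\<close>

lemma W_has_derivative:
 assumes u: "u \<in> U"
 shows "(W i j has_derivative dW i j u) (at u)"
proof -
 obtain R r c K \<eta> where lc: "local_const u R r c K \<eta>" by (rule local_constants[OF u])
 note L = local_constD(1,2,5,6,8,9,15)[OF lc]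
 have uR: "u \<in> cball u R" using L by simp
 define K' where "K' = (real CARD('n))\<^sup>2 * K"
 have K': "K' \<ge> 0" using L by (simp add: K'_def)
 define J where "J = (LINT z::real^'n|lborel. (1 + norm z) ^ 6 * exp (- (a * c) * (norm z)\<^sup>2))"
 have Jint: "integrable lborel (%z::real^'n. (1 + norm z) ^ 6 * exp (- (a * c) * (norm z)\<^sup>2))"
  using a_pos L by (intro integrable_poly_gaussian) auto
 show ?thesis
 proof (rule has_derivative_quadratic[of _ R _ _ "A * (K'\<^sup>2 + K') * J"])
  show "linear (dW i j u)"
  proof (rule linearI)
   have "k1 (cform u z) * dcform u (x + y) z * (z $ i * z $ j) =
    k1 (cform u z) * dcform u x z * (z $ i * z $ j) + k1 (cform u z) * dcform u y z * (z $ i * z $ j)" for x y z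
    by (simp add: dcform_linear[OF u] distrib_left distrib_right)
   then show "dW i j u (x + y) = dW i j u x + dW i j u y" for x y
    unfolding dW_def using k1_dcform_integrable[OF u] by simp
   have "k1 (cform u z) * dcform u (t *\<^sub>R x) z * (z $ i * z $ j) = t * (k1 (cform u z) * dcform u x z * (z $ i * z $ j))" for t x z
    by (simp add: dcform_linear[OF u])
   then show "dW i j u (t *\<^sub>R x) = t *\<^sub>R dW i j u x" for t x
    unfolding dW_def by (simp only: integral_mult_right_zero real_scaleR_def)
  qed
  fix w :: "real^'n" assume w: "norm w <= R"
  have uw: "u + w \<in> cball u R" "u + w \<in> U"
  proof -
   show uw: "u + w \<in> cball u R" using w by (simp add: dist_norm)
   then have "u + w \<in> cball u (2 * R)" using L(1) by auto
   then show "u + w \<in> U" using L(5) by blast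
  qed
  have factor: "(E * (p * v * x) + E * (q * v * x)) * y = E * (p + q) * v * (x * y)" for E p q v x y :: real
   by (simp add: algebra_simps)
  have pt: "\<bar>k0 (cform (u + w) z) * (z $ i * z $ j) - k0 (cform u z) * (z $ i * z $ j) - k1 (cform u z) * dcform u w z * (z $ i * z $ j)\<bar>
   <= A * (K'\<^sup>2 + K') * (norm w)\<^sup>2 * ((1 + norm z) ^ 6 * exp (- (a * c) * (norm z)\<^sup>2))" if z: "z ~= 0" for z
  proof -
   let ?x = "cform (u + w) z" and ?y = "cform u z" and ?n = "norm z"
   let ?E = "A * exp (- a * (c * ?n\<^sup>2))"
   have E0: "?E \<ge> 0" using A_pos by simp
   have m: "c * ?n\<^sup>2 > 0" "c * ?n\<^sup>2 <= ?x" "c * ?n\<^sup>2 <= ?y"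
    using L(3) z L(6)[OF uw(1), of z] L(6)[OF uR, of z] by simp_all
   have 1: "\<bar>k0 ?x - k0 ?y - k1 ?y * (?x - ?y)\<bar> <= ?E * (?x - ?y)\<^sup>2"
    using m A_pos a_pos by (intro exp_decay_taylor[OF k0_der k1_der k2_bound]) auto
   have "\<bar>?x - ?y\<bar> <= K' * norm w * ?n\<^sup>2"
    using cmetric_bounds(1)[OF L(7) uR w, of z] by (simp add: K'_def mult_ac)
   from power_mono[OF this, of 2] have sq: "(?x - ?y)\<^sup>2 <= K'\<^sup>2 * (norm w)\<^sup>2 * ?n ^ 4"
    by (simp add: power_mult_distrib)
   have "\<bar>k1 ?y\<bar> <= ?E"
   proof -
    have "A * exp (- a * ?y) <= ?E" using m(3) A_pos a_pos by simp
    then show ?thesis using k1_bound[of ?y] m by linarith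
   qed
   moreover have "\<bar>?x - ?y - dcform u w z\<bar> <= K' * (norm w)\<^sup>2 * ?n\<^sup>2"
    using cmetric_bounds(2)[OF L(7) uR w, of z] by (simp add: K'_def mult_ac)
   ultimately have 2: "\<bar>k1 ?y * (?x - ?y - dcform u w z)\<bar> <= ?E * (K' * (norm w)\<^sup>2 * ?n\<^sup>2)"
    by (rule abs_mult_le)
   have n: "?n ^ 4 <= (1 + ?n) ^ 4" "?n\<^sup>2 <= (1 + ?n) ^ 4"
   proof -
    show "?n ^ 4 <= (1 + ?n) ^ 4" by (intro power_mono) auto
    have "?n\<^sup>2 <= (1 + ?n)\<^sup>2" by (intro power_mono) auto
    also have "... <= (1 + ?n) ^ 4" by (intro power_increasing) auto
    finally show "?n\<^sup>2 <= (1 + ?n) ^ 4" .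
   qed
   have "k0 ?x - k0 ?y - k1 ?y * dcform u w z = (k0 ?x - k0 ?y - k1 ?y * (?x - ?y)) + k1 ?y * (?x - ?y - dcform u w z)"
    by (simp add: algebra_simps)
   then have "\<bar>k0 ?x - k0 ?y - k1 ?y * dcform u w z\<bar> <= ?E * (K'\<^sup>2 * (norm w)\<^sup>2 * ?n ^ 4) + ?E * (K' * (norm w)\<^sup>2 * ?n\<^sup>2)"
    using 1 2 mult_left_mono[OF sq E0] by linarith
   also have "... <= ?E * (K'\<^sup>2 * (norm w)\<^sup>2 * (1 + ?n) ^ 4) + ?E * (K' * (norm w)\<^sup>2 * (1 + ?n) ^ 4)"
    using n E0 K' by (intro add_mono mult_left_mono) auto
   finally have 3: "\<bar>k0 ?x - k0 ?y - k1 ?y * dcform u w z\<bar> <= ..." .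
   have zz: "\<bar>z $ i * z $ j\<bar> <= (1 + ?n) * (1 + ?n)"
    using component_le_norm_cart[of z i] component_le_norm_cart[of z j] by (intro abs_mult_le) linarith+
   have "\<bar>(k0 ?x - k0 ?y - k1 ?y * dcform u w z) * (z $ i * z $ j)\<bar> \<le>
    (?E * (K'\<^sup>2 * (norm w)\<^sup>2 * (1 + ?n) ^ 4) + ?E * (K' * (norm w)\<^sup>2 * (1 + ?n) ^ 4)) * ((1 + ?n) * (1 + ?n))"
    by (rule abs_mult_le[OF 3 zz])
   also have "... = ?E * (K'\<^sup>2 + K') * (norm w)\<^sup>2 * ((1 + ?n) ^ 4 * ((1 + ?n) * (1 + ?n)))"
    by (rule factor)
   also have "(1 + ?n) ^ 4 * ((1 + ?n) * (1 + ?n)) = (1 + ?n) ^ 6" by (simp add: power_numeral_reduce)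
   finally have "\<bar>(k0 ?x - k0 ?y - k1 ?y * dcform u w z) * (z $ i * z $ j)\<bar> <= ?E * (K'\<^sup>2 + K') * (norm w)\<^sup>2 * (1 + ?n) ^ 6" .
   moreover have "?E * (K'\<^sup>2 + K') * (norm w)\<^sup>2 * (1 + ?n) ^ 6 = A * (K'\<^sup>2 + K') * (norm w)\<^sup>2 * ((1 + ?n) ^ 6 * exp (- (a * c) * ?n\<^sup>2))"
    by (simp add: mult_ac)
   ultimately show ?thesis by (simp only: left_diff_distrib)
  qed
  have eq: "W i j (u + w) - W i j u - dW i j u w = (LINT z|lborel. k0 (cform (u + w) z) * (z $ i * z $ j) - k0 (cform u z) * (z $ i * z $ j) - k1 (cform u z) * dcform u w z * (z $ i * z $ j))"
   by (simp only: W_def dW_def Bochner_Integration.integral_diff[OF k0_integrable[OF uw(2)] k0_integrable[OF u]]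
     Bochner_Integration.integral_diff[OF Bochner_Integration.integrable_diff[OF k0_integrable[OF uw(2)] k0_integrable[OF u]] k1_dcform_integrable[OF u]])
  have "\<bar>W i j (u + w) - W i j u - dW i j u w\<bar> <= (LINT z|lborel. \<bar>k0 (cform (u + w) z) * (z $ i * z $ j) - k0 (cform u z) * (z $ i * z $ j) - k1 (cform u z) * dcform u w z * (z $ i * z $ j)\<bar>)"
   unfolding eq by (rule integral_abs_bound)
  also have "... <= (LINT z|lborel. A * (K'\<^sup>2 + K') * (norm w)\<^sup>2 * ((1 + norm (z::real^'n)) ^ 6 * exp (- (a * c) * (norm z)\<^sup>2)))"
  proof (rule integral_mono_AE)
   show "AE z in lborel. \<bar>k0 (cform (u + w) z) * (z $ i * z $ j) - k0 (cform u z) * (z $ i * z $ j) - k1 (cform u z) * dcform u w z * (z $ i * z $ j)\<bar>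
    <= A * (K'\<^sup>2 + K') * (norm w)\<^sup>2 * ((1 + norm z) ^ 6 * exp (- (a * c) * (norm z)\<^sup>2))"
    using AE_lborel_singleton[of 0] by eventually_elim (rule pt)
  qed (intro integrable_abs Bochner_Integration.integrable_diff integrable_mult_right
    k0_integrable[OF u] k0_integrable[OF uw(2)] k1_dcform_integrable[OF u] Jint)+
  also have "... = A * (K'\<^sup>2 + K') * J * (norm w)\<^sup>2"
   unfolding J_def integral_mult_right_zero by (simp only: mult_ac)
  finally show "norm (W i j (u + w) - W i j u - dW i j u w) <= A * (K'\<^sup>2 + K') * J * (norm w)\<^sup>2" by simp
 qed (rule L)
qed

end

section \<open>The bias in a chart\<close>

lemma linear_axis_expansion:
 fixes f :: "real^'n => 'b::real_vector"
 assumes "linear f"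
 shows "f w = (\<Sum>i\<in>UNIV. (w $ i) *\<^sub>R f (axis i 1))"
proof -
 have "w = (\<Sum>i\<in>UNIV. (w $ i) *\<^sub>R axis i 1)"
  by (simp add: vec_eq_iff axis_def if_distrib cong: if_cong)
 then have "f w = f (\<Sum>i\<in>UNIV. (w $ i) *\<^sub>R axis i 1)" by simp
 also have "... = (\<Sum>i\<in>UNIV. (w $ i) *\<^sub>R f (axis i 1))"
  by (simp add: linear_sum[OF assms] linear_scale[OF assms])
 finally show ?thesis .
qed

lemma dir_deriv_axis:
 fixes f :: "real^'n => real"
 assumes "open U" "Cinf_on f U" "u \<in> U"
 shows "dir_deriv 1 f z u = (\<Sum>j\<in>UNIV. coord_deriv j f u * z $ j)"
  and "dir_deriv 2 f z u = (\<Sum>i\<in>UNIV. \<Sum>j\<in>UNIV. coord_deriv i (coord_deriv j f) u * (z $ i * z $ j))"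
proof -
 show 1: "dir_deriv 1 f z u = (\<Sum>j\<in>UNIV. coord_deriv j f u * z $ j)"
  unfolding dir_deriv_1 frechet_derivative_axis[OF assms(2,3)] by (simp add: mult.commute)
 have "dir_deriv 2 f z u = dir_deriv 1 (%x. frechet_derivative f (at x) z) z u"
  by (simp add: numeral_2_eq_2)
 also have "... = dir_deriv 1 (%x. \<Sum>j\<in>UNIV. (z $ j) *\<^sub>R coord_deriv j f x) z u"
  by (intro dir_deriv_cong[OF assms(1) _ _ assms(3)] frechet_derivative_axis[OF assms(2)] Cinf_on_derivative assms(2))
 also have "... = (\<Sum>j\<in>UNIV. (z $ j) *\<^sub>R dir_deriv 1 (coord_deriv j f) z u)"
  by (intro dir_deriv_lincomb[OF assms(1) _ assms(3)] Cinf_on_coord_deriv assms(2))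
 also have "... = (\<Sum>j\<in>UNIV. \<Sum>i\<in>UNIV. coord_deriv i (coord_deriv j f) u * (z $ i * z $ j))"
  unfolding dir_deriv_1 frechet_derivative_axis[OF Cinf_on_coord_deriv[OF assms(2)] assms(3)]
  by (simp add: sum_distrib_left mult_ac)
 also have "... = (\<Sum>i\<in>UNIV. \<Sum>j\<in>UNIV. coord_deriv i (coord_deriv j f) u * (z $ i * z $ j))"
  by (rule sum.swap)
 finally show "dir_deriv 2 f z u = ..." .
qed

text \<open>Taylor constants hold near the origin, whereas the leading parts are integrated over the
  whole space; homogeneity carries the bound from the one to the other.\<close>

lemma homogeneous_bound:
 fixes f :: "'b::real_normed_vector => real"
 assumes "R > 0" "!!t w. t > 0 ==> f (t *\<^sub>R w) = t ^ k * f w" "!!w. norm w <= R ==> \<bar>f w\<bar> <= C * norm w ^ k"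
 shows "\<bar>f w\<bar> <= C * norm w ^ k"
proof -
 define t where "t = R / (norm w + 1)"
 have t: "t > 0" using assms(1) by (simp add: t_def add_nonneg_pos)
 have "norm (t *\<^sub>R w) <= R"
 proof -
  have "norm w / (norm w + 1) <= 1" by (simp add: divide_le_eq_1 add_nonneg_pos)
  then have "R * (norm w / (norm w + 1)) <= R * 1" using assms(1) by (intro mult_left_mono) auto
  then show ?thesis using t assms(1) by (simp add: t_def)
 qed
 from assms(3)[OF this] have "t ^ k * \<bar>f w\<bar> <= t ^ k * (C * norm w ^ k)"
  unfolding assms(2)[OF t] using t by (simp add: abs_mult power_mult_distrib mult_ac)
 then show ?thesis using t by (simp add: mult_le_cancel_left_pos)
qed

lemma measurable_cutoff:
 fixes f :: "'b::euclidean_space => real"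
 assumes "continuous_on (ball 0 R) f"
 shows "(%w. if norm w < R then f w else 0) \<in> borel_measurable borel"
proof -
 have "(%w. indicator (ball 0 R) w *\<^sub>R f w) \<in> borel_measurable borel"
  by (rule borel_measurable_continuous_on_indicator[OF _ assms]) simp
 moreover have "(%w. indicator (ball 0 R) w *\<^sub>R f w) = (%w. if norm w < R then f w else 0)"
  by (auto simp: fun_eq_iff indicator_def)
 ultimately show ?thesis by simp
qed

lemma half_abs_le:
 fixes x y z b :: real
 assumes "2 * x = y + z" "\<bar>y\<bar> + \<bar>z\<bar> <= 2 * b"
 shows "\<bar>x\<bar> <= b"
proof -
 have "2 * \<bar>x\<bar> = \<bar>y + z\<bar>" using assms(1) by (simp flip: assms(1) add: abs_mult)
 then show ?thesis using assms(2) abs_triangle_ineq[of y z] by linarith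
qed

lemma product_approx:
 fixes a b e f :: real
 assumes "\<bar>a - e\<bar> <= \<delta>" "\<bar>b - f\<bar> <= \<gamma>" "\<bar>e\<bar> <= m" "\<bar>f\<bar> <= n"
 shows "\<bar>a * b - e * f\<bar> <= \<delta> * (n + \<gamma>) + m * \<gamma>"
proof -
 have "\<bar>b\<bar> <= n + \<gamma>" using assms(2,4) by linarith
 then have "\<bar>(a - e) * b\<bar> <= \<delta> * (n + \<gamma>)" "\<bar>e * (b - f)\<bar> <= m * \<gamma>"
  using assms by (auto intro: abs_mult_le)
 moreover have "a * b - e * f = (a - e) * b + e * (b - f)" by (simp add: algebra_simps)
 ultimately show ?thesis by linarith
qed

text \<open>
 Even and odd parts of products: with \<open>E x = x\<^sub>+ + x\<^sub>-\<close> and \<open>O x = x\<^sub>+ - x\<^sub>-\<close> one has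
 \<open>2 E (x y) = E x E y + O x O y\<close> and \<open>2 O (x y) = E x O y + O x E y\<close>.
\<close>

lemma sym_square:
 fixes p q L Q :: "'a::real_inner"
 assumes n: "0 <= n" "n <= 1" and K: "1 <= K"
  and 1: "norm (p - q - 2 *\<^sub>R L) <= K * n ^ 3" and 2: "norm (p + q - Q) <= K * n ^ 4"
  and 3: "norm L <= K * n" and 4: "norm Q <= K * n\<^sup>2"
 shows "\<bar>(norm p)\<^sup>2 + (norm q)\<^sup>2 - 2 * (norm L)\<^sup>2\<bar> <= 5 * K\<^sup>2 * n ^ 4"
  and "\<bar>(norm p)\<^sup>2 - (norm q)\<^sup>2 - 2 * (L \<bullet> Q)\<bar> <= 4 * K\<^sup>2 * n ^ 5"
proof -
 have n3: "K * n ^ 3 <= K * n" "K * n ^ 4 <= K * n\<^sup>2"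
  using power_decreasing[of 1 3 n] power_decreasing[of 2 4 n] n K by (auto intro: mult_left_mono)
 have pq: "norm (p - q) <= 3 * (K * n)"
 proof -
  have "norm (p - q) <= norm (p - q - 2 *\<^sub>R L) + norm (2 *\<^sub>R L)" by norm
  then show ?thesis using 1 3 n3 by simp
 qed
 have pq': "norm (p - q + 2 *\<^sub>R L) <= 5 * (K * n)"
 proof -
  have "norm (p - q + 2 *\<^sub>R L) <= norm (p - q) + norm (2 *\<^sub>R L)" by norm
  then show ?thesis using pq 3 by simp
 qed
 have pp: "norm (p + q) <= 2 * (K * n\<^sup>2)"
 proof -
  have "norm (p + q) <= norm (p + q - Q) + norm Q" by norm
  then show ?thesis using 2 4 n3 by simp
 qed
 have a: "(norm (p + q))\<^sup>2 <= 4 * (K\<^sup>2 * n ^ 4)"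
  using power_mono[OF pp, of 2] by (simp add: power_mult_distrib flip: power_mult)
 have b: "\<bar>(norm (p - q))\<^sup>2 - 4 * (norm L)\<^sup>2\<bar> <= 5 * (K\<^sup>2 * n ^ 4)"
 proof -
  have eq: "(norm (p - q))\<^sup>2 - 4 * (norm L)\<^sup>2 = (p - q - 2 *\<^sub>R L) \<bullet> (p - q + 2 *\<^sub>R L)"
   by (simp add: power2_norm_eq_inner inner_diff_left inner_diff_right inner_add_left inner_add_right inner_commute)
  have "\<bar>(norm (p - q))\<^sup>2 - 4 * (norm L)\<^sup>2\<bar> <= norm (p - q - 2 *\<^sub>R L) * norm (p - q + 2 *\<^sub>R L)"
   unfolding eq by (rule Cauchy_Schwarz_ineq2)
  also have "... <= (K * n ^ 3) * (5 * (K * n))" using 1 pq' n K by (intro mult_mono) auto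
  also have "... = 5 * (K\<^sup>2 * n ^ 4)" by (simp add: power2_eq_square power_numeral_reduce)
  finally show ?thesis .
 qed
 have pn: "0 <= K\<^sup>2 * n ^ 4" using n by simp
 have "2 * ((norm p)\<^sup>2 + (norm q)\<^sup>2 - 2 * (norm L)\<^sup>2) = (norm (p + q))\<^sup>2 + ((norm (p - q))\<^sup>2 - 4 * (norm L)\<^sup>2)"
  by (simp add: power2_norm_eq_inner inner_diff_left inner_diff_right inner_add_left inner_add_right inner_commute)
 then show "\<bar>(norm p)\<^sup>2 + (norm q)\<^sup>2 - 2 * (norm L)\<^sup>2\<bar> <= 5 * K\<^sup>2 * n ^ 4"
 proof (rule half_abs_le)
  have "\<bar>(norm (p + q))\<^sup>2\<bar> = (norm (p + q))\<^sup>2" by simp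
  then show "\<bar>(norm (p + q))\<^sup>2\<bar> + \<bar>(norm (p - q))\<^sup>2 - 4 * (norm L)\<^sup>2\<bar> <= 2 * (5 * K\<^sup>2 * n ^ 4)"
   using a b pn unfolding mult.assoc by linarith
 qed
 have c: "\<bar>(p + q - Q) \<bullet> (p - q)\<bar> <= 3 * (K\<^sup>2 * n ^ 5)"
 proof -
  have "\<bar>(p + q - Q) \<bullet> (p - q)\<bar> <= norm (p + q - Q) * norm (p - q)" by (rule Cauchy_Schwarz_ineq2)
  also have "... <= (K * n ^ 4) * (3 * (K * n))" using 2 pq n K by (intro mult_mono) auto
  also have "... = 3 * (K\<^sup>2 * n ^ 5)" by (simp add: power2_eq_square power_numeral_reduce)
  finally show ?thesis .
 qed
 have e: "\<bar>Q \<bullet> (p - q - 2 *\<^sub>R L)\<bar> <= K\<^sup>2 * n ^ 5"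
 proof -
  have "\<bar>Q \<bullet> (p - q - 2 *\<^sub>R L)\<bar> <= norm Q * norm (p - q - 2 *\<^sub>R L)" by (rule Cauchy_Schwarz_ineq2)
  also have "... <= (K * n\<^sup>2) * (K * n ^ 3)" using 4 1 n K by (intro mult_mono) auto
  also have "... = K\<^sup>2 * n ^ 5" by (simp add: power2_eq_square power_numeral_reduce)
  finally show ?thesis .
 qed
 have "(norm p)\<^sup>2 - (norm q)\<^sup>2 - 2 * (L \<bullet> Q) = (p + q - Q) \<bullet> (p - q) + Q \<bullet> (p - q - 2 *\<^sub>R L)"
  by (simp add: power2_norm_eq_inner inner_diff_left inner_diff_right inner_add_left inner_add_right inner_commute)
 then show "\<bar>(norm p)\<^sup>2 - (norm q)\<^sup>2 - 2 * (L \<bullet> Q)\<bar> <= 4 * K\<^sup>2 * n ^ 5"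
  using c e unfolding mult.assoc by linarith
qed

text \<open>Read \<open>Np\<close>, \<open>Nm\<close> as the squared chords to the two mirror points
  with leading parts \<open>l2\<close> and \<open>lq\<close>, and \<open>Ip\<close>,
  \<open>Im\<close> as \<open>inv_rho\<close> at these points with value \<open>I0\<close> and
  directional derivative \<open>dI\<close> at the centre. The products are then the kernel arguments
  before division by the squared bandwidth scale.\<close>

lemma sym_distance:
 fixes Np Nm Ip Im l2 lq I0 dI :: real
 assumes n: "0 <= n" "n <= 1" and K: "1 <= K"
  and N: "\<bar>Np + Nm - 2 * l2\<bar> <= 5 * K\<^sup>2 * n ^ 4" "\<bar>Np - Nm - 2 * lq\<bar> <= 4 * K\<^sup>2 * n ^ 5"
  and l: "\<bar>l2\<bar> <= K\<^sup>2 * n\<^sup>2" "\<bar>lq\<bar> <= K\<^sup>2 * n ^ 3"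
  and I: "\<bar>I0\<bar> <= K" "\<bar>Ip + Im - 2 * I0\<bar> <= K * n\<^sup>2" "\<bar>Ip - Im - 2 * dI\<bar> <= K * n ^ 3" "\<bar>dI\<bar> <= K * n"
 shows "\<bar>Np * I0 * Ip + Nm * I0 * Im - 2 * (I0\<^sup>2 * l2)\<bar> <= 18 * K ^ 4 * n ^ 4"
  and "\<bar>Np * I0 * Ip - Nm * I0 * Im - (2 * I0 * dI * l2 + 2 * I0\<^sup>2 * lq)\<bar> <= 18 * K ^ 4 * n ^ 5"
proof -
 have pw: "n ^ j <= n ^ i" if "i <= j" for i j using power_decreasing[OF that n] .
 have K3: "K\<^sup>2 * K = K ^ 3" "K * K\<^sup>2 = K ^ 3" by (simp_all add: power2_eq_square power3_eq_cube)
 have K0: "0 <= K ^ j" for j using K by simp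
 have EE: "\<bar>(Np + Nm) * (Ip + Im) - (2 * l2) * (2 * I0)\<bar> <= 17 * (K ^ 3 * n ^ 4)"
 proof -
  have "\<bar>(Np + Nm) * (Ip + Im) - (2 * l2) * (2 * I0)\<bar> <= 5 * K\<^sup>2 * n ^ 4 * (2 * K + K * n\<^sup>2) + 2 * (K\<^sup>2 * n\<^sup>2) * (K * n\<^sup>2)"
   using N I l by (intro product_approx) auto
  also have "... = 12 * (K ^ 3 * n ^ 4) + 5 * (K ^ 3 * n ^ 6)"
   by (simp add: K3[symmetric] power_numeral_reduce algebra_simps)
  also have "... <= 12 * (K ^ 3 * n ^ 4) + 5 * (K ^ 3 * n ^ 4)"
   using K K0 pw[of 4 6] by (intro add_mono mult_left_mono) auto
  finally show ?thesis by simp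
 qed
 have OO: "\<bar>(Np - Nm) * (Ip - Im)\<bar> <= 18 * (K ^ 3 * n ^ 4)"
 proof -
  have "K\<^sup>2 * n ^ 5 <= K\<^sup>2 * n ^ 3" "K * n ^ 3 <= K * n"
   using K K0 pw[of 3 5] pw[of 1 3] by (auto intro: mult_left_mono)
  then have "\<bar>Np - Nm\<bar> <= 6 * (K\<^sup>2 * n ^ 3)" "\<bar>Ip - Im\<bar> <= 3 * (K * n)"
   using N(2) l(2) I(3,4) unfolding mult.assoc by linarith+
  then have "\<bar>(Np - Nm) * (Ip - Im)\<bar> <= 6 * (K\<^sup>2 * n ^ 3) * (3 * (K * n))" by (rule abs_mult_le)
  also have "... = 18 * (K ^ 3 * n ^ 4)" by (simp add: power_numeral_reduce)
  finally show ?thesis .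
 qed
 have K4: "K * (K ^ 3 * x) = K ^ 4 * x" for x by (simp add: power_numeral_reduce)
 have "2 * (Np * I0 * Ip + Nm * I0 * Im - 2 * (I0\<^sup>2 * l2)) =
  I0 * ((Np + Nm) * (Ip + Im) - (2 * l2) * (2 * I0)) + I0 * ((Np - Nm) * (Ip - Im))"
  by (simp add: power2_eq_square algebra_simps)
 then show "\<bar>Np * I0 * Ip + Nm * I0 * Im - 2 * (I0\<^sup>2 * l2)\<bar> <= 18 * K ^ 4 * n ^ 4"
 proof (rule half_abs_le)
  have "0 <= K ^ 4 * n ^ 4" using n K0 by simp
  then show "\<bar>I0 * ((Np + Nm) * (Ip + Im) - (2 * l2) * (2 * I0))\<bar> + \<bar>I0 * ((Np - Nm) * (Ip - Im))\<bar> <= 2 * (18 * K ^ 4 * n ^ 4)"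
   using abs_mult_le[OF I(1) EE] abs_mult_le[OF I(1) OO] K4[of "n ^ 4"] unfolding mult.assoc by linarith
 qed
 have EO: "\<bar>(Np + Nm) * (Ip - Im) - (2 * l2) * (2 * dI)\<bar> <= 17 * (K ^ 3 * n ^ 5)"
 proof -
  have "\<bar>(Np + Nm) * (Ip - Im) - (2 * l2) * (2 * dI)\<bar> <= 5 * K\<^sup>2 * n ^ 4 * (2 * (K * n) + K * n ^ 3) + 2 * (K\<^sup>2 * n\<^sup>2) * (K * n ^ 3)"
   using N I l by (intro product_approx) auto
  also have "... = 12 * (K ^ 3 * n ^ 5) + 5 * (K ^ 3 * n ^ 7)"
   by (simp add: K3[symmetric] power_numeral_reduce algebra_simps)
  also have "... <= 12 * (K ^ 3 * n ^ 5) + 5 * (K ^ 3 * n ^ 5)"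
   using K K0 pw[of 5 7] by (intro add_mono mult_left_mono) auto
  finally show ?thesis by simp
 qed
 have OE: "\<bar>(Np - Nm) * (Ip + Im) - (2 * lq) * (2 * I0)\<bar> <= 14 * (K ^ 3 * n ^ 5)"
 proof -
  have "\<bar>(Np - Nm) * (Ip + Im) - (2 * lq) * (2 * I0)\<bar> <= 4 * K\<^sup>2 * n ^ 5 * (2 * K + K * n\<^sup>2) + 2 * (K\<^sup>2 * n ^ 3) * (K * n\<^sup>2)"
   using N I l by (intro product_approx) auto
  also have "... = 10 * (K ^ 3 * n ^ 5) + 4 * (K ^ 3 * n ^ 7)"
   by (simp add: K3[symmetric] power_numeral_reduce algebra_simps)
  also have "... <= 10 * (K ^ 3 * n ^ 5) + 4 * (K ^ 3 * n ^ 5)"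
   using K K0 pw[of 5 7] by (intro add_mono mult_left_mono) auto
  finally show ?thesis by simp
 qed
 have "2 * (Np * I0 * Ip - Nm * I0 * Im - (2 * I0 * dI * l2 + 2 * I0\<^sup>2 * lq)) =
  I0 * ((Np + Nm) * (Ip - Im) - (2 * l2) * (2 * dI)) + I0 * ((Np - Nm) * (Ip + Im) - (2 * lq) * (2 * I0))"
  by (simp add: power2_eq_square algebra_simps)
 then show "\<bar>Np * I0 * Ip - Nm * I0 * Im - (2 * I0 * dI * l2 + 2 * I0\<^sup>2 * lq)\<bar> <= 18 * K ^ 4 * n ^ 5"
 proof (rule half_abs_le)
  have "0 <= K ^ 4 * n ^ 5" using n K0 by simp
  then show "\<bar>I0 * ((Np + Nm) * (Ip - Im) - (2 * l2) * (2 * dI))\<bar> + \<bar>I0 * ((Np - Nm) * (Ip + Im) - (2 * lq) * (2 * I0))\<bar> <= 2 * (18 * K ^ 4 * n ^ 5)"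
   using abs_mult_le[OF I(1) EO] abs_mult_le[OF I(1) OE] K4[of "n ^ 5"] unfolding mult.assoc by linarith
 qed
qed

text \<open>Read \<open>hp\<close>, \<open>hm\<close> as the increments of the function and
  \<open>Dp\<close>, \<open>Dm\<close> as the weights at the mirror points. An increment has no
  constant term, so its even part is quadratic; the product \<open>l * dD\<close> of two odd parts
  enters at the same order.\<close>

lemma sym_weighted_increment:
 fixes hp hm Dp Dm l q D0 dD :: real
 assumes n: "0 <= n" "n <= 1" and K: "1 <= K"
  and h: "\<bar>hp + hm - q\<bar> <= K * n ^ 4" "\<bar>hp - hm - 2 * l\<bar> <= K * n ^ 3" "\<bar>q\<bar> <= K * n\<^sup>2" "\<bar>l\<bar> <= K * n"
  and D: "\<bar>D0\<bar> <= K" "\<bar>Dp + Dm - 2 * D0\<bar> <= K * n\<^sup>2" "\<bar>Dp - Dm - 2 * dD\<bar> <= K * n ^ 3" "\<bar>dD\<bar> <= K * n"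
 shows "\<bar>hp * Dp + hm * Dm - 2 * (D0 * q / 2 + l * dD)\<bar> <= 9 * K\<^sup>2 * n ^ 4"
  and "n * \<bar>hp * Dp - hm * Dm - 2 * (l * D0)\<bar> <= 11 * K\<^sup>2 * n ^ 4"
proof -
 have pw: "n ^ j <= n ^ i" if "i <= j" for i j using power_decreasing[OF that n] .
 have EE: "\<bar>(hp + hm) * (Dp + Dm) - q * (2 * D0)\<bar> <= 4 * (K\<^sup>2 * n ^ 4)"
 proof -
  have "\<bar>(hp + hm) * (Dp + Dm) - q * (2 * D0)\<bar> <= K * n ^ 4 * (2 * K + K * n\<^sup>2) + K * n\<^sup>2 * (K * n\<^sup>2)"
   using h D by (intro product_approx) auto
  also have "... = 3 * (K\<^sup>2 * n ^ 4) + K\<^sup>2 * n ^ 6"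
   by (simp add: power_numeral_reduce algebra_simps)
  also have "... <= 3 * (K\<^sup>2 * n ^ 4) + K\<^sup>2 * n ^ 4"
   using pw[of 4 6] by (intro add_mono mult_left_mono) auto
  finally show ?thesis by simp
 qed
 have OO: "\<bar>(hp - hm) * (Dp - Dm) - (2 * l) * (2 * dD)\<bar> <= 5 * (K\<^sup>2 * n ^ 4)"
 proof -
  have "\<bar>(hp - hm) * (Dp - Dm) - (2 * l) * (2 * dD)\<bar> <= K * n ^ 3 * (2 * (K * n) + K * n ^ 3) + 2 * (K * n) * (K * n ^ 3)"
   using h D by (intro product_approx) auto
  also have "... = 4 * (K\<^sup>2 * n ^ 4) + K\<^sup>2 * n ^ 6"
   by (simp add: power_numeral_reduce algebra_simps)
  also have "... <= 4 * (K\<^sup>2 * n ^ 4) + K\<^sup>2 * n ^ 4"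
   using pw[of 4 6] by (intro add_mono mult_left_mono) auto
  finally show ?thesis by simp
 qed
 have "2 * (hp * Dp + hm * Dm - 2 * (D0 * q / 2 + l * dD)) =
  ((hp + hm) * (Dp + Dm) - q * (2 * D0)) + ((hp - hm) * (Dp - Dm) - (2 * l) * (2 * dD))"
  by (simp add: algebra_simps)
 then show "\<bar>hp * Dp + hm * Dm - 2 * (D0 * q / 2 + l * dD)\<bar> <= 9 * K\<^sup>2 * n ^ 4"
 proof (rule half_abs_le)
  have "0 <= K\<^sup>2 * n ^ 4" using n by simp
  then show "\<bar>(hp + hm) * (Dp + Dm) - q * (2 * D0)\<bar> + \<bar>(hp - hm) * (Dp - Dm) - (2 * l) * (2 * dD)\<bar> <= 2 * (9 * K\<^sup>2 * n ^ 4)"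
   using EE OO unfolding mult.assoc by linarith
 qed
 have EO: "\<bar>(hp + hm) * (Dp - Dm)\<bar> <= 6 * (K\<^sup>2 * n ^ 3)"
 proof -
  have "K * n ^ 4 <= K * n\<^sup>2" "K * n ^ 3 <= K * n"
   using K pw[of 2 4] pw[of 1 3] by (auto intro: mult_left_mono)
  then have "\<bar>hp + hm\<bar> <= 2 * (K * n\<^sup>2)" "\<bar>Dp - Dm\<bar> <= 3 * (K * n)"
   using h(1,3) D(3,4) by linarith+
  then have "\<bar>(hp + hm) * (Dp - Dm)\<bar> <= 2 * (K * n\<^sup>2) * (3 * (K * n))" by (rule abs_mult_le)
  also have "... = 6 * (K\<^sup>2 * n ^ 3)" by (simp add: power_numeral_reduce)
  finally show ?thesis .
 qed
 have OE: "\<bar>(hp - hm) * (Dp + Dm) - (2 * l) * (2 * D0)\<bar> <= 5 * (K\<^sup>2 * n ^ 3)"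
 proof -
  have "\<bar>(hp - hm) * (Dp + Dm) - (2 * l) * (2 * D0)\<bar> <= K * n ^ 3 * (2 * K + K * n\<^sup>2) + 2 * (K * n) * (K * n\<^sup>2)"
   using h D by (intro product_approx) auto
  also have "... = 4 * (K\<^sup>2 * n ^ 3) + K\<^sup>2 * n ^ 5"
   by (simp add: power_numeral_reduce algebra_simps)
  also have "... <= 4 * (K\<^sup>2 * n ^ 3) + K\<^sup>2 * n ^ 3"
   using pw[of 3 5] by (intro add_mono mult_left_mono) auto
  finally show ?thesis by simp
 qed
 have "2 * (hp * Dp - hm * Dm - 2 * (l * D0)) = (hp + hm) * (Dp - Dm) + ((hp - hm) * (Dp + Dm) - (2 * l) * (2 * D0))"
  by (simp add: algebra_simps)
 then have "\<bar>hp * Dp - hm * Dm - 2 * (l * D0)\<bar> <= 11 * (K\<^sup>2 * n ^ 3)"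
 proof (rule half_abs_le)
  have "0 <= K\<^sup>2 * n ^ 3" using n by simp
  then show "\<bar>(hp + hm) * (Dp - Dm)\<bar> + \<bar>(hp - hm) * (Dp + Dm) - (2 * l) * (2 * D0)\<bar> <= 2 * (11 * (K\<^sup>2 * n ^ 3))"
   using EO OE by linarith
 qed
 from mult_left_mono[OF this n(1)]
 show "n * \<bar>hp * Dp - hm * Dm - 2 * (l * D0)\<bar> <= 11 * K\<^sup>2 * n ^ 4"
  by (simp add: power_numeral_reduce mult_ac)
qed

context weighted_chart
begin

text \<open>Together with \<open>num1\<close> the leading parts, of degrees two and one, of the
  amplitude \<open>(h (u + z) - h u) * weight (u + z)\<close>.\<close>

definition num2 :: "real^'n => real^'n => real" where
 "num2 u z = weight u * dir_deriv 2 h z u / 2 + dir_deriv 1 h z u * dir_deriv 1 weight z u"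
definition num1 :: "real^'n => real^'n => real" where
 "num1 u z = dir_deriv 1 h z u * weight u"
definition J0 :: "real^'n => real" where
 "J0 u = (LINT z|lborel. k0 (cform u z) * num2 u z + k1 (cform u z) * dcform u z z * num1 u z / 2)"
definition kappa :: real where "kappa = 1 + 2 * (\<alpha> - 1) / real CARD('n)"
definition limit_chart :: "real^'n => real" where
 "limit_chart u = coord_laplacian \<phi> h u + kappa * ((coord_gradient \<phi> P u /\<^sub>R P u) \<bullet> coord_gradient \<phi> h u)"

lemma linear_dcform: "u \<in> U ==> linear (%x. dcform u x z)"
 by (rule linearI) (simp_all add: dcform_linear)

text \<open>Expanding the direction of \<open>dcform\<close> along the axes turns the fourth moments
  of \<open>k1\<close> into derivatives of the second moments \<open>W\<close>, so they never have
  to be evaluated.\<close>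

lemma J0_sum:
 assumes u: "u \<in> U"
 shows "J0 u = (\<Sum>i\<in>UNIV. \<Sum>j\<in>UNIV. (weight u * coord_deriv i (coord_deriv j h) u / 2 + coord_deriv i h u * coord_deriv j weight u) * W i j u)
  + (\<Sum>k\<in>UNIV. \<Sum>l\<in>UNIV. (weight u * coord_deriv l h u / 2) * dW k l u (axis k 1))"
proof -
 let ?c = "%i j. weight u * coord_deriv i (coord_deriv j h) u / 2 + coord_deriv i h u * coord_deriv j weight u"
 let ?e = "%l. weight u * coord_deriv l h u / 2"
 have n2: "num2 u z = (\<Sum>i\<in>UNIV. \<Sum>j\<in>UNIV. ?c i j * (z $ i * z $ j))" for z
  unfolding num2_def dir_deriv_axis[OF openU h u] dir_deriv_axis(1)[OF openU Cinf_weight u] sum_product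
  unfolding sum_distrib_left sum_divide_distrib sum.distrib[symmetric]
  by (intro sum.cong refl) (simp add: algebra_simps)
 have n1: "dcform u z z * num1 u z / 2 = (\<Sum>k\<in>UNIV. \<Sum>l\<in>UNIV. ?e l * (dcform u (axis k 1) z * (z $ k * z $ l)))" for z
 proof -
  have "dcform u z z = (\<Sum>k\<in>UNIV. z $ k * dcform u (axis k 1) z)"
   using linear_axis_expansion[OF linear_dcform[OF u, of z], of z] by simp
  then have "dcform u z z * num1 u z / 2 = (\<Sum>k\<in>UNIV. z $ k * dcform u (axis k 1) z) * (\<Sum>l\<in>UNIV. coord_deriv l h u * z $ l) * (weight u / 2)"
   unfolding num1_def dir_deriv_axis(1)[OF openU h u] by simp
  also have "... = (\<Sum>k\<in>UNIV. \<Sum>l\<in>UNIV. ?e l * (dcform u (axis k 1) z * (z $ k * z $ l)))"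
   unfolding sum_product unfolding sum_distrib_right by (intro sum.cong refl) simp
  finally show ?thesis .
 qed
 have "J0 u = (LINT z|lborel. (\<Sum>i\<in>UNIV. \<Sum>j\<in>UNIV. ?c i j * (k0 (cform u z) * (z $ i * z $ j)))
  + (\<Sum>k\<in>UNIV. \<Sum>l\<in>UNIV. ?e l * (k1 (cform u z) * dcform u (axis k 1) z * (z $ k * z $ l))))"
  unfolding J0_def
 proof (intro Bochner_Integration.integral_cong refl)
  fix z
  have "k0 (cform u z) * num2 u z = (\<Sum>i\<in>UNIV. \<Sum>j\<in>UNIV. ?c i j * (k0 (cform u z) * (z $ i * z $ j)))"
   unfolding n2 sum_distrib_left by (intro sum.cong refl) (simp only: mult_ac)
  moreover have "k1 (cform u z) * dcform u z z * num1 u z / 2 = k1 (cform u z) * (dcform u z z * num1 u z / 2)" by simp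
  moreover have "k1 (cform u z) * (dcform u z z * num1 u z / 2) = (\<Sum>k\<in>UNIV. \<Sum>l\<in>UNIV. ?e l * (k1 (cform u z) * dcform u (axis k 1) z * (z $ k * z $ l)))"
   unfolding n1 sum_distrib_left by (intro sum.cong refl) (simp only: mult_ac)
  ultimately show "k0 (cform u z) * num2 u z + k1 (cform u z) * dcform u z z * num1 u z / 2 =
   (\<Sum>i\<in>UNIV. \<Sum>j\<in>UNIV. ?c i j * (k0 (cform u z) * (z $ i * z $ j)))
   + (\<Sum>k\<in>UNIV. \<Sum>l\<in>UNIV. ?e l * (k1 (cform u z) * dcform u (axis k 1) z * (z $ k * z $ l)))" by simp
 qed
 also have "... = (LINT z|lborel. (\<Sum>i\<in>UNIV. \<Sum>j\<in>UNIV. ?c i j * (k0 (cform u z) * (z $ i * z $ j))))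
  + (LINT z|lborel. (\<Sum>k\<in>UNIV. \<Sum>l\<in>UNIV. ?e l * (k1 (cform u z) * dcform u (axis k 1) z * (z $ k * z $ l))))"
  by (intro Bochner_Integration.integral_add Bochner_Integration.integrable_sum integrable_mult_right
    k0_integrable[OF u] k1_dcform_integrable[OF u])
 also have "(LINT z|lborel. (\<Sum>i\<in>UNIV. \<Sum>j\<in>UNIV. ?c i j * (k0 (cform u z) * (z $ i * z $ j)))) = (\<Sum>i\<in>UNIV. \<Sum>j\<in>UNIV. ?c i j * W i j u)"
  by (subst Bochner_Integration.integral_sum, intro Bochner_Integration.integrable_sum integrable_mult_right k0_integrable[OF u],
    intro sum.cong refl, subst Bochner_Integration.integral_sum, intro integrable_mult_right k0_integrable[OF u],
    simp only: integral_mult_right_zero W_def)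
 also have "(LINT z|lborel. (\<Sum>k\<in>UNIV. \<Sum>l\<in>UNIV. ?e l * (k1 (cform u z) * dcform u (axis k 1) z * (z $ k * z $ l)))) = (\<Sum>k\<in>UNIV. \<Sum>l\<in>UNIV. ?e l * dW k l u (axis k 1))"
  by (subst Bochner_Integration.integral_sum, intro Bochner_Integration.integrable_sum integrable_mult_right k1_dcform_integrable[OF u],
    intro sum.cong refl, subst Bochner_Integration.integral_sum, intro integrable_mult_right k1_dcform_integrable[OF u],
    simp only: integral_mult_right_zero dW_def)
 finally show ?thesis .
qed

text \<open>
 The weight is chosen such that \<open>weight\<^sup>2 W\<^sub>i\<^sub>j\<close> is a multiple of \<open>P\<^sup>\<kappa> sg g\<^sup>i\<^sup>j\<close>; hence \<open>J0\<close> is a divergence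
 and no derivative of the determinant has to be computed.
\<close>

lemma flux_eq:
 assumes v: "v \<in> U"
 shows "sg v * inverse_metric \<phi> i j v = (weight v)\<^sup>2 * W i j v * (P v powr (- kappa) / kernel_m2 TYPE('n) k0)"
proof -
 let ?N = "real CARD('n)"
 note p = P_pos[OF v] and s = sqrt_det_metric_pos[OF lp v] and m = kernel_m2_pos[where 'n = 'n]
 have "(P v powr (1 + \<alpha> / ?N))\<^sup>2 * P v powr (- kappa) = P v powr (1 + 2 / ?N)"
  by (simp add: power2_eq_square powr_add[symmetric] kappa_def diff_divide_distrib add_divide_distrib algebra_simps)
 then show ?thesis
  unfolding W_eq(1)[OF v] weight_def using p s m by (simp add: power_mult_distrib power2_eq_square field_simps)
qed

text \<open>By the product rule the divergence of the field \<open>X\<close> is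
  \<open>2 * weight u * J0 u\<close>. By \<open>flux_eq\<close> the flux in the coordinate formula
  of the Laplacian is \<open>X\<close> times \<open>q\<close>, a power of \<open>P\<close>;
  differentiating \<open>q\<close> yields the drift with coefficient \<open>kappa\<close>.\<close>

lemma J0_eq:
 assumes u: "u \<in> U"
 shows "J0 u = kernel_m2 TYPE('n) k0 / 2 * P u powr ((\<alpha> - 2) / real CARD('n)) * limit_chart u"
proof -
 let ?m = "kernel_m2 TYPE('n) k0"
 note p = P_pos[OF u] and s = sqrt_det_metric_pos[OF lp u] and m = kernel_m2_pos[where 'n = 'n]
 define X where "X i v = (\<Sum>j\<in>UNIV. weight v * weight v * W i j v * coord_deriv j h v)" for i v
 define X' where "X' i w = (\<Sum>j\<in>UNIV. weight u * weight u * W i j u * frechet_derivative (coord_deriv j h) (at u) w +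
  (weight u * weight u * dW i j u w + (weight u * frechet_derivative weight (at u) w + frechet_derivative weight (at u) w * weight u) * W i j u) * coord_deriv j h u)" for i w
 define q where "q v = P v powr (- kappa) / ?m" for v
 define q' where "q' w = - kappa * P u powr (- kappa - 1) * frechet_derivative P (at u) w / ?m" for w
 have dX: "(X i has_derivative X' i) (at u)" for i
  unfolding X_def[abs_def] X'_def[abs_def]
  by (intro has_derivative_sum has_derivative_mult W_has_derivative[OF u] Cinf_on_has_derivative[OF Cinf_weight u]
    Cinf_on_has_derivative[OF Cinf_on_coord_deriv[OF h] u])
 have dq: "(q has_derivative q') (at u)"
 proof -
  have "((%y. y powr (- kappa)) has_derivative (*) (- kappa * P u powr (- kappa - 1))) (at (P u))"
   using has_real_derivative_powr[OF p, of "- kappa"] by (simp only: has_field_derivative_def)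
  from has_derivative_compose[OF Cinf_on_has_derivative[OF P u] this]
  have "((%v. P v powr (- kappa)) has_derivative (%w. - kappa * P u powr (- kappa - 1) * frechet_derivative P (at u) w)) (at u)" .
  from bounded_linear.has_derivative[OF bounded_linear_divide this, of ?m] show ?thesis
   unfolding q_def[abs_def] q'_def[abs_def] .
 qed
 have flux: "(%v. \<Sum>j\<in>UNIV. sg v * inverse_metric \<phi> i j v * coord_deriv j h v) v = X i v * q v" if "v \<in> U" for i v
  unfolding flux_eq[OF that] X_def q_def sum_distrib_right power2_eq_square by (intro sum.cong refl) (simp only: mult_ac)
 have der: "coord_deriv i (%v. \<Sum>j\<in>UNIV. sg v * inverse_metric \<phi> i j v * coord_deriv j h v) u = X i u * q' (axis i 1) + X' i (axis i 1) * q u" for i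
 proof -
  have "((%v. X i v * q v) has_derivative (%w. X i u * q' w + X' i w * q u)) (at u)"
   by (rule has_derivative_mult[OF dX dq])
  then have "((%v. \<Sum>j\<in>UNIV. sg v * inverse_metric \<phi> i j v * coord_deriv j h v) has_derivative (%w. X i u * q' w + X' i w * q u)) (at u)"
   by (rule has_derivative_transform_within_open[OF _ openU u]) (simp only: flux)
  from fun_cong[OF frechet_derivative_at[OF this], of "axis i 1"] show ?thesis by (simp only: coord_deriv_def)
 qed
 have Xq: "X i u * q u = sg u * (\<Sum>j\<in>UNIV. inverse_metric \<phi> i j u * coord_deriv j h u)" for i
  using flux[OF u, of i] by (simp add: sum_distrib_left mult.assoc)
 have q': "q' (axis i 1) = q u * (- kappa / P u * coord_deriv i P u)" for i
 proof -
  have "P u powr (- kappa - 1) = P u powr (- kappa) / P u" using p by (simp add: powr_diff)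
  then show ?thesis by (simp add: q'_def q_def coord_deriv_def mult_ac)
 qed
 have grad: "coord_gradient \<phi> P u \<bullet> coord_gradient \<phi> h u = (\<Sum>i\<in>UNIV. (\<Sum>j\<in>UNIV. inverse_metric \<phi> i j u * coord_deriv j h u) * coord_deriv i P u)"
 proof -
  have "coord_gradient \<phi> P u \<bullet> coord_deriv i \<phi> u = coord_deriv i P u" for i
   using coord_gradient_inner[OF lp u P, of "axis i 1"] by (simp only: coord_deriv_def)
  then show ?thesis by (subst (2) coord_gradient_def) (simp add: inner_sum_right)
 qed
 have "sg u * coord_laplacian \<phi> h u = (\<Sum>i\<in>UNIV. X i u * q' (axis i 1) + X' i (axis i 1) * q u)"
  unfolding coord_laplacian_def der using s by simp
 also have "... = (\<Sum>i\<in>UNIV. (X i u * q u) * (- kappa / P u * coord_deriv i P u)) + q u * (\<Sum>i\<in>UNIV. X' i (axis i 1))"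
  unfolding q' sum.distrib sum_distrib_left by (simp add: mult_ac)
 also have "(\<Sum>i\<in>UNIV. (X i u * q u) * (- kappa / P u * coord_deriv i P u)) = - kappa / P u * (sg u * (coord_gradient \<phi> P u \<bullet> coord_gradient \<phi> h u))"
  unfolding Xq grad sum_distrib_left by (intro sum.cong refl) (simp add: sum_distrib_left mult_ac)
 finally have lap: "sg u * limit_chart u = q u * (\<Sum>i\<in>UNIV. X' i (axis i 1))"
  unfolding limit_chart_def using p by (simp add: field_simps)
 have "(\<Sum>i\<in>UNIV. X' i (axis i 1)) = 2 * weight u * J0 u"
 proof -
  let ?w = "weight u" and ?wd = "%i. coord_deriv i weight u" and ?hd = "%j. coord_deriv j h u"
   and ?h2 = "%i j. coord_deriv i (coord_deriv j h) u"
  have "(\<Sum>i\<in>UNIV. X' i (axis i 1)) = (\<Sum>i\<in>UNIV. \<Sum>j\<in>UNIV. 2 * ?w * (?wd i * ?hd j * W i j u) + ?w\<^sup>2 * (?h2 i j * W i j u) + ?w\<^sup>2 * (?hd j * dW i j u (axis i 1)))"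
   unfolding X'_def power2_eq_square by (intro sum.cong refl) (simp add: coord_deriv_def algebra_simps)
  also have "... = 2 * ?w * (\<Sum>i\<in>UNIV. \<Sum>j\<in>UNIV. ?wd i * ?hd j * W i j u) + ?w\<^sup>2 * (\<Sum>i\<in>UNIV. \<Sum>j\<in>UNIV. ?h2 i j * W i j u)
    + ?w\<^sup>2 * (\<Sum>i\<in>UNIV. \<Sum>j\<in>UNIV. ?hd j * dW i j u (axis i 1))"
   by (simp only: sum.distrib sum_distrib_left)
  also have "(\<Sum>i\<in>UNIV. \<Sum>j\<in>UNIV. ?wd i * ?hd j * W i j u) = (\<Sum>i\<in>UNIV. \<Sum>j\<in>UNIV. ?hd i * ?wd j * W i j u)"
  proof (subst sum.swap, intro sum.cong refl)
   fix x y show "?wd y * ?hd x * W y x u = ?hd x * ?wd y * W x y u" using W_sym[of x y u] by simp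
  qed
  finally have L: "(\<Sum>i\<in>UNIV. X' i (axis i 1)) = 2 * ?w * (\<Sum>i\<in>UNIV. \<Sum>j\<in>UNIV. ?hd i * ?wd j * W i j u) + ?w\<^sup>2 * (\<Sum>i\<in>UNIV. \<Sum>j\<in>UNIV. ?h2 i j * W i j u)
    + ?w\<^sup>2 * (\<Sum>i\<in>UNIV. \<Sum>j\<in>UNIV. ?hd j * dW i j u (axis i 1))" .
  have a: "(\<Sum>i\<in>UNIV. \<Sum>j\<in>UNIV. (?w * ?h2 i j / 2 + ?hd i * ?wd j) * W i j u) = ?w / 2 * (\<Sum>i\<in>UNIV. \<Sum>j\<in>UNIV. ?h2 i j * W i j u) + (\<Sum>i\<in>UNIV. \<Sum>j\<in>UNIV. ?hd i * ?wd j * W i j u)"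
   unfolding sum_distrib_left sum.distrib[symmetric] by (intro sum.cong refl) (simp add: algebra_simps)
  have b: "(\<Sum>k\<in>UNIV. \<Sum>l\<in>UNIV. (?w * ?hd l / 2) * dW k l u (axis k 1)) = ?w / 2 * (\<Sum>i\<in>UNIV. \<Sum>j\<in>UNIV. ?hd j * dW i j u (axis i 1))"
   unfolding sum_distrib_left by (intro sum.cong refl) simp
  show ?thesis unfolding L J0_sum[OF u] a b by (simp add: power2_eq_square algebra_simps)
 qed
 with lap have "sg u * limit_chart u = q u * (2 * weight u * J0 u)" by simp
 then have "?m * (P u powr kappa) * limit_chart u = 2 * P u powr (1 + \<alpha> / real CARD('n)) * J0 u"
  using s m p by (simp add: q_def weight_def powr_minus field_simps)
 moreover have "P u powr kappa = P u powr (1 + \<alpha> / real CARD('n)) * P u powr ((\<alpha> - 2) / real CARD('n))"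
  by (simp add: powr_add[symmetric] kappa_def diff_divide_distrib add_divide_distrib algebra_simps)
 moreover have "P u powr (1 + \<alpha> / real CARD('n)) > 0" using p by simp
 ultimately show ?thesis by (simp add: field_simps)
qed

end

section \<open>Symmetric expansions of the kernel argument and of the amplitudes\<close>

context weighted_chart
begin

text \<open>The map \<open>v \<mapsto> cform v w\<close> with fixed \<open>w\<close> is
  differentiated in two ways, entry by entry and through \<open>cform_eq\<close>. This identifies
  the odd part found in \<open>sym_distance\<close> with \<open>dcform\<close>.\<close>

lemma dcform_expand:
 assumes u: "u \<in> U"
 shows "dcform u w w = 2 * inv_rho u * dir_deriv 1 inv_rho w u * (norm (dir_deriv 1 \<phi> w u))\<^sup>2
  + 2 * (inv_rho u)\<^sup>2 * (dir_deriv 1 \<phi> w u \<bullet> dir_deriv 2 \<phi> w u)"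
proof -
 let ?F = "dir_deriv 1 \<phi> w"
 have F: "Cinf_on ?F U" by (rule Cinf_on_dir_deriv[OF local_paramD(2)[OF lp]])
 have F2: "frechet_derivative ?F (at u) w = dir_deriv 2 \<phi> w u"
  unfolding dir_deriv_Suc[symmetric] by (simp only: numeral_2_eq_2 One_nat_def)
 have c: "((%v. cform v w) has_derivative (%x. dcform u x w)) (at u)"
  unfolding cform_def dcform_def
  by (intro has_derivative_sum has_derivative_mult_left Cinf_on_has_derivative[OF Cinf_cmetric u])
 have i: "(inv_rho has_derivative frechet_derivative inv_rho (at u)) (at u)"
  by (rule Cinf_on_has_derivative[OF Cinf_inv_rho u])
 have f: "(?F has_derivative frechet_derivative ?F (at u)) (at u)"
  by (rule Cinf_on_has_derivative[OF F u])
 have "((%v. (inv_rho v * inv_rho v) * (?F v \<bullet> ?F v)) has_derivative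
  (%x. (inv_rho u * inv_rho u) * (?F u \<bullet> frechet_derivative ?F (at u) x + frechet_derivative ?F (at u) x \<bullet> ?F u)
   + (inv_rho u * frechet_derivative inv_rho (at u) x + frechet_derivative inv_rho (at u) x * inv_rho u) * (?F u \<bullet> ?F u))) (at u)"
  by (intro has_derivative_mult has_derivative_inner i f)
 note prod_der = this
 have eq_form: "(inv_rho v * inv_rho v) * (?F v \<bullet> ?F v) = cform v w" if "v \<in> U" for v
  by (simp only: cform_eq[OF that] dir_deriv_1 power2_norm_eq_inner power2_eq_square)
    (simp only: power2_eq_square[symmetric] power2_norm_eq_inner)
 have "((%v. cform v w) has_derivative
  (%x. (inv_rho u * inv_rho u) * (?F u \<bullet> frechet_derivative ?F (at u) x + frechet_derivative ?F (at u) x \<bullet> ?F u)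
   + (inv_rho u * frechet_derivative inv_rho (at u) x + frechet_derivative inv_rho (at u) x * inv_rho u) * (?F u \<bullet> ?F u))) (at u)"
  by (rule has_derivative_transform_within_open[OF prod_der openU u eq_form])
 from fun_cong[OF has_derivative_unique[OF c this], of w] show ?thesis
  unfolding F2 by (simp add: dir_deriv_1[unfolded One_nat_def] power2_eq_square dot_square_norm inner_commute algebra_simps del: dir_deriv.simps)
qed

lemma dir_deriv_scale:
 fixes f :: "real^'n => real"
 assumes "Cinf_on f U" "u \<in> U"
 shows "dir_deriv 1 f (t *\<^sub>R z) u = t * dir_deriv 1 f z u" "dir_deriv 2 f (t *\<^sub>R z) u = t\<^sup>2 * dir_deriv 2 f z u"
 unfolding dir_deriv_axis[OF openU assms] sum_distrib_left
 by (auto intro!: sum.cong simp: power2_eq_square)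

lemma dir_deriv_measurable:
 fixes f :: "real^'n => real"
 assumes "Cinf_on f U" "u \<in> U"
 shows "(%z. dir_deriv 1 f z u) \<in> borel_measurable borel" "(%z. dir_deriv 2 f z u) \<in> borel_measurable borel"
 unfolding dir_deriv_axis[OF openU assms] by measurable

lemma taylor_bd_sym:
 fixes f :: "real^'n => real"
 assumes "taylor_bd f u0 R K" "u \<in> cball u0 R" "norm w <= R" "R <= 1" "0 <= K"
 shows "\<bar>f u\<bar> <= 2 * K" "\<bar>f (u + w) + f (u - w) - 2 * f u\<bar> <= 2 * K * (norm w)\<^sup>2"
  "\<bar>f (u + w) - f (u - w) - 2 * dir_deriv 1 f w u\<bar> <= 2 * K * norm w ^ 3" "\<bar>dir_deriv 1 f w u\<bar> <= 2 * K * norm w"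
  "\<bar>(f (u + w) - f u) + (f (u - w) - f u) - dir_deriv 2 f w u\<bar> <= 2 * K * norm w ^ 4"
  "\<bar>dir_deriv 2 f w u\<bar> <= 2 * K * (norm w)\<^sup>2" "\<bar>f (u + w) - f u\<bar> <= 2 * K"
proof -
 note H = assms(1)[unfolded taylor_bd_def, rule_format, OF assms(2,3), unfolded real_norm_def real_scaleR_def]
 have n: "norm w <= 1" using assms(3,4) by linarith
 have nn: "0 <= K * norm w" "0 <= K * norm w ^ 2" "0 <= K * norm w ^ 3" "0 <= K * norm w ^ 4" using assms(5) by simp_all
 have p: "K * norm w ^ 4 <= K * norm w ^ 2" "K * norm w <= K"
  using power_decreasing[of 2 4 "norm w"] n assms(5) by (auto intro: mult_left_mono simp: mult_left_le)
 show "\<bar>f u\<bar> <= 2 * K" "\<bar>f (u + w) + f (u - w) - 2 * f u\<bar> <= 2 * K * (norm w)\<^sup>2"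
  "\<bar>f (u + w) - f (u - w) - 2 * dir_deriv 1 f w u\<bar> <= 2 * K * norm w ^ 3" "\<bar>dir_deriv 1 f w u\<bar> <= 2 * K * norm w"
  "\<bar>(f (u + w) - f u) + (f (u - w) - f u) - dir_deriv 2 f w u\<bar> <= 2 * K * norm w ^ 4"
  "\<bar>dir_deriv 2 f w u\<bar> <= 2 * K * (norm w)\<^sup>2" "\<bar>f (u + w) - f u\<bar> <= 2 * K"
  using H nn p assms(5) unfolding mult.assoc by linarith+
qed

text \<open>The phase and the two amplitudes as functions of the increment. The cut-off makes them
  total Borel functions; beyond it \<open>u + w\<close> may leave the chart.\<close>

definition sdist :: "real => real^'n => real^'n => real" where
 "sdist R u w = (if norm w < R then (norm (\<phi> (u + w) - \<phi> u))\<^sup>2 * inv_rho u * inv_rho (u + w) else 0)"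
definition hnum :: "real => real^'n => real^'n => real" where
 "hnum R u w = (if norm w < R then (h (u + w) - h u) * weight (u + w) else 0)"
definition hden :: "real => real^'n => real^'n => real" where
 "hden R u w = (if norm w < R then weight (u + w) else 0)"
definition expansion_const :: "real => real" where
 "expansion_const K = 18 * (2 * K) ^ 4 * (real CARD('n))\<^sup>2"

lemma expansion_const_ge:
 assumes "1 <= K"
 shows "18 * (2 * K) ^ 4 <= expansion_const K" "11 * (2 * K)\<^sup>2 <= expansion_const K"
  "(real CARD('n))\<^sup>2 * K <= expansion_const K" "12 * K <= expansion_const K" "0 <= expansion_const K"
proof -
 let ?N = "(real CARD('n))\<^sup>2"
 have N: "1 <= ?N" by (intro one_le_power) simp
 have k: "(2 * K)\<^sup>2 <= (2 * K) ^ 4" "K <= (2 * K) ^ 4" "2 * K <= (2 * K) ^ 4"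
  using assms power_increasing[of 2 4 "2 * K"] power_increasing[of 1 4 "2 * K"] by auto
 show 1: "18 * (2 * K) ^ 4 <= expansion_const K"
  unfolding expansion_const_def using mult_left_mono[OF N, of "18 * (2 * K) ^ 4"] by simp
 show "11 * (2 * K)\<^sup>2 <= expansion_const K" "12 * K <= expansion_const K" using 1 k assms by linarith+
 have "?N * K <= ?N * (18 * (2 * K) ^ 4)" using k(2) assms by (intro mult_left_mono) auto
 then show "?N * K <= expansion_const K" by (simp add: expansion_const_def mult_ac)
 show "0 <= expansion_const K" by (simp add: expansion_const_def)
qed

text \<open>The numerator is of order \<open>m = 2\<close> since its amplitude vanishes at the
  centre. The denominator is of order \<open>m = 0\<close> with odd part zero: the linear term of
  \<open>weight\<close>, multiplied by \<open>norm w\<close>, already counts as a remainder of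
  degree \<open>m + 2\<close>.\<close>

lemma sym_expansions:
 assumes lc: "local_const u0 R r c K \<eta>" and u: "u \<in> cball u0 R"
 shows "sym_expansion c (expansion_const K) R 2 (sdist R u) (cform u) (%w. dcform u w w) (hnum R u) (num2 u) (num1 u)"
  and "sym_expansion c (expansion_const K) R 0 (sdist R u) (cform u) (%w. dcform u w w) (hden R u) (%_. weight u) (%_. 0)"
proof -
 let ?C = "expansion_const K" and ?K = "2 * K"
 note L = local_constD[OF lc]
 have u0R: "cball u0 R \<subseteq> cball u0 (2 * R)" using L(1) by auto
 have uU: "u \<in> U" using u u0R L(8) by blast
 have K0: "0 <= K" "1 <= ?K" using L(6) by auto
 note C = expansion_const_ge[OF L(6)]
 note Lphi = local_paramD(2)[OF lp]
 have uwU: "u + w \<in> U" if "norm w <= R" for w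
 proof -
  have "dist u0 (u + w) <= dist u0 u + norm w" using dist_triangle[of u0 "u + w" u] by (simp add: dist_norm)
  then have "u + w \<in> cball u0 (2 * R)" using that u by simp
  then show ?thesis using L(8) by blast
 qed
 have ph: "norm (\<phi> (u + w) - \<phi> (u - w) - 2 *\<^sub>R dir_deriv 1 \<phi> w u) <= K * norm w ^ 3"
  "norm (\<phi> (u + w) + \<phi> (u - w) - 2 *\<^sub>R \<phi> u - dir_deriv 2 \<phi> w u) <= K * norm w ^ 4"
  "norm (dir_deriv 1 \<phi> w u) <= K * norm w" "norm (dir_deriv 2 \<phi> w u) <= K * norm w ^ 2" if "norm w <= R" for w
  using L(11)[unfolded taylor_bd_def, rule_format, OF u that] by blast+
 note bI = taylor_bd_sym[OF L(12) u _ L(2) K0(1)] and bW = taylor_bd_sym[OF L(13) u _ L(2) K0(1)]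
  and bh = taylor_bd_sym[OF L(14) u _ L(2) K0(1)]
 have dist_bounds: "\<bar>sdist R u w + sdist R u (- w) - 2 * cform u w\<bar> <= ?C * norm w ^ 4"
  "\<bar>sdist R u w - sdist R u (- w) - dcform u w w\<bar> <= ?C * norm w ^ 5" if w: "norm w < R" for w
 proof -
  let ?n = "norm w"
  have wR: "?n <= R" and n: "0 <= ?n" "?n <= 1" using w L(2) by auto
  let ?p = "\<phi> (u + w) - \<phi> u" and ?q = "\<phi> (u - w) - \<phi> u" and ?L = "dir_deriv 1 \<phi> w u" and ?Q = "dir_deriv 2 \<phi> w u"
  have KK: "K * x <= ?K * x" if "0 <= x" for x using that K0 by (intro mult_right_mono) auto
  have sq: "\<bar>(norm ?p)\<^sup>2 + (norm ?q)\<^sup>2 - 2 * (norm ?L)\<^sup>2\<bar> <= 5 * ?K\<^sup>2 * ?n ^ 4"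
   "\<bar>(norm ?p)\<^sup>2 - (norm ?q)\<^sup>2 - 2 * (?L \<bullet> ?Q)\<bar> <= 4 * ?K\<^sup>2 * ?n ^ 5"
  proof -
   have e1: "?p - ?q - 2 *\<^sub>R ?L = \<phi> (u + w) - \<phi> (u - w) - 2 *\<^sub>R ?L" by simp
   have e2: "?p + ?q - ?Q = \<phi> (u + w) + \<phi> (u - w) - 2 *\<^sub>R \<phi> u - ?Q" by (simp add: scaleR_2)
   have b1: "norm (?p - ?q - 2 *\<^sub>R ?L) <= ?K * ?n ^ 3" unfolding e1 using ph(1)[OF wR] KK[of "?n ^ 3"] by simp
   have b2: "norm (?p + ?q - ?Q) <= ?K * ?n ^ 4" unfolding e2 using ph(2)[OF wR] KK[of "?n ^ 4"] by simp
   have b3: "norm ?L <= ?K * ?n" using ph(3)[OF wR] KK[of ?n] by simp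
   have b4: "norm ?Q <= ?K * ?n\<^sup>2" using ph(4)[OF wR] KK[of "?n\<^sup>2"] by simp
   show "\<bar>(norm ?p)\<^sup>2 + (norm ?q)\<^sup>2 - 2 * (norm ?L)\<^sup>2\<bar> <= 5 * ?K\<^sup>2 * ?n ^ 4"
    by (rule sym_square(1)[OF n K0(2) b1 b2 b3 b4])
   show "\<bar>(norm ?p)\<^sup>2 - (norm ?q)\<^sup>2 - 2 * (?L \<bullet> ?Q)\<bar> <= 4 * ?K\<^sup>2 * ?n ^ 5"
    by (rule sym_square(2)[OF n K0(2) b1 b2 b3 b4])
  qed
  have l: "\<bar>(norm ?L)\<^sup>2\<bar> <= ?K\<^sup>2 * ?n\<^sup>2" "\<bar>?L \<bullet> ?Q\<bar> <= ?K\<^sup>2 * ?n ^ 3"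
  proof -
   have b3: "norm ?L <= ?K * ?n" using ph(3)[OF wR] KK[of ?n] by simp
   have b4: "norm ?Q <= ?K * ?n\<^sup>2" using ph(4)[OF wR] KK[of "?n\<^sup>2"] by simp
   show "\<bar>(norm ?L)\<^sup>2\<bar> <= ?K\<^sup>2 * ?n\<^sup>2" using power_mono[OF b3, of 2] by (simp add: power_mult_distrib)
   have "\<bar>?L \<bullet> ?Q\<bar> <= norm ?L * norm ?Q" by (rule Cauchy_Schwarz_ineq2)
   also have "... <= (?K * ?n) * (?K * ?n\<^sup>2)" using b3 b4 K0 by (intro mult_mono) auto
   also have "... = ?K\<^sup>2 * ?n ^ 3" by (simp add: power2_eq_square power3_eq_cube)
   finally show "\<bar>?L \<bullet> ?Q\<bar> <= ?K\<^sup>2 * ?n ^ 3" .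
  qed
  have s: "sdist R u w = (norm ?p)\<^sup>2 * inv_rho u * inv_rho (u + w)" "sdist R u (- w) = (norm ?q)\<^sup>2 * inv_rho u * inv_rho (u - w)"
   using w by (simp_all add: sdist_def)
  have c: "cform u w = (inv_rho u)\<^sup>2 * (norm ?L)\<^sup>2" unfolding cform_eq[OF uU] dir_deriv_1 ..
  have up: "x <= 18 * ?K ^ 4 * ?n ^ j ==> x <= ?C * ?n ^ j" for x j
   using mult_right_mono[OF C(1), of "?n ^ j"] by simp
  show "\<bar>sdist R u w + sdist R u (- w) - 2 * cform u w\<bar> <= ?C * ?n ^ 4"
   unfolding s c by (intro up sym_distance(1)[OF n K0(2) sq l bI(1-4)[OF wR]])
  show "\<bar>sdist R u w - sdist R u (- w) - dcform u w w\<bar> <= ?C * ?n ^ 5"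
   unfolding s dcform_expand[OF uU] by (intro up sym_distance(2)[OF n K0(2) sq l bI(1-4)[OF wR]])
 qed
 have dist_low: "c * (norm w)\<^sup>2 <= sdist R u w" if "norm w < R" for w
  using L(10)[OF u, of w] that by (simp add: sdist_def)
 have num_bounds: "\<bar>hnum R u w + hnum R u (- w) - 2 * num2 u w\<bar> <= ?C * norm w ^ 4"
  "norm w * \<bar>hnum R u w - hnum R u (- w) - 2 * num1 u w\<bar> <= ?C * norm w ^ 4" "\<bar>hnum R u w\<bar> <= ?C" if w: "norm w < R" for w
 proof -
  let ?n = "norm w"
  have wR: "?n <= R" and n: "0 <= ?n" "?n <= 1" using w L(2) by auto
  have s: "hnum R u w = (h (u + w) - h u) * weight (u + w)" "hnum R u (- w) = (h (u - w) - h u) * weight (u - w)"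
   using w by (simp_all add: hnum_def)
  have d: "\<bar>(h (u + w) - h u) - (h (u - w) - h u) - 2 * dir_deriv 1 h w u\<bar> <= ?K * ?n ^ 3"
   using bh(3)[OF wR] by (simp only: diff_diff_eq2 diff_add_cancel)
  note B = sym_weighted_increment[OF n K0(2) bh(5)[OF wR] d bh(6,4)[OF wR] bW(1-4)[OF wR]]
  have up: "x <= k * ?K\<^sup>2 * ?n ^ j ==> k <= 11 ==> x <= ?C * ?n ^ j" for x j and k :: real
  proof -
   assume x: "x <= k * ?K\<^sup>2 * ?n ^ j" "k <= 11"
   have "k * ?K\<^sup>2 <= 11 * ?K\<^sup>2" using x(2) by (intro mult_right_mono) auto
   then have "k * ?K\<^sup>2 <= ?C" using C(2) by linarith
   from mult_right_mono[OF this, of "?n ^ j"] show "x <= ?C * ?n ^ j" using x(1) by simp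
  qed
  show "\<bar>hnum R u w + hnum R u (- w) - 2 * num2 u w\<bar> <= ?C * ?n ^ 4"
   unfolding s num2_def by (rule up[OF B(1)]) simp
  show "?n * \<bar>hnum R u w - hnum R u (- w) - 2 * num1 u w\<bar> <= ?C * ?n ^ 4"
   unfolding s num1_def by (rule up[OF B(2)]) simp
  have "\<bar>weight (u + w)\<bar> <= 4 * K" using bW(1,7)[OF wR] by linarith
  then have "\<bar>hnum R u w\<bar> <= ?K * (4 * K)" unfolding s by (intro abs_mult_le bh(7)[OF wR])
  also have "... <= 11 * ?K\<^sup>2" by (simp add: power2_eq_square)
  finally show "\<bar>hnum R u w\<bar> <= ?C" using C(2) by linarith
 qed
 have den_bounds: "\<bar>hden R u w + hden R u (- w) - 2 * weight u\<bar> <= ?C * (norm w)\<^sup>2"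
  "norm w * \<bar>hden R u w - hden R u (- w)\<bar> <= ?C * (norm w)\<^sup>2" "\<bar>hden R u w\<bar> <= ?C" if w: "norm w < R" for w
 proof -
  let ?n = "norm w"
  have wR: "?n <= R" and n: "0 <= ?n" "?n <= 1" using w L(2) by auto
  have s: "hden R u w = weight (u + w)" "hden R u (- w) = weight (u - w)"
   using w by (simp_all add: hden_def)
  have C2: "2 * K * x <= ?C * x" "6 * K * x <= ?C * x" if "0 <= x" for x
   using C(4) K0 that by (auto intro!: mult_right_mono)
  show "\<bar>hden R u w + hden R u (- w) - 2 * weight u\<bar> <= ?C * ?n\<^sup>2"
   unfolding s using bW(2)[OF wR] C2(1)[of "?n\<^sup>2"] by simp
  have "K * ?n ^ 3 <= K * ?n" using power_decreasing[of 1 3 ?n] n K0 by (auto intro: mult_left_mono)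
  then have "\<bar>weight (u + w) - weight (u - w)\<bar> <= 6 * (K * ?n)" using bW(3,4)[OF wR] unfolding mult.assoc by linarith
  from mult_left_mono[OF this n(1)] have "?n * \<bar>weight (u + w) - weight (u - w)\<bar> <= 6 * K * ?n\<^sup>2"
   by (simp add: power2_eq_square mult_ac)
  then show "?n * \<bar>hden R u w - hden R u (- w)\<bar> <= ?C * ?n\<^sup>2" unfolding s using C2(2)[of "?n\<^sup>2"] by simp
  have "\<bar>weight (u + w)\<bar> <= 4 * K" using bW(1,7)[OF wR] by linarith
  then show "\<bar>hden R u w\<bar> <= ?C" unfolding s using C(4) K0 by linarith
 qed
 have m_phi: "continuous_on (ball 0 R) (%w. \<phi> (u + w))" "continuous_on (ball 0 R) (%w. inv_rho (u + w))"
  "continuous_on (ball 0 R) (%w. weight (u + w))" "continuous_on (ball 0 R) (%w. h (u + w))"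
 proof -
  have s: "continuous_on (ball 0 R) (%w. u + w)" by (intro continuous_on_add continuous_on_const continuous_on_id)
  have i: "(%w. u + w) ` ball 0 R \<subseteq> U"
   by (intro image_subsetI uwU) (simp add: less_imp_le)
  show "continuous_on (ball 0 R) (%w. \<phi> (u + w))" "continuous_on (ball 0 R) (%w. inv_rho (u + w))"
   "continuous_on (ball 0 R) (%w. weight (u + w))" "continuous_on (ball 0 R) (%w. h (u + w))"
   by (rule continuous_on_compose2[OF Cinf_on_continuous_on s i], rule Lphi Cinf_inv_rho Cinf_weight h)+
 qed
 have meas: "sdist R u \<in> borel_measurable borel" "hnum R u \<in> borel_measurable borel" "hden R u \<in> borel_measurable borel"
  unfolding sdist_def[abs_def] hnum_def[abs_def] hden_def[abs_def]
  by (rule measurable_cutoff,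
    intro continuous_on_mult continuous_on_diff continuous_on_power continuous_on_norm continuous_on_const m_phi)+
 have meas2: "num1 u \<in> borel_measurable borel" "num2 u \<in> borel_measurable borel"
  unfolding num1_def[abs_def] num2_def[abs_def]
  using dir_deriv_measurable[OF h uU] dir_deriv_measurable[OF Cinf_weight uU] by measurable
 have hom: "dcform u (t *\<^sub>R w) (t *\<^sub>R w) = t ^ 3 * dcform u w w" "num2 u (t *\<^sub>R w) = t\<^sup>2 * num2 u w"
  "num1 u (t *\<^sub>R w) = t * num1 u w" for t w
 proof -
  have "dcform u (t *\<^sub>R w) (t *\<^sub>R w) = t * dcform u w (t *\<^sub>R w)" by (rule dcform_linear(2)[OF uU])
  also have "dcform u w (t *\<^sub>R w) = t\<^sup>2 * dcform u w w"
   unfolding dcform_def sum_distrib_left by (intro sum.cong refl) (simp add: power2_eq_square)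
  finally show "dcform u (t *\<^sub>R w) (t *\<^sub>R w) = t ^ 3 * dcform u w w" by (simp add: power2_eq_square power3_eq_cube)
  show "num2 u (t *\<^sub>R w) = t\<^sup>2 * num2 u w" "num1 u (t *\<^sub>R w) = t * num1 u w"
   unfolding num2_def num1_def dir_deriv_scale[OF h uU] dir_deriv_scale[OF Cinf_weight uU]
   by (simp_all add: power2_eq_square algebra_simps)
 qed
 have dc_bd: "\<bar>dcform u w w\<bar> <= ?C * norm w ^ 3" for w
 proof (rule homogeneous_bound[OF L(1)])
  show "dcform u (t *\<^sub>R w) (t *\<^sub>R w) = t ^ 3 * dcform u w w" for t w by (rule hom)
  fix w :: "real^'n" assume w: "norm w <= R"
  have "\<bar>dcform u w w\<bar> <= (real CARD('n))\<^sup>2 * (K * norm w) * (norm w)\<^sup>2" by (rule cmetric_bounds(3)[OF L(15) u w])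
  also have "... = ((real CARD('n))\<^sup>2 * K) * norm w ^ 3" by (simp add: power2_eq_square power3_eq_cube)
  also have "... <= ?C * norm w ^ 3" using C(3) by (intro mult_right_mono) auto
  finally show "\<bar>dcform u w w\<bar> <= ?C * norm w ^ 3" .
 qed
 have n2_bd: "\<bar>num2 u w\<bar> <= ?C * norm w ^ 2" for w
 proof (rule homogeneous_bound[OF L(1)])
  show "num2 u (t *\<^sub>R w) = t\<^sup>2 * num2 u w" for t w by (rule hom)
  fix w :: "real^'n" assume w: "norm w <= R"
  have "\<bar>weight u * dir_deriv 2 h w u\<bar> <= ?K * (?K * (norm w)\<^sup>2)" by (intro abs_mult_le bW(1)[OF w] bh(6)[OF w])
  moreover have "\<bar>dir_deriv 1 h w u * dir_deriv 1 weight w u\<bar> <= (?K * norm w) * (?K * norm w)" by (intro abs_mult_le bW(4)[OF w] bh(4)[OF w])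
  moreover have "(?K * norm w) * (?K * norm w) = ?K\<^sup>2 * (norm w)\<^sup>2" "?K * (?K * (norm w)\<^sup>2) = ?K\<^sup>2 * (norm w)\<^sup>2"
   by (simp_all add: power2_eq_square)
  moreover have "0 <= ?K\<^sup>2 * (norm w)\<^sup>2" by simp
  ultimately have "\<bar>num2 u w\<bar> <= 2 * (?K\<^sup>2 * (norm w)\<^sup>2)" unfolding num2_def by linarith
  also have "... = (2 * ?K\<^sup>2) * (norm w)\<^sup>2" by simp
  also have "... <= ?C * (norm w)\<^sup>2" using C(2) zero_le_power2[of ?K] by (intro mult_right_mono zero_le_power2) linarith
  finally show "\<bar>num2 u w\<bar> <= ?C * norm w ^ 2" .
 qed
 have n1_bd: "norm w * \<bar>num1 u w\<bar> <= ?C * norm w ^ 2" for w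
 proof -
  have "\<bar>num1 u w\<bar> <= ?K\<^sup>2 * norm w ^ 1"
  proof (rule homogeneous_bound[OF L(1)])
   show "num1 u (t *\<^sub>R w) = t ^ 1 * num1 u w" for t w by (simp add: hom)
   fix w :: "real^'n" assume w: "norm w <= R"
   have "\<bar>num1 u w\<bar> <= (?K * norm w) * ?K" unfolding num1_def by (intro abs_mult_le bW(1)[OF w] bh(4)[OF w])
   then show "\<bar>num1 u w\<bar> <= ?K\<^sup>2 * norm w ^ 1" by (simp add: power2_eq_square mult_ac)
  qed
  then have "norm w * \<bar>num1 u w\<bar> <= norm w * (?K\<^sup>2 * norm w)" by (intro mult_left_mono) auto
  also have "... = ?K\<^sup>2 * (norm w)\<^sup>2" by (simp add: power2_eq_square)
  also have "... <= ?C * (norm w)\<^sup>2" using C(2) zero_le_power2[of ?K] by (intro mult_right_mono zero_le_power2) linarith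
  finally show ?thesis .
 qed
 have cf: "c * (norm w)\<^sup>2 <= cform u w" for w by (rule L(9)[OF u])
 have pw: "norm w ^ 4 = norm w ^ (2 + 2)" "(norm w)\<^sup>2 = norm w ^ (0 + 2)" for w :: "real^'n" by (simp_all add: power2_eq_square)
 show "sym_expansion c ?C R 2 (sdist R u) (cform u) (%w. dcform u w w) (hnum R u) (num2 u) (num1 u)"
  unfolding sym_expansion_def
 proof (intro conjI allI impI)
  fix w :: "real^'n" assume w: "norm w < R"
  show "\<bar>hnum R u w + hnum R u (- w) - 2 * num2 u w\<bar> <= ?C * norm w ^ (2 + 2)"
   using num_bounds(1)[OF w] unfolding pw(1) .
  show "norm w * \<bar>hnum R u w - hnum R u (- w) - 2 * num1 u w\<bar> <= ?C * norm w ^ (2 + 2)"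
   using num_bounds(2)[OF w] unfolding pw(1) .
 next
  fix w :: "real^'n" and t :: real
  show "t * num1 u (t *\<^sub>R w) = t\<^sup>2 * num1 u w" unfolding hom(3) by (simp add: power2_eq_square)
 qed (fact meas cform_measurable dcform_measurable2[OF uU] meas2 hom cform_scale n1_bd n2_bd dc_bd cf
  | (rule cform_scale hom) | (rule dist_low num_bounds(3) dist_bounds; assumption))+
 have wb: "\<bar>weight u\<bar> <= ?C" using bW(1)[of 0] L(1) C(4) K0 by simp
 show "sym_expansion c ?C R 0 (sdist R u) (cform u) (%w. dcform u w w) (hden R u) (%_. weight u) (%_. 0)"
  unfolding sym_expansion_def
 proof (intro conjI allI impI)
  fix w :: "real^'n" assume w: "norm w < R"
  show "\<bar>hden R u w + hden R u (- w) - 2 * weight u\<bar> <= ?C * norm w ^ (0 + 2)"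
   using den_bounds(1)[OF w] unfolding pw(2) .
  show "norm w * \<bar>hden R u w - hden R u (- w) - 2 * 0\<bar> <= ?C * norm w ^ (0 + 2)"
   using den_bounds(2)[OF w] by (simp add: power2_eq_square)
 next
  fix w :: "real^'n"
  show "\<bar>weight u\<bar> <= ?C * norm w ^ 0" using wb by simp
  show "norm w * \<bar>0\<bar> <= ?C * norm w ^ 0" using C(5) by simp
 next
  fix t :: real and w :: "real^'n"
  show "weight u = t ^ 0 * weight u" "t * 0 = t ^ 0 * (0::real)" by simp_all
  show "(%_::real^'n. weight u) \<in> borel_measurable borel" "(%_::real^'n. 0::real) \<in> borel_measurable borel" by simp_all
 qed (fact meas cform_measurable dcform_measurable2[OF uU] hom cform_scale dc_bd cf
  | (rule cform_scale hom) | (rule dist_low den_bounds(3) dist_bounds; assumption))+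
qed

lemma chart_expansion:
 assumes u0: "u0 \<in> U"
 shows "\<exists>R r c K \<eta> B. local_const u0 R r c K \<eta> \<and> B \<ge> 0 \<and> (\<forall>u\<in>cball u0 R. \<forall>e. 0 < e --> e <= 1 -->
  \<bar>(LINT w|lborel. indicator (ball 0 R) w * (k0 (sdist R u w / e\<^sup>2) * hnum R u w))
   - e ^ (CARD('n) + 2) * (kernel_m2 TYPE('n) k0 / 2 * P u powr ((\<alpha> - 2) / real CARD('n)) * limit_chart u)\<bar> <= B * e ^ (CARD('n) + 4) \<and>
  \<bar>(LINT w|lborel. indicator (ball 0 R) w * (k0 (sdist R u w / e\<^sup>2) * hden R u w))
   - e ^ CARD('n) * (kernel_m0 TYPE('n) k0 * P u powr (\<alpha> / real CARD('n)))\<bar> <= B * e ^ (CARD('n) + 2))"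
proof -
 obtain R r c K \<eta> where lc: "local_const u0 R r c K \<eta>" by (rule local_constants[OF u0])
 note L = local_constD[OF lc]
 note C0 = expansion_const_ge(5)[OF L(6)]
 obtain B1 where B1: "B1 \<ge> 0" "!!(s::real^'n => real) g g1 H P Q e. sym_expansion c (expansion_const K) R 2 s g g1 H P Q ==> 0 < e ==> e <= 1 ==>
  \<bar>(LINT w|lborel. indicator (ball 0 R) w * (k0 (s w / e\<^sup>2) * H w))
   - e ^ (DIM(real^'n) + 2) * (LINT z|lborel. k0 (g z) * P z + k1 (g z) * g1 z * Q z / 2)\<bar> <= B1 * e ^ (DIM(real^'n) + 2 + 2)"
  using laplace_expansion[OF L(5) C0 L(1), where 'b = "real^'n" and m = 2] by blast
 obtain B2 where B2: "B2 \<ge> 0" "!!(s::real^'n => real) g g1 H P Q e. sym_expansion c (expansion_const K) R 0 s g g1 H P Q ==> 0 < e ==> e <= 1 ==>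
  \<bar>(LINT w|lborel. indicator (ball 0 R) w * (k0 (s w / e\<^sup>2) * H w))
   - e ^ (DIM(real^'n) + 0) * (LINT z|lborel. k0 (g z) * P z + k1 (g z) * g1 z * Q z / 2)\<bar> <= B2 * e ^ (DIM(real^'n) + 0 + 2)"
  using laplace_expansion[OF L(5) C0 L(1), where 'b = "real^'n" and m = 0] by blast
 have dim: "DIM(real^'n) = CARD('n)" by simp
 have p4: "CARD('n) + 2 + 2 = CARD('n) + 4" by simp
 show ?thesis
 proof (rule exI[of _ R], rule exI[of _ r], rule exI[of _ c], rule exI[of _ K], rule exI[of _ \<eta>], rule exI[of _ "max B1 B2"],
   intro conjI ballI allI impI)
  show "local_const u0 R r c K \<eta>" by (rule lc)
  show "max B1 B2 \<ge> 0" using B1 by simp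
  fix u e assume u: "u \<in> cball u0 R" and e: "(0::real) < e" "e <= 1"
  have "u \<in> cball u0 (2 * R)" using u L(1) by auto
  then have uU: "u \<in> U" using L(8) by blast
  note se = sym_expansions[OF lc u]
  have b1: "B1 * e ^ (CARD('n) + 4) <= max B1 B2 * e ^ (CARD('n) + 4)" using e by (intro mult_right_mono) auto
  have "\<bar>(LINT w|lborel. indicator (ball 0 R) w * (k0 (sdist R u w / e\<^sup>2) * hnum R u w))
   - e ^ (CARD('n) + 2) * J0 u\<bar> <= B1 * e ^ (CARD('n) + 4)"
   using B1(2)[OF se(1) e] unfolding J0_def dim p4 .
  then show "\<bar>(LINT w|lborel. indicator (ball 0 R) w * (k0 (sdist R u w / e\<^sup>2) * hnum R u w))
   - e ^ (CARD('n) + 2) * (kernel_m2 TYPE('n) k0 / 2 * P u powr ((\<alpha> - 2) / real CARD('n)) * limit_chart u)\<bar> <= max B1 B2 * e ^ (CARD('n) + 4)"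
   unfolding J0_eq[OF uU] using b1 by (rule order_trans)
  have b2: "B2 * e ^ (CARD('n) + 2) <= max B1 B2 * e ^ (CARD('n) + 2)" using e by (intro mult_right_mono) auto
  have den: "(LINT z|lborel. k0 (cform u z) * weight u + k1 (cform u z) * dcform u z z * 0 / 2) = kernel_m0 TYPE('n) k0 * P u powr (\<alpha> / real CARD('n))"
   using W_eq(2)[OF uU] P_pos[OF uU] sqrt_det_metric_pos[OF lp uU] by (simp add: weight_def powr_add)
  have "\<bar>(LINT w|lborel. indicator (ball 0 R) w * (k0 (sdist R u w / e\<^sup>2) * hden R u w))
   - e ^ CARD('n) * (kernel_m0 TYPE('n) k0 * P u powr (\<alpha> / real CARD('n)))\<bar> <= B2 * e ^ (CARD('n) + 2)"
   using B2(2)[OF se(2) e] unfolding den dim add_0_right .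
  then show "\<bar>(LINT w|lborel. indicator (ball 0 R) w * (k0 (sdist R u w / e\<^sup>2) * hden R u w))
   - e ^ CARD('n) * (kernel_m0 TYPE('n) k0 * P u powr (\<alpha> / real CARD('n)))\<bar> <= max B1 B2 * e ^ (CARD('n) + 2)"
   using b2 by (rule order_trans)
 qed
qed

end

section \<open>The bias on the manifold\<close>

lemma exp_inverse_square_bound:
 fixes c :: real
 assumes "c > 0"
 shows "\<exists>C>0. \<forall>e>0. exp (- c / e\<^sup>2) <= C * e ^ m"
proof -
 have "exp (- c / e\<^sup>2) <= (fact m / c ^ m + 1) * e ^ m" if e: "e > 0" for e :: real
 proof (cases "e <= 1")
  case True
  have x: "c / e\<^sup>2 > 0" using assms e by simp
  define X where "X = c / e\<^sup>2"
  have X: "X > 0" using x by (simp add: X_def)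
  \<comment> \<open>A single term of the exponential series is a lower bound for
    \<open>exp X\<close>. With \<open>X = c / e^2\<close> it gives \<open>e ^ (2 * m)\<close>, hence
    \<open>e ^ m\<close> for \<open>e \<le> 1\<close>.\<close>
  have "(\<Sum>n\<in>{m}. X ^ n /\<^sub>R fact n) <= (\<Sum>n. X ^ n /\<^sub>R fact n)"
   by (rule sum_le_suminf[OF summable_exp_generic]) (use X in auto)
  then have "X ^ m / fact m <= exp X" by (simp add: exp_def divide_inverse mult.commute)
  then have "X ^ m <= fact m * exp X" by (simp add: divide_le_eq mult.commute)
  then have "exp (- X) <= fact m / X ^ m" using X by (simp add: exp_minus le_divide_eq divide_le_eq inverse_eq_divide mult.commute)
  then have "exp (- (c / e\<^sup>2)) <= fact m / (c / e\<^sup>2) ^ m" unfolding X_def .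
  also have "... = (fact m / c ^ m) * (e ^ m * e ^ m)"
   using e by (simp add: power_divide power2_eq_square power_mult_distrib)
  also have "... <= (fact m / c ^ m) * (e ^ m * 1)"
   using e True assms by (intro mult_left_mono power_le_one) auto
  also have "... <= (fact m / c ^ m + 1) * e ^ m" using e by (simp add: algebra_simps)
  finally show ?thesis by simp
 next
  case False
  have "exp (- c / e\<^sup>2) <= 1" using assms e by simp
  also have "1 <= e ^ m" using False by (intro one_le_power) simp
  also have "... <= (fact m / c ^ m + 1) * e ^ m"
   using e assms by (simp add: distrib_right)
  finally show ?thesis .
 qed
 moreover have "fact m / c ^ m + 1 > 0" using assms by (intro add_nonneg_pos) auto
 ultimately show ?thesis by blast
qed

lemma continuous_on_compact_bounded:
 fixes g :: "'a::topological_space => real"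
 assumes "compact M" "continuous_on M g"
 shows "\<exists>K>0. \<forall>y\<in>M. \<bar>g y\<bar> <= K"
proof -
 obtain K where "K > 0" "\<forall>z\<in>g ` M. norm z <= K"
  using compact_imp_bounded[OF compact_continuous_image[OF assms(2,1)]] unfolding bounded_pos by blast
 then show ?thesis by (intro exI[of _ K]) simp
qed

lemma rho_bar_pos: "p x > 0 ==> rho_bar T p x > 0"
 by (simp add: rho_bar_def)

lemma continuous_on_rho_bar:
 "continuous_on M p ==> \<forall>x\<in>M. p x > 0 ==> continuous_on M (%x. rho_bar TYPE('n::finite) p x powr \<beta>)"
proof -
 assume c: "continuous_on M p" and p: "\<forall>x\<in>M. p x > 0"
 have 1: "continuous_on M (%x. p x powr (- 1 / real CARD('n)))"
  by (rule continuous_on_powr[OF c continuous_on_const]) (use p in force)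
 show "continuous_on M (%x. rho_bar TYPE('n) p x powr \<beta>)" unfolding rho_bar_def
  by (rule continuous_on_powr[OF 1 continuous_on_const]) (use p in force)
qed

text \<open>The parameter \<open>T\<close> fixes the dimension type, which occurs in the type of no
  other parameter.\<close>

locale kernel_manifold = decaying_kernel +
 fixes M :: "'a::euclidean_space set" and V :: "'a measure" and T :: "'n::finite itself"
 assumes sub: "smooth_submanifold TYPE('n) M" and M: "compact M" and V: "riemannian_volume TYPE('n) M V"
begin

definition kint :: "('a => real) => real => 'a => ('a => real) => real" where
 "kint p e x G = (LINT y|V. k0 ((norm (x - y))\<^sup>2 / (e\<^sup>2 * rho_bar TYPE('n) p x * rho_bar TYPE('n) p y)) * (G y * p y))"

text \<open>The number \<open>L\<close> stands for the limit at \<open>x\<close> and is left as a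
  parameter: the integrals mention no chart, so candidates computed in different charts can be
  compared.\<close>

definition bias_at :: "real => ('a => real) => ('a => real) => real => 'a => real => bool" where
 "bias_at \<alpha> p f B x L \<longleftrightarrow> (\<forall>e. 0 < e --> e <= 1 -->
   \<bar>kint p e x (%y. rho_bar TYPE('n) p y powr (- \<alpha>) * (f y - f x))
    - e ^ (CARD('n) + 2) * (kernel_m2 TYPE('n) k0 / 2 * rho_bar TYPE('n) p x powr (2 - \<alpha>) * L)\<bar> <= B * e ^ (CARD('n) + 4) \<and>
   \<bar>kint p e x (%y. rho_bar TYPE('n) p y powr (- \<alpha>))
    - e ^ CARD('n) * (kernel_m0 TYPE('n) k0 * rho_bar TYPE('n) p x powr (- \<alpha>))\<bar> <= B * e ^ (CARD('n) + 2))"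

lemma space_V: "space V = M" using V by (simp add: riemannian_volume_def)

lemma densityD:
 assumes "smooth_positive_density TYPE('n) M V p"
 shows "smooth_on_manifold TYPE('n) M p" "!!x. x \<in> M ==> p x > 0" "continuous_on M p" "p \<in> borel_measurable V"
  "integrable V p" "(LINT y|V. p y) = 1" "finite_measure V"
proof -
 show sm: "smooth_on_manifold TYPE('n) M p" and pos: "!!x. x \<in> M ==> p x > 0"
  using assms by (auto simp: smooth_positive_density_def intro: less_le_trans)
 show c: "continuous_on M p" by (rule smooth_continuous_on[OF sub sm])
 show m [measurable]: "p \<in> borel_measurable V" by (rule borel_measurable_volume(2)[OF V c])
 have i: "(\<integral>\<^sup>+x. ennreal (p x) \<partial>V) = 1" using assms by (simp add: smooth_positive_density_def)
 have nn: "AE x in V. 0 <= p x" by (rule AE_I2) (use pos space_V in \<open>auto intro: less_imp_le\<close>)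
 show int: "integrable V p" by (rule integrableI_nonneg[OF m nn]) (simp add: i)
 show "(LINT y|V. p y) = 1" using integral_eq_nn_integral[OF m nn] i by simp
 \<comment> \<open>The volume is finite because the density has total mass one and a positive lower
   bound.\<close>
 obtain pm where pm: "pm > 0" "!!x. x \<in> M ==> pm <= p x" using assms by (auto simp: smooth_positive_density_def)
 have "integrable V (%x. pm)"
  by (rule Bochner_Integration.integrable_bound[OF int]) (use pm pos space_V in \<open>auto intro!: AE_I2 order_trans[OF _ abs_ge_self]\<close>)
 then have "ennreal pm * emeasure V (space V) < \<infinity>" using pm(1) by (simp add: integrable_iff_bounded)
 then show "finite_measure V" using pm(1) by (intro finite_measureI) (auto simp: ennreal_mult_less_top top_unique less_top)
qed

lemma kernel_measurable:
 assumes [measurable]: "\<rho> \<in> borel_measurable V"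
 shows "(%y. k0 ((norm (x - y))\<^sup>2 / (t * \<rho> x * \<rho> y))) \<in> borel_measurable V"
proof -
 have [measurable]: "(%y. norm (x - y)) \<in> borel_measurable V" by (rule borel_measurable_volume(1)[OF V]) simp
 show ?thesis by measurable
qed

text \<open>Off the chart the distance to \<open>x\<close> is at least \<open>\<eta>\<close>, so the
  kernel there is below \<open>A * exp (- (a * \<eta>^2 / b) / e^2)\<close>; the density integrates
  to one and contributes no further factor.\<close>

lemma chart_split:
 assumes p: "smooth_positive_density TYPE('n) M V p"
  and lp: "local_param M U (\<phi> :: real^'n => 'a)" and B: "B \<in> sets borel" "B \<subseteq> U"
  and G: "continuous_on M G" "!!y. y \<in> M ==> \<bar>G y\<bar> <= K" and x: "x \<in> M" and e: "e > 0"
  and b: "!!y. y \<in> M ==> rho_bar TYPE('n) p x * rho_bar TYPE('n) p y <= b"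
  and far: "!!y. y \<in> M ==> y \<notin> \<phi> ` B ==> \<eta> <= norm (x - y)" "\<eta> > 0"
 shows "\<bar>kint p e x G - (LINT u|lborel. indicator B u * (k0 ((norm (x - \<phi> u))\<^sup>2 / (e\<^sup>2 * rho_bar TYPE('n) p x * rho_bar TYPE('n) p (\<phi> u)))
   * (G (\<phi> u) * p (\<phi> u)) * sqrt_det_metric \<phi> u))\<bar> <= A * exp (- (a * \<eta>\<^sup>2 / b) / e\<^sup>2) * K"
proof -
 note pD = densityD[OF p]
 let ?\<rho> = "rho_bar TYPE('n) p"
 let ?k = "%y. k0 ((norm (x - y))\<^sup>2 / (e\<^sup>2 * ?\<rho> x * ?\<rho> y))"
 let ?F = "%y. ?k y * (G y * p y)"
 have \<rho>: "?\<rho> y > 0" if "y \<in> M" for y using pD(2)[OF that] by (rule rho_bar_pos)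
 have [measurable]: "G \<in> borel_measurable V" by (rule borel_measurable_volume(2)[OF V G(1)])
 note [measurable] = pD(4)
 have [measurable]: "?\<rho> \<in> borel_measurable V" unfolding rho_bar_def by measurable
 have [measurable]: "?k \<in> borel_measurable V" by (rule kernel_measurable) measurable
 have [measurable]: "\<phi> ` B \<in> sets V" by (rule chart_measure(1)[OF V lp B x])
 have arg: "0 <= (norm (x - y))\<^sup>2 / (e\<^sup>2 * ?\<rho> x * ?\<rho> y)" if "y \<in> M" for y
  using \<rho>[OF x] \<rho>[OF that] by (intro divide_nonneg_nonneg mult_nonneg_nonneg) auto
 have kA: "?k y <= A" if "y \<in> M" for y
 proof -
  have "?k y <= A * exp (- a * ((norm (x - y))\<^sup>2 / (e\<^sup>2 * ?\<rho> x * ?\<rho> y)))" by (rule k0_bound[OF arg[OF that]])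
  also have "... <= A * 1" using A_pos mult_nonneg_nonneg[OF less_imp_le[OF a_pos] arg[OF that]] by (intro mult_left_mono) (simp_all only: exp_le_one_iff mult_minus_left neg_le_0_iff_le less_imp_le)
  finally show ?thesis by simp
 qed
 have Fb: "\<bar>?F y\<bar> <= A * (K * p y)" if "y \<in> M" for y
  using kA[OF that] k0_nonneg[of "(norm (x - y))\<^sup>2 / (e\<^sup>2 * ?\<rho> x * ?\<rho> y)"] G(2)[OF that] pD(2)[OF that]
  by (intro abs_mult_le) (simp_all only: abs_of_nonneg less_imp_le)
 define F where "F y = ?F y" for y
 have Fm [measurable]: "F \<in> borel_measurable V" unfolding F_def by measurable
 have FB: "\<bar>F y\<bar> <= A * (K * p y)" if "y \<in> M" for y unfolding F_def by (rule Fb[OF that])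
 have int: "integrable V F"
 proof (rule Bochner_Integration.integrable_bound)
  show "integrable V (%y. A * (K * p y))" using pD(5) by simp
  show "AE y in V. norm (F y) <= norm (A * (K * p y))"
   by (rule AE_I2) (use FB space_V order_trans[OF _ abs_ge_self] in \<open>simp only: real_norm_def, blast\<close>)
 qed measurable
 have ii: "integrable V (%y. indicator S y * F y)" if "S \<in> sets V" for S
  using integrable_real_mult_indicator[OF that int] by (simp only: mult.commute)
 have mc: "M - \<phi> ` B \<in> sets V" using sets.compl_sets[of "\<phi> ` B" V] unfolding space_V by measurable
 have i1: "integrable V (%y. indicator (\<phi> ` B) y * F y)" by (rule ii) measurable
 have i2: "integrable V (%y. indicator (M - \<phi> ` B) y * F y)" by (rule ii[OF mc])
 have "kint p e x G = (LINT y|V. indicator (\<phi> ` B) y * F y + indicator (M - \<phi> ` B) y * F y)"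
  unfolding kint_def F_def[symmetric] by (rule Bochner_Integration.integral_cong) (auto simp: indicator_def space_V)
 then have s: "kint p e x G = (LINT y|V. indicator (\<phi> ` B) y * F y) + (LINT y|V. indicator (M - \<phi> ` B) y * F y)"
  unfolding Bochner_Integration.integral_add[OF i1 i2] .
 have ch: "(LINT y|V. indicator (\<phi> ` B) y * F y) = (LINT u|lborel. indicator B u * (?F (\<phi> u) * sqrt_det_metric \<phi> u))"
  unfolding F_def[symmetric] by (rule chart_integral[OF V lp B Fm])
 let ?E = "A * exp (- (a * \<eta>\<^sup>2 / b) / e\<^sup>2) * K"
 have fb: "\<bar>indicator (M - \<phi> ` B) y * F y\<bar> <= ?E * p y" if y: "y \<in> M" for y
 proof (cases "y \<in> \<phi> ` B")
  case True
  have "K \<ge> 0" using G(2)[OF y] by linarith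
  then show ?thesis using True A_pos pD(2)[OF y] by simp
 next
  case False
  have bp: "0 < b" using b[OF y] \<rho>[OF x] \<rho>[OF y] by (meson less_le_trans mult_pos_pos)
  have "\<eta>\<^sup>2 / (b * e\<^sup>2) <= (norm (x - y))\<^sup>2 / (?\<rho> x * ?\<rho> y * e\<^sup>2)"
  proof (rule frac_le)
   show "\<eta>\<^sup>2 <= (norm (x - y))\<^sup>2" using far(1)[OF y False] far(2) by (intro power_mono) simp_all
   show "?\<rho> x * ?\<rho> y * e\<^sup>2 <= b * e\<^sup>2" using b[OF y] by (intro mult_right_mono) simp_all
   show "0 < ?\<rho> x * ?\<rho> y * e\<^sup>2" using e \<rho>[OF x] \<rho>[OF y] by (intro mult_pos_pos) simp_all
  qed simp
  then have "a * (\<eta>\<^sup>2 / (b * e\<^sup>2)) <= a * ((norm (x - y))\<^sup>2 / (?\<rho> x * ?\<rho> y * e\<^sup>2))"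
   by (rule mult_left_mono[OF _ less_imp_le[OF a_pos]])
  moreover have "?\<rho> x * ?\<rho> y * e\<^sup>2 = e\<^sup>2 * ?\<rho> x * ?\<rho> y" "a * (\<eta>\<^sup>2 / (b * e\<^sup>2)) = a * \<eta>\<^sup>2 / b / e\<^sup>2" by (simp_all add: mult_ac)
  ultimately have ex: "exp (- a * ((norm (x - y))\<^sup>2 / (e\<^sup>2 * ?\<rho> x * ?\<rho> y))) <= exp (- (a * \<eta>\<^sup>2 / b) / e\<^sup>2)"
   by (simp only: exp_le_cancel_iff mult_minus_left minus_divide_left[symmetric] neg_le_iff_le)
  have "?k y <= A * exp (- (a * \<eta>\<^sup>2 / b) / e\<^sup>2)"
   using k0_bound[OF arg[OF y]] mult_left_mono[OF ex, of A] A_pos by linarith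
  then have "\<bar>F y\<bar> <= (A * exp (- (a * \<eta>\<^sup>2 / b) / e\<^sup>2)) * (K * p y)"
   unfolding F_def using k0_nonneg[of "(norm (x - y))\<^sup>2 / (e\<^sup>2 * ?\<rho> x * ?\<rho> y)"] G(2)[OF y] pD(2)[OF y]
   by (intro abs_mult_le) (simp_all only: abs_of_nonneg less_imp_le)
  then show ?thesis using False y by (simp add: mult.assoc)
 qed
 have "\<bar>LINT y|V. indicator (M - \<phi> ` B) y * F y\<bar> <= (LINT y|V. \<bar>indicator (M - \<phi> ` B) y * F y\<bar>)"
  by (rule integral_abs_bound)
 also have "... <= (LINT y|V. ?E * p y)"
 proof (rule integral_mono)
  show "integrable V (%y. ?E * p y)" using pD(5) by (rule integrable_mult_right)
  show "\<bar>indicator (M - \<phi> ` B) y * F y\<bar> <= ?E * p y" if "y \<in> space V" for y using fb that unfolding space_V by blast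
 qed (rule integrable_abs[OF i2])
 also have "... = ?E" using pD(6) by simp
 finally show ?thesis unfolding s ch by simp
qed

end

context kernel_manifold
begin

definition chart_limit :: "real => ('a => real) => ('a => real) => (real^'n => 'a) => real^'n => real" where
 "chart_limit \<alpha> p f \<phi> u = coord_laplacian \<phi> (f \<circ> \<phi>) u + (1 + 2 * (\<alpha> - 1) / real CARD('n)) *
   ((coord_gradient \<phi> (p \<circ> \<phi>) u /\<^sub>R p (\<phi> u)) \<bullet> coord_gradient \<phi> (f \<circ> \<phi>) u)"

lemma chart_bias:
 assumes p: "smooth_positive_density TYPE('n) M V p" and f: "smooth_on_manifold TYPE('n) M f"
  and lp: "local_param M U (\<phi> :: real^'n => 'a)" and u0: "u0 \<in> U"
 shows "\<exists>r>0. \<exists>B. \<forall>u\<in>ball u0 r \<inter> U. bias_at \<alpha> p f B (\<phi> u) (chart_limit \<alpha> p f \<phi> u)"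
proof -
 note pD = densityD[OF p]
 let ?\<rho> = "rho_bar TYPE('n) p"
 note inM = local_paramD(5)[OF lp]
 interpret W: weighted_chart k0 k1 k2 k3 A a M U \<phi> "p \<circ> \<phi>" "f \<circ> \<phi>" \<alpha>
  by unfold_locales (use lp smooth_on_chart[OF pD(1) lp] smooth_on_chart[OF f lp] pD(2) inM in auto)
 obtain R r c K \<eta> B where lc: "W.local_const u0 R r c K \<eta>" and B0: "B \<ge> 0" and E: "\<forall>u\<in>cball u0 R. \<forall>e. 0 < e --> e <= 1 -->
  \<bar>(LINT w|lborel. indicator (ball 0 R) w * (k0 (W.sdist R u w / e\<^sup>2) * W.hnum R u w))
   - e ^ (CARD('n) + 2) * (kernel_m2 TYPE('n) k0 / 2 * (p \<circ> \<phi>) u powr ((\<alpha> - 2) / real CARD('n)) * W.limit_chart u)\<bar> <= B * e ^ (CARD('n) + 4) \<and>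
  \<bar>(LINT w|lborel. indicator (ball 0 R) w * (k0 (W.sdist R u w / e\<^sup>2) * W.hden R u w))
   - e ^ CARD('n) * (kernel_m0 TYPE('n) k0 * (p \<circ> \<phi>) u powr (\<alpha> / real CARD('n)))\<bar> <= B * e ^ (CARD('n) + 2)"
  using W.chart_expansion[OF u0] by (elim exE conjE) (rule that)
 note L = W.local_constD[OF lc]
 have pos: "\<forall>x\<in>M. p x > 0" using pD(2) by blast
 note \<rho>c = continuous_on_rho_bar[OF pD(3) pos]
 have \<rho>0: "?\<rho> y > 0" if "y \<in> M" for y using pD(2)[OF that] by (rule rho_bar_pos)
 have fc: "continuous_on M f" by (rule smooth_continuous_on[OF sub f])
 obtain b1 where b1: "b1 > 0" "\<forall>y\<in>M. \<bar>?\<rho> y powr 1\<bar> <= b1" using continuous_on_compact_bounded[OF M \<rho>c] by blast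
 obtain K1 where K1: "K1 > 0" "\<forall>y\<in>M. \<bar>?\<rho> y powr (- \<alpha>)\<bar> <= K1" using continuous_on_compact_bounded[OF M \<rho>c] by blast
 obtain K2 where K2: "K2 > 0" "\<forall>y\<in>M. \<bar>f y\<bar> <= K2" using continuous_on_compact_bounded[OF M fc] by blast
 define b where "b = b1 * b1"
 have b: "b > 0" "!!x y. x \<in> M ==> y \<in> M ==> ?\<rho> x * ?\<rho> y <= b"
 proof -
  show "b > 0" using b1 by (simp add: b_def)
  have "?\<rho> y <= b1" if "y \<in> M" for y using b1(2) that \<rho>0[OF that] by auto
  then show "?\<rho> x * ?\<rho> y <= b" if "x \<in> M" "y \<in> M" for x y
   unfolding b_def using that \<rho>0 b1(1) by (intro mult_mono) (auto intro: less_imp_le)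
 qed
 define K' where "K' = K1 * (2 * K2 + 1)"
 have K'0: "K' > 0" using K1 K2 by (simp add: K'_def)
 have G1: "\<bar>?\<rho> y powr (- \<alpha>) * (f y - f x)\<bar> <= K'" if "x \<in> M" "y \<in> M" for x y
 proof -
  have "\<bar>f y - f x\<bar> <= 2 * K2 + 1" using K2(2)[rule_format, OF that(1)] K2(2)[rule_format, OF that(2)] by linarith
  then show ?thesis unfolding K'_def using K1(2) that(2) by (intro abs_mult_le) auto
 qed
 have G2: "\<bar>?\<rho> y powr (- \<alpha>)\<bar> <= K'" if "y \<in> M" for y
 proof -
  have "\<bar>?\<rho> y powr (- \<alpha>)\<bar> <= K1 * 1" using K1 that by auto
  also have "... <= K'" unfolding K'_def using K1 K2 by (intro mult_left_mono) auto
  finally show ?thesis .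
 qed
 \<comment> \<open>The exponent is that of the remainder of the numerator; for
   \<open>e \<le> 1\<close> it also fits into the weaker remainder of the denominator.\<close>
 obtain C where C: "C > 0" "\<forall>e>0. exp (- (a * \<eta>\<^sup>2 / b) / e\<^sup>2) <= C * e ^ (CARD('n) + 4)"
  using exp_inverse_square_bound[of "a * \<eta>\<^sup>2 / b" "CARD('n) + 4"] a_pos L(7) b(1) by auto
 define D where "D = A * C * K'"
 have D0: "D \<ge> 0" using A_pos C(1) K'0 by (simp add: D_def)
 have rho_eq: "?\<rho> (\<phi> v) = 1 / W.inv_rho v" "(p \<circ> \<phi>) v powr ((\<alpha> - 2) / real CARD('n)) = ?\<rho> (\<phi> v) powr (2 - \<alpha>)"
  "(p \<circ> \<phi>) v powr (\<alpha> / real CARD('n)) = ?\<rho> (\<phi> v) powr (- \<alpha>)" if v: "v \<in> U" for v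
 proof -
  have ex: "(\<alpha> - 2) / real CARD('n) = (- 1 / real CARD('n)) * (2 - \<alpha>)" "\<alpha> / real CARD('n) = (- 1 / real CARD('n)) * (- \<alpha>)"
   by (simp_all add: field_simps)
  show "?\<rho> (\<phi> v) = 1 / W.inv_rho v" using pD(2)[OF inM[OF v]]
   by (simp add: rho_bar_def W.inv_rho_def powr_minus_divide minus_divide_left[symmetric])
  show "(p \<circ> \<phi>) v powr ((\<alpha> - 2) / real CARD('n)) = ?\<rho> (\<phi> v) powr (2 - \<alpha>)"
   "(p \<circ> \<phi>) v powr (\<alpha> / real CARD('n)) = ?\<rho> (\<phi> v) powr (- \<alpha>)"
   unfolding rho_bar_def powr_powr ex o_def by (rule refl)+
 qed
 have "bias_at \<alpha> p f (B + D) (\<phi> u) (chart_limit \<alpha> p f \<phi> u)" if u: "u \<in> ball u0 r" for u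
 proof -
  have ur: "u \<in> cball u0 r" and uR: "u \<in> cball u0 R" using u L(4) by auto
  have "u \<in> cball u0 (2 * R)" using uR L(1) by auto
  then have uU: "u \<in> U" using L(8) by blast
  have xM: "\<phi> u \<in> M" by (rule inM[OF uU])
  have bU: "ball u R \<subseteq> U"
  proof
   fix v assume "v \<in> ball u R"
   then have "v \<in> cball u0 (2 * R)" using uR dist_triangle[of u0 v u] by auto
   then show "v \<in> U" using L(8) by blast
  qed
  have far: "\<eta> <= norm (\<phi> u - y)" if yM: "y \<in> M" and yB: "y \<notin> \<phi> ` ball u R" for y
  proof (rule ccontr)
   assume "\<not> ?thesis"
   then have "norm (y - \<phi> u) < \<eta>" by (simp add: norm_minus_commute)
   then obtain w where "norm w < R" "y = \<phi> (u + w)" using L(16)[OF ur yM] by blast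
   then show False using yB by (auto simp: dist_norm intro!: image_eqI[of _ _ "u + w"])
  qed
  note se = W.sym_expansions[OF lc uR, unfolded sym_expansion_def]
  have meas [measurable]: "W.sdist R u \<in> borel_measurable borel" "W.hnum R u \<in> borel_measurable borel" "W.hden R u \<in> borel_measurable borel"
   using se by blast+
  \<comment> \<open>One passage from the manifold to the chart, centred at \<open>u\<close>, that is
    used for numerator and denominator alike.\<close>
  have tr: "\<bar>kint p e (\<phi> u) G - (LINT w|lborel. indicator (ball 0 R) w * (k0 (W.sdist R u w / e\<^sup>2) * H w))\<bar> <= D * e ^ (CARD('n) + 4)"
   if e: "0 < e" and G: "continuous_on M G" "!!y. y \<in> M ==> \<bar>G y\<bar> <= K'" and Hm [measurable]: "H \<in> borel_measurable borel"
    and HG: "!!v. v \<in> ball u R ==> G (\<phi> v) * p (\<phi> v) * sqrt_det_metric \<phi> v = H (v - u)" for G e and H :: "real^'n => real"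
  proof -
   define F where "F v = indicator (ball 0 R) (v - u) * (k0 (W.sdist R u (v - u) / e\<^sup>2) * H (v - u))" for v
   have [measurable]: "ball (0::real^'n) R \<in> sets borel" by simp
   note [measurable] = Hm meas k0_meas
   have "(%w::real^'n. indicator (ball 0 R) w * (k0 (W.sdist R u w / e\<^sup>2) * H w)) \<in> borel_measurable borel" by measurable
   from measurable_compose[OF borel_measurable_diff[OF measurable_ident_sets[OF refl] borel_measurable_const[of u]] this]
   have Fm: "F \<in> borel_measurable borel" unfolding F_def[abs_def] by (simp only: id_def)
   have pw: "indicator (ball u R) v * (k0 ((norm (\<phi> u - \<phi> v))\<^sup>2 / (e\<^sup>2 * ?\<rho> (\<phi> u) * ?\<rho> (\<phi> v)))
    * (G (\<phi> v) * p (\<phi> v)) * sqrt_det_metric \<phi> v) = F v" for v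
   proof (cases "v \<in> ball u R")
    case True
    then have n: "norm (v - u) < R" "v - u \<in> ball 0 R" by (auto simp: dist_norm norm_minus_commute)
    have vU: "v \<in> U" using True bU by blast
    have arg: "(norm (\<phi> u - \<phi> v))\<^sup>2 / (e\<^sup>2 * ?\<rho> (\<phi> u) * ?\<rho> (\<phi> v)) = W.sdist R u (v - u) / e\<^sup>2"
     unfolding W.sdist_def rho_eq(1)[OF uU] rho_eq(1)[OF vU] using n(1) by (simp add: norm_minus_commute)
    show ?thesis unfolding F_def arg using True n(2) HG[OF True] by (simp add: mult.assoc)
   next
    case False
    then have "v - u \<notin> ball 0 R" by (auto simp: dist_norm norm_minus_commute)
    then show ?thesis using False by (simp add: F_def)
   qed
   have "(LINT v|lborel. F v) = (LINT w|lborel. F (u + 1 *\<^sub>R w))"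
    using integral_affine[OF _ Fm, of 1 u] by simp
   then have i: "(LINT v|lborel. F v) = (LINT w|lborel. indicator (ball 0 R) w * (k0 (W.sdist R u w / e\<^sup>2) * H w))"
    by (simp add: F_def)
   have "\<bar>kint p e (\<phi> u) G - (LINT v|lborel. F v)\<bar> <= A * exp (- (a * \<eta>\<^sup>2 / b) / e\<^sup>2) * K'"
    using chart_split[OF p lp _ bU G xM e b(2)[OF xM] far L(7)] unfolding pw by simp
   also have "... <= A * (C * e ^ (CARD('n) + 4)) * K'"
    using C(2) e A_pos K'0 by (intro mult_right_mono mult_left_mono) auto
   also have "... = D * e ^ (CARD('n) + 4)" by (simp add: D_def)
   finally show ?thesis unfolding i .
  qed
  show ?thesis unfolding bias_at_def
  proof (intro allI impI conjI)
   fix e :: real assume e: "0 < e" "e <= 1"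
   have wt: "?\<rho> (\<phi> v) powr (- \<alpha>) * p (\<phi> v) * sqrt_det_metric \<phi> v = W.weight v" if "v \<in> ball u R" for v
   proof -
    have vU: "v \<in> U" using that bU by blast
    show ?thesis unfolding rho_eq(3)[OF vU, symmetric] W.weight_def
     using pD(2)[OF inM[OF vU]] by (simp add: powr_add mult_ac)
   qed
   have 1: "\<bar>kint p e (\<phi> u) (%y. ?\<rho> y powr (- \<alpha>) * (f y - f (\<phi> u)))
    - (LINT w|lborel. indicator (ball 0 R) w * (k0 (W.sdist R u w / e\<^sup>2) * W.hnum R u w))\<bar> <= D * e ^ (CARD('n) + 4)"
   proof (rule tr[OF e(1) _ G1[OF xM] meas(2)])
    show "continuous_on M (%y. ?\<rho> y powr (- \<alpha>) * (f y - f (\<phi> u)))"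
     by (intro continuous_on_mult continuous_on_diff continuous_on_const \<rho>c fc)
    fix v assume v: "v \<in> ball u R"
    then have "norm (v - u) < R" by (auto simp: dist_norm norm_minus_commute)
    then show "?\<rho> (\<phi> v) powr (- \<alpha>) * (f (\<phi> v) - f (\<phi> u)) * p (\<phi> v) * sqrt_det_metric \<phi> v = W.hnum R u (v - u)"
     using wt[OF v] by (simp add: W.hnum_def wt[OF v, symmetric])
   qed
   have 2: "\<bar>kint p e (\<phi> u) (%y. ?\<rho> y powr (- \<alpha>))
    - (LINT w|lborel. indicator (ball 0 R) w * (k0 (W.sdist R u w / e\<^sup>2) * W.hden R u w))\<bar> <= D * e ^ (CARD('n) + 4)"
   proof (rule tr[OF e(1) \<rho>c G2 meas(3)])
    fix v assume v: "v \<in> ball u R"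
    then have "norm (v - u) < R" by (auto simp: dist_norm norm_minus_commute)
    then show "?\<rho> (\<phi> v) powr (- \<alpha>) * p (\<phi> v) * sqrt_det_metric \<phi> v = W.hden R u (v - u)"
     using wt[OF v] by (simp add: W.hden_def)
   qed
   have lim: "W.limit_chart u = chart_limit \<alpha> p f \<phi> u"
    by (simp add: W.limit_chart_def W.kappa_def chart_limit_def)
   note E' = E[rule_format, OF uR e, unfolded rho_eq(2,3)[OF uU] lim]
   show "\<bar>kint p e (\<phi> u) (%y. ?\<rho> y powr (- \<alpha>) * (f y - f (\<phi> u)))
    - e ^ (CARD('n) + 2) * (kernel_m2 TYPE('n) k0 / 2 * ?\<rho> (\<phi> u) powr (2 - \<alpha>) * chart_limit \<alpha> p f \<phi> u)\<bar> <= (B + D) * e ^ (CARD('n) + 4)"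
    unfolding distrib_right using 1 E'[THEN conjunct1] by linarith
   have "D * e ^ (CARD('n) + 4) <= D * e ^ (CARD('n) + 2)"
    using D0 e by (intro mult_left_mono power_decreasing) auto
   then show "\<bar>kint p e (\<phi> u) (%y. ?\<rho> y powr (- \<alpha>)) - e ^ CARD('n) * (kernel_m0 TYPE('n) k0 * ?\<rho> (\<phi> u) powr (- \<alpha>))\<bar> <= (B + D) * e ^ (CARD('n) + 2)"
    unfolding distrib_right using 2 E'[THEN conjunct2] by linarith
  qed
 qed
 then show ?thesis using L(3) by blast
qed

text \<open>Dividing the two expansions by \<open>e ^ (d + 2)\<close> leaves an error of order
  \<open>e^2\<close>. The coefficient \<open>\<kappa>\<close> is positive, so letting
  \<open>e\<close> tend to zero forces the limits to agree.\<close>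

lemma bias_unique:
 assumes p: "smooth_positive_density TYPE('n) M V p" and x: "x \<in> M"
  and 1: "bias_at \<alpha> p f B1 x L1" and 2: "bias_at \<alpha> p f B2 x L2"
 shows "L1 = L2"
proof -
 define \<kappa> where "\<kappa> = kernel_m2 TYPE('n) k0 / 2 * rho_bar TYPE('n) p x powr (2 - \<alpha>)"
 have "rho_bar TYPE('n) p x > 0" using densityD(2)[OF p x] by (rule rho_bar_pos)
 then have \<kappa>: "\<kappa> > 0" using kernel_m2_pos[where 'n = 'n] by (simp add: \<kappa>_def)
 have "\<kappa> * \<bar>L1 - L2\<bar> <= 0"
 proof (rule abs_le_linear_imp[of 1 _ _ "\<bar>B1 + B2\<bar>"])
  fix e :: real assume e: "0 < e" "e < 1"
  have ee: "e <= 1" using e by simp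
  let ?k = "kint p e x (%y. rho_bar TYPE('n) p y powr (- \<alpha>) * (f y - f x))" and ?d = "e ^ (CARD('n) + 2)"
  have "\<bar>?k - ?d * (\<kappa> * L1)\<bar> <= B1 * e ^ (CARD('n) + 4)" "\<bar>?k - ?d * (\<kappa> * L2)\<bar> <= B2 * e ^ (CARD('n) + 4)"
   using 1 2 e(1) ee unfolding bias_at_def \<kappa>_def by blast+
  then have "\<bar>?d * (\<kappa> * L1) - ?d * (\<kappa> * L2)\<bar> <= B1 * e ^ (CARD('n) + 4) + B2 * e ^ (CARD('n) + 4)" by linarith
  moreover have "\<bar>?d * (\<kappa> * L1) - ?d * (\<kappa> * L2)\<bar> = ?d * (\<kappa> * \<bar>L1 - L2\<bar>)"
   using \<kappa> e by (simp add: abs_mult right_diff_distrib[symmetric])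
  moreover have "B1 * e ^ (CARD('n) + 4) + B2 * e ^ (CARD('n) + 4) = ?d * (e\<^sup>2 * (B1 + B2))"
   by (simp add: power_add power_numeral_reduce algebra_simps)
  ultimately have "\<kappa> * \<bar>L1 - L2\<bar> <= e\<^sup>2 * (B1 + B2)" using e by (simp add: mult_le_cancel_left)
  also have "... <= e\<^sup>2 * \<bar>B1 + B2\<bar>" by (intro mult_left_mono) auto
  also have "... <= e * \<bar>B1 + B2\<bar>" using e by (intro mult_right_mono) (auto simp: power2_eq_square mult_left_le)
  finally show "\<kappa> * \<bar>L1 - L2\<bar> <= 0 + e * \<bar>B1 + B2\<bar>" by simp
 qed simp
 then have "\<bar>L1 - L2\<bar> <= 0" using \<kappa> by (simp add: mult_le_0_iff)
 then show ?thesis by simp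
qed

text \<open>The limit operator is evaluated in the chart that \<open>param_at\<close> selects, which
  may change from point to point without any control of its constants. The uniform constant is
  therefore taken from a fixed chart, and \<open>bias_unique\<close> identifies the value there with
  the selected one.\<close>

lemma bias_global:
 assumes p: "smooth_positive_density TYPE('n) M V p" and f: "smooth_on_manifold TYPE('n) M f"
 shows "\<exists>B>0. \<forall>x\<in>M. bias_at \<alpha> p f B x (limit_operator TYPE('n) M p \<alpha> f x)"
proof (rule mono_if_charts[OF sub M])
 fix B B' x assume B: "B <= B'" and b: "bias_at \<alpha> p f B x (limit_operator TYPE('n) M p \<alpha> f x)"
 have m: "B * e ^ k <= B' * e ^ k" if "0 < e" for e :: real and k using B that by (intro mult_right_mono) auto
 show "bias_at \<alpha> p f B' x (limit_operator TYPE('n) M p \<alpha> f x)"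
  using b unfolding bias_at_def by (meson m order_trans)
next
 fix U and \<phi> :: "real^'n => 'a" and u0 assume lp: "local_param M U \<phi>" "u0 \<in> U"
 obtain r B where r: "r > 0" and B: "!!u. u \<in> ball u0 r \<inter> U ==> bias_at \<alpha> p f B (\<phi> u) (chart_limit \<alpha> p f \<phi> u)"
  using chart_bias[OF p f lp] by blast
 have "bias_at \<alpha> p f B (\<phi> u) (limit_operator TYPE('n) M p \<alpha> f (\<phi> u))" if u: "u \<in> ball u0 r \<inter> U" for u
 proof -
  have x: "\<phi> u \<in> M" using local_paramD(5)[OF lp(1)] u by blast
  obtain U' and \<phi>' :: "real^'n => 'a" and u' where pa: "param_at M (\<phi> u) = (\<phi>', u')"
   and lp': "local_param M U' \<phi>'" "u' \<in> U'" "\<phi>' u' = \<phi> u"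
   by (rule param_at_chart[OF sub x])
  obtain r' B' where r': "r' > 0" and B': "!!v. v \<in> ball u' r' \<inter> U' ==> bias_at \<alpha> p f B' (\<phi>' v) (chart_limit \<alpha> p f \<phi>' v)"
   using chart_bias[OF p f lp'(1,2)] by blast
  have lim: "limit_operator TYPE('n) M p \<alpha> f (\<phi> u) = chart_limit \<alpha> p f \<phi>' u'"
   by (simp add: limit_operator_def laplace_beltrami_def manifold_gradient_def pa chart_limit_def lp'(3))
  have "bias_at \<alpha> p f B' (\<phi> u) (chart_limit \<alpha> p f \<phi>' u')" using B'[of u'] r' lp' by simp
  from bias_unique[OF p x B[OF u] this] show ?thesis using B[OF u] unfolding lim by simp
 qed
 then show "\<exists>r>0. \<exists>B. \<forall>u\<in>ball u0 r \<inter> U. bias_at \<alpha> p f B (\<phi> u) (limit_operator TYPE('n) M p \<alpha> f (\<phi> u))"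
  using r by blast
qed

end

section \<open>Bernstein's inequality\<close>

lemma exp_le_quadratic:
 fixes x :: real
 assumes "x <= 1"
 shows "exp x <= 1 + x + x\<^sup>2"
proof (cases "x \<ge> 0")
 case True
 then show ?thesis using exp_bound[of x] assms by simp
next
 case False
 define y where "y = - x"
 have y: "y > 0" using False by (simp add: y_def)
 \<comment> \<open>For negative \<open>x = - y\<close> the claim reads
   \<open>1 \<le> (1 - y + y^2) * exp y\<close>; it holds already with the quadratic Taylor
   polynomial of \<open>exp y\<close>, in the product with which the linear terms cancel.\<close>
 have "1 <= (1 - y + y\<^sup>2) * (1 + y + y\<^sup>2 / 2)"
 proof -
  have "(1 - y + y\<^sup>2) * (1 + y + y\<^sup>2 / 2) = 1 + y\<^sup>2 / 2 + y ^ 3 / 2 + y ^ 4 / 2"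
   by (simp add: field_simps power2_eq_square power3_eq_cube power4_eq_xxxx)
  then show ?thesis using y by simp
 qed
 also have "... <= (1 - y + y\<^sup>2) * exp y"
 proof (rule mult_left_mono[OF exp_lower_Taylor_quadratic])
  have "0 <= (y - 1/2)\<^sup>2" by simp
  also have "(y - 1/2)\<^sup>2 <= 1 - y + y\<^sup>2" by (simp add: power2_eq_square algebra_simps)
  finally show "0 <= 1 - y + y\<^sup>2" .
 qed (use y in simp)
 finally have "exp (- y) <= 1 - y + y\<^sup>2" by (simp add: exp_minus field_simps)
 then show ?thesis by (simp add: y_def)
qed

text \<open>Chernoff's method with the probability prescribed through \<open>l\<close> and the
  threshold solved for: \<open>s * sqrt l\<close> belongs to the Gaussian regime,
  \<open>B * l\<close> to the range of the summands.\<close>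

lemma bernstein_tail:
 fixes Z :: "'a => real"
 assumes D: "prob_space D" and Z [measurable]: "Z \<in> borel_measurable D" and B: "B > 0" "!!y. y \<in> space D ==> \<bar>Z y\<bar> <= B"
  and mean: "(LINT y|D. Z y) = 0" and var: "(LINT y|D. (Z y)\<^sup>2) <= s\<^sup>2" and s: "s \<ge> 0" and l: "l \<ge> 0"
 shows "measure (\<Pi>\<^sub>M j\<in>{..<N}. D) {X\<in>space (\<Pi>\<^sub>M j\<in>{..<N}. D). real N * (2 * (s * sqrt l + B * l)) <= (\<Sum>j<N. Z (X j))} <= exp (- real N * l)"
proof -
 interpret D: prob_space D by fact
 interpret PS: product_prob_space "%_. D" "{..<N}" by unfold_locales
 let ?P = "\<Pi>\<^sub>M j\<in>{..<N}. D" and ?t = "real N * (2 * (s * sqrt l + B * l))"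
 let ?E = "{X\<in>space ?P. ?t <= (\<Sum>j<N. Z (X j))}"
 \<comment> \<open>In the Gaussian regime the exponent is \<open>sqrt l / s\<close>, up to a
   constant the minimizer. It is used only as long as it stays below \<open>1 / B\<close>, and
   replaced by \<open>1 / B\<close> otherwise, so that \<open>lam * Z\<close> is at most one and
   \<open>exp_le_quadratic\<close> applies.\<close>
 define lam where "lam = (if s > 0 \<and> sqrt l * B <= s then sqrt l / s else 1 / B)"
 have lam0: "lam \<ge> 0" using s l B by (simp add: lam_def)
 have lamB: "lam * B <= 1" using B by (simp add: lam_def field_simps)
 have expo: "lam\<^sup>2 * s\<^sup>2 - lam * (2 * (s * sqrt l + B * l)) <= - l"
 proof (cases "s > 0 \<and> sqrt l * B <= s")
  case True
  then have e: "lam * s = sqrt l" "lam\<^sup>2 * s\<^sup>2 = l" using l by (simp_all add: lam_def power_divide)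
  have "lam * (2 * (s * sqrt l + B * l)) = 2 * ((lam * s) * sqrt l) + lam * (2 * (B * l))" by (simp add: algebra_simps)
  moreover have "(lam * s) * sqrt l = l" unfolding e using l by simp
  moreover have "lam * (2 * (B * l)) \<ge> 0" using lam0 B l by simp
  ultimately show ?thesis unfolding e by linarith
 next
  case False
  then have sl: "s <= sqrt l * B" using s B l by (cases "s > 0") auto
  have lam: "lam = 1 / B" using False by (auto simp: lam_def)
  have "lam\<^sup>2 * s\<^sup>2 = (s / B) * (s / B)" by (simp add: lam power2_eq_square)
  also have "... <= (s / B) * sqrt l" using sl s B by (intro mult_left_mono) (simp_all add: field_simps)
  finally have "lam\<^sup>2 * s\<^sup>2 <= s / B * sqrt l" .
  moreover have "lam * (2 * (s * sqrt l + B * l)) = 2 * (s / B * sqrt l) + 2 * l" using B by (simp add: lam field_simps)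
  moreover have "0 <= s / B * sqrt l" using s B l by simp
  ultimately show ?thesis using l by linarith
 qed
 have ZB: "\<bar>lam * Z y\<bar> <= 1" if "y \<in> space D" for y
  using mult_left_mono[OF B(2)[OF that] lam0] lamB lam0 by (simp add: abs_mult)
 have iZ: "integrable D Z" by (rule D.integrable_const_bound[of _ B]) (use B in auto)
 have iZ2: "integrable D (%y. (Z y)\<^sup>2)"
 proof (rule D.integrable_const_bound[of _ "B\<^sup>2"])
  show "AE y in D. norm ((Z y)\<^sup>2) <= B\<^sup>2" by (rule AE_I2) (use B power_mono[OF B(2), of _ 2] in auto)
 qed measurable
 have iE: "integrable D (%y. exp (lam * Z y))"
 proof (rule D.integrable_const_bound[of _ "exp 1"])
  show "AE y in D. norm (exp (lam * Z y)) <= exp 1" by (rule AE_I2) (use ZB in \<open>auto simp: abs_le_iff\<close>)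
 qed measurable
 have mgf: "(LINT y|D. exp (lam * Z y)) <= exp (lam\<^sup>2 * s\<^sup>2)"
 proof -
  have "(LINT y|D. exp (lam * Z y)) <= (LINT y|D. 1 + lam * Z y + lam\<^sup>2 * (Z y)\<^sup>2)"
  proof (rule integral_mono[OF iE])
   show "integrable D (%y. 1 + lam * Z y + lam\<^sup>2 * (Z y)\<^sup>2)" using iZ iZ2 by simp
   show "exp (lam * Z y) <= 1 + lam * Z y + lam\<^sup>2 * (Z y)\<^sup>2" if "y \<in> space D" for y
    using exp_le_quadratic[of "lam * Z y"] ZB[OF that] by (simp add: power_mult_distrib)
  qed
  also have "... = 1 + lam\<^sup>2 * (LINT y|D. (Z y)\<^sup>2)" using iZ iZ2 mean by (simp add: D.prob_space)
  also have "... <= 1 + lam\<^sup>2 * s\<^sup>2" using var by (intro add_mono mult_left_mono) auto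
  also have "... <= exp (lam\<^sup>2 * s\<^sup>2)" by (rule exp_ge_add_one_self)
  finally show ?thesis .
 qed
 have Em [measurable]: "?E \<in> sets ?P" by measurable
 have ip: "integrable ?P (%X. \<Prod>j<N. exp (lam * Z (X j)))"
  by (rule PS.product_integrable_prod) (use iE in auto)
 have "measure ?P ?E = (LINT X|?P. indicator ?E X)" by (simp add: sets.Int_space_eq2[OF Em])
 also have "... <= (LINT X|?P. exp (- lam * ?t) * (\<Prod>j<N. exp (lam * Z (X j))))"
 proof (rule integral_mono)
  show "integrable ?P (indicator ?E :: _ => real)" using Em by (simp add: PS.P.emeasure_finite less_top[symmetric])
  show "integrable ?P (%X. exp (- lam * ?t) * (\<Prod>j<N. exp (lam * Z (X j))))" using ip by simp
  fix X assume "X \<in> space ?P"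
  show "indicator ?E X <= exp (- lam * ?t) * (\<Prod>j<N. exp (lam * Z (X j)))"
  proof (cases "X \<in> ?E")
   case True
   then have "lam * ?t <= lam * (\<Sum>j<N. Z (X j))" using lam0 by (intro mult_left_mono) auto
   then have "1 <= exp (- lam * ?t + lam * (\<Sum>j<N. Z (X j)))" by simp
   also have "... = exp (- lam * ?t) * (\<Prod>j<N. exp (lam * Z (X j)))" by (simp only: exp_add sum_distrib_left exp_sum[OF finite_lessThan])
   finally show ?thesis using True by simp
  qed (simp add: prod_nonneg)
 qed
 also have "... = exp (- lam * ?t) * (LINT y|D. exp (lam * Z y)) ^ N"
  using PS.product_integral_prod[of "{..<N}" "%_ y. exp (lam * Z y)"] iE by simp
 also have "... <= exp (- lam * ?t) * exp (lam\<^sup>2 * s\<^sup>2) ^ N"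
  using mgf by (intro mult_left_mono power_mono) (auto intro: Bochner_Integration.integral_nonneg)
 also have "... = exp (real N * (lam\<^sup>2 * s\<^sup>2 - lam * (2 * (s * sqrt l + B * l))))"
  by (simp add: exp_of_nat_mult[symmetric] exp_add[symmetric] algebra_simps)
 also have "... <= exp (- real N * l)" using mult_left_mono[OF expo, of "real N"] by simp
 finally show ?thesis .
qed

section \<open>Pointwise bounds for the kernel with a perturbed bandwidth\<close>

lemma powr_perturbation:
 fixes \<beta> :: real
 shows "\<exists>C>0. \<forall>\<rho> \<rho>' \<tau>. \<rho> > 0 --> \<bar>\<rho>' - \<rho>\<bar> <= \<tau> * \<rho> --> \<tau> <= 1 / 10 --> \<bar>\<rho>' powr \<beta> - \<rho> powr \<beta>\<bar> <= C * \<tau> * \<rho> powr \<beta>"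
proof -
 let ?I = "{9/10..11/10::real}"
 have "continuous_on ?I (%t. \<beta> * t powr (\<beta> - 1))" by (intro continuous_intros) auto
 then obtain K where K: "K > 0" "\<forall>t\<in>?I. \<bar>\<beta> * t powr (\<beta> - 1)\<bar> <= K"
  using continuous_on_compact_bounded[OF compact_Icc] by blast
 have "\<bar>\<rho>' powr \<beta> - \<rho> powr \<beta>\<bar> <= K * \<tau> * \<rho> powr \<beta>"
  if \<rho>: "\<rho> > 0" "\<bar>\<rho>' - \<rho>\<bar> <= \<tau> * \<rho>" "\<tau> <= 1 / 10" for \<rho> \<rho>' \<tau>
 proof -
  \<comment> \<open>By homogeneity only the ratio matters; it lies in \<open>[9/10, 11/10]\<close>,
    where the derivative of \<open>t powr \<beta>\<close> is bounded.\<close>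
  define t where "t = \<rho>' / \<rho>"
  have t: "\<bar>t - 1\<bar> <= \<tau>" "\<rho>' = t * \<rho>"
  proof -
   have "t - 1 = (\<rho>' - \<rho>) / \<rho>" using \<rho>(1) by (simp add: t_def diff_divide_distrib)
   then show "\<bar>t - 1\<bar> <= \<tau>" using \<rho>(1,2) by (simp add: abs_divide pos_divide_le_eq)
   show "\<rho>' = t * \<rho>" using \<rho>(1) by (simp add: t_def)
  qed
  have tI: "t \<in> ?I" using t(1) \<rho>(3) unfolding abs_le_iff atLeastAtMost_iff by linarith
  have "norm (t powr \<beta> - 1 powr \<beta>) <= K * norm (t - 1)"
  proof (rule field_differentiable_bound[of ?I])
   show "((%t. t powr \<beta>) has_field_derivative \<beta> * s powr (\<beta> - 1)) (at s within ?I)" if "s \<in> ?I" for s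
    by (rule has_field_derivative_at_within[OF has_real_derivative_powr]) (use that in auto)
  qed (use K tI in auto)
  then have "\<bar>t powr \<beta> - 1\<bar> <= K * \<bar>t - 1\<bar>" by simp
  also have "... <= K * \<tau>" using t(1) K(1) by (intro mult_left_mono) auto
  finally have "\<bar>t powr \<beta> - 1\<bar> <= K * \<tau>" .
  moreover have "\<rho>' powr \<beta> - \<rho> powr \<beta> = (t powr \<beta> - 1) * \<rho> powr \<beta>"
   using tI \<rho>(1) by (simp add: t(2) powr_mult left_diff_distrib)
  ultimately show ?thesis using mult_right_mono[of "\<bar>t powr \<beta> - 1\<bar>" "K * \<tau>" "\<rho> powr \<beta>"]
   by (simp only: abs_mult powr_ge_zero abs_of_nonneg)
 qed
 then show ?thesis using K(1) by blast
qed

text \<open>Relative closeness is uniform continuity of the logarithm: \<open>1/10\<close> there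
  gives \<open>1/5\<close> for the function.\<close>

lemma uniform_ratio:
 fixes q :: "'a::metric_space => real"
 assumes "compact M" "continuous_on M q" "\<forall>x\<in>M. q x > 0"
 shows "\<exists>r>0. \<forall>x\<in>M. \<forall>y\<in>M. dist y x < r --> \<bar>q y - q x\<bar> <= q x / 5"
proof -
 have "continuous_on M (%x. ln (q x))" by (rule continuous_on_ln[OF assms(2)]) (use assms(3) in force)
 then have "uniformly_continuous_on M (%x. ln (q x))" by (rule compact_uniformly_continuous[OF _ assms(1)])
 then have "\<exists>d>0. \<forall>x\<in>M. \<forall>x'\<in>M. dist x' x < d --> dist (ln (q x')) (ln (q x)) < 1 / 10"
  unfolding uniformly_continuous_on_def by (rule allE[of _ "1 / 10"]) simp
 then obtain r where r: "r > 0" "!!x y. x \<in> M ==> y \<in> M ==> dist y x < r ==> \<bar>ln (q y) - ln (q x)\<bar> < 1 / 10"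
  unfolding dist_real_def by blast
 have "\<bar>q y - q x\<bar> <= q x / 5" if xy: "x \<in> M" "y \<in> M" "dist y x < r" for x y
 proof -
  define s where "s = ln (q y) - ln (q x)"
  have s: "\<bar>s\<bar> < 1 / 10" using r(2)[OF xy] by (simp add: s_def)
  have q: "q x > 0" "q y > 0" using assms xy by auto
  have e: "q y = q x * exp s" using q by (simp add: s_def exp_diff)
  have "exp (- \<bar>s\<bar>) \<ge> 1 - \<bar>s\<bar>" using exp_ge_add_one_self[of "- \<bar>s\<bar>"] by simp
  moreover have "exp (- \<bar>s\<bar>) <= exp s" "exp s <= exp \<bar>s\<bar>" by auto
  moreover have "exp \<bar>s\<bar> <= 1 + \<bar>s\<bar> + \<bar>s\<bar>\<^sup>2" using exp_bound[of "\<bar>s\<bar>"] s by simp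
  moreover have "\<bar>s\<bar>\<^sup>2 <= 1 * \<bar>s\<bar>" unfolding power2_eq_square using s by (intro mult_right_mono) auto
  ultimately have "\<bar>exp s - 1\<bar> <= 1 / 5" using s by linarith
  from mult_left_mono[OF this, of "q x"] q(1) have "\<bar>q x * (exp s - 1)\<bar> <= q x / 5" by (simp add: abs_mult)
  then show ?thesis by (simp add: e right_diff_distrib)
 qed
 then show ?thesis using r(1) by blast
qed

context kernel_manifold
begin

text \<open>The weight of a sample point \<open>y\<close> in the row of \<open>x\<close>, for an
  arbitrary bandwidth function; the graph Laplacian is built from its weighted sums.\<close>

definition khat :: "real => ('a => real) => real => 'a => 'a => real" where
 "khat \<alpha> \<rho> e x y = k0 ((norm (x - y))\<^sup>2 / (e\<^sup>2 * \<rho> x * \<rho> y)) * \<rho> y powr (- \<alpha>)"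

definition close_to :: "('a => real) => ('a => real) => real => bool" where
 "close_to p \<rho>' \<tau> \<longleftrightarrow> 0 <= \<tau> \<and> \<tau> <= 1 / 10 \<and> (\<forall>z\<in>M. \<bar>\<rho>' z - rho_bar TYPE('n) p z\<bar> <= \<tau> * rho_bar TYPE('n) p z)"

text \<open>Three bounds of different quality. The first, for near points, has constants from the
  kernel and factors at \<open>x\<close> alone, as the noise term requires. The other two may use
  \<open>c\<close> and \<open>K\<close>, which depend on \<open>p\<close> and
  \<open>\<alpha>\<close>; they serve far points and the bias.\<close>

definition khat_const :: "real => ('a => real) => real => real => real => bool" where
 "khat_const \<alpha> p r c K \<longleftrightarrow> r > 0 \<and> c > 0 \<and> K > 0 \<and>
  (\<forall>x\<in>M. \<forall>y\<in>M. norm (x - y) < r --> p y <= 2 * p x) \<and>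
  (\<forall>\<rho>' \<tau> e. \<forall>x\<in>M. \<forall>y\<in>M. close_to p \<rho>' \<tau> --> e > 0 -->
   (norm (x - y) < r --> K * \<tau> <= 1 -->
    khat \<alpha> \<rho>' e x y <= 2 * A * rho_bar TYPE('n) p x powr (- \<alpha>) * exp (- (a / (2 * e\<^sup>2 * (rho_bar TYPE('n) p x)\<^sup>2)) * (norm (x - y))\<^sup>2)) \<and>
   khat \<alpha> \<rho>' e x y <= K * exp (- (c * (norm (x - y))\<^sup>2) / e\<^sup>2) \<and>
   \<bar>khat \<alpha> \<rho>' e x y - khat \<alpha> (rho_bar TYPE('n) p) e x y\<bar> <= K * \<tau> * exp (- (c * (norm (x - y))\<^sup>2) / e\<^sup>2))"

lemma close_toD:
 assumes p: "smooth_positive_density TYPE('n) M V p" and c: "close_to p \<rho>' \<tau>" and z: "z \<in> M"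
 shows "rho_bar TYPE('n) p z > 0" "9/10 * rho_bar TYPE('n) p z <= \<rho>' z" "\<rho>' z <= 11/10 * rho_bar TYPE('n) p z" "\<rho>' z > 0"
proof -
 show r: "rho_bar TYPE('n) p z > 0" using densityD(2)[OF p z] by (rule rho_bar_pos)
 have "\<tau> * rho_bar TYPE('n) p z <= 1/10 * rho_bar TYPE('n) p z" using c r unfolding close_to_def by (intro mult_right_mono) auto
 then have "\<bar>\<rho>' z - rho_bar TYPE('n) p z\<bar> <= 1/10 * rho_bar TYPE('n) p z" using c z unfolding close_to_def by force
 then show "9/10 * rho_bar TYPE('n) p z <= \<rho>' z" "\<rho>' z <= 11/10 * rho_bar TYPE('n) p z" by linarith+
 then show "\<rho>' z > 0" using r by linarith
qed

lemma khat_bounds: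
 assumes p: "smooth_positive_density TYPE('n) M V p"
 shows "\<exists>r c K. khat_const \<alpha> p r c K"
proof -
 note pD = densityD[OF p]
 let ?\<rho> = "rho_bar TYPE('n) p"
 have pos: "\<forall>x\<in>M. p x > 0" using pD(2) by blast
 note \<rho>c = continuous_on_rho_bar[OF pD(3) pos, where 'n = 'n]
 have \<rho>0: "?\<rho> y > 0" if "y \<in> M" for y using pD(2)[OF that] by (rule rho_bar_pos)
 have \<rho>c1: "continuous_on M ?\<rho>" by (rule continuous_on_eq[OF \<rho>c[of 1]]) (use \<rho>0 in \<open>simp add: abs_of_pos\<close>)
 have qpos: "\<forall>x\<in>M. ?\<rho> x powr (- \<alpha>) > 0" using \<rho>0 by fastforce
 obtain r1 where r1: "r1 > 0" "\<forall>x\<in>M. \<forall>y\<in>M. dist y x < r1 --> \<bar>p y - p x\<bar> <= p x / 5"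
  using uniform_ratio[OF M pD(3) pos] by blast
 obtain r2 where r2: "r2 > 0" "\<forall>x\<in>M. \<forall>y\<in>M. dist y x < r2 --> \<bar>?\<rho> y - ?\<rho> x\<bar> <= ?\<rho> x / 5"
  using uniform_ratio[OF M \<rho>c1] \<rho>0 by blast
 obtain r3 where r3: "r3 > 0" "\<forall>x\<in>M. \<forall>y\<in>M. dist y x < r3 --> \<bar>?\<rho> y powr (- \<alpha>) - ?\<rho> x powr (- \<alpha>)\<bar> <= ?\<rho> x powr (- \<alpha>) / 5"
  using uniform_ratio[OF M \<rho>c qpos] by blast
 obtain b1 where b1: "b1 > 0" "\<forall>y\<in>M. \<bar>?\<rho> y\<bar> <= b1" using continuous_on_compact_bounded[OF M \<rho>c1] by blast
 obtain K1 where K1: "K1 > 0" "\<forall>y\<in>M. \<bar>?\<rho> y powr (- \<alpha>)\<bar> <= K1" using continuous_on_compact_bounded[OF M \<rho>c] by blast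
 obtain C where C: "C > 0" "!!\<rho> \<rho>' \<tau>. \<rho> > 0 ==> \<bar>\<rho>' - \<rho>\<bar> <= \<tau> * \<rho> ==> \<tau> <= 1 / 10 ==> \<bar>\<rho>' powr (- \<alpha>) - \<rho> powr (- \<alpha>)\<bar> <= C * \<tau> * \<rho> powr (- \<alpha>)"
  using powr_perturbation[of "- \<alpha>"] by blast
 define r where "r = min r1 (min r2 r3)"
 \<comment> \<open>A quarter of the decay rate: \<open>k0_scale_bound\<close> retains one half of
   the exponent, and half of that is spent on the factor \<open>X\<close>. The square of
   \<open>b1\<close> bounds the product of two bandwidths.\<close>
 define c where "c = a / (4 * b1\<^sup>2)"
 \<comment> \<open>The summands serve in turn the smallness \<open>C * \<tau> \<le> 1/4\<close>, the
   crude kernel bound and the perturbation bound.\<close>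
 define K where "K = 4 * C + A * (1 + C) * K1 + A * K1 * (C + 12 / a * (1 + C))"
 have AK: "0 < A * K1" "0 <= A * K1 * (C + 12 / a * (1 + C))" "0 <= A * (1 + C) * K1" using A_pos K1 C a_pos by auto
 have K: "K > 0" "4 * C <= K" "A * (1 + C) * K1 <= K" "A * K1 * (C + 12 / a * (1 + C)) <= K"
  using AK C by (auto simp: K_def)
 have c: "c > 0" using a_pos b1 by (simp add: c_def)
 have \<rho>b: "?\<rho> y <= b1" if "y \<in> M" for y using b1(2)[rule_format, OF that] \<rho>0[OF that] by simp
 have "khat_const \<alpha> p r c K"
  unfolding khat_const_def
 proof (intro conjI allI ballI impI)
  show "r > 0" using r1 r2 r3 by (simp add: r_def)
  show "c > 0" by (rule c)
  show "K > 0" by (rule K(1))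
 next
  fix x y assume xy: "x \<in> M" "y \<in> M" and n: "norm (x - y) < r"
  have d: "dist y x < r1" using n by (simp add: r_def dist_norm norm_minus_commute)
  show "p y <= 2 * p x" using r1(2)[rule_format, OF xy d] pD(2)[OF xy(1)] by linarith
 next
  fix \<rho>' \<tau> e x y assume xy: "x \<in> M" "y \<in> M" and cl: "close_to p \<rho>' \<tau>" and e: "(e::real) > 0"
  have \<tau>: "0 <= \<tau>" "\<tau> <= 1 / 10" "\<bar>\<rho>' y - ?\<rho> y\<bar> <= \<tau> * ?\<rho> y" "\<bar>\<rho>' x - ?\<rho> x\<bar> <= \<tau> * ?\<rho> x" using cl xy by (auto simp: close_to_def)
  note clx = close_toD[OF p cl xy(1)] and cly = close_toD[OF p cl xy(2)]
  let ?n = "(norm (x - y))\<^sup>2"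
  define X where "X = ?n / (e\<^sup>2 * ?\<rho> x * ?\<rho> y)"
  define X' where "X' = ?n / (e\<^sup>2 * \<rho>' x * \<rho>' y)"
  have kh: "khat \<alpha> ?\<rho> e x y = k0 X * ?\<rho> y powr (- \<alpha>)" "khat \<alpha> \<rho>' e x y = k0 X' * \<rho>' y powr (- \<alpha>)"
   by (simp_all only: khat_def X_def X'_def)
  have "0 < e\<^sup>2 * ?\<rho> x * ?\<rho> y" "0 < e\<^sup>2 * \<rho>' x * \<rho>' y" using e clx(1,4) cly(1,4) by (intro mult_pos_pos; simp)+
  note pp0 = this
  have X0: "X \<ge> 0" "X' \<ge> 0" unfolding X_def X'_def
   by (rule divide_nonneg_pos[OF zero_le_power2 pp0(1)], rule divide_nonneg_pos[OF zero_le_power2 pp0(2)])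
  have P: "\<bar>\<rho>' y powr (- \<alpha>) - ?\<rho> y powr (- \<alpha>)\<bar> <= C * \<tau> * ?\<rho> y powr (- \<alpha>)" by (rule C(2)[OF cly(1) \<tau>(3,2)])
  have q0: "0 <= ?\<rho> y powr (- \<alpha>)" "?\<rho> y powr (- \<alpha>) <= K1" using K1(2) xy by auto
  have prod_le: "\<rho>' x * \<rho>' y <= 121/100 * (?\<rho> x * ?\<rho> y)" "81/100 * (?\<rho> x * ?\<rho> y) <= \<rho>' x * \<rho>' y"
  proof -
   have "\<rho>' x * \<rho>' y <= (11/10 * ?\<rho> x) * (11/10 * ?\<rho> y)" using clx(1,4) cly(1,4) by (intro mult_mono clx(3) cly(3)) simp_all
   moreover have "(9/10 * ?\<rho> x) * (9/10 * ?\<rho> y) <= \<rho>' x * \<rho>' y" using clx(1,4) cly(1,4) by (intro mult_mono clx(2) cly(2)) simp_all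
   moreover have "(11/10 * ?\<rho> x) * (11/10 * ?\<rho> y) = 121/100 * (?\<rho> x * ?\<rho> y)" "(9/10 * ?\<rho> x) * (9/10 * ?\<rho> y) = 81/100 * (?\<rho> x * ?\<rho> y)" by simp_all
   ultimately show "\<rho>' x * \<rho>' y <= 121/100 * (?\<rho> x * ?\<rho> y)" "81/100 * (?\<rho> x * ?\<rho> y) <= \<rho>' x * \<rho>' y" by simp_all
  qed
  define Q where "Q = c * (?n / e\<^sup>2)"
  have exp_le: "exp (- (a * t)) <= exp (- (c * ?n) / e\<^sup>2)" if "Q <= a * t" for t
  proof -
   have "Q = c * ?n / e\<^sup>2" by (simp only: Q_def times_divide_eq_right)
   then show ?thesis using that by (simp only: exp_le_cancel_iff minus_divide_left[symmetric] neg_le_iff_le)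
  qed
  { assume near: "norm (x - y) < r" "K * \<tau> <= 1"
   have d: "dist y x < r2" "dist y x < r3" using near by (auto simp: r_def dist_norm norm_minus_commute)
   have y1: "?\<rho> y <= 6/5 * ?\<rho> x" using r2(2)[rule_format, OF xy d(1)] by linarith
   have y2: "?\<rho> y powr (- \<alpha>) <= 6/5 * ?\<rho> x powr (- \<alpha>)" using r3(2)[rule_format, OF xy d(2)] by linarith
   have "4 * (C * \<tau>) <= K * \<tau>" using K(2) \<tau>(1) mult_right_mono[OF K(2) \<tau>(1)] by simp
   then have "C * \<tau> <= 1/4" using near(2) by linarith
   then have "C * \<tau> * ?\<rho> y powr (- \<alpha>) <= 1/4 * ?\<rho> y powr (- \<alpha>)" by (intro mult_right_mono) auto
   then have w: "\<rho>' y powr (- \<alpha>) <= 2 * ?\<rho> x powr (- \<alpha>)" using P y2 powr_ge_zero[of "?\<rho> x" "- \<alpha>"] by linarith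
   have "?\<rho> x * ?\<rho> y <= ?\<rho> x * (6/5 * ?\<rho> x)" using y1 clx(1) by (intro mult_left_mono) auto
   moreover have "?\<rho> x * (6/5 * ?\<rho> x) = 6/5 * (?\<rho> x)\<^sup>2" by (simp add: power2_eq_square)
   moreover have "0 <= (?\<rho> x)\<^sup>2" by simp
   \<comment> \<open>Since \<open>121/100 * 6/5 < 2\<close>, one half of the decay rate
     \<open>a\<close> survives with the bandwidth at \<open>x\<close> alone.\<close>
   ultimately have pr: "\<rho>' x * \<rho>' y <= 2 * (?\<rho> x)\<^sup>2" using prod_le(1) by linarith
   have "?n / (e\<^sup>2 * (2 * (?\<rho> x)\<^sup>2)) <= ?n / (e\<^sup>2 * (\<rho>' x * \<rho>' y))"
   proof (rule divide_left_mono)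
    show "e\<^sup>2 * (\<rho>' x * \<rho>' y) <= e\<^sup>2 * (2 * (?\<rho> x)\<^sup>2)" by (rule mult_left_mono[OF pr]) simp
    show "0 < e\<^sup>2 * (2 * (?\<rho> x)\<^sup>2) * (e\<^sup>2 * (\<rho>' x * \<rho>' y))" using clx(1,4) cly(4) e by simp
   qed simp
   then have "a * (?n / (e\<^sup>2 * (2 * (?\<rho> x)\<^sup>2))) <= a * X'" unfolding X'_def using a_pos by (simp only: mult.assoc mult_le_cancel_left_pos)
   moreover have "a * (?n / (e\<^sup>2 * (2 * (?\<rho> x)\<^sup>2))) = a / (2 * e\<^sup>2 * (?\<rho> x)\<^sup>2) * ?n" by (simp add: mult_ac)
   ultimately have ex: "exp (- a * X') <= exp (- (a / (2 * e\<^sup>2 * (?\<rho> x)\<^sup>2)) * ?n)" by simp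
   have kx: "k0 X' <= A * exp (- (a / (2 * e\<^sup>2 * (?\<rho> x)\<^sup>2)) * ?n)"
    using k0_bound[OF X0(2)] mult_left_mono[OF ex less_imp_le[OF A_pos]] by linarith
   have "khat \<alpha> \<rho>' e x y <= A * exp (- (a / (2 * e\<^sup>2 * (?\<rho> x)\<^sup>2)) * ?n) * (2 * ?\<rho> x powr (- \<alpha>))"
    unfolding kh by (rule mult_mono[OF kx w]) (use A_pos in auto)
   then show "khat \<alpha> \<rho>' e x y <= 2 * A * ?\<rho> x powr (- \<alpha>) * exp (- (a / (2 * e\<^sup>2 * (?\<rho> x)\<^sup>2)) * ?n)" by (simp only: mult_ac) }
  have xyb: "?\<rho> x * ?\<rho> y <= b1\<^sup>2" unfolding power2_eq_square using clx(1) cly(1) b1(1) by (intro mult_mono \<rho>b xy) simp_all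
  have cX: "4 * Q <= a * X"
  proof -
   have "?n / (e\<^sup>2 * b1\<^sup>2) <= ?n / (e\<^sup>2 * (?\<rho> x * ?\<rho> y))"
   proof (rule divide_left_mono)
    show "e\<^sup>2 * (?\<rho> x * ?\<rho> y) <= e\<^sup>2 * b1\<^sup>2" by (rule mult_left_mono[OF xyb]) simp
    show "0 < e\<^sup>2 * b1\<^sup>2 * (e\<^sup>2 * (?\<rho> x * ?\<rho> y))" using clx(1) cly(1) e b1(1) by simp
   qed simp
   then have "a * (?n / (e\<^sup>2 * b1\<^sup>2)) <= a * X" unfolding X_def using a_pos by (simp only: mult.assoc mult_le_cancel_left_pos)
   moreover have "a * (?n / (e\<^sup>2 * b1\<^sup>2)) = 4 * Q" by (simp add: c_def Q_def)
   ultimately show ?thesis by (simp only:)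
  qed
  have cn0: "0 <= Q" using c by (simp add: Q_def)
  define t where "t = (?\<rho> x * ?\<rho> y) / (\<rho>' x * \<rho>' y)"
  have pp: "0 < \<rho>' x * \<rho>' y" "0 < ?\<rho> x * ?\<rho> y" using clx cly by simp_all
  have Xt: "X' = X * t" using clx cly by (simp add: t_def X_def X'_def)
  have t: "1/2 <= t" "t > 0" using prod_le pp by (simp_all add: t_def pos_le_divide_eq[OF pp(1)] divide_pos_pos)
  \<comment> \<open>The difference of the bandwidth products costs \<open>21/10\<close> and their
    ratio \<open>100/81\<close>, together less than \<open>3\<close>.\<close>
  have t1: "\<bar>t - 1\<bar> <= 3 * \<tau>"
  proof -
   have "\<bar>(\<rho>' x - ?\<rho> x) * \<rho>' y\<bar> <= (\<tau> * ?\<rho> x) * (11/10 * ?\<rho> y)" using \<tau> cly by (intro abs_mult_le) auto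
   moreover have "\<bar>?\<rho> x * (\<rho>' y - ?\<rho> y)\<bar> <= ?\<rho> x * (\<tau> * ?\<rho> y)" using \<tau> clx by (intro abs_mult_le) auto
   moreover have "\<rho>' x * \<rho>' y - ?\<rho> x * ?\<rho> y = (\<rho>' x - ?\<rho> x) * \<rho>' y + ?\<rho> x * (\<rho>' y - ?\<rho> y)" by (simp add: algebra_simps)
   moreover have "(\<tau> * ?\<rho> x) * (11/10 * ?\<rho> y) = 11/10 * (\<tau> * (?\<rho> x * ?\<rho> y))" "?\<rho> x * (\<tau> * ?\<rho> y) = \<tau> * (?\<rho> x * ?\<rho> y)" by simp_all
   ultimately have "\<bar>\<rho>' x * \<rho>' y - ?\<rho> x * ?\<rho> y\<bar> <= 21/10 * (\<tau> * (?\<rho> x * ?\<rho> y))" by linarith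
   moreover have "\<tau> * (81/100 * (?\<rho> x * ?\<rho> y)) <= \<tau> * (\<rho>' x * \<rho>' y)" using prod_le(2) \<tau>(1) by (intro mult_left_mono) auto
   moreover have "0 <= \<tau> * (?\<rho> x * ?\<rho> y)" using \<tau>(1) pp by simp
   moreover have "\<tau> * (81/100 * (?\<rho> x * ?\<rho> y)) = 81/100 * (\<tau> * (?\<rho> x * ?\<rho> y))" by simp
   ultimately have "\<bar>?\<rho> x * ?\<rho> y - \<rho>' x * \<rho>' y\<bar> <= 3 * (\<tau> * (\<rho>' x * \<rho>' y))" by linarith
   moreover have "t - 1 = (?\<rho> x * ?\<rho> y - \<rho>' x * \<rho>' y) / (\<rho>' x * \<rho>' y)" using clx(4) cly(4) by (simp add: t_def diff_divide_distrib)
   ultimately show ?thesis using pp by (simp add: abs_divide pos_divide_le_eq mult.assoc)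
  qed
  have w': "\<rho>' y powr (- \<alpha>) <= (1 + C) * K1"
  proof -
   have "C * \<tau> * ?\<rho> y powr (- \<alpha>) <= C * 1 * K1" using C(1) \<tau> q0 by (intro mult_mono) auto
   then show ?thesis using P q0 by (simp add: algebra_simps)
  qed
  have kX': "k0 X' <= A * exp (- (c * ?n) / e\<^sup>2)"
  proof -
   have "1/2 * X <= t * X" by (rule mult_right_mono[OF t(1) X0(1)])
   then have "a * (1/2 * X) <= a * X'" unfolding Xt using a_pos by (simp only: mult_le_cancel_left_pos mult.commute[of X t])
   then have "Q <= a * X'" using cX cn0 by linarith
   from mult_left_mono[OF exp_le[OF this] less_imp_le[OF A_pos]] show ?thesis using k0_bound[OF X0(2)] by simp
  qed
  have "khat \<alpha> \<rho>' e x y <= (A * exp (- (c * ?n) / e\<^sup>2)) * ((1 + C) * K1)"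
   unfolding kh by (rule mult_mono[OF kX' w']) (use A_pos in auto)
  also have "... = (A * (1 + C) * K1) * exp (- (c * ?n) / e\<^sup>2)" by simp
  also have "... <= K * exp (- (c * ?n) / e\<^sup>2)" using K(3) by (intro mult_right_mono) auto
  finally show "khat \<alpha> \<rho>' e x y <= K * exp (- (c * ?n) / e\<^sup>2)" .
  have kd: "\<bar>k0 X' - k0 X\<bar> <= A * exp (- (c * ?n) / e\<^sup>2) * (12 / a * \<tau>)"
  proof -
   \<comment> \<open>The available exponential is \<open>q * q\<close>: one copy absorbs the factor
     \<open>X\<close> through \<open>q * X \<le> 4 / a\<close>, the other one keeps the Gaussian
     decay.\<close>
   define q where "q = exp (- (a * (1/4 * X)))"
   have q: "q > 0" by (simp add: q_def)
   have "\<bar>k0 (X * t) - k0 X\<bar> <= A * exp (- a * (1/2 * X)) * (X * \<bar>t - 1\<bar>)"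
    by (rule k0_scale_bound[OF X0(1) t(2) t(1)]) simp_all
   moreover have "exp (- a * (1/2 * X)) = q * q" by (simp add: q_def exp_add[symmetric])
   moreover have "A * (q * q) * (X * \<bar>t - 1\<bar>) = (A * q) * ((q * X) * \<bar>t - 1\<bar>)" by (simp only: mult_ac)
   ultimately have h1: "\<bar>k0 (X * t) - k0 X\<bar> <= (A * q) * ((q * X) * \<bar>t - 1\<bar>)" by simp
   have h2: "q * X <= 4 / a"
   proof -
    have "a * (1/4 * X) <= exp (a * (1/4 * X))" using exp_ge_add_one_self[of "a * (1/4 * X)"] by linarith
    then have "q * (a * (1/4 * X)) <= q * exp (a * (1/4 * X))" using q by (intro mult_left_mono) auto
    moreover have "q * exp (a * (1/4 * X)) = 1" by (simp add: q_def exp_minus)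
    ultimately have "q * X * a <= 4" by (simp add: mult_ac)
    then show ?thesis using a_pos by (simp add: pos_le_divide_eq)
   qed
   have e1: "q <= exp (- (c * ?n) / e\<^sup>2)" unfolding q_def by (rule exp_le) (use cX in linarith)
   have "(q * X) * \<bar>t - 1\<bar> <= 4 / a * (3 * \<tau>)" using a_pos by (intro mult_mono[OF h2 t1]) auto
   moreover have "4 / a * (3 * \<tau>) = 12 / a * \<tau>" by simp
   ultimately have h3: "(q * X) * \<bar>t - 1\<bar> <= 12 / a * \<tau>" by simp
   have "(A * q) * ((q * X) * \<bar>t - 1\<bar>) <= (A * exp (- (c * ?n) / e\<^sup>2)) * (12 / a * \<tau>)"
    using A_pos q X0(1) by (intro mult_mono[OF mult_left_mono[OF e1] h3]) auto
   with h1 show ?thesis unfolding Xt by linarith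
  qed
  have k0X: "k0 X <= A * exp (- (c * ?n) / e\<^sup>2)"
  proof -
   have "Q <= a * X" using cX cn0 by linarith
   from mult_left_mono[OF exp_le[OF this] less_imp_le[OF A_pos]] show ?thesis using k0_bound[OF X0(1)] by simp
  qed
  let ?E = "A * exp (- (c * ?n) / e\<^sup>2)"
  have "khat \<alpha> \<rho>' e x y - khat \<alpha> ?\<rho> e x y = (k0 X' - k0 X) * \<rho>' y powr (- \<alpha>) + k0 X * (\<rho>' y powr (- \<alpha>) - ?\<rho> y powr (- \<alpha>))"
   unfolding kh by (simp add: left_diff_distrib right_diff_distrib)
  moreover have "\<bar>(k0 X' - k0 X) * \<rho>' y powr (- \<alpha>)\<bar> <= (?E * (12 / a * \<tau>)) * ((1 + C) * K1)"
   by (rule abs_mult_le[OF kd]) (use w' in simp)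
  moreover have "\<bar>k0 X * (\<rho>' y powr (- \<alpha>) - ?\<rho> y powr (- \<alpha>))\<bar> <= ?E * (C * \<tau> * K1)"
  proof (rule abs_mult_le)
   show "\<bar>k0 X\<bar> <= ?E" using k0X k0_nonneg[of X] by simp
   have "C * \<tau> * ?\<rho> y powr (- \<alpha>) <= C * \<tau> * K1" using q0 C(1) \<tau>(1) by (intro mult_left_mono) auto
   then show "\<bar>\<rho>' y powr (- \<alpha>) - ?\<rho> y powr (- \<alpha>)\<bar> <= C * \<tau> * K1" using P by linarith
  qed
  moreover have "(?E * (12 / a * \<tau>)) * ((1 + C) * K1) + ?E * (C * \<tau> * K1) = (A * K1 * (C + 12 / a * (1 + C))) * (\<tau> * exp (- (c * ?n) / e\<^sup>2))"
   by (simp add: algebra_simps)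
  moreover have "(A * K1 * (C + 12 / a * (1 + C))) * (\<tau> * exp (- (c * ?n) / e\<^sup>2)) <= K * (\<tau> * exp (- (c * ?n) / e\<^sup>2))"
   using K(4) \<tau>(1) by (intro mult_right_mono) auto
  ultimately show "\<bar>khat \<alpha> \<rho>' e x y - khat \<alpha> ?\<rho> e x y\<bar> <= K * \<tau> * exp (- (c * ?n) / e\<^sup>2)"
   unfolding mult.assoc by linarith
 qed
 then show ?thesis by blast
qed

end

section \<open>Concentration of a weighted mean and arithmetic of the errors\<close>

lemma prob_compl_bound:
 assumes "prob_space P" "E1 \<in> sets P" "E2 \<in> sets P" "E3 \<in> sets P" "G \<in> sets P"
  and "measure P E1 <= q" "measure P E2 <= q" "measure P E3 <= q" and sub: "space P - (E1 \<union> E2 \<union> E3) \<subseteq> G"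
 shows "1 - 3 * q <= measure P G"
proof -
 interpret prob_space P by fact
 have "measure P (E1 \<union> E2 \<union> E3) <= measure P (E1 \<union> E2) + measure P E3" by (rule measure_Un_le) (use assms in auto)
 moreover have "measure P (E1 \<union> E2) <= measure P E1 + measure P E2" by (rule measure_Un_le) (use assms in auto)
 moreover have "measure P (space P - (E1 \<union> E2 \<union> E3)) = 1 - measure P (E1 \<union> E2 \<union> E3)"
  by (rule prob_compl) (use assms in auto)
 moreover have "measure P (space P - (E1 \<union> E2 \<union> E3)) <= measure P G" by (rule finite_measure_mono[OF sub assms(5)])
 ultimately show ?thesis using assms(6-8) by linarith
qed

text \<open>
 The variance of \<open>\<kappa> (g - \<theta>)\<close> is at most \<open>H\<close> times the weighted second moment of \<open>g\<close>, since
 \<open>\<theta>\<close> minimizes the mean of \<open>\<kappa> (g - \<theta>)\<^sup>2\<close>.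
\<close>

lemma weighted_mean_concentration:
 fixes \<kappa> g :: "'a => real"
 assumes D: "prob_space D" and m [measurable]: "\<kappa> \<in> borel_measurable D" "g \<in> borel_measurable D"
  and \<kappa>: "!!y. y \<in> space D ==> 0 <= \<kappa> y" "!!y. y \<in> space D ==> \<kappa> y <= H"
  and gK: "!!y. y \<in> space D ==> \<bar>g y\<bar> <= K" and G: "!!y. y \<in> space D ==> \<kappa> y * \<bar>g y\<bar> <= G" "G > 0"
  and \<delta>: "(LINT y|D. \<kappa> y) = \<delta>" "\<delta> > 0" and \<nu>: "(LINT y|D. \<kappa> y * g y) = \<nu>"
  and W: "(LINT y|D. \<kappa> y * (g y)\<^sup>2) <= W" and l: "0 <= l" "256 * (H * l) <= \<delta>" and N: "N > 0"
 shows "\<nu>\<^sup>2 <= \<delta> * W"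
  and "1 - 3 * exp (- real N * l) <= measure (\<Pi>\<^sub>M j\<in>{..<N}. D) {X\<in>space (\<Pi>\<^sub>M j\<in>{..<N}. D).
   \<bar>(\<Sum>j<N. \<kappa> (X j) * g (X j)) / (\<Sum>j<N. \<kappa> (X j)) - \<nu> / \<delta>\<bar> <= 4 / \<delta> * (sqrt (H * W) * sqrt l + (G + H * \<bar>\<nu> / \<delta>\<bar>) * l) \<and> (\<Sum>j<N. \<kappa> (X j)) > 0}"
proof -
 interpret D: prob_space D by fact
 define \<theta> where "\<theta> = \<nu> / \<delta>"
 obtain y0 where y0: "y0 \<in> space D" using D.not_empty by blast
 have H0: "H \<ge> 0" using \<kappa>[OF y0] by linarith
 have K0: "K \<ge> 0" using gK[OF y0] by linarith
 have bnd: "integrable D F" if [measurable]: "F \<in> borel_measurable D" and "!!y. y \<in> space D ==> \<bar>F y\<bar> <= B" for F :: "'a => real" and B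
  by (rule D.integrable_const_bound[of _ B]) (use that in auto)
 have \<kappa>H: "\<bar>\<kappa> y\<bar> <= H" if "y \<in> space D" for y using \<kappa>[OF that] by simp
 have i0: "integrable D \<kappa>" by (rule bnd[OF m(1) \<kappa>H])
 have i1: "integrable D (%y. \<kappa> y * g y)" by (rule bnd[of _ "H * K"]) (auto intro!: abs_mult_le \<kappa>H gK)
 have g2: "\<bar>(g y)\<^sup>2\<bar> <= K\<^sup>2" if "y \<in> space D" for y using power_mono[OF gK[OF that], of 2] by simp
 have i2: "integrable D (%y. \<kappa> y * (g y)\<^sup>2)" by (rule bnd[of _ "H * K\<^sup>2"]) (auto intro!: abs_mult_le \<kappa>H g2)
 let ?Q = "%y. \<kappa> y * (g y - \<theta>)\<^sup>2"
 have Qe: "?Q y = \<kappa> y * (g y)\<^sup>2 - 2 * \<theta> * (\<kappa> y * g y) + \<theta>\<^sup>2 * \<kappa> y" for y by (simp add: power2_eq_square algebra_simps)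
 have iQ: "integrable D ?Q" unfolding Qe using i0 i1 i2 by simp
 have EQ: "(LINT y|D. ?Q y) = (LINT y|D. \<kappa> y * (g y)\<^sup>2) - \<nu>\<^sup>2 / \<delta>"
 proof -
  have "(LINT y|D. ?Q y) = (LINT y|D. \<kappa> y * (g y)\<^sup>2) - 2 * \<theta> * \<nu> + \<theta>\<^sup>2 * \<delta>"
   unfolding Qe using i0 i1 i2 \<delta> \<nu> by simp
  also have "... = (LINT y|D. \<kappa> y * (g y)\<^sup>2) - \<nu>\<^sup>2 / \<delta>" using \<delta>(2) by (simp add: \<theta>_def power2_eq_square)
  finally show ?thesis .
 qed
 have "0 <= (LINT y|D. ?Q y)" by (rule Bochner_Integration.integral_nonneg) (use \<kappa> in simp)
 then have "\<nu>\<^sup>2 / \<delta> <= W" using EQ W by linarith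
 then show cs: "\<nu>\<^sup>2 <= \<delta> * W" using \<delta>(2) by (simp add: pos_divide_le_eq mult.commute)
 have W0: "W \<ge> 0" using cs \<delta>(2) zero_le_power2[of \<nu>] by (metis mult_le_0_iff not_le order_trans zero_le_mult_iff)
 have QW: "(LINT y|D. ?Q y) <= W" using EQ W \<delta>(2) zero_le_power2[of \<nu>] by (smt (verit) divide_nonneg_pos)
 let ?P = "\<Pi>\<^sub>M j\<in>{..<N}. D"
 interpret P: prob_space ?P by (rule prob_space_PiM) (rule D)
 \<comment> \<open>Centring at the quotient \<open>\<theta>\<close> makes the deviation of the ratio
   exactly the sum of \<open>Z\<close> over the sum of \<open>\<kappa>\<close>. Besides the tails of
   \<open>Z\<close> only a lower bound for the denominator is needed.\<close>
 define Z where "Z y = \<kappa> y * (g y - \<theta>)" for y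
 have [measurable]: "Z \<in> borel_measurable D" unfolding Z_def by measurable
 define Bz where "Bz = G + H * \<bar>\<theta>\<bar>"
 have ZB: "\<bar>Z y\<bar> <= Bz" if y: "y \<in> space D" for y
 proof -
  have "\<bar>Z y\<bar> = \<kappa> y * \<bar>g y - \<theta>\<bar>" using \<kappa>(1)[OF y] by (simp add: Z_def abs_mult)
  also have "... <= \<kappa> y * (\<bar>g y\<bar> + \<bar>\<theta>\<bar>)" using \<kappa>(1)[OF y] by (intro mult_left_mono) auto
  also have "... = \<kappa> y * \<bar>g y\<bar> + \<kappa> y * \<bar>\<theta>\<bar>" by (simp add: algebra_simps)
  also have "... <= Bz" unfolding Bz_def using G(1)[OF y] \<kappa>(2)[OF y] by (intro add_mono mult_right_mono) auto
  finally show ?thesis .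
 qed
 have Bz0: "Bz > 0" unfolding Bz_def using G(2) H0 by (intro add_pos_nonneg mult_nonneg_nonneg) auto
 have mZ: "(LINT y|D. Z y) = 0"
 proof -
  have "Z y = \<kappa> y * g y - \<theta> * \<kappa> y" for y by (simp add: Z_def algebra_simps)
  then show ?thesis using i0 i1 \<delta> \<nu> by (simp add: \<theta>_def)
 qed
 have vZ: "(LINT y|D. (Z y)\<^sup>2) <= (sqrt (H * W))\<^sup>2"
 proof -
  have "(LINT y|D. (Z y)\<^sup>2) <= (LINT y|D. H * ?Q y)"
  proof (rule integral_mono)
   have "\<bar>(Z y)\<^sup>2\<bar> <= Bz\<^sup>2" if "y \<in> space D" for y using power_mono[OF ZB[OF that], of 2] by simp
   then show "integrable D (%y. (Z y)\<^sup>2)" by (intro bnd[of _ "Bz\<^sup>2"]) auto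
   show "integrable D (%y. H * ?Q y)" using iQ by simp
   fix y assume y: "y \<in> space D"
   have "(Z y)\<^sup>2 = \<kappa> y * ?Q y" by (simp add: Z_def power2_eq_square)
   also have "... <= H * ?Q y" using \<kappa>[OF y] by (intro mult_right_mono) auto
   finally show "(Z y)\<^sup>2 <= H * ?Q y" .
  qed
  also have "... = H * (LINT y|D. ?Q y)" by simp
  also have "... <= H * W" using QW H0 by (intro mult_left_mono)
  finally show ?thesis using H0 W0 by simp
 qed
 have \<delta>H: "\<delta> <= H"
 proof -
  have "(LINT y|D. \<kappa> y) <= (LINT y|D. H)" by (rule integral_mono[OF i0]) (use \<kappa> in auto)
  then show ?thesis using \<delta>(1) by (simp add: D.prob_space)
 qed
 have HP: "H > 0" using \<delta>H \<delta>(2) by linarith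
 \<comment> \<open>Only a small denominator is harmful, so one tail of
   \<open>\<delta> - \<kappa>\<close> is enough. With the two tails of \<open>Z\<close> this makes
   three exceptional events.\<close>
 define Y where "Y y = \<delta> - \<kappa> y" for y
 have [measurable]: "Y \<in> borel_measurable D" unfolding Y_def by measurable
 have YB: "\<bar>Y y\<bar> <= H" if "y \<in> space D" for y using \<kappa>[OF that] \<delta>H \<delta>(2) by (simp add: Y_def abs_le_iff)
 have mY: "(LINT y|D. Y y) = 0" unfolding Y_def using i0 \<delta>(1) by (simp add: D.prob_space)
 have vY: "(LINT y|D. (Y y)\<^sup>2) <= (sqrt (H * \<delta>))\<^sup>2"
 proof -
  have "(LINT y|D. (Y y)\<^sup>2) <= (LINT y|D. \<delta>\<^sup>2 - 2 * \<delta> * \<kappa> y + H * \<kappa> y)"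
  proof (rule integral_mono)
   have "\<bar>(Y y)\<^sup>2\<bar> <= H\<^sup>2" if "y \<in> space D" for y using power_mono[OF YB[OF that], of 2] by simp
   then show "integrable D (%y. (Y y)\<^sup>2)" by (intro bnd[of _ "H\<^sup>2"]) auto
   show "integrable D (%y. \<delta>\<^sup>2 - 2 * \<delta> * \<kappa> y + H * \<kappa> y)" using i0 by simp
   fix y assume y: "y \<in> space D"
   have "\<kappa> y * \<kappa> y <= H * \<kappa> y" using \<kappa>[OF y] by (intro mult_right_mono) auto
   then show "(Y y)\<^sup>2 <= \<delta>\<^sup>2 - 2 * \<delta> * \<kappa> y + H * \<kappa> y" by (simp add: Y_def power2_eq_square algebra_simps)
  qed
  also have "... = H * \<delta> - \<delta>\<^sup>2" using i0 \<delta>(1) by (simp add: D.prob_space power2_eq_square algebra_simps)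
  also have "... <= (sqrt (H * \<delta>))\<^sup>2" using HP \<delta>(2) by simp
  finally show ?thesis .
 qed
 define t1 where "t1 = 2 * (sqrt (H * W) * sqrt l + Bz * l)"
 define t2 where "t2 = 2 * (sqrt (H * \<delta>) * sqrt l + H * l)"
 \<comment> \<open>Here \<open>256 = 16^2\<close>: the two terms of \<open>t2\<close> are at most
   \<open>\<delta> / 16\<close> and \<open>\<delta> / 256\<close> before doubling, so the
   denominator stays above half of its mean.\<close>
 have t2: "t2 <= \<delta> / 2"
 proof -
  have "H * \<delta> * l = (H * l) * \<delta>" by simp
  also have "... <= (\<delta> / 256) * \<delta>" using l(2) \<delta>(2) by (intro mult_right_mono) auto
  also have "... = (\<delta> / 16)\<^sup>2" by (simp add: power2_eq_square)
  finally have "sqrt (H * \<delta> * l) <= sqrt ((\<delta> / 16)\<^sup>2)" by (rule real_sqrt_le_mono)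
  also have "... = \<delta> / 16" using \<delta>(2) by simp
  finally have "sqrt (H * \<delta>) * sqrt l <= \<delta> / 16" by (simp add: real_sqrt_mult)
  then have "sqrt (H * \<delta>) * sqrt l + H * l <= \<delta> / 16 + \<delta> / 256" by (rule add_mono) (use l(2) in simp)
  then have "t2 <= 2 * (\<delta> / 16 + \<delta> / 256)" unfolding t2_def by (rule mult_left_mono) simp
  also have "2 * (\<delta> / 16 + \<delta> / 256) <= \<delta> / 2" using \<delta>(2) by (simp add: field_simps)
  finally show ?thesis .
 qed
 let ?S = "%X. \<Sum>j<N. \<kappa> (X j)"
 let ?E1 = "{X\<in>space ?P. real N * t1 <= (\<Sum>j<N. Z (X j))}" and ?E2 = "{X\<in>space ?P. real N * t1 <= (\<Sum>j<N. - Z (X j))}"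
  and ?E3 = "{X\<in>space ?P. real N * t2 <= (\<Sum>j<N. Y (X j))}"
 show "1 - 3 * exp (- real N * l) <= measure ?P {X\<in>space ?P.
   \<bar>(\<Sum>j<N. \<kappa> (X j) * g (X j)) / ?S X - \<nu> / \<delta>\<bar> <= 4 / \<delta> * (sqrt (H * W) * sqrt l + (G + H * \<bar>\<nu> / \<delta>\<bar>) * l) \<and> ?S X > 0}"
 proof (rule prob_compl_bound[of ?P ?E1 ?E2 ?E3])
  show "prob_space ?P" by (rule P.prob_space_axioms)
  show "measure ?P ?E1 <= exp (- real N * l)" unfolding t1_def
   by (rule bernstein_tail[OF D _ Bz0 ZB mZ vZ _ l(1)]) (use H0 W0 in auto)
  show "measure ?P ?E2 <= exp (- real N * l)" unfolding t1_def
   by (rule bernstein_tail[OF D _ Bz0 _ _ _ _ l(1)]) (use H0 W0 ZB mZ vZ in auto)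
  show "measure ?P ?E3 <= exp (- real N * l)" unfolding t2_def
   by (rule bernstein_tail[OF D _ HP YB mY vY _ l(1)]) (use HP \<delta>(2) in auto)
  show "space ?P - (?E1 \<union> ?E2 \<union> ?E3) \<subseteq> {X\<in>space ?P.
   \<bar>(\<Sum>j<N. \<kappa> (X j) * g (X j)) / ?S X - \<nu> / \<delta>\<bar> <= 4 / \<delta> * (sqrt (H * W) * sqrt l + (G + H * \<bar>\<nu> / \<delta>\<bar>) * l) \<and> ?S X > 0}"
  proof
   fix X assume X: "X \<in> space ?P - (?E1 \<union> ?E2 \<union> ?E3)"
   have s: "(\<Sum>j<N. Z (X j)) < real N * t1" "- (\<Sum>j<N. Z (X j)) < real N * t1" "(\<Sum>j<N. Y (X j)) < real N * t2"
    using X by (auto simp: sum_negf not_le)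
   have "(\<Sum>j<N. Y (X j)) = real N * \<delta> - ?S X" by (simp add: Y_def sum_subtractf)
   moreover have "real N * t2 <= real N * (\<delta> / 2)" using t2 by (intro mult_left_mono) auto
   ultimately have S: "real N * (\<delta> / 2) < ?S X" using s(3) by (simp add: algebra_simps)
   have S0: "0 < real N * (\<delta> / 2)" using N \<delta>(2) by simp
   have SP: "?S X > 0" using S S0 by linarith
   have "(\<Sum>j<N. Z (X j)) = (\<Sum>j<N. \<kappa> (X j) * g (X j)) - \<theta> * ?S X"
    unfolding Z_def by (simp add: sum_subtractf sum_distrib_left algebra_simps)
   then have "(\<Sum>j<N. \<kappa> (X j) * g (X j)) / ?S X - \<theta> = (\<Sum>j<N. Z (X j)) / ?S X" using SP by (simp add: field_simps)
   then have "\<bar>(\<Sum>j<N. \<kappa> (X j) * g (X j)) / ?S X - \<theta>\<bar> = \<bar>\<Sum>j<N. Z (X j)\<bar> / ?S X" using SP by (simp add: abs_divide)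
   also have "... <= (real N * t1) / (real N * (\<delta> / 2))"
    using s(1,2) S S0 by (intro frac_le) auto
   also have "... = 4 / \<delta> * (sqrt (H * W) * sqrt l + Bz * l)" using N by (simp add: t1_def)
   finally show "X \<in> {X\<in>space ?P.
    \<bar>(\<Sum>j<N. \<kappa> (X j) * g (X j)) / ?S X - \<nu> / \<delta>\<bar> <= 4 / \<delta> * (sqrt (H * W) * sqrt l + (G + H * \<bar>\<nu> / \<delta>\<bar>) * l) \<and> ?S X > 0}"
    using SP X by (simp add: \<theta>_def Bz_def)
  qed
 qed measurable
qed

text \<open>In the application \<open>E = e ^ d\<close>, \<open>R\<close> and \<open>R'\<close> are
  the ideal and the estimated bandwidth at \<open>x\<close>, \<open>q = R powr (- \<alpha>)\<close>,
  \<open>\<nu> / \<delta>\<close> is the quotient of the means and \<open>Lm\<close> the limit. The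
  lower bounds \<open>s\<close> and \<open>q0\<close> make the constant uniform in \<open>x\<close>.
  The prefactor with \<open>e^2\<close> in the denominator is what turns the bandwidth error
  \<open>\<tau>\<close> into \<open>\<tau> / e^2\<close>.\<close>

lemma bias_arith:
 fixes e E R R' q \<tau> m0 m2 \<delta> \<nu> Lm C Cl s q0 :: real
 assumes pos: "0 < e" "e <= 1" "0 < E" "0 < R" "0 < q" "0 < m0" "0 < m2" "0 <= C" "0 <= Cl" "0 < s" "0 < q0"
  and R': "\<bar>R' - R\<bar> <= \<tau> * R" "0 <= \<tau>" "\<tau> <= 1 / 10" and q0: "q0 <= q" and s: "s <= R\<^sup>2" and L: "\<bar>Lm\<bar> <= Cl"
  and r1: "\<bar>\<nu> - e\<^sup>2 * E * (m2 / 2 * (q * R\<^sup>2) * Lm)\<bar> <= C * ((e ^ 4 + \<tau>) * E)"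
  and r2: "\<bar>\<delta> - E * (m0 * q)\<bar> <= C * ((e\<^sup>2 + \<tau>) * E)" and \<delta>: "m0 * q * E / 2 <= \<delta>"
 shows "\<bar>2 * m0 / (m2 * e\<^sup>2 * R'\<^sup>2) * (\<nu> / \<delta>) - Lm\<bar> <= 3 * (2 * C / (m2 * s * q0) + 3 * Cl + 2 * Cl * C / (m0 * q0)) * (e\<^sup>2 + \<tau> / e\<^sup>2)"
proof -
 have "\<tau> * R <= 1/10 * R" using R'(3) pos by (intro mult_right_mono) auto
 then have Rb: "9/10 * R <= R'" "R' <= 11/10 * R" using R'(1) unfolding abs_le_iff by linarith+
 then have R'0: "0 < R'" using pos(4) by linarith
 have R2: "81/100 * R\<^sup>2 <= R'\<^sup>2" "R'\<^sup>2 <= 2 * R\<^sup>2"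
  using power_mono[OF Rb(1), of 2] power_mono[OF Rb(2), of 2] pos(4) R'0 zero_le_power2[of R]
  by (simp_all add: power_mult_distrib power2_eq_square)
 have dR: "\<bar>R\<^sup>2 - R'\<^sup>2\<bar> <= 3 * \<tau> * R\<^sup>2"
 proof -
  have "R\<^sup>2 - R'\<^sup>2 = (R - R') * (R + R')" by (simp add: power2_eq_square algebra_simps)
  moreover have "\<bar>(R - R') * (R + R')\<bar> <= (\<tau> * R) * (3 * R)"
   by (rule abs_mult_le) (use R'(1) Rb pos(4) in \<open>auto simp: abs_minus_commute\<close>)
  ultimately show ?thesis by (simp add: power2_eq_square mult_ac)
 qed
 have \<delta>0: "\<delta> > 0" using \<delta> pos by (smt (verit) divide_pos_pos mult_pos_pos)
 define u1 where "u1 = \<nu> - e\<^sup>2 * E * (m2 / 2 * (q * R\<^sup>2) * Lm)"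
 define u2 where "u2 = \<delta> - E * (m0 * q)"
 let ?T = "(e ^ 4 + \<tau>) * E"
 have T0: "0 <= ?T" using pos R'(2) by simp
 \<comment> \<open>The factor \<open>81/100\<close> from the squared bandwidth and
   \<open>1/2\<close> from the bound on \<open>\<delta>\<close> give \<open>81/200\<close>, which
   exceeds \<open>1/3\<close>.\<close>
 have den: "m2 * m0 * e\<^sup>2 * R\<^sup>2 * q * E / 3 <= m2 * e\<^sup>2 * R'\<^sup>2 * \<delta>"
 proof -
  have "m2 * e\<^sup>2 * (81/100 * R\<^sup>2) * (m0 * q * E / 2) <= m2 * e\<^sup>2 * R'\<^sup>2 * \<delta>"
   using pos R2(1) \<delta> by (intro mult_mono mult_left_mono mult_nonneg_nonneg) auto
  moreover have "m2 * e\<^sup>2 * (81/100 * R\<^sup>2) * (m0 * q * E / 2) = 81/200 * (m2 * m0 * e\<^sup>2 * R\<^sup>2 * q * E)" by simp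
  moreover have "0 <= m2 * m0 * e\<^sup>2 * R\<^sup>2 * q * E" using pos by simp
  ultimately show ?thesis by linarith
 qed
 have D0: "0 < m2 * m0 * e\<^sup>2 * R\<^sup>2 * q * E / 3" using pos by simp
 \<comment> \<open>Over the common denominator three errors remain: the bias of the numerator, the
   estimated bandwidth in the prefactor, and the bias of the denominator multiplied by the
   limit.\<close>
 have num: "2 * m0 * \<nu> - Lm * (m2 * e\<^sup>2 * R'\<^sup>2 * \<delta>) = 2 * m0 * u1 + (m0 * m2 * e\<^sup>2 * E * q * Lm) * (R\<^sup>2 - R'\<^sup>2) - (m2 * e\<^sup>2 * Lm * R'\<^sup>2) * u2"
  by (simp add: u1_def u2_def algebra_simps)
 have e2: "e\<^sup>2 <= 1" using pos by (simp add: power_le_one)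
 have n1: "\<bar>2 * m0 * u1\<bar> <= 2 * m0 * (C * ?T)" unfolding u1_def by (rule abs_mult_le[OF _ r1]) (use pos in simp)
 have n2: "\<bar>(m0 * m2 * e\<^sup>2 * E * q * Lm) * (R\<^sup>2 - R'\<^sup>2)\<bar> <= 3 * m0 * m2 * q * R\<^sup>2 * Cl * ?T"
 proof -
  have "\<bar>m0 * m2 * e\<^sup>2 * E * q * Lm\<bar> <= (m0 * m2 * e\<^sup>2 * E * q) * Cl"
   by (rule abs_mult_le[OF _ L]) (use pos in simp)
  then have "\<bar>(m0 * m2 * e\<^sup>2 * E * q * Lm) * (R\<^sup>2 - R'\<^sup>2)\<bar> <= (m0 * m2 * e\<^sup>2 * E * q * Cl) * (3 * \<tau> * R\<^sup>2)"
   by (rule abs_mult_le[OF _ dR])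
  also have "... = (3 * m0 * m2 * q * R\<^sup>2 * Cl * E) * (e\<^sup>2 * \<tau>)" by simp
  also have "... <= (3 * m0 * m2 * q * R\<^sup>2 * Cl * E) * (e ^ 4 + \<tau>)"
  proof (rule mult_left_mono)
   have "e\<^sup>2 * \<tau> <= 1 * \<tau>" using e2 R'(2) by (rule mult_right_mono)
   then show "e\<^sup>2 * \<tau> <= e ^ 4 + \<tau>" using pos(1) zero_le_power[of e 4] by linarith
  qed (use pos in simp)
  finally show ?thesis by (simp add: mult_ac)
 qed
 have n3: "\<bar>(m2 * e\<^sup>2 * Lm * R'\<^sup>2) * u2\<bar> <= 2 * m2 * Cl * R\<^sup>2 * C * ?T"
 proof -
  have "\<bar>m2 * e\<^sup>2 * Lm\<bar> <= m2 * e\<^sup>2 * Cl" by (rule abs_mult_le[OF _ L]) (use pos in simp)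
  then have "\<bar>m2 * e\<^sup>2 * Lm * R'\<^sup>2\<bar> <= (m2 * e\<^sup>2 * Cl) * (2 * R\<^sup>2)" by (rule abs_mult_le) (use R2(2) in simp)
  then have "\<bar>(m2 * e\<^sup>2 * Lm * R'\<^sup>2) * u2\<bar> <= (m2 * e\<^sup>2 * Cl) * (2 * R\<^sup>2) * (C * ((e\<^sup>2 + \<tau>) * E))" unfolding u2_def by (rule abs_mult_le[OF _ r2])
  also have "... = (2 * m2 * Cl * R\<^sup>2 * C * E) * (e\<^sup>2 * (e\<^sup>2 + \<tau>))" by simp
  also have "... <= (2 * m2 * Cl * R\<^sup>2 * C * E) * (e ^ 4 + \<tau>)"
  proof (rule mult_left_mono)
   have "e\<^sup>2 * \<tau> <= 1 * \<tau>" using e2 R'(2) by (rule mult_right_mono)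
   then show "e\<^sup>2 * (e\<^sup>2 + \<tau>) <= e ^ 4 + \<tau>" by (simp add: distrib_left power_numeral_reduce)
  qed (use pos in simp)
  finally show ?thesis by (simp add: mult_ac)
 qed
 let ?N = "2 * m0 * C + 3 * m0 * m2 * q * R\<^sup>2 * Cl + 2 * m2 * Cl * R\<^sup>2 * C"
 have N: "\<bar>2 * m0 * \<nu> - Lm * (m2 * e\<^sup>2 * R'\<^sup>2 * \<delta>)\<bar> <= ?N * ?T"
 proof -
  have "?N * ?T = 2 * m0 * (C * ?T) + 3 * m0 * m2 * q * R\<^sup>2 * Cl * ?T + 2 * m2 * Cl * R\<^sup>2 * C * ?T" by (simp only: distrib_right mult.assoc)
  then show ?thesis unfolding num using n1 n2 n3 by linarith
 qed
 have N0: "0 <= ?N" using pos by simp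
 have nz: "m2 * e\<^sup>2 * R'\<^sup>2 * \<delta> > 0" using pos R'0 \<delta>0 by simp
 have "2 * m0 / (m2 * e\<^sup>2 * R'\<^sup>2) * (\<nu> / \<delta>) - Lm = (2 * m0 * \<nu> - Lm * (m2 * e\<^sup>2 * R'\<^sup>2 * \<delta>)) / (m2 * e\<^sup>2 * R'\<^sup>2 * \<delta>)"
  using pos R'0 \<delta>0 by (simp add: diff_divide_distrib)
 then have "\<bar>2 * m0 / (m2 * e\<^sup>2 * R'\<^sup>2) * (\<nu> / \<delta>) - Lm\<bar> = \<bar>2 * m0 * \<nu> - Lm * (m2 * e\<^sup>2 * R'\<^sup>2 * \<delta>)\<bar> / (m2 * e\<^sup>2 * R'\<^sup>2 * \<delta>)"
  using nz by (simp only: abs_divide abs_of_pos)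
 also have "... <= (?N * ?T) / (m2 * m0 * e\<^sup>2 * R\<^sup>2 * q * E / 3)"
  by (rule frac_le[OF mult_nonneg_nonneg[OF N0 T0] N D0 den])
 also have "... = (3 * (2 * C / (m2 * R\<^sup>2 * q) + 3 * Cl + 2 * Cl * C / (m0 * q))) * ((e ^ 4 + \<tau>) / e\<^sup>2)"
  using pos by (simp add: field_simps)
 also have "(e ^ 4 + \<tau>) / e\<^sup>2 = e\<^sup>2 + \<tau> / e\<^sup>2" using pos(1) by (simp add: add_divide_distrib power_diff[of e 2 4, symmetric])
 also have "(3 * (2 * C / (m2 * R\<^sup>2 * q) + 3 * Cl + 2 * Cl * C / (m0 * q))) * (e\<^sup>2 + \<tau> / e\<^sup>2)
  <= (3 * (2 * C / (m2 * s * q0) + 3 * Cl + 2 * Cl * C / (m0 * q0))) * (e\<^sup>2 + \<tau> / e\<^sup>2)"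
 proof (rule mult_right_mono)
  have "2 * C / (m2 * R\<^sup>2 * q) <= 2 * C / (m2 * s * q0)"
   using pos s q0 by (intro divide_left_mono mult_mono mult_left_mono mult_nonneg_nonneg mult_pos_pos) auto
  moreover have "2 * Cl * C / (m0 * q) <= 2 * Cl * C / (m0 * q0)"
   using pos q0 by (intro divide_left_mono mult_left_mono mult_nonneg_nonneg mult_pos_pos) auto
  ultimately show "3 * (2 * C / (m2 * R\<^sup>2 * q) + 3 * Cl + 2 * Cl * C / (m0 * q)) <= 3 * (2 * C / (m2 * s * q0) + 3 * Cl + 2 * Cl * C / (m0 * q0))" by (intro mult_left_mono add_mono order_refl) (assumption | simp)+
 qed (use pos R'(2) in simp)
 finally show ?thesis .
qed

text \<open>In the variance term all powers of \<open>q\<close> and \<open>R\<close> cancel except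
  \<open>1 / R\<close>, which is \<open>p x powr (1 / d)\<close>; what remains is a constant in
  \<open>A\<close>, \<open>C0\<close> and \<open>m2\<close>. The range term has constants depending
  on \<open>p\<close>, but it is linear in \<open>L\<close>: the hypothesis on \<open>sqrt L\<close>
  absorbs one root and leaves the summand \<open>1\<close>.\<close>

lemma noise_arith:
 fixes e E R R' q m0 m2 \<delta> \<nu> A C0 Cp S L K1 b1 u :: real
 assumes pos: "0 < e" "e <= 1" "0 < E" "0 < R" "0 < q" "0 < m0" "0 < m2" "0 < A" "0 < C0" "0 < Cp" "0 < S" "0 <= L" "0 < u"
  and R': "9/10 * R <= R'" and q: "q <= K1" and R: "R <= b1" and u: "u <= q * R\<^sup>2" and \<delta>: "m0 * q * E / 2 <= \<delta>"
  and \<nu>: "\<nu>\<^sup>2 <= \<delta> * (C0 * (q * R\<^sup>2) * (e\<^sup>2 * E) * S\<^sup>2)"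
  and L: "264 * (Cp + 2 * A * K1 * sqrt (2 * C0 / m0) * b1) / (m2 * u) * b1 * sqrt L <= 1"
 shows "2 * m0 / (m2 * e\<^sup>2 * R'\<^sup>2) * (4 / \<delta> * (sqrt (2 * A * q * (C0 * (q * R\<^sup>2) * (e\<^sup>2 * E) * S\<^sup>2)) * sqrt (11 * L * (e\<^sup>2 * E))
   + (Cp * S + 2 * A * q * \<bar>\<nu> / \<delta>\<bar>) * (11 * L * (e\<^sup>2 * E))))
  <= (24 * sqrt (22 * A * C0) / m2 + 1) * (S * (1 / R) * sqrt L)"
proof -
 have R'0: "0 < R'" using R' pos(4) by linarith
 have R2: "81/100 * R\<^sup>2 <= R'\<^sup>2" using power_mono[OF R', of 2] pos(4) by (simp add: power_mult_distrib power2_eq_square)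
 have m0qE: "0 < m0 * q * E / 2" using pos by simp
 then have \<delta>0: "\<delta> > 0" using \<delta> by linarith
 have b1: "0 < b1" using R pos(4) by linarith
 have K1: "0 < K1" using q pos(5) by linarith
 let ?W = "C0 * (q * R\<^sup>2) * (e\<^sup>2 * E) * S\<^sup>2"
 have W0: "0 <= ?W" using pos by simp
 \<comment> \<open>The Cauchy-Schwarz bound on \<open>\<nu>\<close> makes the centre of the quotient
   proportional to \<open>S\<close>, so that the whole range term is proportional to
   \<open>S\<close> as well.\<close>
 have \<theta>: "\<bar>\<nu> / \<delta>\<bar> <= sqrt (2 * C0 / m0) * b1 * S"
 proof -
  have "(\<nu> / \<delta>)\<^sup>2 = \<nu>\<^sup>2 / (\<delta> * \<delta>)" by (simp add: power2_eq_square)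
  also have "... <= (\<delta> * ?W) / (\<delta> * \<delta>)" using \<nu> \<delta>0 by (intro divide_right_mono) auto
  also have "... = ?W / \<delta>" using \<delta>0 by simp
  also have "... <= ?W / (m0 * q * E / 2)" using \<delta> W0 m0qE \<delta>0 by (intro divide_left_mono) auto
  also have "... = 2 * C0 / m0 * (R * e * S)\<^sup>2" using pos by (simp add: field_simps power2_eq_square)
  finally have "sqrt ((\<nu> / \<delta>)\<^sup>2) <= sqrt (2 * C0 / m0 * (R * e * S)\<^sup>2)" by (rule real_sqrt_le_mono)
  moreover have "0 <= R * e * S" using pos by simp
  ultimately have "\<bar>\<nu> / \<delta>\<bar> <= sqrt (2 * C0 / m0) * (R * e * S)" by (simp only: real_sqrt_mult real_sqrt_abs abs_of_nonneg)
  also have "... <= sqrt (2 * C0 / m0) * (b1 * S)"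
  proof (rule mult_left_mono)
   have "R * e <= b1 * 1" using R pos b1 by (intro mult_mono) auto
   then show "R * e * S <= b1 * S" using pos(11) by (intro mult_right_mono) auto
  qed (use pos in simp)
  finally show ?thesis by (simp add: mult.assoc)
 qed
 let ?C4 = "Cp + 2 * A * K1 * sqrt (2 * C0 / m0) * b1"
 have C40: "0 <= ?C4" using pos K1 b1 by simp
 have Bz: "Cp * S + 2 * A * q * \<bar>\<nu> / \<delta>\<bar> <= ?C4 * S"
 proof -
  have "2 * A * q * \<bar>\<nu> / \<delta>\<bar> <= 2 * A * K1 * (sqrt (2 * C0 / m0) * b1 * S)"
   using \<theta> q pos K1 by (intro mult_mono) auto
  then show ?thesis by (simp add: distrib_right mult.assoc)
 qed
 \<comment> \<open>\<open>24 = 8 * 3\<close>, again because \<open>81/200\<close> exceeds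
   \<open>1/3\<close>.\<close>
 have F: "2 * m0 / (m2 * e\<^sup>2 * R'\<^sup>2) * (4 / \<delta>) <= 24 / (m2 * e\<^sup>2 * R\<^sup>2 * q * E)"
 proof -
  have "2 * m0 / (m2 * e\<^sup>2 * R'\<^sup>2) * (4 / \<delta>) = 8 * m0 / (m2 * e\<^sup>2 * R'\<^sup>2 * \<delta>)" by simp
  also have "... <= 8 * m0 / (m2 * m0 * e\<^sup>2 * R\<^sup>2 * q * E / 3)"
  proof (rule divide_left_mono)
   have "m2 * e\<^sup>2 * (81/100 * R\<^sup>2) * (m0 * q * E / 2) <= m2 * e\<^sup>2 * R'\<^sup>2 * \<delta>"
    using pos R2 \<delta> by (intro mult_mono mult_left_mono mult_nonneg_nonneg) auto
   moreover have "m2 * e\<^sup>2 * (81/100 * R\<^sup>2) * (m0 * q * E / 2) = 81/200 * (m2 * m0 * e\<^sup>2 * R\<^sup>2 * q * E)" by simp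
   moreover have "0 <= m2 * m0 * e\<^sup>2 * R\<^sup>2 * q * E" using pos by simp
   ultimately show "m2 * m0 * e\<^sup>2 * R\<^sup>2 * q * E / 3 <= m2 * e\<^sup>2 * R'\<^sup>2 * \<delta>" by linarith
  qed (use pos R'0 \<delta>0 in simp_all)
  also have "... = 24 / (m2 * e\<^sup>2 * R\<^sup>2 * q * E)" using pos by (simp add: field_simps)
  finally show ?thesis .
 qed
 have sq: "sqrt (2 * A * q * ?W) * sqrt (11 * L * (e\<^sup>2 * E)) = sqrt (22 * A * C0) * (q * R * e\<^sup>2 * E * S) * sqrt L"
 proof -
  have "2 * A * q * ?W * (11 * L * (e\<^sup>2 * E)) = (22 * A * C0) * (q * R * e\<^sup>2 * E * S)\<^sup>2 * L" by (simp add: power2_eq_square)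
  then have "sqrt (2 * A * q * ?W * (11 * L * (e\<^sup>2 * E))) = sqrt ((22 * A * C0) * (q * R * e\<^sup>2 * E * S)\<^sup>2 * L)" by (rule arg_cong)
  then show ?thesis unfolding real_sqrt_mult[of "2 * A * q * ?W"] using pos by (simp only: real_sqrt_mult real_sqrt_abs) simp
 qed
 let ?X = "sqrt (2 * A * q * ?W) * sqrt (11 * L * (e\<^sup>2 * E)) + (Cp * S + 2 * A * q * \<bar>\<nu> / \<delta>\<bar>) * (11 * L * (e\<^sup>2 * E))"
 let ?Y = "sqrt (22 * A * C0) * (q * R * e\<^sup>2 * E * S) * sqrt L + (?C4 * S) * (11 * L * (e\<^sup>2 * E))"
 have XY: "?X <= ?Y" unfolding sq using Bz pos by (intro add_left_mono mult_right_mono) auto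
 have Y0: "0 <= ?Y" using pos C40 by simp
 have "2 * m0 / (m2 * e\<^sup>2 * R'\<^sup>2) * (4 / \<delta> * ?X) = (2 * m0 / (m2 * e\<^sup>2 * R'\<^sup>2) * (4 / \<delta>)) * ?X" by (simp only: mult.assoc)
 also have "... <= (2 * m0 / (m2 * e\<^sup>2 * R'\<^sup>2) * (4 / \<delta>)) * ?Y" using XY pos R'0 \<delta>0 by (intro mult_left_mono) auto
 also have "... <= 24 / (m2 * e\<^sup>2 * R\<^sup>2 * q * E) * ?Y" using F Y0 by (rule mult_right_mono)
 also have "... = 24 * sqrt (22 * A * C0) / m2 * (S * (1 / R) * sqrt L) + 264 * ?C4 / (m2 * (q * R\<^sup>2)) * S * L"
 proof -
  have 1: "24 / (m2 * e\<^sup>2 * R\<^sup>2 * q * E) * (z * (q * R * e\<^sup>2 * E * S) * w) = 24 * z / m2 * (S * (1 / R) * w)" for z w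
   using pos by (simp add: field_simps power2_eq_square)
  have 2: "24 / (m2 * e\<^sup>2 * R\<^sup>2 * q * E) * ((z * S) * (11 * L * (e\<^sup>2 * E))) = 264 * z / (m2 * (q * R\<^sup>2)) * S * L" for z
   using pos by (simp add: field_simps)
  show ?thesis unfolding distrib_left[of "24 / (m2 * e\<^sup>2 * R\<^sup>2 * q * E)"] 1 2 ..
 qed
 also have "264 * ?C4 / (m2 * (q * R\<^sup>2)) * S * L <= S * (1 / R) * sqrt L"
 proof -
  let ?C5 = "264 * ?C4 / (m2 * u)"
  have "264 * ?C4 / (m2 * (q * R\<^sup>2)) <= ?C5"
   using pos C40 u by (intro divide_left_mono mult_left_mono mult_pos_pos) auto
  then have "264 * ?C4 / (m2 * (q * R\<^sup>2)) * (S * L) <= ?C5 * (S * L)" using pos by (intro mult_right_mono) auto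
  moreover have "?C5 * (S * L) = (?C5 * b1 * sqrt L) * (S * (1 / b1) * sqrt L)"
  proof -
   have "(z * b1 * w) * (S * (1 / b1) * w) = z * (S * (w * w))" for z w using b1 by simp
   moreover have "sqrt L * sqrt L = L" using pos(12) by simp
   ultimately show ?thesis by (simp only:)
  qed
  moreover have "(?C5 * b1 * sqrt L) * (S * (1 / b1) * sqrt L) <= 1 * (S * (1 / b1) * sqrt L)"
   using L pos b1 by (intro mult_right_mono) auto
  moreover have "S * (1 / b1) * sqrt L <= S * (1 / R) * sqrt L"
   using R pos b1 by (intro mult_right_mono mult_left_mono divide_left_mono) auto
  ultimately show ?thesis by (simp add: mult.assoc)
 qed
 finally show ?thesis by (simp only: distrib_right[of "24 * sqrt (22 * A * C0) / m2" 1] mult_1_left)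
qed

section \<open>Means against the density and the second moment\<close>

context kernel_manifold
begin

definition pmean :: "('a => real) => ('a => real) => real" where
 "pmean p F = (LINT y|V. F y * p y)"

lemma integral_le_of_nn_integral:
 assumes m: "F \<in> borel_measurable V" and nn: "!!y. y \<in> M ==> 0 <= F y"
  and le: "(\<integral>\<^sup>+y. ennreal (F y) \<partial>V) <= ennreal C" and C: "0 <= C"
 shows "integrable V F" "(LINT y|V. F y) <= C"
proof -
 have ae: "AE y in V. 0 <= F y" by (rule AE_I2) (use nn space_V in auto)
 show "integrable V F" by (rule integrableI_nonneg[OF m ae]) (use le_less_trans[OF le ennreal_less_top] in simp)
 show "(LINT y|V. F y) <= C" by (rule integral_real_bounded[OF C le])
qed

lemma gaussian_integral_bound:
 "\<exists>B>0. \<forall>x\<in>M. \<forall>b>0. integrable V (%y. indicator {y. norm (y - x) < 1 / B} y * (exp (- b * (norm (y - x))\<^sup>2) * norm (y - x) ^ m)) \<and>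
  (LINT y|V. indicator {y. norm (y - x) < 1 / B} y * (exp (- b * (norm (y - x))\<^sup>2) * norm (y - x) ^ m)) <= B / sqrt b ^ (CARD('n) + m)"
proof -
 obtain B where B: "B > 0" "!!x b. x \<in> M ==> b > 0 ==>
  (\<integral>\<^sup>+y\<in>{y. norm (y - x) < 1 / B}. ennreal (exp (- b * (norm (y - x))\<^sup>2) * norm (y - x) ^ m) \<partial>V) <= ennreal (B / sqrt b ^ (CARD('n) + m))"
  using gaussian_volume_bound[OF sub M V, of m] by blast
 have "integrable V (%y. indicator {y. norm (y - x) < 1 / B} y * (exp (- b * (norm (y - x))\<^sup>2) * norm (y - x) ^ m)) \<and>
  (LINT y|V. indicator {y. norm (y - x) < 1 / B} y * (exp (- b * (norm (y - x))\<^sup>2) * norm (y - x) ^ m)) <= B / sqrt b ^ (CARD('n) + m)"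
  if x: "x \<in> M" and b: "b > 0" for x b
 proof -
  let ?F = "%y. indicator {y. norm (y - x) < 1 / B} y * (exp (- b * (norm (y - x))\<^sup>2) * norm (y - x) ^ m)"
  have eq: "ennreal (?F y) = ennreal (exp (- b * (norm (y - x))\<^sup>2) * norm (y - x) ^ m) * indicator {y. norm (y - x) < 1 / B} y" for y
   by (simp add: indicator_def)
  have m: "?F \<in> borel_measurable V" by (rule borel_measurable_volume(1)[OF V]) measurable
  show ?thesis
   using integral_le_of_nn_integral[OF m, of "B / sqrt b ^ (CARD('n) + m)"] B(2)[OF x b] B(1) b unfolding eq by simp
 qed
 then show ?thesis using B(1) by blast
qed

lemma pmean_integrable:
 assumes p: "smooth_positive_density TYPE('n) M V p" and [measurable]: "F \<in> borel_measurable V" and B: "!!y. y \<in> M ==> \<bar>F y\<bar> <= B"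
 shows "integrable V (%y. F y * p y)"
proof -
 note pD = densityD[OF p]
 note [measurable] = pD(4)
 show ?thesis
 proof (rule Bochner_Integration.integrable_bound)
  show "integrable V (%y. B * p y)" using pD(5) by simp
  have "\<bar>F y * p y\<bar> <= \<bar>B * p y\<bar>" if "y \<in> M" for y
  proof -
   have "\<bar>F y * p y\<bar> <= B * p y" by (rule abs_mult_le[OF B[OF that]]) (use pD(2)[OF that] in simp)
   also have "... <= \<bar>B * p y\<bar>" by (rule abs_ge_self)
   finally show ?thesis .
  qed
  then show "AE y in V. norm (F y * p y) <= norm (B * p y)" unfolding real_norm_def by (intro AE_I2) (simp add: space_V)
 qed measurable
qed

lemma khat_measurable:
 assumes [measurable]: "\<rho> \<in> borel_measurable V"
 shows "khat \<alpha> \<rho> e x \<in> borel_measurable V"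
proof -
 have [measurable]: "(%y. k0 ((norm (x - y))\<^sup>2 / (e\<^sup>2 * \<rho> x * \<rho> y))) \<in> borel_measurable V" by (rule kernel_measurable) measurable
 show ?thesis unfolding khat_def[abs_def] by measurable
qed

lemma khat_nonneg: "0 <= khat \<alpha> \<rho> e x y"
 unfolding khat_def by (intro mult_nonneg_nonneg k0_nonneg) simp

text \<open>Near \<open>x\<close> the volume bound with \<open>b = c / e^2\<close> gives
  \<open>e ^ d\<close>; at a fixed distance the exponential is below every power of
  \<open>e\<close>.\<close>

lemma gaussian_pmean:
 assumes p: "smooth_positive_density TYPE('n) M V p" and c: "c > 0"
 shows "\<exists>C>0. \<forall>x\<in>M. \<forall>e. 0 < e --> e <= 1 --> pmean p (%y. exp (- (c * (norm (x - y))\<^sup>2) / e\<^sup>2)) <= C * e ^ CARD('n)"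
proof -
 note pD = densityD[OF p]
 obtain B where B: "B > 0" "!!x b. x \<in> M ==> b > 0 ==> integrable V (%y. indicator {y. norm (y - x) < 1 / B} y * (exp (- b * (norm (y - x))\<^sup>2) * norm (y - x) ^ 0)) \<and>
  (LINT y|V. indicator {y. norm (y - x) < 1 / B} y * (exp (- b * (norm (y - x))\<^sup>2) * norm (y - x) ^ 0)) <= B / sqrt b ^ (CARD('n) + 0)"
  using gaussian_integral_bound[of 0] by blast
 obtain K where K: "K > 0" "\<forall>y\<in>M. \<bar>p y\<bar> <= K" using continuous_on_compact_bounded[OF M pD(3)] by blast
 obtain C1 where C1: "C1 > 0" "\<forall>e>0. exp (- (c / B\<^sup>2) / e\<^sup>2) <= C1 * e ^ CARD('n)"
  using exp_inverse_square_bound[of "c / B\<^sup>2" "CARD('n)"] c B(1) by auto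
 have "pmean p (%y. exp (- (c * (norm (x - y))\<^sup>2) / e\<^sup>2)) <= (K * (B / sqrt c ^ CARD('n)) + C1) * e ^ CARD('n)"
  if x: "x \<in> M" and e: "0 < e" for x e
 proof -
  define b where "b = c / e\<^sup>2"
  have b: "b > 0" using c e by (simp add: b_def)
  let ?I = "%y. indicator {y. norm (y - x) < 1 / B} y * (exp (- b * (norm (y - x))\<^sup>2) * norm (y - x) ^ 0)"
  note Bx = B(2)[OF x b]
  have i1: "integrable V (%y. K * ?I y + exp (- (c / B\<^sup>2) / e\<^sup>2) * p y)" using Bx pD(5) by simp
  have le: "exp (- (c * (norm (x - y))\<^sup>2) / e\<^sup>2) * p y <= K * ?I y + exp (- (c / B\<^sup>2) / e\<^sup>2) * p y" if y: "y \<in> M" for y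
  proof (cases "norm (y - x) < 1 / B")
   case True
   have "exp (- (c * (norm (x - y))\<^sup>2) / e\<^sup>2) * p y <= exp (- b * (norm (y - x))\<^sup>2) * K"
    using K(2) y pD(2)[OF y] by (intro mult_mono) (auto simp: b_def norm_minus_commute intro: less_imp_le)
   moreover have "0 <= exp (- (c / B\<^sup>2) / e\<^sup>2) * p y" using pD(2)[OF y] by simp
   moreover have "?I y = exp (- b * (norm (y - x))\<^sup>2)" using True by simp
   ultimately show ?thesis by (simp only: mult.commute[of K])
  next
   case False
   then have "(1 / B)\<^sup>2 <= (norm (x - y))\<^sup>2" using B(1) by (intro power_mono) (auto simp: norm_minus_commute)
   then have "c * (1 / B)\<^sup>2 / e\<^sup>2 <= c * (norm (x - y))\<^sup>2 / e\<^sup>2" using c by (intro divide_right_mono mult_left_mono) auto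
   then have "exp (- (c * (norm (x - y))\<^sup>2) / e\<^sup>2) <= exp (- (c / B\<^sup>2) / e\<^sup>2)" by (simp add: power_divide)
   from mult_right_mono[OF this less_imp_le[OF pD(2)[OF y]]] show ?thesis using False by simp
  qed
  have "pmean p (%y. exp (- (c * (norm (x - y))\<^sup>2) / e\<^sup>2)) <= (LINT y|V. K * ?I y + exp (- (c / B\<^sup>2) / e\<^sup>2) * p y)"
   unfolding pmean_def
  proof (rule integral_mono[OF _ i1])
   show "integrable V (%y. exp (- (c * (norm (x - y))\<^sup>2) / e\<^sup>2) * p y)"
   proof (rule pmean_integrable[OF p, of _ 1])
    show "(%y. exp (- (c * (norm (x - y))\<^sup>2) / e\<^sup>2)) \<in> borel_measurable V" by (rule borel_measurable_volume(1)[OF V]) measurable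
    show "\<bar>exp (- (c * (norm (x - y))\<^sup>2) / e\<^sup>2)\<bar> <= 1" for y using c e by (simp add: divide_nonneg_pos)
   qed
  qed (use le space_V in auto)
  also have "... = K * (LINT y|V. ?I y) + exp (- (c / B\<^sup>2) / e\<^sup>2)" using Bx pD(5,6) by simp
  also have "... <= K * (B / sqrt b ^ (CARD('n) + 0)) + C1 * e ^ CARD('n)"
   using Bx K(1) C1(2) e by (intro add_mono mult_left_mono) auto
  also have "sqrt b ^ (CARD('n) + 0) = sqrt c ^ CARD('n) / e ^ CARD('n)" using e by (simp add: b_def real_sqrt_divide power_divide)
  finally show ?thesis by (simp add: distrib_right)
 qed
 moreover have "K * (B / sqrt c ^ CARD('n)) + C1 > 0" using K B c C1 by (intro add_pos_pos mult_pos_pos divide_pos_pos zero_less_power) auto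
 ultimately show ?thesis by blast
qed

lemma rho_bar_measurable: "smooth_positive_density TYPE('n) M V p ==> rho_bar TYPE('n) p \<in> borel_measurable V"
proof -
 assume p: "smooth_positive_density TYPE('n) M V p"
 note [measurable] = densityD(4)[OF p]
 show ?thesis unfolding rho_bar_def by measurable
qed

lemma khat_constD:
 assumes "khat_const \<alpha> p r c K"
 shows "r > 0" "c > 0" "K > 0" "x \<in> M ==> y \<in> M ==> norm (x - y) < r ==> p y <= 2 * p x"
  and "x \<in> M ==> y \<in> M ==> close_to p \<rho>' \<tau> ==> e > 0 ==> norm (x - y) < r ==> K * \<tau> <= 1 ==>
   khat \<alpha> \<rho>' e x y <= 2 * A * rho_bar TYPE('n) p x powr (- \<alpha>) * exp (- (a / (2 * e\<^sup>2 * (rho_bar TYPE('n) p x)\<^sup>2)) * (norm (x - y))\<^sup>2)"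
  and "x \<in> M ==> y \<in> M ==> close_to p \<rho>' \<tau> ==> e > 0 ==> khat \<alpha> \<rho>' e x y <= K * exp (- (c * (norm (x - y))\<^sup>2) / e\<^sup>2)"
  and "x \<in> M ==> y \<in> M ==> close_to p \<rho>' \<tau> ==> e > 0 ==>
   \<bar>khat \<alpha> \<rho>' e x y - khat \<alpha> (rho_bar TYPE('n) p) e x y\<bar> <= K * \<tau> * exp (- (c * (norm (x - y))\<^sup>2) / e\<^sup>2)"
proof -
 note H = assms[unfolded khat_const_def]
 show "r > 0" "c > 0" "K > 0" using H by simp_all
 note H2 = H[THEN conjunct2, THEN conjunct2, THEN conjunct2]
 show "p y <= 2 * p x" if "x \<in> M" "y \<in> M" "norm (x - y) < r"
  by (rule H2[THEN conjunct1, THEN bspec, THEN bspec, THEN mp, OF that])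
 note B = H2[THEN conjunct2, THEN spec, THEN spec, THEN spec, THEN bspec, THEN bspec, THEN mp, THEN mp]
 show "khat \<alpha> \<rho>' e x y <= 2 * A * rho_bar TYPE('n) p x powr (- \<alpha>) * exp (- (a / (2 * e\<^sup>2 * (rho_bar TYPE('n) p x)\<^sup>2)) * (norm (x - y))\<^sup>2)"
  if "x \<in> M" "y \<in> M" "close_to p \<rho>' \<tau>" "e > 0" "norm (x - y) < r" "K * \<tau> <= 1"
  by (rule B[OF that(1-4), THEN conjunct1, THEN mp, THEN mp, OF that(5,6)])
 show "khat \<alpha> \<rho>' e x y <= K * exp (- (c * (norm (x - y))\<^sup>2) / e\<^sup>2)"
  if "x \<in> M" "y \<in> M" "close_to p \<rho>' \<tau>" "e > 0" by (rule B[OF that, THEN conjunct2, THEN conjunct1])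
 show "\<bar>khat \<alpha> \<rho>' e x y - khat \<alpha> (rho_bar TYPE('n) p) e x y\<bar> <= K * \<tau> * exp (- (c * (norm (x - y))\<^sup>2) / e\<^sup>2)"
  if "x \<in> M" "y \<in> M" "close_to p \<rho>' \<tau>" "e > 0" by (rule B[OF that, THEN conjunct2, THEN conjunct2])
qed

text \<open>The estimated bandwidth enters only through measurability and uniform relative
  closeness: the pointwise kernel error is \<open>\<tau>\<close> times a Gaussian of width
  \<open>e\<close>, whose mean is of order \<open>e ^ d\<close>.\<close>

lemma bandwidth_replacement:
 assumes p: "smooth_positive_density TYPE('n) M V p"
 shows "\<exists>C>0. \<forall>x\<in>M. \<forall>\<rho>' \<tau> e G Kg. close_to p \<rho>' \<tau> --> \<rho>' \<in> borel_measurable V --> 0 < e --> e <= 1 -->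
  G \<in> borel_measurable V --> (\<forall>y\<in>M. \<bar>G y\<bar> <= Kg) -->
  \<bar>pmean p (%y. khat \<alpha> \<rho>' e x y * G y) - kint p e x (%y. rho_bar TYPE('n) p y powr (- \<alpha>) * G y)\<bar> <= C * Kg * (\<tau> * e ^ CARD('n))"
proof -
 note pD = densityD[OF p]
 obtain r c K where kc: "khat_const \<alpha> p r c K" using khat_bounds[OF p] by blast
 note kD = khat_constD[OF kc]
 note c = kD(2) and K = kD(3)
 obtain C where C: "C > 0" "!!x e. x \<in> M ==> 0 < e ==> e <= 1 ==> pmean p (%y. exp (- (c * (norm (x - y))\<^sup>2) / e\<^sup>2)) <= C * e ^ CARD('n)"
  using gaussian_pmean[OF p c] by blast
 have R: "\<bar>pmean p (%y. khat \<alpha> \<rho>' e x y * G y) - kint p e x (%y. rho_bar TYPE('n) p y powr (- \<alpha>) * G y)\<bar> <= (K * C) * Kg * (\<tau> * e ^ CARD('n))"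
  if x: "x \<in> M" and cl: "close_to p \<rho>' \<tau>" and m: "\<rho>' \<in> borel_measurable V" and e: "0 < e" "e <= 1"
   and G: "G \<in> borel_measurable V" "\<forall>y\<in>M. \<bar>G y\<bar> <= Kg" for x \<rho>' \<tau> e G Kg
 proof -
  let ?\<rho> = "rho_bar TYPE('n) p" and ?X = "%y. exp (- (c * (norm (x - y))\<^sup>2) / e\<^sup>2)"
  note [measurable] = G(1) khat_measurable[OF m] khat_measurable[OF rho_bar_measurable[OF p]] pD(4)
  have Xm [measurable]: "?X \<in> borel_measurable V" by (rule borel_measurable_volume(1)[OF V]) measurable
  have X1: "\<bar>?X y\<bar> <= 1" for y using c e by (simp add: divide_nonneg_pos)
  have Kg: "Kg \<ge> 0" using G(2) x by force
  have \<tau>: "0 <= \<tau>" "close_to p ?\<rho> 0" using cl by (auto simp: close_to_def)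
  have kb: "\<bar>khat \<alpha> \<rho>'' e x y\<bar> <= K" if cl': "close_to p \<rho>'' \<sigma>" and y: "y \<in> M" for \<rho>'' \<sigma> y
  proof -
   have "khat \<alpha> \<rho>'' e x y <= K * ?X y" by (rule kD(6)[OF x y cl' e(1)])
   also have "... <= K * 1" using X1[of y] K by (intro mult_left_mono) auto
   finally show ?thesis using khat_nonneg[of \<alpha> \<rho>'' e x y] by simp
  qed
  have i1: "integrable V (%y. (khat \<alpha> \<rho>' e x y * G y) * p y)" and i2: "integrable V (%y. (khat \<alpha> ?\<rho> e x y * G y) * p y)"
  proof -
   have g: "\<bar>G y\<bar> <= Kg" if "y \<in> M" for y using G(2) that by blast
   show "integrable V (%y. (khat \<alpha> \<rho>' e x y * G y) * p y)"
   proof (rule pmean_integrable[OF p])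
    show "\<bar>khat \<alpha> \<rho>' e x y * G y\<bar> <= K * Kg" if "y \<in> M" for y by (rule abs_mult_le[OF kb[OF cl that] g[OF that]])
   qed measurable
   show "integrable V (%y. (khat \<alpha> ?\<rho> e x y * G y) * p y)"
   proof (rule pmean_integrable[OF p])
    show "\<bar>khat \<alpha> ?\<rho> e x y * G y\<bar> <= K * Kg" if "y \<in> M" for y by (rule abs_mult_le[OF kb[OF \<tau>(2) that] g[OF that]])
   qed measurable
  qed
  have i3: "integrable V (%y. ?X y * p y)" by (rule pmean_integrable[OF p Xm X1])
  have k: "kint p e x (%y. ?\<rho> y powr (- \<alpha>) * G y) = pmean p (%y. khat \<alpha> ?\<rho> e x y * G y)"
   unfolding kint_def pmean_def khat_def by (simp only: mult.assoc)
  have le: "\<bar>(khat \<alpha> \<rho>' e x y * G y) * p y - (khat \<alpha> ?\<rho> e x y * G y) * p y\<bar> <= (K * \<tau> * Kg) * (?X y * p y)" if y: "y \<in> M" for y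
  proof -
   have d: "\<bar>khat \<alpha> \<rho>' e x y - khat \<alpha> ?\<rho> e x y\<bar> <= K * \<tau> * ?X y" by (rule kD(7)[OF x y cl e(1)])
   have "\<bar>(khat \<alpha> \<rho>' e x y - khat \<alpha> ?\<rho> e x y) * G y * p y\<bar> <= (K * \<tau> * ?X y) * Kg * p y"
    by (intro abs_mult_le d) (use G(2) y pD(2)[OF y] in auto)
   then show ?thesis by (simp add: algebra_simps)
  qed
  have eqn: "pmean p (%y. khat \<alpha> \<rho>' e x y * G y) - kint p e x (%y. ?\<rho> y powr (- \<alpha>) * G y)
   = (LINT y|V. (khat \<alpha> \<rho>' e x y * G y) * p y - (khat \<alpha> ?\<rho> e x y * G y) * p y)"
   unfolding k pmean_def using i1 i2 by simp
  have "\<bar>pmean p (%y. khat \<alpha> \<rho>' e x y * G y) - kint p e x (%y. ?\<rho> y powr (- \<alpha>) * G y)\<bar>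
   <= (LINT y|V. \<bar>(khat \<alpha> \<rho>' e x y * G y) * p y - (khat \<alpha> ?\<rho> e x y * G y) * p y\<bar>)" unfolding eqn by (rule integral_abs_bound)
  also have "... <= (LINT y|V. (K * \<tau> * Kg) * (?X y * p y))"
  proof (rule integral_mono)
   show "integrable V (%y. \<bar>(khat \<alpha> \<rho>' e x y * G y) * p y - (khat \<alpha> ?\<rho> e x y * G y) * p y\<bar>)"
    by (rule integrable_abs[OF Bochner_Integration.integrable_diff[OF i1 i2]])
   show "integrable V (%y. (K * \<tau> * Kg) * (?X y * p y))" by (rule integrable_mult_right[OF i3])
  qed (use le space_V in auto)
  also have "... = (K * \<tau> * Kg) * pmean p ?X" unfolding pmean_def by simp
  also have "... <= (K * \<tau> * Kg) * (C * e ^ CARD('n))" using C(2)[OF x e] K \<tau>(1) Kg by (intro mult_left_mono) auto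
  finally show ?thesis by (simp add: mult_ac)
 qed
 have KC: "K * C > 0" using K C(1) by simp
 show ?thesis by (intro exI[of _ "K * C"] conjI KC ballI allI impI) (rule R; assumption)
qed

end

context kernel_manifold
begin

text \<open>The factor \<open>rho_bar^2 * e^2\<close> is the squared kernel width at
  \<open>x\<close>, and \<open>S\<close> takes the place of the gradient norm. The first and third
  bounds determine the noise constant, hence \<open>C0\<close> and \<open>A\<close> there;
  \<open>Cp\<close> may depend on everything.\<close>

definition moment_bounds :: "real => real => real => ('a => real) => ('a => real) => 'a => ('a => real) => real => real => bool" where
 "moment_bounds C0 Cp \<alpha> p f x \<rho>' e S \<longleftrightarrow>
  pmean p (%y. khat \<alpha> \<rho>' e x y * (f y - f x)\<^sup>2) <= C0 * (rho_bar TYPE('n) p x powr (- \<alpha>) * (rho_bar TYPE('n) p x)\<^sup>2) * (e\<^sup>2 * e ^ CARD('n)) * S\<^sup>2 \<and>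
  (\<forall>y\<in>M. khat \<alpha> \<rho>' e x y * \<bar>f y - f x\<bar> <= Cp * S) \<and>
  (\<forall>y\<in>M. khat \<alpha> \<rho>' e x y <= 2 * A * rho_bar TYPE('n) p x powr (- \<alpha>))"

text \<open>Near \<open>x\<close> the Lipschitz constant of \<open>f\<close> is a manifold constant
  times the gradient norm, and \<open>p y \<le> 2 * p x\<close> with \<open>p x * R ^ d = 1\<close>
  removes the density. Far points contribute \<open>e ^ (d + 6)\<close>, that is
  \<open>e^2 * e ^ d * (e^2)^2\<close>, which fits into the summand \<open>Cp * e^2\<close> of
  \<open>S\<close>; so nothing breaks when the gradient vanishes.\<close>

lemma second_moment:
 "\<exists>C0>0. \<forall>\<alpha> p f. smooth_positive_density TYPE('n) M V p --> smooth_on_manifold TYPE('n) M f -->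
  (\<exists>Cp\<ge>1. \<forall>x\<in>M. \<forall>\<rho>' \<tau> e. close_to p \<rho>' \<tau> --> \<rho>' \<in> borel_measurable V --> 0 < e --> Cp * e <= 1 --> Cp * \<tau> <= 1 -->
   moment_bounds C0 Cp \<alpha> p f x \<rho>' e (gradient_sup_norm TYPE('n) M f + Cp * e\<^sup>2))"
proof -
 obtain BL where BL: "BL > 0" "\<forall>x\<in>M. \<forall>f y. smooth_on_manifold TYPE('n) M f --> y \<in> M --> norm (y - x) < 1 / BL -->
  \<bar>f y - f x\<bar> <= BL * gradient_sup_norm TYPE('n) M f * norm (y - x)"
  using lipschitz_on_manifold[OF sub M] by blast
 obtain BG where BG: "BG > 0" "!!x b. x \<in> M ==> b > 0 ==> integrable V (%y. indicator {y. norm (y - x) < 1 / BG} y * (exp (- b * (norm (y - x))\<^sup>2) * norm (y - x) ^ 2)) \<and>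
  (LINT y|V. indicator {y. norm (y - x) < 1 / BG} y * (exp (- b * (norm (y - x))\<^sup>2) * norm (y - x) ^ 2)) <= BG / sqrt b ^ (CARD('n) + 2)"
  using gaussian_integral_bound[of 2] by blast
 define s2 where "s2 = sqrt (a / 2)"
 have s2: "s2 > 0" using a_pos by (simp add: s2_def)
 \<comment> \<open>The \<open>4\<close> is the \<open>2\<close> of the near kernel bound times the
   \<open>2\<close> of the density ratio; \<open>s2\<close> comes from the halved decay
   rate.\<close>
 define C0 where "C0 = 4 * A * BL\<^sup>2 * BG / s2 ^ (CARD('n) + 2)"
 have C0: "C0 > 0" using A_pos BL(1) BG(1) s2 by (simp add: C0_def)
 have main: "\<exists>Cp\<ge>1. \<forall>x\<in>M. \<forall>\<rho>' \<tau> e. close_to p \<rho>' \<tau> --> \<rho>' \<in> borel_measurable V --> 0 < e --> Cp * e <= 1 --> Cp * \<tau> <= 1 -->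
   moment_bounds C0 Cp \<alpha> p f x \<rho>' e (gradient_sup_norm TYPE('n) M f + Cp * e\<^sup>2)"
  if p: "smooth_positive_density TYPE('n) M V p" and f: "smooth_on_manifold TYPE('n) M f" for \<alpha> p f
 proof -
  note pD = densityD[OF p]
  let ?\<rho> = "rho_bar TYPE('n) p" and ?G = "gradient_sup_norm TYPE('n) M f"
  have pos: "\<forall>x\<in>M. p x > 0" using pD(2) by blast
  note \<rho>c = continuous_on_rho_bar[OF pD(3) pos, where 'n = 'n]
  have \<rho>0: "?\<rho> y > 0" if "y \<in> M" for y using pD(2)[OF that] by (rule rho_bar_pos)
  have \<rho>p: "?\<rho> y powr \<beta> > 0" if "y \<in> M" for y \<beta> using \<rho>0[OF that] by simp
  have fc: "continuous_on M f" by (rule smooth_continuous_on[OF sub f])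
  obtain r c K where kc: "khat_const \<alpha> p r c K" using khat_bounds[OF p] by blast
  note kD = khat_constD[OF kc]
  obtain K1 where K1: "K1 > 0" "\<forall>y\<in>M. \<bar>?\<rho> y powr (- \<alpha>)\<bar> <= K1" using continuous_on_compact_bounded[OF M \<rho>c] by blast
  obtain K2 where K2: "K2 > 0" "\<forall>y\<in>M. \<bar>f y\<bar> <= K2" using continuous_on_compact_bounded[OF M fc] by blast
  obtain q0 where q0: "q0 > 0" "!!y. y \<in> M ==> q0 <= ?\<rho> y powr (- \<alpha>)" using compact_positive_lower_bound[OF M \<rho>c \<rho>p] by blast
  obtain u0 where u0: "u0 > 0" "!!y. y \<in> M ==> u0 <= ?\<rho> y powr (2 - \<alpha>)" using compact_positive_lower_bound[OF M \<rho>c \<rho>p] by blast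
  define r' where "r' = min r (min (1 / BL) (min (1 / BG) 1))"
  have r': "r' > 0" "r' <= r" "r' <= 1 / BL" "r' <= 1 / BG" "r' <= 1" using kD(1) BL(1) BG(1) by (simp_all add: r'_def)
  obtain C' where C': "C' > 0" "\<forall>e>0. exp (- (c * r'\<^sup>2) / e\<^sup>2) <= C' * e ^ (CARD('n) + 6)"
   using exp_inverse_square_bound[of "c * r'\<^sup>2" "CARD('n) + 6"] kD(2) r'(1) by auto
  define D where "D = K * C'"
  have D: "D > 0" using kD(3) C'(1) by (simp add: D_def)
  define Cp where "Cp = 1 + 2 * A * K1 * BL + 2 * D * K2 + 4 * D * K2\<^sup>2 / (C0 * u0) + K + D / (2 * A * q0)"
  have Cpos: "0 < 2 * A * K1 * BL" "0 < 2 * D * K2" "0 < 4 * D * K2\<^sup>2 / (C0 * u0)" "0 < K" "0 < D / (2 * A * q0)"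
   using A_pos K1 BL(1) D K2 C0 u0 kD(3) q0 by simp_all
  have Cp: "1 <= Cp" "2 * A * K1 * BL <= Cp" "2 * D * K2 <= Cp" "4 * D * K2\<^sup>2 / (C0 * u0) <= Cp" "K <= Cp" "D / (2 * A * q0) <= Cp"
   unfolding Cp_def using Cpos by linarith+
  have "moment_bounds C0 Cp \<alpha> p f x \<rho>' e (?G + Cp * e\<^sup>2)"
   if x: "x \<in> M" and cl: "close_to p \<rho>' \<tau>" and m: "\<rho>' \<in> borel_measurable V" and e: "0 < e" "Cp * e <= 1" and \<tau>: "Cp * \<tau> <= 1" for x \<rho>' \<tau> e
  proof -
   define S where "S = ?G + Cp * e\<^sup>2"
   define R where "R = ?\<rho> x"
   define q where "q = R powr (- \<alpha>)"
   have R: "R > 0" using \<rho>0[OF x] by (simp add: R_def)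
   have q: "q > 0" "q <= K1" "q0 <= q" using K1(2) q0(2)[OF x] x \<rho>p[OF x, of "- \<alpha>"] by (auto simp: q_def R_def)
   have u: "u0 <= q * R\<^sup>2"
   proof -
    have "R powr (2 - \<alpha>) = R powr (- \<alpha>) * R powr 2" by (simp add: powr_add[symmetric])
    then show ?thesis using u0(2)[OF x] R by (simp add: q_def R_def)
   qed
   have G0: "?G \<ge> 0" by (rule order_trans[OF norm_ge_zero manifold_gradient_le_sup[OF sub M f x]])
   have K\<tau>: "K * \<tau> <= 1" using Cp(5) \<tau> cl mult_right_mono[of K Cp \<tau>] by (simp add: close_to_def)
   have e1: "e <= 1" using mult_right_mono[OF Cp(1), of e] e by linarith
   have ep: "e ^ (j + k) <= e ^ j" for j k using e(1) e1 by (intro power_decreasing) auto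
   have S0: "0 <= Cp * e\<^sup>2" "?G <= S" "Cp * e\<^sup>2 <= S" using Cp(1) G0 by (auto simp: S_def)
   define b where "b = a / (2 * e\<^sup>2 * R\<^sup>2)"
   have b: "b > 0" using a_pos e R by (simp add: b_def)
   let ?k = "khat \<alpha> \<rho>' e x"
   have near: "?k y <= 2 * A * q * exp (- b * (norm (y - x))\<^sup>2)" if y: "y \<in> M" and n: "norm (y - x) < r'" for y
    using kD(5)[OF x y cl e(1) _ K\<tau>] n r'(2) by (simp add: q_def R_def b_def norm_minus_commute)
   have far: "?k y <= D * e ^ (CARD('n) + 6)" if y: "y \<in> M" and n: "\<not> norm (y - x) < r'" for y
   proof -
    have "r'\<^sup>2 <= (norm (x - y))\<^sup>2" using n r'(1) by (intro power_mono) (auto simp: norm_minus_commute)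
    then have "c * r'\<^sup>2 / e\<^sup>2 <= c * (norm (x - y))\<^sup>2 / e\<^sup>2" using kD(2) by (intro divide_right_mono mult_left_mono) auto
    then have "exp (- (c * (norm (x - y))\<^sup>2) / e\<^sup>2) <= exp (- (c * r'\<^sup>2) / e\<^sup>2)" by simp
    also have "... <= C' * e ^ (CARD('n) + 6)" using C'(2) e(1) by blast
    finally have "K * exp (- (c * (norm (x - y))\<^sup>2) / e\<^sup>2) <= K * (C' * e ^ (CARD('n) + 6))" using kD(3) by (intro mult_left_mono) auto
    then show ?thesis using kD(6)[OF x y cl e(1)] by (simp add: D_def mult.assoc)
   qed
   have gn: "\<bar>f y - f x\<bar> <= BL * ?G * norm (y - x)" if "y \<in> M" "norm (y - x) < r'" for y
    using BL(2) x f that r'(3) by (meson less_le_trans)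
   have gf: "\<bar>f y - f x\<bar> <= 2 * K2" if "y \<in> M" for y
    using K2(2)[rule_format, OF that] K2(2)[rule_format, OF x] by linarith
   have sup: "?k y <= 2 * A * q" if y: "y \<in> M" for y
   proof (cases "norm (y - x) < r'")
    case True
    have "2 * A * q * exp (- b * (norm (y - x))\<^sup>2) <= 2 * A * q * 1" using A_pos q(1) b by (intro mult_left_mono) auto
    then show ?thesis using near[OF y True] by linarith
   next
    case False
    \<comment> \<open>Far from \<open>x\<close> the crude constant \<open>D\<close> is beaten by a
      power of \<open>e\<close>, so the sharp bound \<open>2 * A * q\<close> holds there
      too.\<close>
    have "D * e ^ (CARD('n) + 6) <= D * e" using D ep[of 1 "CARD('n) + 5"] by (intro mult_left_mono) (simp_all add: add.commute)
    also have "... <= (Cp * (2 * A * q0)) * e" using Cp(6) A_pos q0(1) e(1) by (intro mult_right_mono) (auto simp: pos_divide_le_eq)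
    also have "... = (Cp * e) * (2 * A * q0)" by simp
    also have "... <= 1 * (2 * A * q)" using e q A_pos q0(1) Cp(1) by (intro mult_mono) auto
    finally show ?thesis using far[OF y False] by linarith
   qed
   have kg: "?k y * \<bar>f y - f x\<bar> <= Cp * S" if y: "y \<in> M" for y
   proof (cases "norm (y - x) < r'")
    case True
    have "BL * ?G * norm (y - x) <= BL * ?G * 1" using True r'(5) BL(1) G0 by (intro mult_left_mono) auto
    then have "\<bar>f y - f x\<bar> <= BL * ?G" using gn[OF y True] by linarith
    then have "?k y * \<bar>f y - f x\<bar> <= (2 * A * K1) * (BL * ?G)"
     using order_trans[OF sup[OF y] mult_left_mono[OF q(2), of "2 * A"]] A_pos K1(1) by (intro mult_mono) auto
    also have "... = (2 * A * K1 * BL) * ?G" by simp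
    also have "... <= Cp * S" using Cp(1,2) G0 S0(2) by (intro mult_mono) auto
    finally show ?thesis .
   next
    case False
    have "?k y * \<bar>f y - f x\<bar> <= (D * e ^ (CARD('n) + 6)) * (2 * K2)"
     using far[OF y False] gf[OF y] D e(1) by (intro mult_mono) auto
    also have "... = (2 * D * K2) * e ^ (2 + (CARD('n) + 4))" by (simp add: add.commute)
    also have "... <= Cp * e\<^sup>2" using Cp(1,3) ep[of 2 "CARD('n) + 4"] e(1) by (intro mult_mono) auto
    also have "... <= Cp * S" using S0 Cp(1) mult_right_mono[OF Cp(1), of "e\<^sup>2"] by (intro mult_left_mono) auto
    finally show ?thesis .
   qed
   define Q where "Q = 4 * A * BL\<^sup>2 * ?G\<^sup>2 * q * p x"
   define T where "T = D * e ^ (CARD('n) + 6) * (4 * K2\<^sup>2)"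
   have Q0: "0 <= Q" and T0: "0 <= T" using A_pos q(1) pD(2)[OF x] D e(1) by (simp_all add: Q_def T_def)
   let ?I = "%y. indicator {y. norm (y - x) < 1 / BG} y * (exp (- b * (norm (y - x))\<^sup>2) * norm (y - x) ^ 2)"
   note Bx = BG(2)[OF x b]
   have I0: "0 <= ?I y" for y by simp
   have le: "?k y * (f y - f x)\<^sup>2 * p y <= Q * ?I y + T * p y" if y: "y \<in> M" for y
   proof (cases "norm (y - x) < r'")
    case True
    have g2: "(f y - f x)\<^sup>2 <= (BL * ?G * norm (y - x))\<^sup>2" using power_mono[OF gn[OF y True] abs_ge_zero, of 2] by simp
    have py: "p y <= 2 * p x" using kD(4)[OF x y] True r'(2) by (simp add: norm_minus_commute)
    have "?k y * (f y - f x)\<^sup>2 * p y <= (2 * A * q * exp (- b * (norm (y - x))\<^sup>2)) * (BL * ?G * norm (y - x))\<^sup>2 * (2 * p x)"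
     using near[OF y True] g2 py A_pos q(1) pD(2)[OF y] khat_nonneg by (intro mult_mono mult_nonneg_nonneg) auto
    also have "... = Q * (exp (- b * (norm (y - x))\<^sup>2) * norm (y - x) ^ 2)" by (simp add: Q_def power_mult_distrib)
    also have "... = Q * ?I y" using True r'(4) by simp
    finally show ?thesis using mult_nonneg_nonneg[OF T0 less_imp_le[OF pD(2)[OF y]]] by linarith
   next
    case False
    have "(f y - f x)\<^sup>2 <= 4 * K2\<^sup>2" using power_mono[OF gf[OF y] abs_ge_zero, of 2] by (simp add: power_mult_distrib)
    then have "?k y * (f y - f x)\<^sup>2 <= T" unfolding T_def using far[OF y False] D e(1) by (intro mult_mono) auto
    from mult_right_mono[OF this less_imp_le[OF pD(2)[OF y]]] show ?thesis using mult_nonneg_nonneg[OF Q0 I0[of y]] by linarith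
   qed
   have fm: "f \<in> borel_measurable V" by (rule borel_measurable_volume(2)[OF V fc])
   note [measurable] = fm khat_measurable[OF m] pD(4)
   have "pmean p (%y. ?k y * (f y - f x)\<^sup>2) <= (LINT y|V. Q * ?I y + T * p y)"
    unfolding pmean_def
   proof (rule integral_mono)
    show "integrable V (%y. Q * ?I y + T * p y)" using Bx pD(5) by simp
    show "integrable V (%y. ?k y * (f y - f x)\<^sup>2 * p y)"
    proof (rule pmean_integrable[OF p])
     fix y assume y: "y \<in> M"
     have "\<bar>?k y\<bar> <= 2 * A * q" using sup[OF y] khat_nonneg by simp
     moreover have "\<bar>(f y - f x)\<^sup>2\<bar> <= (2 * K2)\<^sup>2" using power_mono[OF gf[OF y] abs_ge_zero, of 2] by simp
     ultimately show "\<bar>?k y * (f y - f x)\<^sup>2\<bar> <= (2 * A * q) * (2 * K2)\<^sup>2" by (rule abs_mult_le)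
    qed measurable
   qed (use le space_V in auto)
   also have "... = Q * (LINT y|V. ?I y) + T" using Bx pD(5,6) by simp
   also have "... <= Q * (BG / sqrt b ^ (CARD('n) + 2)) + T" using Bx Q0 by (intro add_right_mono mult_left_mono) auto
   also have "Q * (BG / sqrt b ^ (CARD('n) + 2)) = C0 * (q * R\<^sup>2) * (e\<^sup>2 * e ^ CARD('n)) * ?G\<^sup>2"
   proof -
    have sb: "sqrt b = s2 / (e * R)"
    proof -
     have "b = (a / 2) / (e * R)\<^sup>2" by (simp add: b_def power_mult_distrib)
     then have "sqrt b = sqrt (a / 2) / sqrt ((e * R)\<^sup>2)" by (simp only: real_sqrt_divide)
     then show ?thesis using e R by (simp only: s2_def real_sqrt_abs abs_of_pos mult_pos_pos)
    qed
    \<comment> \<open>Here the density leaves the constant: the \<open>d\<close>-th power of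
      \<open>rho_bar\<close> is its reciprocal.\<close>
    have pR: "p x * R ^ CARD('n) = 1"
    proof -
     have "R ^ CARD('n) = p x powr (- 1)" using pD(2)[OF x] by (simp add: R_def rho_bar_def powr_realpow[symmetric] powr_powr)
     then show ?thesis using pD(2)[OF x] by (simp add: powr_minus)
    qed
    have "Q * (BG / sqrt b ^ (CARD('n) + 2)) = C0 * ?G\<^sup>2 * q * p x * (e * R) ^ (CARD('n) + 2)"
     unfolding sb using s2 e R by (simp add: Q_def C0_def power_divide field_simps)
    also have "(e * R) ^ (CARD('n) + 2) = (e\<^sup>2 * e ^ CARD('n)) * (R ^ CARD('n) * R\<^sup>2)" by (simp add: power_mult_distrib power_add power2_eq_square mult_ac)
    also have "C0 * ?G\<^sup>2 * q * p x * ((e\<^sup>2 * e ^ CARD('n)) * (R ^ CARD('n) * R\<^sup>2)) = C0 * (q * R\<^sup>2) * (e\<^sup>2 * e ^ CARD('n)) * ?G\<^sup>2 * (p x * R ^ CARD('n))"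
     by (simp only: mult_ac)
    finally show ?thesis unfolding pR by simp
   qed
   also have "T <= C0 * (q * R\<^sup>2) * (e\<^sup>2 * e ^ CARD('n)) * (Cp * e\<^sup>2)\<^sup>2"
   proof -
    have "4 * D * K2\<^sup>2 <= Cp * (C0 * u0)" using Cp(4) C0 u0(1) by (simp add: pos_divide_le_eq)
    also have "... <= Cp\<^sup>2 * (C0 * (q * R\<^sup>2))"
     using Cp(1) u C0 u0(1) by (intro mult_mono mult_left_mono) (auto simp: power2_eq_square)
    finally have "(4 * D * K2\<^sup>2) * e ^ (CARD('n) + 6) <= (Cp\<^sup>2 * (C0 * (q * R\<^sup>2))) * e ^ (CARD('n) + 6)" using e(1) by (intro mult_right_mono) auto
    moreover have "e ^ (CARD('n) + 6) = (e\<^sup>2 * e ^ CARD('n)) * (e\<^sup>2)\<^sup>2"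
    proof -
     have "CARD('n) + 6 = 2 + CARD('n) + 2 * 2" by simp
     then have "e ^ (CARD('n) + 6) = e ^ (2 + CARD('n) + 2 * 2)" by (rule arg_cong)
     then show ?thesis by (simp only: power_add power_mult)
    qed
    ultimately show ?thesis unfolding T_def by (simp add: power_mult_distrib mult_ac)
   qed
   finally have "pmean p (%y. ?k y * (f y - f x)\<^sup>2) <= C0 * (q * R\<^sup>2) * (e\<^sup>2 * e ^ CARD('n)) * ?G\<^sup>2 + C0 * (q * R\<^sup>2) * (e\<^sup>2 * e ^ CARD('n)) * (Cp * e\<^sup>2)\<^sup>2" by simp
   also have "... = C0 * (q * R\<^sup>2) * (e\<^sup>2 * e ^ CARD('n)) * (?G\<^sup>2 + (Cp * e\<^sup>2)\<^sup>2)" by (rule distrib_left[symmetric])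
   also have "... <= C0 * (q * R\<^sup>2) * (e\<^sup>2 * e ^ CARD('n)) * S\<^sup>2"
   proof (rule mult_left_mono)
    show "?G\<^sup>2 + (Cp * e\<^sup>2)\<^sup>2 <= S\<^sup>2" using mult_nonneg_nonneg[OF G0 S0(1)] by (simp add: S_def power2_sum mult_ac)
   qed (use C0 q(1) e(1) in simp)
   finally show ?thesis unfolding moment_bounds_def S_def[symmetric] R_def[symmetric] q_def[symmetric]
    using kg sup by blast
  qed
  then show ?thesis using Cp(1) by blast
 qed
 show ?thesis by (rule exI[of _ C0], intro conjI C0 allI impI) (rule main; assumption)
qed

end

section \<open>The probability estimate for the graph Laplacian\<close>

context kernel_manifold
begin

lemma density_prob_space:
 assumes p: "smooth_positive_density TYPE('n) M V p"
 shows "prob_space (density V (%x. ennreal (p x)))"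
  and "F \<in> borel_measurable V ==> (LINT y|density V (%x. ennreal (p x)). F y) = pmean p F"
proof -
 note pD = densityD[OF p]
 note [measurable] = pD(4)
 show "prob_space (density V (%x. ennreal (p x)))"
 proof (rule prob_spaceI)
  have "emeasure (density V (%x. ennreal (p x))) (space V) = (\<integral>\<^sup>+x. ennreal (p x) * indicator (space V) x \<partial>V)"
   by (rule emeasure_density) measurable
  also have "... = (\<integral>\<^sup>+x. ennreal (p x) \<partial>V)" by (rule nn_integral_cong) simp
  also have "... = 1" using p by (simp add: smooth_positive_density_def)
  finally show "emeasure (density V (%x. ennreal (p x))) (space (density V (%x. ennreal (p x)))) = 1" by simp
 qed
 assume F: "F \<in> borel_measurable V"
 have "AE x in V. 0 <= p x" by (rule AE_I2) (use pD(2) space_V in \<open>auto intro: less_imp_le\<close>)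
 from integral_density[OF F pD(4) this] show "(LINT y|density V (%x. ennreal (p x)). F y) = pmean p F"
  by (simp add: pmean_def mult.commute)
qed

lemma pmean_abs_bound:
 assumes p: "smooth_positive_density TYPE('n) M V p" and F: "F \<in> borel_measurable V" and B: "!!y. y \<in> M ==> \<bar>F y\<bar> <= B"
 shows "\<bar>pmean p F\<bar> <= B"
proof -
 note pD = densityD[OF p]
 have "\<bar>pmean p F\<bar> <= (LINT y|V. \<bar>F y * p y\<bar>)" unfolding pmean_def by (rule integral_abs_bound)
 also have "... <= (LINT y|V. B * p y)"
 proof (rule integral_mono)
  show "integrable V (%y. \<bar>F y * p y\<bar>)" by (rule integrable_abs[OF pmean_integrable[OF p F B]])
  show "integrable V (%y. B * p y)" using pD(5) by simp
  show "\<bar>F y * p y\<bar> <= B * p y" if "y \<in> space V" for y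
   by (rule abs_mult_le) (use B pD(2) that space_V in \<open>auto simp: abs_of_pos\<close>)
 qed
 also have "... = B" using pD(6) by simp
 finally show ?thesis .
qed

text \<open>The asymptotic hypotheses are replaced by inequalities with one threshold
  \<open>\<eta>\<close> that may depend on \<open>\<alpha>\<close>, \<open>p\<close> and
  \<open>f\<close>. It is the same for all points, bandwidth functions and sample sizes, whereas
  \<open>C1\<close> precedes everything.\<close>

lemma laplacian_concentration:
 "\<exists>C1>0. \<forall>\<alpha> p f. smooth_positive_density TYPE('n) M V p --> smooth_on_manifold TYPE('n) M f -->
  (\<exists>C>0. \<exists>\<eta>>0. \<forall>x\<in>M. \<forall>\<rho>' \<tau> e N. close_to p \<rho>' \<tau> --> \<rho>' \<in> borel_measurable V --> 0 < e --> e <= \<eta> --> \<tau> <= \<eta> --> 2 <= N -->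
   ln (real N) <= \<eta> * (real N * (e\<^sup>2 * e ^ CARD('n))) -->
   measure (iid_sample V p N) {X\<in>space (iid_sample V p N).
    \<bar>graph_laplacian_rw TYPE('n) k0 \<alpha> (e\<^sup>2) \<rho>' N X f x - limit_operator TYPE('n) M p \<alpha> f x\<bar>
     <= C * (e\<^sup>2 + \<tau> / e\<^sup>2) + C1 * (gradient_sup_norm TYPE('n) M f * p x powr (1 / real CARD('n)) * sqrt (ln (real N) / (real N * (e\<^sup>2 * e ^ CARD('n)))))}
   > 1 - 4 * real N powr (- 10))"
proof -
 define m0 where "m0 = kernel_m0 TYPE('n) k0"
 define m2 where "m2 = kernel_m2 TYPE('n) k0"
 have m: "m0 > 0" "m2 > 0" unfolding m0_def m2_def by (rule kernel_m0_pos, rule kernel_m2_pos)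
 obtain C0 where C0: "C0 > 0" "\<forall>\<alpha> p f. smooth_positive_density TYPE('n) M V p --> smooth_on_manifold TYPE('n) M f -->
  (\<exists>Cp\<ge>1. \<forall>x\<in>M. \<forall>\<rho>' \<tau> e. close_to p \<rho>' \<tau> --> \<rho>' \<in> borel_measurable V --> 0 < e --> Cp * e <= 1 --> Cp * \<tau> <= 1 -->
   moment_bounds C0 Cp \<alpha> p f x \<rho>' e (gradient_sup_norm TYPE('n) M f + Cp * e\<^sup>2))"
  using second_moment by (elim exE conjE) (rule that)
 define C1 where "C1 = 24 * sqrt (22 * A * C0) / m2 + 1"
 have C1: "C1 > 0" using A_pos C0(1) m by (simp add: C1_def add_nonneg_pos)
 have main: "\<exists>C>0. \<exists>\<eta>>0. \<forall>x\<in>M. \<forall>\<rho>' \<tau> e N. close_to p \<rho>' \<tau> --> \<rho>' \<in> borel_measurable V --> 0 < e --> e <= \<eta> --> \<tau> <= \<eta> --> 2 <= N -->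
   ln (real N) <= \<eta> * (real N * (e\<^sup>2 * e ^ CARD('n))) -->
   measure (iid_sample V p N) {X\<in>space (iid_sample V p N).
    \<bar>graph_laplacian_rw TYPE('n) k0 \<alpha> (e\<^sup>2) \<rho>' N X f x - limit_operator TYPE('n) M p \<alpha> f x\<bar>
     <= C * (e\<^sup>2 + \<tau> / e\<^sup>2) + C1 * (gradient_sup_norm TYPE('n) M f * p x powr (1 / real CARD('n)) * sqrt (ln (real N) / (real N * (e\<^sup>2 * e ^ CARD('n)))))}
   > 1 - 4 * real N powr (- 10)"
  if p: "smooth_positive_density TYPE('n) M V p" and f: "smooth_on_manifold TYPE('n) M f" for \<alpha> p f
 proof -
  note pD = densityD[OF p]
  let ?\<rho> = "rho_bar TYPE('n) p" and ?G = "gradient_sup_norm TYPE('n) M f"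
  have pos: "\<forall>x\<in>M. p x > 0" using pD(2) by blast
  note \<rho>c = continuous_on_rho_bar[OF pD(3) pos, where 'n = 'n]
  have \<rho>0: "?\<rho> y > 0" if "y \<in> M" for y using pD(2)[OF that] by (rule rho_bar_pos)
  have \<rho>p: "?\<rho> y powr \<beta> > 0" if "y \<in> M" for y \<beta> using \<rho>0[OF that] by simp
  have fc: "continuous_on M f" by (rule smooth_continuous_on[OF sub f])
  have fm: "f \<in> borel_measurable V" by (rule borel_measurable_volume(2)[OF V fc])
  obtain Cp where Cp: "Cp \<ge> 1" "\<forall>x\<in>M. \<forall>\<rho>' \<tau> e. close_to p \<rho>' \<tau> --> \<rho>' \<in> borel_measurable V --> 0 < e --> Cp * e <= 1 --> Cp * \<tau> <= 1 -->
   moment_bounds C0 Cp \<alpha> p f x \<rho>' e (?G + Cp * e\<^sup>2)"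
   using C0(2)[THEN spec[where x=\<alpha>], THEN spec[where x=p], THEN spec[where x=f], THEN mp, THEN mp, OF p f] by (elim exE conjE) (rule that)
  obtain B where B: "B > 0" "\<forall>x\<in>M. bias_at \<alpha> p f B x (limit_operator TYPE('n) M p \<alpha> f x)"
   using bias_global[OF p f, where \<alpha> = \<alpha>] by (elim exE conjE) (rule that)
  obtain Cr where Cr: "Cr > 0" "\<forall>x\<in>M. \<forall>\<rho>' \<tau> e G Kg. close_to p \<rho>' \<tau> --> \<rho>' \<in> borel_measurable V --> 0 < e --> e <= 1 -->
   G \<in> borel_measurable V --> (\<forall>y\<in>M. \<bar>G y\<bar> <= Kg) -->
   \<bar>pmean p (%y. khat \<alpha> \<rho>' e x y * G y) - kint p e x (%y. ?\<rho> y powr (- \<alpha>) * G y)\<bar> <= Cr * Kg * (\<tau> * e ^ CARD('n))"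
   using bandwidth_replacement[OF p, where \<alpha> = \<alpha>] by (elim exE conjE) (rule that)
  note CrD = Cr(2)[THEN bspec, THEN spec, THEN spec, THEN spec, THEN spec, THEN spec, THEN mp, THEN mp, THEN mp, THEN mp, THEN mp, THEN mp]
  note CpD = Cp(2)[THEN bspec, THEN spec, THEN spec, THEN spec, THEN mp, THEN mp, THEN mp, THEN mp, THEN mp]
  obtain r c K where kc: "khat_const \<alpha> p r c K" using khat_bounds[OF p] by blast
  note kD = khat_constD[OF kc]
  obtain K1 where K1: "K1 > 0" "\<forall>y\<in>M. \<bar>?\<rho> y powr (- \<alpha>)\<bar> <= K1" using continuous_on_compact_bounded[OF M \<rho>c] by blast
  obtain b1 where b1: "b1 > 0" "\<forall>y\<in>M. \<bar>?\<rho> y powr 1\<bar> <= b1" using continuous_on_compact_bounded[OF M \<rho>c] by blast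
  obtain K3 where K3: "K3 > 0" "\<forall>y\<in>M. \<bar>?\<rho> y powr (- 1)\<bar> <= K3" using continuous_on_compact_bounded[OF M \<rho>c] by blast
  obtain K2 where K2: "K2 > 0" "\<forall>y\<in>M. \<bar>f y\<bar> <= K2" using continuous_on_compact_bounded[OF M fc] by blast
  obtain q0 where q0: "q0 > 0" "!!y. y \<in> M ==> q0 <= ?\<rho> y powr (- \<alpha>)" using compact_positive_lower_bound[OF M \<rho>c \<rho>p] by blast
  obtain u0 where u0: "u0 > 0" "!!y. y \<in> M ==> u0 <= ?\<rho> y powr (2 - \<alpha>)" using compact_positive_lower_bound[OF M \<rho>c \<rho>p] by blast
  obtain s0 where s0: "s0 > 0" "!!y. y \<in> M ==> s0 <= ?\<rho> y powr 2" using compact_positive_lower_bound[OF M \<rho>c \<rho>p] by blast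
  have gf: "\<bar>f y - f x\<bar> <= 2 * K2" if "x \<in> M" "y \<in> M" for x y
   using K2(2)[rule_format, OF that(1)] K2(2)[rule_format, OF that(2)] by linarith
  have gm: "(%y. f y - f x) \<in> borel_measurable V" for x using fm by simp
  define C where "C = B + Cr * (2 * K2) + Cr"
  have c0: "0 < Cr * (2 * K2)" using Cr(1) K2(1) by simp
  have C: "C > 0" "B <= C" "Cr * (2 * K2) + B <= C" "Cr + B <= C" "Cr * (2 * K2) <= C" "Cr <= C"
   unfolding C_def using B(1) Cr(1) c0 by linarith+
  define Cl where "Cl = (B + 2 * K * K2) / (m2 / 2 * u0)"
  have Cl0: "Cl \<ge> 0" using B(1) kD(3) K2(1) m u0(1) by (simp add: Cl_def)
  \<comment> \<open>The limit operator is bounded by reading the bias estimate at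
    \<open>e = 1\<close>, where the integral is trivially bounded; its coordinate formula is not
    estimated.\<close>
  have Cl: "\<bar>limit_operator TYPE('n) M p \<alpha> f x\<bar> <= Cl" if x: "x \<in> M" for x
  proof -
   let ?Lm = "limit_operator TYPE('n) M p \<alpha> f x"
   have cl: "close_to p ?\<rho> 0" by (simp add: close_to_def)
   note \<rho>m = rho_bar_measurable[OF p]
   have k1: "\<bar>pmean p (%y. khat \<alpha> ?\<rho> 1 x y * (f y - f x))\<bar> <= K * (2 * K2)"
   proof (rule pmean_abs_bound[OF p])
    show "(%y. khat \<alpha> ?\<rho> 1 x y * (f y - f x)) \<in> borel_measurable V"
     by (rule borel_measurable_times[OF khat_measurable[OF \<rho>m] gm])
    fix y assume y: "y \<in> M"
    have "khat \<alpha> ?\<rho> 1 x y <= K * exp (- (c * (norm (x - y))\<^sup>2) / 1\<^sup>2)" by (rule kD(6)[OF x y cl]) simp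
    also have "... <= K * 1" using kD(2,3) by (intro mult_left_mono) auto
    finally show "\<bar>khat \<alpha> ?\<rho> 1 x y * (f y - f x)\<bar> <= K * (2 * K2)"
     using khat_nonneg[of \<alpha> ?\<rho> 1 x y] by (intro abs_mult_le gf[OF x y]) simp
   qed
   have k2: "\<bar>pmean p (%y. khat \<alpha> ?\<rho> 1 x y * (f y - f x)) - kint p 1 x (%y. ?\<rho> y powr (- \<alpha>) * (f y - f x))\<bar> <= Cr * (2 * K2) * (0 * 1 ^ CARD('n))"
    by (rule CrD[OF x cl \<rho>m _ _ gm]) (use gf[OF x] in auto)
   have k3: "\<bar>kint p 1 x (%y. ?\<rho> y powr (- \<alpha>) * (f y - f x)) - 1 ^ (CARD('n) + 2) * (kernel_m2 TYPE('n) k0 / 2 * ?\<rho> x powr (2 - \<alpha>) * ?Lm)\<bar> <= B * 1 ^ (CARD('n) + 4)"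
    using B(2)[THEN bspec, OF x, unfolded bias_at_def, THEN spec, of 1] by simp
   have "\<bar>m2 / 2 * ?\<rho> x powr (2 - \<alpha>) * ?Lm\<bar> <= B + 2 * K * K2" using k1 k2 k3 by (simp add: m2_def)
   moreover have "\<bar>m2 / 2 * ?\<rho> x powr (2 - \<alpha>) * ?Lm\<bar> = (m2 / 2 * ?\<rho> x powr (2 - \<alpha>)) * \<bar>?Lm\<bar>" using m by (simp add: abs_mult)
   moreover have "(m2 / 2 * u0) * \<bar>?Lm\<bar> <= (m2 / 2 * ?\<rho> x powr (2 - \<alpha>)) * \<bar>?Lm\<bar>" using m u0(2)[OF x] by (intro mult_right_mono mult_left_mono) auto
   ultimately have "(m2 / 2 * u0) * \<bar>?Lm\<bar> <= B + 2 * K * K2" by linarith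
   then show ?thesis using m u0(1) by (simp add: Cl_def pos_le_divide_eq mult.commute)
  qed
  define Cb where "Cb = 3 * (2 * C / (m2 * s0 * q0) + 3 * Cl + 2 * Cl * C / (m0 * q0))"
  have Cb0: "Cb \<ge> 0" using C(1) m s0(1) q0(1) Cl0 by (simp add: Cb_def)
  define C5 where "C5 = 264 * (Cp + 2 * A * K1 * sqrt (2 * C0 / m0) * b1) / (m2 * u0) * b1"
  have C5: "C5 \<ge> 0" using Cp(1) A_pos K1(1) b1(1) C0(1) m u0(1) by (simp add: C5_def)
  define Ct where "Ct = Cb + C1 * Cp * K3 + 1"
  have Ct: "Ct > 0" "Cb + C1 * Cp * K3 <= Ct" using Cb0 C1 Cp(1) K3(1) by (simp_all add: Ct_def add_nonneg_pos)
  \<comment> \<open>In turn: the range of \<open>moment_bounds\<close>; a mean denominator above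
    half of its leading term; absorption of the range term in \<open>noise_arith\<close>; and the
    hypothesis \<open>256 * (H * l) \<le> \<delta>\<close> of the concentration lemma, where
    \<open>11264 = 256 * 2 * 11 * 2\<close>.\<close>
  define \<eta> where "\<eta> = min (1 / Cp) (min (m0 * q0 / (4 * C)) (min (1 / (C5 + 1)\<^sup>2) (m0 / (11264 * A))))"
  have \<eta>: "\<eta> > 0" "\<eta> <= 1 / Cp" "\<eta> <= m0 * q0 / (4 * C)" "\<eta> <= 1 / (C5 + 1)\<^sup>2" "\<eta> <= m0 / (11264 * A)"
   using Cp(1) m q0(1) C(1) C5 A_pos by (simp_all add: \<eta>_def)
  have \<eta>1: "Cp * \<eta> <= 1" "\<eta> <= 1"
  proof -
   show "Cp * \<eta> <= 1" using \<eta>(2) Cp(1) by (simp add: pos_le_divide_eq mult.commute)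
   have "1 / Cp <= 1" using Cp(1) by simp
   then show "\<eta> <= 1" using \<eta>(2) by linarith
  qed
  have "measure (iid_sample V p N) {X\<in>space (iid_sample V p N).
    \<bar>graph_laplacian_rw TYPE('n) k0 \<alpha> (e\<^sup>2) \<rho>' N X f x - limit_operator TYPE('n) M p \<alpha> f x\<bar>
     <= Ct * (e\<^sup>2 + \<tau> / e\<^sup>2) + C1 * (?G * p x powr (1 / real CARD('n)) * sqrt (ln (real N) / (real N * (e\<^sup>2 * e ^ CARD('n)))))}
   > 1 - 4 * real N powr (- 10)"
   if x: "x \<in> M" and cl: "close_to p \<rho>' \<tau>" and \<rho>m: "\<rho>' \<in> borel_measurable V" and e: "0 < e" "e <= \<eta>" and \<tau>: "\<tau> <= \<eta>" and N: "2 <= N"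
    and lN: "ln (real N) <= \<eta> * (real N * (e\<^sup>2 * e ^ CARD('n)))" for x \<rho>' \<tau> e N
  proof -
   define S where "S = ?G + Cp * e\<^sup>2"
   define R where "R = ?\<rho> x"
   define R' where "R' = \<rho>' x"
   define q where "q = R powr (- \<alpha>)"
   define E where "E = e ^ CARD('n)"
   define L where "L = ln (real N) / (real N * (e\<^sup>2 * E))"
   define Lm where "Lm = limit_operator TYPE('n) M p \<alpha> f x"
   define D where "D = density V (%x. ennreal (p x))"
   define \<kappa> where "\<kappa> = khat \<alpha> \<rho>' e x"
   define g where "g y = f y - f x" for y
   define \<delta> where "\<delta> = pmean p \<kappa>"
   define \<nu> where "\<nu> = pmean p (%y. \<kappa> y * g y)"
   define W where "W = C0 * (q * R\<^sup>2) * (e\<^sup>2 * E) * S\<^sup>2"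
   \<comment> \<open>This is \<open>11 * ln N / N\<close>, so each of the three exceptional events
     has probability at most \<open>N powr (- 11)\<close>, together less than
     \<open>4 * N powr (- 10)\<close>. It is written with \<open>L\<close> for the sake of
     \<open>noise_arith\<close>.\<close>
   define l where "l = 11 * L * (e\<^sup>2 * E)"
   have R: "R > 0" "R <= b1" "s0 <= R\<^sup>2" using \<rho>0[OF x] b1(2)[rule_format, OF x] s0(2)[OF x] by (auto simp: R_def)
   have q: "q > 0" "q <= K1" "q0 <= q" using K1(2) q0(2)[OF x] x \<rho>p[OF x, of "- \<alpha>"] by (auto simp: q_def R_def)
   have qR: "R powr (2 - \<alpha>) = q * R\<^sup>2"
   proof -
    have "R powr (2 - \<alpha>) = R powr (- \<alpha>) * R powr 2" by (simp add: powr_add[symmetric])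
    then show ?thesis using R(1) by (simp add: q_def)
   qed
   have u: "u0 <= q * R\<^sup>2" using u0(2)[OF x] unfolding R_def[symmetric] qR .
   have e1: "e <= 1" using e(2) \<eta>1(2) by linarith
   have E0: "E > 0" using e(1) by (simp add: E_def)
   have Cpe: "Cp * e <= 1" "Cp * \<tau> <= 1"
    using mult_left_mono[OF e(2), of Cp] mult_left_mono[OF \<tau>, of Cp] Cp(1) \<eta>1(1) by linarith+
   have \<tau>0: "0 <= \<tau>" "\<tau> <= 1 / 10" "\<bar>R' - R\<bar> <= \<tau> * R" using cl x by (auto simp: close_to_def R_def R'_def)
   have G0: "?G \<ge> 0" by (rule order_trans[OF norm_ge_zero manifold_gradient_le_sup[OF sub M f x]])
   have S0: "S > 0" using G0 Cp(1) e(1) by (simp add: S_def add_nonneg_pos)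
   have Np: "real N > 0" using N by simp
   have L: "0 <= L" "L <= \<eta>"
   proof -
    have d: "0 < real N * (e\<^sup>2 * E)" using Np e(1) E0 by simp
    show "0 <= L" unfolding L_def using d N by (intro divide_nonneg_pos) auto
    show "L <= \<eta>" unfolding L_def pos_divide_le_eq[OF d] using lN by (simp only: E_def)
   qed
   have "moment_bounds C0 Cp \<alpha> p f x \<rho>' e (?G + Cp * e\<^sup>2)" by (rule CpD[OF x cl \<rho>m e(1) Cpe])
   note mb = this[unfolded moment_bounds_def, folded S_def R_def q_def E_def \<kappa>_def g_def W_def]
   have \<kappa>m: "\<kappa> \<in> borel_measurable V" unfolding \<kappa>_def by (rule khat_measurable[OF \<rho>m])
   have gm': "g \<in> borel_measurable V" unfolding g_def[abs_def] by (rule gm)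
   have gK: "\<bar>g y\<bar> <= 2 * K2" if "y \<in> M" for y unfolding g_def by (rule gf[OF x that])
   have bias: "\<bar>kint p e x (%y. ?\<rho> y powr (- \<alpha>) * g y) - e ^ (CARD('n) + 2) * (m2 / 2 * R powr (2 - \<alpha>) * Lm)\<bar> <= B * e ^ (CARD('n) + 4)"
    "\<bar>kint p e x (%y. ?\<rho> y powr (- \<alpha>)) - E * (m0 * q)\<bar> <= B * e ^ (CARD('n) + 2)"
    using B(2)[THEN bspec, OF x, unfolded bias_at_def, THEN spec, THEN mp, THEN mp, OF e(1) e1]
    unfolding Lm_def R_def m2_def m0_def g_def q_def E_def by simp_all
   have eE: "e ^ (CARD('n) + 2) = e\<^sup>2 * E" "e ^ (CARD('n) + 4) = e ^ 4 * E" by (simp_all add: E_def power_add power2_eq_square)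
   have r1: "\<bar>\<nu> - e\<^sup>2 * E * (m2 / 2 * (q * R\<^sup>2) * Lm)\<bar> <= C * ((e ^ 4 + \<tau>) * E)"
   proof -
    have "\<bar>\<nu> - kint p e x (%y. ?\<rho> y powr (- \<alpha>) * g y)\<bar> <= Cr * (2 * K2) * (\<tau> * E)"
     unfolding \<nu>_def \<kappa>_def E_def by (rule CrD[OF x cl \<rho>m e(1) e1 gm']) (use gK in blast)
    moreover have "Cr * (2 * K2) * (\<tau> * E) <= C * (\<tau> * E)" "B * (e ^ 4 * E) <= C * (e ^ 4 * E)"
     using \<tau>0(1) E0 e(1) by (intro mult_right_mono C; simp)+
    moreover have "C * ((e ^ 4 + \<tau>) * E) = C * (e ^ 4 * E) + C * (\<tau> * E)" by (simp add: algebra_simps)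
    ultimately show ?thesis using bias(1) unfolding eE qR by linarith
   qed
   have r2: "\<bar>\<delta> - E * (m0 * q)\<bar> <= C * ((e\<^sup>2 + \<tau>) * E)"
   proof -
    have "\<bar>pmean p (%y. khat \<alpha> \<rho>' e x y * 1) - kint p e x (%y. ?\<rho> y powr (- \<alpha>) * 1)\<bar> <= Cr * 1 * (\<tau> * E)"
     unfolding E_def by (rule CrD[OF x cl \<rho>m e(1) e1]) auto
    then have "\<bar>\<delta> - kint p e x (%y. ?\<rho> y powr (- \<alpha>))\<bar> <= Cr * (\<tau> * E)" unfolding \<delta>_def \<kappa>_def by simp
    moreover have "Cr * (\<tau> * E) <= C * (\<tau> * E)" "B * (e\<^sup>2 * E) <= C * (e\<^sup>2 * E)"
     using \<tau>0(1) E0 e(1) by (intro mult_right_mono C; simp)+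
    moreover have "C * ((e\<^sup>2 + \<tau>) * E) = C * (e\<^sup>2 * E) + C * (\<tau> * E)" by (simp add: algebra_simps)
    ultimately show ?thesis using bias(2) unfolding eE by linarith
   qed
   have \<delta>: "m0 * q * E / 2 <= \<delta>"
   proof -
    have "e\<^sup>2 <= e" using e(1) e1 by (simp add: power2_eq_square mult_left_le)
    then have "e\<^sup>2 + \<tau> <= 2 * (m0 * q0 / (4 * C))" using e(2) \<tau> \<eta>(3) by linarith
    then have "C * (e\<^sup>2 + \<tau>) <= C * (2 * (m0 * q0 / (4 * C)))" using C(1) by (intro mult_left_mono) auto
    also have "... = m0 * q0 / 2" using C(1) by simp
    also have "... <= m0 * q / 2" using m q(3) by simp
    finally have "C * (e\<^sup>2 + \<tau>) * E <= m0 * q / 2 * E" using E0 by (intro mult_right_mono) auto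
    then have "C * ((e\<^sup>2 + \<tau>) * E) <= m0 * q * E / 2" by (simp only: mult.assoc times_divide_eq_left)
    moreover have "E * (m0 * q) = m0 * q * E" by simp
    ultimately show ?thesis using r2 unfolding abs_le_iff by linarith
   qed
   have \<delta>0: "\<delta> > 0" by (rule less_le_trans[OF _ \<delta>]) (use m q E0 in simp)
   have l0: "0 <= l" using L(1) E0 by (simp add: l_def)
   have Hl: "256 * (2 * A * q * l) <= \<delta>"
   proof -
    have "11264 * A * L <= 11264 * A * (m0 / (11264 * A))" using L(2) \<eta>(5) A_pos by (intro mult_left_mono) auto
    then have "11264 * A * L <= m0" using A_pos by simp
    then have h1: "(11264 * A * L) * (q * E / 2) <= m0 * (q * E / 2)" using q(1) E0 by (intro mult_right_mono) auto
    have "256 * (2 * A * q * l) = ((11264 * A * L) * (q * E / 2)) * e\<^sup>2" by (simp add: l_def)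
    also have "... <= ((11264 * A * L) * (q * E / 2)) * 1"
     using e(1) e1 A_pos L(1) q(1) E0 by (intro mult_left_mono) (auto simp: power_le_one)
    also have "... <= m0 * (q * E / 2)" using h1 by (simp only: mult_1_right)
    also have "... = m0 * q * E / 2" by (simp only: mult.assoc times_divide_eq_right)
    also have "... <= \<delta>" by (rule \<delta>)
    finally show ?thesis .
   qed
   note dp = density_prob_space[OF p, folded D_def]
   have spD: "space D = M" by (simp add: D_def space_V)
   have mD: "\<kappa> \<in> borel_measurable D" "g \<in> borel_measurable D" using \<kappa>m gm' by (simp_all add: D_def)
   have i1: "(LINT y|D. \<kappa> y) = \<delta>" unfolding \<delta>_def by (rule dp(2)[OF \<kappa>m])
   have i2: "(LINT y|D. \<kappa> y * g y) = \<nu>" unfolding \<nu>_def by (rule dp(2)) (rule borel_measurable_times[OF \<kappa>m gm'])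
   have i3: "(LINT y|D. \<kappa> y * (g y)\<^sup>2) <= W"
   proof -
    have "(LINT y|D. \<kappa> y * (g y)\<^sup>2) = pmean p (%y. \<kappa> y * (g y)\<^sup>2)"
     by (rule dp(2)) (rule borel_measurable_times[OF \<kappa>m borel_measurable_power[OF gm']])
    then show ?thesis unfolding W_def using mb[THEN conjunct1, unfolded W_def] by (simp only:)
   qed
   have kn: "0 <= \<kappa> y" for y unfolding \<kappa>_def by (rule khat_nonneg)
   have N0: "N > 0" using N by simp
   note wm = weighted_mean_concentration[of D \<kappa> g "2 * A * q" "2 * K2" "Cp * S" \<delta> \<nu> W l N]
   have G1: "0 < Cp * S" using Cp(1) S0 by simp
   have cs: "\<nu>\<^sup>2 <= \<delta> * W"
    by (rule wm(1)[OF dp(1) mD kn _ _ _ G1 i1 \<delta>0 i2 i3 l0 Hl N0]) (use mb gK spD in auto)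
   let ?err = "4 / \<delta> * (sqrt (2 * A * q * W) * sqrt l + (Cp * S + 2 * A * q * \<bar>\<nu> / \<delta>\<bar>) * l)"
   let ?good = "{X\<in>space (\<Pi>\<^sub>M j\<in>{..<N}. D). \<bar>(\<Sum>j<N. \<kappa> (X j) * g (X j)) / (\<Sum>j<N. \<kappa> (X j)) - \<nu> / \<delta>\<bar> <= ?err \<and> (\<Sum>j<N. \<kappa> (X j)) > 0}"
   have good: "1 - 3 * exp (- real N * l) <= measure (\<Pi>\<^sub>M j\<in>{..<N}. D) ?good"
    by (rule wm(2)[OF dp(1) mD kn _ _ _ G1 i1 \<delta>0 i2 i3 l0 Hl N0]) (use mb gK spD in auto)
   let ?F = "2 * m0 / (m2 * e\<^sup>2 * R'\<^sup>2)"
   have bb: "\<bar>?F * (\<nu> / \<delta>) - Lm\<bar> <= Cb * (e\<^sup>2 + \<tau> / e\<^sup>2)" unfolding Cb_def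
    by (rule bias_arith[OF e(1) e1 E0 R(1) q(1) m less_imp_le[OF C(1)] Cl0 s0(1) q0(1) \<tau>0(3,1,2) q(3) R(3) _ r1 r2 \<delta>])
     (use Cl[OF x] in \<open>simp add: Lm_def\<close>)
   have R9: "9/10 * R <= R'" using close_toD(2)[OF p cl x] by (simp add: R_def R'_def)
   have sL: "C5 * sqrt L <= 1"
   proof -
    have "sqrt L <= sqrt (1 / (C5 + 1)\<^sup>2)" using L(2) \<eta>(4) by (intro real_sqrt_le_mono) linarith
    also have "... = 1 / (C5 + 1)" using C5 by (simp add: real_sqrt_divide)
    finally have "C5 * sqrt L <= C5 * (1 / (C5 + 1))" using C5 by (intro mult_left_mono)
    also have "... <= 1" using C5 by (simp add: divide_le_eq)
    finally show ?thesis .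
   qed
   have Cp0: "Cp > 0" using Cp(1) by simp
   have nb: "?F * ?err <= C1 * (S * (1 / R) * sqrt L)" unfolding C1_def l_def W_def
    by (rule noise_arith[OF e(1) e1 E0 R(1) q(1) m A_pos C0(1) Cp0 S0 L(1) u0(1) R9 q(2) R(2) u \<delta> cs[unfolded W_def] sL[unfolded C5_def]])
   have rp: "1 / R = p x powr (1 / real CARD('n))" "1 / R <= K3"
   proof -
    show "1 / R = p x powr (1 / real CARD('n))" using pD(2)[OF x]
     by (simp add: R_def rho_bar_def powr_minus_divide minus_divide_left[symmetric])
    show "1 / R <= K3" using K3(2)[rule_format, OF x] R(1) by (simp add: R_def powr_minus_divide)
   qed
   \<comment> \<open>The summand \<open>Cp * e^2\<close> of \<open>S\<close> moves from the noise to
     the bias: there it is multiplied by \<open>(1 / R) * sqrt L\<close>, which is at most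
     \<open>K3\<close>.\<close>
   have tot: "Cb * (e\<^sup>2 + \<tau> / e\<^sup>2) + C1 * (S * (1 / R) * sqrt L) <= Ct * (e\<^sup>2 + \<tau> / e\<^sup>2) + C1 * (?G * (1 / R) * sqrt L)"
   proof -
    have "sqrt L <= 1" using L(2) \<eta>1(2) by simp
    then have "Cp * e\<^sup>2 * ((1 / R) * sqrt L) <= Cp * e\<^sup>2 * (K3 * 1)"
     using rp(2) R(1) Cp0 K3(1) L(1) by (intro mult_left_mono mult_mono) auto
    then have "C1 * (Cp * e\<^sup>2 * ((1 / R) * sqrt L)) <= C1 * (Cp * e\<^sup>2 * (K3 * 1))" by (rule mult_left_mono) (simp add: C1 less_imp_le)
    moreover have "C1 * (S * (1 / R) * sqrt L) = C1 * (?G * (1 / R) * sqrt L) + C1 * (Cp * e\<^sup>2 * ((1 / R) * sqrt L))"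
     unfolding S_def by (simp only: distrib_left distrib_right mult.assoc)
    moreover have "C1 * (Cp * e\<^sup>2 * (K3 * 1)) <= C1 * Cp * K3 * (e\<^sup>2 + \<tau> / e\<^sup>2)"
    proof -
     have "0 <= C1 * Cp * K3 * (\<tau> / e\<^sup>2)" using C1 Cp0 K3(1) \<tau>0(1) by simp
     then show ?thesis by (simp add: distrib_left mult_ac)
    qed
    moreover have "(Cb + C1 * Cp * K3) * (e\<^sup>2 + \<tau> / e\<^sup>2) <= Ct * (e\<^sup>2 + \<tau> / e\<^sup>2)" using Ct(2) \<tau>0(1) by (intro mult_right_mono) auto
    moreover have "(Cb + C1 * Cp * K3) * (e\<^sup>2 + \<tau> / e\<^sup>2) = Cb * (e\<^sup>2 + \<tau> / e\<^sup>2) + C1 * Cp * K3 * (e\<^sup>2 + \<tau> / e\<^sup>2)" by (rule distrib_right)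
    ultimately show ?thesis by linarith
   qed
   let ?P = "\<Pi>\<^sub>M j\<in>{..<N}. D"
   have P: "iid_sample V p N = ?P" by (simp add: iid_sample_def D_def)
   have gl: "graph_laplacian_rw TYPE('n) k0 \<alpha> (e\<^sup>2) \<rho>' N X f x = ?F * ((\<Sum>j<N. \<kappa> (X j) * f (X j)) / (\<Sum>j<N. \<kappa> (X j)) - f x)" for X
   proof -
    have k1: "k0 ((norm (x - X j))\<^sup>2 / (e\<^sup>2 * \<rho>' x * \<rho>' (X j))) * (f (X j) / \<rho>' (X j) powr \<alpha>) = \<kappa> (X j) * f (X j)"
     "k0 ((norm (x - X j))\<^sup>2 / (e\<^sup>2 * \<rho>' x * \<rho>' (X j))) * (1 / \<rho>' (X j) powr \<alpha>) = \<kappa> (X j)" for j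
     by (simp_all add: \<kappa>_def khat_def powr_minus_divide)
    have k2: "1 / (e\<^sup>2 * (m2 / (2 * m0)) * R'\<^sup>2) = ?F" by simp
    show ?thesis unfolding graph_laplacian_rw_def k1
     unfolding m0_def[symmetric] m2_def[symmetric] R'_def[symmetric] k2 by (rule refl)
   qed
   let ?bound = "Ct * (e\<^sup>2 + \<tau> / e\<^sup>2) + C1 * (?G * p x powr (1 / real CARD('n)) * sqrt (ln (real N) / (real N * (e\<^sup>2 * e ^ CARD('n)))))"
   let ?target = "{X\<in>space ?P. \<bar>graph_laplacian_rw TYPE('n) k0 \<alpha> (e\<^sup>2) \<rho>' N X f x - Lm\<bar> <= ?bound}"
   have fD: "f \<in> borel_measurable D" using fm by (simp add: D_def)
   note [measurable] = mD fD
   have tm: "?target \<in> sets ?P" unfolding gl by measurable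
   have sub': "?good \<subseteq> ?target"
   proof
    fix X assume X: "X \<in> ?good"
    let ?Q = "(\<Sum>j<N. \<kappa> (X j) * g (X j)) / (\<Sum>j<N. \<kappa> (X j))"
    have sp: "(\<Sum>j<N. \<kappa> (X j)) > 0" and Q: "\<bar>?Q - \<nu> / \<delta>\<bar> <= ?err" using X by auto
    have "(\<Sum>j<N. \<kappa> (X j) * g (X j)) = (\<Sum>j<N. \<kappa> (X j) * f (X j)) - f x * (\<Sum>j<N. \<kappa> (X j))"
     by (simp add: g_def sum_subtractf sum_distrib_left algebra_simps)
    then have "(\<Sum>j<N. \<kappa> (X j) * f (X j)) / (\<Sum>j<N. \<kappa> (X j)) - f x = ?Q" using sp by (simp add: field_simps)
    then have eq: "graph_laplacian_rw TYPE('n) k0 \<alpha> (e\<^sup>2) \<rho>' N X f x = ?F * ?Q" unfolding gl by (simp only:)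
    have F0: "0 <= ?F" using m by simp
    have "\<bar>?F * (?Q - \<nu> / \<delta>)\<bar> <= ?F * ?err" using mult_left_mono[OF Q F0] F0 by (simp only: abs_mult abs_of_nonneg)
    moreover have "?F * ?Q - Lm = ?F * (?Q - \<nu> / \<delta>) + (?F * (\<nu> / \<delta>) - Lm)" by (simp only: right_diff_distrib)
    ultimately have "\<bar>?F * ?Q - Lm\<bar> <= Cb * (e\<^sup>2 + \<tau> / e\<^sup>2) + C1 * (S * (1 / R) * sqrt L)" using bb nb by linarith
    also have "... <= ?bound" using tot unfolding rp(1) L_def E_def .
    finally have "\<bar>graph_laplacian_rw TYPE('n) k0 \<alpha> (e\<^sup>2) \<rho>' N X f x - Lm\<bar> <= ?bound" unfolding eq .
    moreover have "X \<in> space ?P" using X by blast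
    ultimately show "X \<in> ?target" by blast
   qed
   interpret PP: prob_space ?P by (rule prob_space_PiM) (rule dp(1))
   have "measure ?P ?good <= measure ?P ?target" by (rule PP.finite_measure_mono[OF sub' tm])
   moreover have "3 * exp (- real N * l) < 4 * real N powr (- 10)"
   proof -
    have "real N * l = 11 * ln (real N)" using Np e(1) E0 by (simp add: l_def L_def power2_eq_square)
    then have "exp (- real N * l) = real N powr (- 11)" using Np by (simp add: powr_def)
    also have "... <= real N powr (- 10)" using N by (intro powr_mono) auto
    finally show ?thesis using Np powr_gt_zero[of "real N" "- 10"] by linarith
   qed
   ultimately show ?thesis unfolding P Lm_def[symmetric] using good by linarith
  qed
  note fin = this
  show ?thesis by (rule exI[of _ Ct], rule conjI[OF Ct(1)], rule exI[of _ \<eta>], intro conjI \<eta>(1) ballI allI impI) (rule fin; assumption)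
 qed
 show ?thesis by (rule exI[of _ C1], intro conjI C1 allI impI) (rule main; assumption)
qed

end

section \<open>The kernel and the nearest neighbour bandwidth of the theorem\<close>

lemma Ck_on_Suc_real:
 fixes f :: "real => real"
 assumes "Ck_on (Suc k) f U"
 shows "Ck_on k (%x. frechet_derivative f (at x) 1) U"
  and "x \<in> U ==> (f has_real_derivative frechet_derivative f (at x) 1) (at x)"
proof -
 show "Ck_on k (%x. frechet_derivative f (at x) 1) U" using assms by simp
 assume "x \<in> U"
 then have d: "f differentiable at x" using assms by simp
 have l: "linear (frechet_derivative f (at x))" by (rule linear_frechet_derivative[OF d])
 have "frechet_derivative f (at x) h = frechet_derivative f (at x) 1 * h" for h
  using linear_scale[OF l, of h 1] by (simp add: mult.commute)
 then have "frechet_derivative f (at x) = (*) (frechet_derivative f (at x) 1)" by (intro ext)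
 then show "(f has_real_derivative frechet_derivative f (at x) 1) (at x)"
  using frechet_derivative_works[of f "at x"] d unfolding has_field_derivative_def by metis
qed

text \<open>The kernel is continued by its value at zero, and its first derivative by zero, which
  makes both measurable on the line. The decay bounds are given at positive arguments only;
  continuity carries the bound for the kernel itself to zero.\<close>

lemma admissible_kernel_decaying:
 assumes "admissible_kernel k0"
 shows "\<exists>k0' k1 k2 k3 A a. decaying_kernel k0' k1 k2 k3 A a \<and> (\<forall>\<xi>\<ge>0. k0' \<xi> = k0 \<xi>)"
proof -
 let ?U = "{0<..} :: real set"
 have cont: "continuous_on {0..} k0" and Ck: "Ck_on 4 k0 ?U" and nn: "!!\<xi>. \<xi> \<ge> 0 ==> 0 <= k0 \<xi>" and sup: "(SUP \<xi>\<in>{0..}. \<bar>k0 \<xi>\<bar>) > 0"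
  using assms by (auto simp: admissible_kernel_def)
 obtain a and A :: "nat => real" where a: "a > 0" and A: "!!l. l <= 4 ==> A l > 0"
  "!!l \<xi>. l <= 4 ==> \<xi> > 0 ==> \<bar>(deriv ^^ l) k0 \<xi>\<bar> <= A l * exp (- a * \<xi>)"
  using assms unfolding admissible_kernel_def by blast
 define d where "d f x = frechet_derivative f (at x) 1" for f :: "real => real" and x :: real
 have C4: "Ck_on (Suc (Suc (Suc (Suc 0)))) k0 ?U"
 proof -
  have "(4::nat) = Suc (Suc (Suc (Suc 0)))" by simp
  then show ?thesis using Ck by (simp only:)
 qed
 note C3 = Ck_on_Suc_real(1)[OF C4, folded d_def] and D0 = Ck_on_Suc_real(2)[OF C4, folded d_def]
 note C2 = Ck_on_Suc_real(1)[OF C3, folded d_def] and D1 = Ck_on_Suc_real(2)[OF C3, folded d_def]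
 note C1 = Ck_on_Suc_real(1)[OF C2, folded d_def] and D2 = Ck_on_Suc_real(2)[OF C2, folded d_def]
 \<comment> \<open>The decay bounds speak of iterated \<open>deriv\<close>, smoothness of Frechet
   derivatives. They agree on the open half-line, where a derivative depends on values nearby
   only.\<close>
 have step: "deriv g x = h' x" if "!!x. x > 0 ==> g x = h x" "!!x. x \<in> ?U ==> (h has_real_derivative h' x) (at x)" "x > 0" for g h h' and x :: real
 proof (rule DERIV_imp_deriv)
  show "(g has_real_derivative h' x) (at x)"
   by (rule has_field_derivative_transform_within_open[OF that(2), of _ ?U]) (use that in auto)
 qed
 have e1: "(deriv ^^ 1) k0 x = d k0 x" if "x > 0" for x using step[of k0 k0 "d k0", OF _ D0 that] by simp
 have e2: "(deriv ^^ 2) k0 x = d (d k0) x" if "x > 0" for x using step[of "(deriv ^^ 1) k0" "d k0" "d (d k0)", OF e1 D1 that] by (simp add: numeral_2_eq_2)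
 have e3: "(deriv ^^ 3) k0 x = d (d (d k0)) x" if "x > 0" for x using step[of "(deriv ^^ 2) k0" "d (d k0)" "d (d (d k0))", OF e2 D2 that] by (simp add: numeral_3_eq_3 numeral_2_eq_2)
 define S where "S = A 0 + A 1 + A 2 + A 3"
 have Apos: "A 0 > 0" "A 1 > 0" "A 2 > 0" "A 3 > 0" by (rule A(1), simp)+
 have S: "S > 0" "A 0 <= S" "A 1 <= S" "A 2 <= S" "A 3 <= S" using Apos by (simp_all add: S_def)
 have bS: "\<bar>(deriv ^^ l) k0 \<xi>\<bar> <= S * exp (- a * \<xi>)" if "l <= 4" "A l <= S" "\<xi> > 0" for l \<xi>
  by (rule order_trans[OF A(2)[OF that(1,3)] mult_right_mono[OF that(2)]]) simp
 have lim: "(k0 \<longlongrightarrow> k0 0) (at_right 0)"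
 proof -
  have "(k0 \<longlongrightarrow> k0 0) (at 0 within {0..})" using cont by (simp add: continuous_on_def)
  then show ?thesis by (rule tendsto_within_subset) auto
 qed
 have k00: "k0 0 <= S"
 proof (rule tendsto_upperbound[OF lim])
  have "k0 \<xi> <= S" if "\<xi> > 0" for \<xi>
  proof -
   have "k0 \<xi> <= S * exp (- a * \<xi>)" using bS[of 0 \<xi>] S that by simp
   also have "... <= S * 1" using S(1) a that by (intro mult_left_mono) auto
   finally show ?thesis by simp
  qed
  then show "\<forall>\<^sub>F \<xi> in at_right 0. k0 \<xi> <= S" unfolding eventually_at_right_field by (intro exI[of _ 1]) auto
 qed simp
 \<comment> \<open>A positive supremum could come from the value at zero alone; continuity from the
   right excludes this.\<close>
 have k0pos: "\<exists>\<xi>>0. k0 \<xi> > 0"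
 proof (rule ccontr)
  assume "\<not> ?thesis"
  then have z: "k0 \<xi> = 0" if "\<xi> > 0" for \<xi> using nn[of \<xi>] that by force
  have "k0 0 <= 0"
  proof (rule tendsto_upperbound[OF lim])
   show "\<forall>\<^sub>F \<xi> in at_right 0. k0 \<xi> <= 0" unfolding eventually_at_right_field using z by (intro exI[of _ 1]) auto
  qed simp
  then have z0: "k0 \<xi> = 0" if "\<xi> \<ge> 0" for \<xi> using z[of \<xi>] nn[of 0] that by (cases "\<xi> = 0") auto
  have "(%\<xi>. \<bar>k0 \<xi>\<bar>) ` {0..} = (%_::real. 0::real) ` {0..}" by (rule image_cong[OF refl]) (use z0 in simp)
  also have "... = {0::real}" by auto
  finally show False using sup by simp
 qed
 let ?k0 = "%\<xi>. k0 (max 0 \<xi>)" and ?k1 = "%\<xi>. if \<xi> \<in> ?U then d k0 \<xi> else 0"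
 have "decaying_kernel ?k0 ?k1 (d (d k0)) (d (d (d k0))) S a"
 proof
  show "continuous_on UNIV ?k0" by (rule continuous_on_compose2[OF cont]) (auto intro!: continuous_intros)
  have "continuous_on ?U (d k0)"
   by (rule continuous_at_imp_continuous_on) (use D1 DERIV_isCont in blast)
  then show "?k1 \<in> borel_measurable borel" by (intro borel_measurable_continuous_on_if) auto
  show "0 <= ?k0 \<xi>" for \<xi> by (rule nn) simp
  show "\<exists>\<xi>>0. ?k0 \<xi> > 0" using k0pos by (metis max.absorb2 less_imp_le)
  fix \<xi> :: real
  show "?k0 \<xi> <= S * exp (- a * \<xi>)" if "\<xi> \<ge> 0"
   using bS[of 0 \<xi>] S k00 that by (cases "\<xi> = 0") (auto simp: max_def)
  assume \<xi>: "\<xi> > 0"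
  then have U: "\<xi> \<in> ?U" by simp
  show "(?k0 has_real_derivative ?k1 \<xi>) (at \<xi>)"
   using has_field_derivative_transform_within_open[OF D0[OF U], of ?U ?k0] \<xi> by (simp add: max_def)
  show "(?k1 has_real_derivative d (d k0) \<xi>) (at \<xi>)"
   using has_field_derivative_transform_within_open[OF D1[OF U], of ?U ?k1] \<xi> by simp
  show "(d (d k0) has_real_derivative d (d (d k0)) \<xi>) (at \<xi>)" by (rule D2[OF U])
  show "\<bar>?k1 \<xi>\<bar> <= S * exp (- a * \<xi>)" using bS[of 1 \<xi>] S \<xi> e1[OF \<xi>] by simp
  show "\<bar>d (d k0) \<xi>\<bar> <= S * exp (- a * \<xi>)" using bS[of 2 \<xi>] S \<xi> e2[OF \<xi>] by simp
  show "\<bar>d (d (d k0)) \<xi>\<bar> <= S * exp (- a * \<xi>)" using bS[of 3 \<xi>] S \<xi> e3[OF \<xi>] by simp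
 qed (rule S(1), rule a)
 moreover have "\<forall>\<xi>\<ge>0. ?k0 \<xi> = k0 \<xi>" by (simp add: max_def)
 ultimately show ?thesis by (intro exI conjI)
qed

text \<open>The nearest neighbour radius is 1-Lipschitz: a ball of radius \<open>r\<close> about
  \<open>x\<close> lies in the ball of radius \<open>r + norm (x - x')\<close> about
  \<open>x'\<close>, so the latter contains at least as many data points. With
  \<open>k \<le> Ny\<close> the infimum is over a nonempty set. Continuity gives measurability and,
  on the compact manifold, a bounded relative error.\<close>

lemma continuous_on_rho_hat:
 assumes k: "1 <= k" "k <= Ny"
 shows "continuous_on M (rho_hat TYPE('n::finite) k Ny Y)"
proof -
 let ?S = "%x. {r. r > 0 \<and> k <= (\<Sum>j<Ny. of_bool (norm (Y j - x) < r))}"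
 have bdd: "bdd_below (?S x)" for x by (rule bdd_belowI[of _ 0]) auto
 have ne: "?S x ~= {}" for x
 proof -
  define r where "r = 1 + (\<Sum>j<Ny. norm (Y j - x))"
  have "norm (Y j - x) < r" if "j < Ny" for j
   using member_le_sum[of j "{..<Ny}" "%j. norm (Y j - x)"] that by (simp add: r_def)
  then have "(\<Sum>j<Ny. of_bool (norm (Y j - x) < r)) = (\<Sum>j<Ny. 1::nat)" by (intro sum.cong) auto
  moreover have "r > 0" by (simp add: r_def add_pos_nonneg sum_nonneg)
  ultimately have "r \<in> ?S x" using k by simp
  then show ?thesis by blast
 qed
 have le: "knn_radius k Ny Y x' - norm (x - x') <= knn_radius k Ny Y x" for x x'
  unfolding knn_radius_def
 proof (rule cInf_greatest[OF ne])
  fix r assume r: "r \<in> ?S x"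
  have "(\<Sum>j<Ny. of_bool (norm (Y j - x) < r)) <= (\<Sum>j<Ny. of_bool (norm (Y j - x') < r + norm (x - x')) :: nat)"
  proof (rule sum_mono)
   fix j
   have "norm (Y j - x') <= norm (Y j - x) + norm (x - x')" using norm_triangle_ineq[of "Y j - x" "x - x'"] by simp
   then show "of_bool (norm (Y j - x) < r) <= (of_bool (norm (Y j - x') < r + norm (x - x')) :: nat)" by auto
  qed
  then have "r + norm (x - x') \<in> ?S x'" using r by (auto intro: add_pos_nonneg)
  then have "Inf (?S x') <= r + norm (x - x')" by (rule cInf_lower[OF _ bdd])
  then show "Inf (?S x') - norm (x - x') <= r" by simp
 qed
 have "1-lipschitz_on M (knn_radius k Ny Y)"
 proof (rule lipschitz_onI)
  fix x y
  show "dist (knn_radius k Ny Y x) (knn_radius k Ny Y y) <= 1 * dist x y"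
   using le[of x y] le[of y x] unfolding dist_real_def dist_norm by (simp add: norm_minus_commute abs_le_iff)
 qed simp
 from lipschitz_on_continuous_on[OF this] show ?thesis
  unfolding rho_hat_def by (intro continuous_on_mult continuous_on_const)
qed

theorem theorem3p5:
  fixes M :: "'a::euclidean_space set"
    and V :: "'a measure"
    and k0 :: "real \<Rightarrow> real"
  assumes "smooth_submanifold TYPE('n::finite) M"
    and "compact M"
    and "riemannian_volume TYPE('n) M V"
    and "admissible_kernel k0"
  shows
    "\<exists>C1 > 0. \<forall>(\<alpha>::real) p f.
       smooth_positive_density TYPE('n) M V p \<longrightarrow> smooth_on_manifold TYPE('n) M f \<longrightarrow>
       (\<exists>C > 0. \<forall>\<epsilon> \<epsilon>\<^sub>\<rho> :: nat \<Rightarrow> real.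
          (\<forall>N. \<epsilon> N > 0) \<longrightarrow> (\<forall>N. \<epsilon>\<^sub>\<rho> N < 1 / 10) \<longrightarrow>
          \<epsilon> \<in> o(\<lambda>_. 1) \<longrightarrow>
          (\<lambda>N. \<epsilon> N powr (real CARD('n) / 2 + 1) * real N) \<in> \<omega>(\<lambda>N. ln (real N)) \<longrightarrow>
          \<epsilon>\<^sub>\<rho> \<in> o(\<epsilon>) \<longrightarrow>
          (\<exists>N0. \<forall>N\<ge>N0. \<forall>k Ny Y.
             1 \<le> k \<longrightarrow> k \<le> Ny \<longrightarrow>
             (SUP x\<in>M. \<bar>rho_hat TYPE('n) k Ny Y x - rho_bar TYPE('n) p x\<bar> / \<bar>rho_bar TYPE('n) p x\<bar>)
               < \<epsilon>\<^sub>\<rho> N \<longrightarrow>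
             (\<forall>x\<in>M.
                \<P>(X in iid_sample V p N.
                   \<bar>graph_laplacian_rw TYPE('n) k0 \<alpha> (\<epsilon> N) (rho_hat TYPE('n) k Ny Y) N X f x
                     - limit_operator TYPE('n) M p \<alpha> f x\<bar>
                   \<le> C * (\<epsilon> N + \<epsilon>\<^sub>\<rho> N / \<epsilon> N)
                      + C1 * (gradient_sup_norm TYPE('n) M f * p x powr (1 / real CARD('n))
                              * sqrt (ln (real N) / (real N * \<epsilon> N powr (real CARD('n) / 2 + 1)))))
                > 1 - 4 * real N powr (- 10))))"
proof -
 obtain k0' k1 k2 k3 A a where dk: "decaying_kernel k0' k1 k2 k3 A a" and k0': "!!\<xi>. \<xi> \<ge> 0 ==> k0' \<xi> = k0 \<xi>"
  using admissible_kernel_decaying[OF assms(4)] by blast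
 interpret kernel_manifold k0' k1 k2 k3 A a M V "TYPE('n)"
  by (intro kernel_manifold.intro dk kernel_manifold_axioms.intro assms(1-3))
 have m: "kernel_m0 TYPE('n) k0 = kernel_m0 TYPE('n) k0'" "kernel_m2 TYPE('n) k0 = kernel_m2 TYPE('n) k0'"
  by (simp_all add: kernel_m0_def kernel_m2_def k0')
 obtain C1 where C1: "C1 > 0" "\<forall>\<alpha> p f. smooth_positive_density TYPE('n) M V p --> smooth_on_manifold TYPE('n) M f -->
  (\<exists>C>0. \<exists>\<eta>>0. \<forall>x\<in>M. \<forall>\<rho>' \<tau> e N. close_to p \<rho>' \<tau> --> \<rho>' \<in> borel_measurable V --> 0 < e --> e <= \<eta> --> \<tau> <= \<eta> --> 2 <= N -->
   ln (real N) <= \<eta> * (real N * (e\<^sup>2 * e ^ CARD('n))) -->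
   measure (iid_sample V p N) {X\<in>space (iid_sample V p N).
    \<bar>graph_laplacian_rw TYPE('n) k0' \<alpha> (e\<^sup>2) \<rho>' N X f x - limit_operator TYPE('n) M p \<alpha> f x\<bar>
     <= C * (e\<^sup>2 + \<tau> / e\<^sup>2) + C1 * (gradient_sup_norm TYPE('n) M f * p x powr (1 / real CARD('n)) * sqrt (ln (real N) / (real N * (e\<^sup>2 * e ^ CARD('n)))))}
   > 1 - 4 * real N powr (- 10))"
  using laplacian_concentration by (elim exE conjE) (rule that)
 show ?thesis
 proof (rule exI[of _ C1], intro conjI C1(1) allI impI)
  fix \<alpha> p f
  assume p: "smooth_positive_density TYPE('n) M V p" and f: "smooth_on_manifold TYPE('n) M f"
  obtain C \<eta> where C: "C > 0" and \<eta>: "\<eta> > 0" and H: "\<forall>x\<in>M. \<forall>\<rho>' \<tau> e N. close_to p \<rho>' \<tau> --> \<rho>' \<in> borel_measurable V --> 0 < e --> e <= \<eta> --> \<tau> <= \<eta> --> 2 <= N -->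
   ln (real N) <= \<eta> * (real N * (e\<^sup>2 * e ^ CARD('n))) -->
   measure (iid_sample V p N) {X\<in>space (iid_sample V p N).
    \<bar>graph_laplacian_rw TYPE('n) k0' \<alpha> (e\<^sup>2) \<rho>' N X f x - limit_operator TYPE('n) M p \<alpha> f x\<bar>
     <= C * (e\<^sup>2 + \<tau> / e\<^sup>2) + C1 * (gradient_sup_norm TYPE('n) M f * p x powr (1 / real CARD('n)) * sqrt (ln (real N) / (real N * (e\<^sup>2 * e ^ CARD('n)))))}
   > 1 - 4 * real N powr (- 10)"
   using C1(2)[THEN spec[where x=\<alpha>], THEN spec[where x=p], THEN spec[where x=f], THEN mp, THEN mp, OF p f] by (elim exE conjE) (rule that)
  note HD = H[THEN bspec, THEN spec, THEN spec, THEN spec, THEN spec, THEN mp, THEN mp, THEN mp, THEN mp, THEN mp, THEN mp, THEN mp]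
  show "\<exists>C > 0. \<forall>\<epsilon> \<epsilon>\<^sub>\<rho> :: nat => real.
     (\<forall>N. \<epsilon> N > 0) --> (\<forall>N. \<epsilon>\<^sub>\<rho> N < 1 / 10) -->
     \<epsilon> \<in> o(%_. 1) -->
     (%N. \<epsilon> N powr (real CARD('n) / 2 + 1) * real N) \<in> \<omega>(%N. ln (real N)) -->
     \<epsilon>\<^sub>\<rho> \<in> o(\<epsilon>) -->
     (\<exists>N0. \<forall>N\<ge>N0. \<forall>k Ny Y.
       1 <= k --> k <= Ny -->
       (SUP x\<in>M. \<bar>rho_hat TYPE('n) k Ny Y x - rho_bar TYPE('n) p x\<bar> / \<bar>rho_bar TYPE('n) p x\<bar>)
        < \<epsilon>\<^sub>\<rho> N -->
       (\<forall>x\<in>M.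
        \<P>(X in iid_sample V p N.
          \<bar>graph_laplacian_rw TYPE('n) k0 \<alpha> (\<epsilon> N) (rho_hat TYPE('n) k Ny Y) N X f x
           - limit_operator TYPE('n) M p \<alpha> f x\<bar>
          <= C * (\<epsilon> N + \<epsilon>\<^sub>\<rho> N / \<epsilon> N)
           + C1 * (gradient_sup_norm TYPE('n) M f * p x powr (1 / real CARD('n))
               * sqrt (ln (real N) / (real N * \<epsilon> N powr (real CARD('n) / 2 + 1)))))
        > 1 - 4 * real N powr (- 10)))"
  proof (rule exI[of _ C], intro conjI C allI impI)
   fix \<epsilon> \<epsilon>\<^sub>\<rho> :: "nat => real"
   assume \<epsilon>: "\<forall>N. \<epsilon> N > 0" and \<epsilon>\<rho>: "\<forall>N. \<epsilon>\<^sub>\<rho> N < 1 / 10" and o1: "\<epsilon> \<in> o(%_. 1)"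
    and om: "(%N. \<epsilon> N powr (real CARD('n) / 2 + 1) * real N) \<in> \<omega>(%N. ln (real N))" and o2: "\<epsilon>\<^sub>\<rho> \<in> o(\<epsilon>)"
   \<comment> \<open>The square gives \<open>sqrt (\<epsilon> N) \<le> \<eta>\<close>; the plain
     \<open>\<eta>\<close> bounds the bandwidth error, which is eventually below
     \<open>\<epsilon> N\<close>.\<close>
   have "min (\<eta>\<^sup>2) \<eta> > 0" using \<eta> by simp
   from landau_o.smallD[OF o1 this] have ev1: "\<forall>\<^sub>F N in sequentially. \<bar>\<epsilon> N\<bar> <= min (\<eta>\<^sup>2) \<eta>" by simp
   from landau_o.smallD[OF o2 zero_less_one] have ev2: "\<forall>\<^sub>F N in sequentially. \<bar>\<epsilon>\<^sub>\<rho> N\<bar> <= \<bar>\<epsilon> N\<bar>" by simp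
   have "1 / \<eta> > 0" using \<eta> by simp
   from landau_omega.smallD[OF om this] have ev3: "\<forall>\<^sub>F N in sequentially. 1 / \<eta> * \<bar>ln (real N)\<bar> <= \<bar>\<epsilon> N powr (real CARD('n) / 2 + 1) * real N\<bar>" by simp
   \<comment> \<open>The threshold is fixed by the sequences and \<open>\<eta>\<close>, before the
     data set \<open>Y\<close> and the point \<open>x\<close> are chosen.\<close>
   obtain N0 where N0: "\<forall>N\<ge>N0. (\<bar>\<epsilon> N\<bar> <= min (\<eta>\<^sup>2) \<eta> \<and> \<bar>\<epsilon>\<^sub>\<rho> N\<bar> <= \<bar>\<epsilon> N\<bar>) \<and>
     1 / \<eta> * \<bar>ln (real N)\<bar> <= \<bar>\<epsilon> N powr (real CARD('n) / 2 + 1) * real N\<bar> \<and> 2 <= N"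
    using eventually_conj[OF eventually_conj[OF ev1 ev2] eventually_conj[OF ev3 eventually_ge_at_top[of 2]]]
    unfolding eventually_sequentially by blast
   show "\<exists>N0. \<forall>N\<ge>N0. \<forall>k Ny Y.
       1 <= k --> k <= Ny -->
       (SUP x\<in>M. \<bar>rho_hat TYPE('n) k Ny Y x - rho_bar TYPE('n) p x\<bar> / \<bar>rho_bar TYPE('n) p x\<bar>)
        < \<epsilon>\<^sub>\<rho> N -->
       (\<forall>x\<in>M.
        \<P>(X in iid_sample V p N.
          \<bar>graph_laplacian_rw TYPE('n) k0 \<alpha> (\<epsilon> N) (rho_hat TYPE('n) k Ny Y) N X f x
           - limit_operator TYPE('n) M p \<alpha> f x\<bar>
          <= C * (\<epsilon> N + \<epsilon>\<^sub>\<rho> N / \<epsilon> N)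
           + C1 * (gradient_sup_norm TYPE('n) M f * p x powr (1 / real CARD('n))
               * sqrt (ln (real N) / (real N * \<epsilon> N powr (real CARD('n) / 2 + 1)))))
        > 1 - 4 * real N powr (- 10))"
   proof (rule exI[of _ N0], intro allI impI ballI)
    fix N k Ny Y x
    assume N: "N0 <= N" and k: "1 <= k" "k <= Ny" and x: "x \<in> M"
     and S: "(SUP x\<in>M. \<bar>rho_hat TYPE('n) k Ny Y x - rho_bar TYPE('n) p x\<bar> / \<bar>rho_bar TYPE('n) p x\<bar>) < \<epsilon>\<^sub>\<rho> N"
    let ?h = "rho_hat TYPE('n) k Ny Y" and ?b = "rho_bar TYPE('n) p"
    note NN = N0[rule_format, OF N]
    note pD = densityD[OF p]
    have pos: "\<forall>x\<in>M. p x > 0" using pD(2) by blast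
    have hc: "continuous_on M ?h" by (rule continuous_on_rho_hat[OF k])
    have b0: "?b z > 0" if "z \<in> M" for z using pD(2)[OF that] by (rule rho_bar_pos)
    have bc: "continuous_on M ?b"
     by (rule continuous_on_eq[OF continuous_on_rho_bar[OF pD(3) pos, where 'n = 'n, of 1]]) (use b0 in \<open>simp add: abs_of_pos\<close>)
    have "continuous_on M (%x. \<bar>?h x - ?b x\<bar> / \<bar>?b x\<bar>)"
     by (intro continuous_on_divide continuous_on_rabs continuous_on_diff hc bc) (use b0 in force)
    then obtain K where K: "\<forall>y\<in>M. \<bar>\<bar>?h y - ?b y\<bar> / \<bar>?b y\<bar>\<bar> <= K" using continuous_on_compact_bounded[OF assms(2)] by blast
    \<comment> \<open>The hypothesis on the supremum yields pointwise bounds only because the set is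
      bounded above, by continuity on the compact \<open>M\<close>.\<close>
    have bdd: "bdd_above ((%x. \<bar>?h x - ?b x\<bar> / \<bar>?b x\<bar>) ` M)" by (rule bdd_aboveI[of _ K]) (use K in force)
    have rat: "\<bar>?h z - ?b z\<bar> / \<bar>?b z\<bar> < \<epsilon>\<^sub>\<rho> N" if "z \<in> M" for z
     by (rule le_less_trans[OF cSUP_upper[OF that bdd] S])
    have \<tau>0: "0 <= \<epsilon>\<^sub>\<rho> N" by (rule order_trans[OF _ less_imp_le[OF rat[OF x]]]) simp
    have cl: "close_to p ?h (\<epsilon>\<^sub>\<rho> N)" unfolding close_to_def
    proof (intro conjI ballI \<tau>0)
     show "\<epsilon>\<^sub>\<rho> N <= 1 / 10" using \<epsilon>\<rho> by (simp add: less_imp_le)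
     fix z assume z: "z \<in> M"
     show "\<bar>?h z - ?b z\<bar> <= \<epsilon>\<^sub>\<rho> N * ?b z" using rat[OF z] b0[OF z] by (simp add: pos_divide_less_eq less_imp_le)
    qed
    have hm: "?h \<in> borel_measurable V" by (rule borel_measurable_volume(2)[OF assms(3) hc])
    \<comment> \<open>The length scale of the kernel; then \<open>e^2 * e ^ d\<close> is
      \<open>\<epsilon> N powr (d / 2 + 1)\<close>.\<close>
    define e where "e = sqrt (\<epsilon> N)"
    have eN: "\<epsilon> N > 0" using \<epsilon> by blast
    have e: "e > 0" "e\<^sup>2 = \<epsilon> N" using eN by (simp_all add: e_def)
    have eE: "e\<^sup>2 * e ^ CARD('n) = \<epsilon> N powr (real CARD('n) / 2 + 1)"
    proof -
     have "e ^ CARD('n) = \<epsilon> N powr (real CARD('n) / 2)"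
      using eN by (simp add: e_def powr_half_sqrt[symmetric] powr_realpow[symmetric] powr_powr)
     then show ?thesis using eN by (simp add: e(2) powr_add)
    qed
    have e\<eta>: "e <= \<eta>" using NN eN \<eta> real_le_lsqrt[of \<eta> "\<epsilon> N"] by (simp add: e_def)
    have \<tau>\<eta>: "\<epsilon>\<^sub>\<rho> N <= \<eta>" using NN by linarith
    have "1 / \<eta> * ln (real N) <= 1 / \<eta> * \<bar>ln (real N)\<bar>" using \<eta> by (intro mult_left_mono) auto
    also have "... <= \<bar>\<epsilon> N powr (real CARD('n) / 2 + 1) * real N\<bar>" using NN by blast
    also have "... = \<epsilon> N powr (real CARD('n) / 2 + 1) * real N" by (rule abs_of_nonneg) simp
    finally have "\<eta> * (1 / \<eta> * ln (real N)) <= \<eta> * (\<epsilon> N powr (real CARD('n) / 2 + 1) * real N)" using \<eta> by (intro mult_left_mono) auto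
    then have lN: "ln (real N) <= \<eta> * (real N * (e\<^sup>2 * e ^ CARD('n)))" unfolding eE using \<eta> by (simp add: mult.commute mult.left_commute)
    \<comment> \<open>The kernel and its extension agree at nonnegative arguments, and all arguments
      are nonnegative because the bandwidth is positive at \<open>x\<close> and at the sample
      points, which lie in \<open>M\<close>.\<close>
    have sets_eq: "graph_laplacian_rw TYPE('n) k0 \<alpha> (\<epsilon> N) ?h N X f x = graph_laplacian_rw TYPE('n) k0' \<alpha> (\<epsilon> N) ?h N X f x"
     if X: "X \<in> space (iid_sample V p N)" for X
    proof -
     have XM: "X j \<in> M" if "j < N" for j
      using X that by (auto simp: iid_sample_def space_PiM PiE_def Pi_def space_V)
     have "k0 ((norm (x - X j))\<^sup>2 / (\<epsilon> N * ?h x * ?h (X j))) = k0' ((norm (x - X j))\<^sup>2 / (\<epsilon> N * ?h x * ?h (X j)))" if "j < N" for j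
     proof (rule k0'[symmetric])
      have "0 < \<epsilon> N * ?h x * ?h (X j)" using eN close_toD(4)[OF p cl x] close_toD(4)[OF p cl XM[OF that]] by simp
      then show "0 <= (norm (x - X j))\<^sup>2 / (\<epsilon> N * ?h x * ?h (X j))" by (intro divide_nonneg_pos) simp
     qed
     then show ?thesis unfolding graph_laplacian_rw_def m by simp
    qed
    have N2: "2 <= N" using NN by blast
    note fin = HD[OF x cl hm e(1) e\<eta> \<tau>\<eta> N2 lN]
    have "{X\<in>space (iid_sample V p N). \<bar>graph_laplacian_rw TYPE('n) k0 \<alpha> (\<epsilon> N) ?h N X f x - limit_operator TYPE('n) M p \<alpha> f x\<bar> <= D}
     = {X\<in>space (iid_sample V p N). \<bar>graph_laplacian_rw TYPE('n) k0' \<alpha> (\<epsilon> N) ?h N X f x - limit_operator TYPE('n) M p \<alpha> f x\<bar> <= D}" for D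
     by (rule Collect_cong) (use sets_eq in auto)
    then show "\<P>(X in iid_sample V p N. \<bar>graph_laplacian_rw TYPE('n) k0 \<alpha> (\<epsilon> N) ?h N X f x - limit_operator TYPE('n) M p \<alpha> f x\<bar>
      <= C * (\<epsilon> N + \<epsilon>\<^sub>\<rho> N / \<epsilon> N) + C1 * (gradient_sup_norm TYPE('n) M f * p x powr (1 / real CARD('n))
       * sqrt (ln (real N) / (real N * \<epsilon> N powr (real CARD('n) / 2 + 1))))) > 1 - 4 * real N powr (- 10)"
     using fin unfolding eE unfolding e(2) by (simp only:)
   qed
  qed
 qed
qed

end
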